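(* Let $1<p<\infty$ and let $\omega$ be a weight on $\mathbb{S}$. Then $\mathcal{B}$ is a bounded operator from $L^{p,2}(\omega)$ to $F^{p,2}_0(\omega)$ if and only if $\omega\in A_p$. In this case, $$\|\mathcal{B}:L^{p,2}(\omega)\to F^{p,2}_0(\omega)\|\le C(p,n)\,[\omega]_{A_p}^{\max\{1,\,1/(p-1)\}},$$ where $C(p,n)$ depends only on $p$ and $n$.
   Context: $\mathbb{B}$ is the open unit ball of $\mathbb{C}^n$, $n\ge1$, $\mathbb{S}=\partial\mathbb{B}$; $d\nu$ and $d\sigma$ are the normalized Lebesgue measures on $\mathbb{B}$ and $\mathbb{S}$; $z\overline w=\sum_j z_j\overline{w_j}$; $|E|=\sigma(E)$ for $E\subset\mathbb{S}$. $p'$ is the conjugate exponent of $p$. A weight on $\mathbb{S}$ is a function $\omega\in L^1(\mathbb{S},d\sigma)$ with $\omega>0$ a.e.; $\omega(E)=\int_E\omega\,d\sigma$, $\omega'=\omega^{-(p'-1)}$. Nonisotropic balls: $B(\zeta,r)=\{\eta\in\mathbb{S}:|1-\zeta\overline\eta|<r\}$. $\omega\in A_p$ means $[\omega]_{A_p}=\sup_B\frac{\omega(B)(\omega'(B))^{p/p'}}{|B|^p}<\infty$, the supremum being over all nonisotropic balls. $L^{p,2}(\omega)$ is the space of measurable functions $\varphi$ on $\mathbb{B}$ with $$\|\varphi\|_{L^{p,2}(\omega)}^p=\int_{\mathbb{S}}\Big(\int_0^1|\varphi(r\zeta)|^2\frac{2nr^{2n-1}dr}{1-r^2}\Big)^{p/2}\omega(\zeta)\,d\sigma(\zeta)<\infty.$$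 $F^{p,2}_0(\omega)$ is the space of holomorphic functions $f$ on $\mathbb{B}$ with $\|f\|_{F^{p,2}_0(\omega)}=\big\|(1-|z|^2)\big(I+\frac Rn\big)f(z)\big\|_{L^{p,2}(\omega)}<\infty$, where $I$ is the identity and $R=\sum_{j=1}^n z_j\frac{\partial}{\partial z_j}$. The Bergman operator is $\mathcal{B}(\varphi)(z)=\int_{\mathbb{B}}\frac{\varphi(w)}{(1-z\overline w)^{n+1}}d\nu(w)$, $z\in\mathbb{B}$, defined for $\varphi\in L^1(d\nu)$. Boundedness of $\mathcal{B}$ from a space $X$ to a normed space $Y$ means that $\mathcal{B}(\varphi)$ is defined and belongs to $Y$ for all $\varphi\in X$ with $\|\mathcal{B}(\varphi)\|_Y\le C\|\varphi\|_X$; $\|\mathcal{B}:X\to Y\|$ is the operator norm. *)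

theory Defs
  imports "HOL-Analysis.Analysis"
begin

text \<open>\<open>\<complex>\<^sup>n\<close> is \<open>complex ^ 'n\<close> with \<open>n = CARD('n)\<close>; its library norm is the Euclidean one.
  Functions on the ball or on the sphere are functions on the whole type of which only the values
  on the ball or on the sphere matter. Measurability and null sets are those of Lebesgue measure.\<close>

definition cdot :: "complex ^ 'n \<Rightarrow> complex ^ 'n \<Rightarrow> complex" where
  "cdot z w = (\<Sum>j\<in>UNIV. z $ j * cnj (w $ j))"

definition ball_meas :: "(complex ^ 'n) measure" where
  "ball_meas = uniform_measure (lebesgue_on (ball 0 1)) (ball 0 1)"

text \<open>Normalized surface measure as cone measure: \<open>\<sigma>(E)\<close> is the proportion of the unit ball occupied
  by the cone \<open>{r\<zeta> | 0 < r < 1, \<zeta> \<in> E}\<close> (\<open>sgn z = z / \<bar>z\<bar>\<close>). This is the measure occurring in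
  polar coordinates, i.e. the rotation invariant probability measure on the sphere. It is completed
  so that its measurable sets are the Lebesgue measurable subsets of the sphere.\<close>
definition sphere_meas :: "(complex ^ 'n) measure" where
  "sphere_meas =
     completion (restrict_space (distr (uniform_measure lborel (ball 0 1)) borel sgn) (sphere 0 1))"

text \<open>Powers \<open>x\<^sup>a\<close> of extended nonnegative numbers, meant for exponents \<open>a > 0\<close>.\<close>
definition epowr :: "ennreal \<Rightarrow> real \<Rightarrow> ennreal" where
  "epowr x a = (if x = \<infinity> then \<infinity> else ennreal (enn2real x powr a))"

definition conj_exponent :: "real \<Rightarrow> real" where
  "conj_exponent p = p / (p - 1)"

definition weight :: "(complex ^ 'n \<Rightarrow> real) \<Rightarrow> bool" where
  "weight \<omega> \<longleftrightarrow> integrable sphere_meas \<omega> \<and> (AE \<zeta> in sphere_meas. 0 < \<omega> \<zeta>)"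

definition weight_mass :: "(complex ^ 'n \<Rightarrow> real) \<Rightarrow> (complex ^ 'n) set \<Rightarrow> ennreal" where
  "weight_mass \<omega> E = (\<integral>\<^sup>+\<zeta>\<in>E. ennreal (\<omega> \<zeta>) \<partial>sphere_meas)"

definition dual_weight :: "real \<Rightarrow> (complex ^ 'n \<Rightarrow> real) \<Rightarrow> complex ^ 'n \<Rightarrow> real" where
  "dual_weight p \<omega> \<zeta> = \<omega> \<zeta> powr - (conj_exponent p - 1)"

definition noniso_ball :: "complex ^ 'n \<Rightarrow> real \<Rightarrow> (complex ^ 'n) set" where
  "noniso_ball \<zeta> r = {\<eta> \<in> sphere 0 1. norm (1 - cdot \<zeta> \<eta>) < r}"

definition Ap_const :: "real \<Rightarrow> (complex ^ 'n \<Rightarrow> real) \<Rightarrow> ennreal" where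
  "Ap_const p \<omega> =
     (SUP B \<in> {noniso_ball \<zeta> r | \<zeta> r. \<zeta> \<in> sphere 0 1 \<and> 0 < r}.
        weight_mass \<omega> B * epowr (weight_mass (dual_weight p \<omega>) B) (p / conj_exponent p)
          / epowr (emeasure sphere_meas B) p)"

definition Ap_weights :: "real \<Rightarrow> (complex ^ 'n \<Rightarrow> real) set" where
  "Ap_weights p = {\<omega>. weight \<omega> \<and> Ap_const p \<omega> < \<infinity>}"

definition L_norm :: "real \<Rightarrow> (complex ^ 'n \<Rightarrow> real) \<Rightarrow> (complex ^ 'n \<Rightarrow> complex) \<Rightarrow> ennreal" where
  "L_norm p \<omega> \<phi> =
     epowr (\<integral>\<^sup>+\<zeta>. epowr (\<integral>\<^sup>+r\<in>{0<..<1}.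
                ennreal ((norm (\<phi> (r *\<^sub>R \<zeta>)))\<^sup>2
                  * (2 * real CARD('n) * r ^ (2 * CARD('n) - 1) / (1 - r\<^sup>2))) \<partial>lebesgue) (p / 2)
            * ennreal (\<omega> \<zeta>) \<partial>sphere_meas) (1 / p)"

definition L_space :: "real \<Rightarrow> (complex ^ 'n \<Rightarrow> real) \<Rightarrow> (complex ^ 'n \<Rightarrow> complex) set" where
  "L_space p \<omega> = {\<phi> \<in> borel_measurable ball_meas. L_norm p \<omega> \<phi> < \<infinity>}"

text \<open>Holomorphy on an open set: Frechet differentiability with complex linear derivative.
  Here \<open>*s\<close> is multiplication of a vector by a complex scalar.\<close>
definition holo_on :: "(complex ^ 'n \<Rightarrow> complex) \<Rightarrow> (complex ^ 'n) set \<Rightarrow> bool" where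
  "holo_on f U \<longleftrightarrow>
     (\<forall>z\<in>U. \<exists>D. (f has_derivative D) (at z) \<and> (\<forall>c v. D (c *s v) = c * D v))"

definition partial_z :: "'n \<Rightarrow> (complex ^ 'n \<Rightarrow> complex) \<Rightarrow> complex ^ 'n \<Rightarrow> complex" where
  "partial_z j f z = deriv (\<lambda>t. f (z + t *s axis j 1)) 0"

definition radial_deriv :: "(complex ^ 'n \<Rightarrow> complex) \<Rightarrow> complex ^ 'n \<Rightarrow> complex" where
  "radial_deriv f z = (\<Sum>j\<in>UNIV. z $ j * partial_z j f z)"

definition F_norm :: "real \<Rightarrow> (complex ^ 'n \<Rightarrow> real) \<Rightarrow> (complex ^ 'n \<Rightarrow> complex) \<Rightarrow> ennreal" where
  "F_norm p \<omega> f =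
     L_norm p \<omega> (\<lambda>z. complex_of_real (1 - (norm z)\<^sup>2) * (f z + radial_deriv f z / of_nat CARD('n)))"

definition F_space :: "real \<Rightarrow> (complex ^ 'n \<Rightarrow> real) \<Rightarrow> (complex ^ 'n \<Rightarrow> complex) set" where
  "F_space p \<omega> = {f. holo_on f (ball 0 1) \<and> F_norm p \<omega> f < \<infinity>}"

definition bergman :: "(complex ^ 'n \<Rightarrow> complex) \<Rightarrow> complex ^ 'n \<Rightarrow> complex" where
  "bergman \<phi> z = (\<integral>w. \<phi> w / (1 - cdot z w) ^ (CARD('n) + 1) \<partial>ball_meas)"

definition bergman_bounded :: "real \<Rightarrow> (complex ^ 'n \<Rightarrow> real) \<Rightarrow> bool" where
  "bergman_bounded p \<omega> \<longleftrightarrow>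
     (\<forall>\<phi>\<in>L_space p \<omega>. integrable ball_meas \<phi> \<and> bergman \<phi> \<in> F_space p \<omega>) \<and>
     (\<exists>C::real. \<forall>\<phi>\<in>L_space p \<omega>. F_norm p \<omega> (bergman \<phi>) \<le> ennreal C * L_norm p \<omega> \<phi>)"

definition bergman_opnorm :: "real \<Rightarrow> (complex ^ 'n \<Rightarrow> real) \<Rightarrow> ennreal" where
  "bergman_opnorm p \<omega> =
     Inf {C. \<forall>\<phi>\<in>L_space p \<omega>. F_norm p \<omega> (bergman \<phi>) \<le> C * L_norm p \<omega> \<phi>}"

end

theory Submission
  imports Defs
begin

text \<open>Sufficiency. Differentiation under the integral shows that \<open>(I + R/n)\<close> applied to the Bergman
  integral has the kernel \<open>(1 + z\<cdot>w/n) (1 - z\<cdot>w)\<^sup>-\<^sup>n\<^sup>-\<^sup>2\<close>, with \<open>z\<cdot>w\<close> the Hermitian product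
  (\<open>bergman_radial_formula\<close>). Hence the \<open>F\<close> norm of the image is at most twice the \<open>L\<close> norm of
  \<open>1 - \<bar>z\<bar>\<^sup>2\<close> times a positive integral operator applied to \<open>\<bar>\<phi>\<bar>\<close>. Its kernel is decomposed according to the dyadic size
  \<open>\<delta>\<^sub>k = 2\<^sup>-\<^sup>k\<close> of \<open>\<bar>1 - z\<cdot>w\<bar>\<close>; in polar coordinates the \<open>k\<close>-th piece is an average over the nonisotropic
  ball of radius \<open>4 \<delta>\<^sub>k\<close> of radial averages of \<open>\<bar>\<phi>\<bar>\<close> over the shell of thickness \<open>\<delta>\<^sub>k\<close> (\<open>potential_le\<close>). The
  radial integrations contribute only geometric sums (\<open>square_fun_shell_avg_le\<close>, \<open>area_le_square_fun\<close>). What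
  remains is a question about the sphere alone: if \<open>A\<^sub>k\<close> denotes averaging at scale \<open>\<delta>\<^sub>k\<close>, is
  \<open>(a\<^sub>k) \<mapsto> (A\<^sub>k a\<^sub>k)\<close> bounded on \<open>L\<^sup>p(\<omega>; \<ell>\<^sup>2)\<close> with the stated dependence on the weight?

  This is \<open>weighted_square_function_bound\<close>. Let \<open>p \<ge> 2\<close>, write \<open>v\<close> for the dual weight \<open>\<omega>'\<close>, and test
  against functions \<open>g\<^sub>k \<omega>\<close> with \<open>a\<^sub>k = f\<^sub>k v\<close>. Inserting a third point \<open>z\<close> near both
  variables turns the form at scale \<open>k\<close> into the integral over \<open>z\<close> of \<open>\<omega>(B) v(B)\<close> times a \<open>v\<close>-average of
  \<open>f\<^sub>k\<close> and an \<open>\<omega>\<close>-average of \<open>g\<^sub>k\<close>, where \<open>B\<close> is a ball about \<open>z\<close> with radius comparable to \<open>\<delta>\<^sub>k\<close>. The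
  \<open>A\<^sub>p\<close> condition bounds \<open>\<omega>(B) v(B)\<close> by \<open>[\<omega>] \<bar>B\<bar>\<^sup>p v(B)\<^sup>2\<^sup>-\<^sup>p\<close>, to the first power of the constant, and Jensen's
  inequality replaces the negative power of the mass by an average of
  \<open>v\<^sup>2\<^sup>-\<^sup>p = v\<^sup>1\<^sup>/\<^sup>p \<omega>\<^sup>1\<^sup>/\<^sup>p'\<close> (\<open>scale_bilinear_bound\<close>). Hoelder's inequality now separates \<open>f\<close> from \<open>g\<close>, and it remains to
  bound \<open>v\<close>-averages in \<open>L\<^sup>p(v; \<ell>\<^sup>2)\<close> and \<open>\<omega>\<close>-averages in \<open>L\<^sup>p'(\<omega>; \<ell>\<^sup>2)\<close> with constants that do not depend on the
  weights. That is the content of \<open>Stein_inequality\<close>. It holds for arbitrary finite measures because the averages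
  are divided by the mass of a much larger ball than the one over which the function is integrated; this costs only a
  larger absolute constant in the \<open>A\<^sub>p\<close> condition, which is available for all balls. Its proof rests on
  a maximal theorem with the same normalisation, derived from a Vitali covering argument. For \<open>p < 2\<close>
  the form is symmetric, so the roles of \<open>\<omega>\<close> and \<open>v\<close> are exchanged, and the constant of the
  exchanged pair is \<open>[\<omega>]\<^sup>1\<^sup>/\<^sup>(\<^sup>p\<^sup>-\<^sup>1\<^sup>)\<close>.

  Necessity. Near the sphere and at small nonisotropic distance the kernel has real part comparable to its modulus
  (\<open>kernel_real_part\<close>). Testing on the truncated dual weight, extended to a shell of thickness comparable
  to the radius of the ball, gives the \<open>A\<^sub>p\<close> condition for small balls
  (\<open>bergman_bounded_imp_small_ball_Ap\<close>). A finite cover of the sphere shows that \<open>\<omega>'\<close> has finite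
  mass, which settles the large balls.\<close>

section \<open>Powers, Hoelder inequality and duality for extended nonnegative functions\<close>

lemma epowr_0 [simp]: "epowr 0 a = 0"
  by (simp add: epowr_def)

lemma epowr_top [simp]: "epowr \<infinity> a = \<infinity>" "epowr top a = top"
  by (simp_all add: epowr_def)

lemma epowr_ennreal: "0 \<le> x \<Longrightarrow> epowr (ennreal x) a = ennreal (x powr a)"
  by (simp add: epowr_def)

lemma epowr_1 [simp]: "epowr x 1 = x"
  by (cases x) (auto simp: epowr_ennreal)

lemma epowr_one [simp]: "epowr 1 a = 1"
  by (simp add: epowr_def)

lemma epowr_eq_0_iff [simp]: "epowr x a = 0 \<longleftrightarrow> x = 0"
  by (cases x) (auto simp: epowr_ennreal)

lemma epowr_eq_top_iff [simp]: "epowr x a = top \<longleftrightarrow> x = top"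
  by (cases x) (auto simp: epowr_ennreal)

lemma epowr_less_top_iff [simp]: "epowr x a < top \<longleftrightarrow> x < top"
  by (metis epowr_eq_top_iff top.not_eq_extremum)

lemma epowr_mono: "x \<le> y \<Longrightarrow> 0 \<le> a \<Longrightarrow> epowr x a \<le> epowr y a"
  by (cases x; cases y) (auto simp: epowr_ennreal top_unique intro!: ennreal_leI powr_mono2)

lemma epowr_mult: "0 < a \<Longrightarrow> epowr (x * y) a = epowr x a * epowr y a"
proof (cases x; cases y)
  fix r s assume "0 < a" "x = ennreal r" "0 \<le> r" "y = ennreal s" "0 \<le> s"
  then show ?thesis by (simp add: epowr_ennreal powr_mult flip: ennreal_mult)
next
  fix r assume "0 < a" "x = ennreal r" "0 \<le> r" "y = top"
  then show ?thesis by (auto simp: epowr_ennreal ennreal_mult_top)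
next
  fix r assume "0 < a" "y = ennreal r" "0 \<le> r" "x = top"
  then show ?thesis by (auto simp: epowr_ennreal ennreal_top_mult)
qed simp

lemma epowr_epowr: "epowr (epowr x a) b = epowr x (a * b)"
  by (cases x) (auto simp: epowr_ennreal powr_powr)

lemma epowr_add: "epowr x (a + b) = epowr x a * epowr x b"
  by (cases x) (auto simp: epowr_ennreal powr_add ennreal_mult')

lemma epowr_of_nat: "0 < n \<Longrightarrow> epowr x (real n) = x ^ n"
  by (cases x) (auto simp: epowr_ennreal ennreal_power powr_realpow' power_eq_top_ennreal)

lemma epowr_2: "epowr x 2 = x\<^sup>2"
  using epowr_of_nat[of 2 x] by simp

lemma epowr_inverse: "0 < a \<Longrightarrow> epowr (inverse x) a = inverse (epowr x a)"
proof (cases x)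
  case (real r)
  then show "0 < a \<Longrightarrow> ?thesis"
    by (cases "r = 0") (auto simp: epowr_ennreal inverse_ennreal inverse_powr powr_minus)
qed auto

lemma epowr_le_iff: "0 < a \<Longrightarrow> epowr x a \<le> y \<longleftrightarrow> x \<le> epowr y (1 / a)"
  using epowr_mono[of "epowr x a" y "1/a"] epowr_mono[of x "epowr y (1/a)" a]
  by (auto simp: epowr_epowr)

lemma epowr_SUP: assumes "0 < a" shows "epowr (SUP i\<in>I. f i) a = (SUP i\<in>I. epowr (f i) a)"
proof (rule antisym)
  have "f i \<le> epowr (SUP i\<in>I. epowr (f i) a) (1 / a)" if "i \<in> I" for i
    using that by (subst epowr_le_iff[OF assms, symmetric]) (rule SUP_upper)
  then show "epowr (SUP i\<in>I. f i) a \<le> (SUP i\<in>I. epowr (f i) a)"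
    by (simp add: epowr_le_iff[OF assms] SUP_least)
  show "(SUP i\<in>I. epowr (f i) a) \<le> epowr (SUP i\<in>I. f i) a"
    using assms by (intro SUP_least epowr_mono SUP_upper) auto
qed

lemma borel_measurable_epowr [measurable (raw)]:
  assumes [measurable]: "f \<in> borel_measurable M"
  shows "(\<lambda>x. epowr (f x) a) \<in> borel_measurable M"
  unfolding epowr_def by measurable

lemma ennreal_mult_divide_cancel_left:
  "(a::ennreal) \<noteq> 0 \<Longrightarrow> a \<noteq> top \<Longrightarrow> a * x / a = x"
  by (metis mult.commute mult_divide_eq_ennreal)

text \<open>Young's inequality, extended to the values \<open>0\<close> and \<open>\<infinity>\<close>. Working in \<open>[0, \<infinity>]\<close> throughout makes
  all integrals meaningful, so that finiteness becomes a consequence of estimates instead of a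
  side condition.\<close>
lemma ennreal_Youngs:
  assumes "0 < a" "0 < b" "a + b = 1"
  shows "epowr x a * epowr y b \<le> ennreal a * x + ennreal b * y"
proof (cases x; cases y)
  fix r s assume *: "x = ennreal r" "0 \<le> r" "y = ennreal s" "0 \<le> s"
  show ?thesis
  proof (cases "r = 0 \<or> s = 0")
    case False
    then have "r powr a * s powr b \<le> a * r + b * s"
      using * assms by (intro Youngs_inequality_0) auto
    then have "ennreal (r powr a * s powr b) \<le> ennreal (a * r + b * s)"
      by (rule ennreal_leI)
    then show ?thesis using assms *
      by (simp add: epowr_ennreal ennreal_mult ennreal_plus)
  qed (use * in auto)
qed (use assms in \<open>auto simp: ennreal_mult_top\<close>)

theorem nn_integral_Hoelder:
  assumes [measurable]: "f \<in> borel_measurable M" "g \<in> borel_measurable M"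
    and ab: "0 < a" "0 < b" "a + b = 1"
  shows "(\<integral>\<^sup>+x. epowr (f x) a * epowr (g x) b \<partial>M)
    \<le> epowr (\<integral>\<^sup>+x. f x \<partial>M) a * epowr (\<integral>\<^sup>+x. g x \<partial>M) b"
proof -
  define F where "F = (\<integral>\<^sup>+x. f x \<partial>M)"
  define G where "G = (\<integral>\<^sup>+x. g x \<partial>M)"
  consider "F = 0 \<or> G = 0" | "F \<noteq> 0" "G \<noteq> 0" "F = top \<or> G = top"
    | "F \<noteq> 0" "F \<noteq> top" "G \<noteq> 0" "G \<noteq> top" by blast
  then show ?thesis
  proof cases
    case 1
    then have "(AE x in M. f x = 0) \<or> (AE x in M. g x = 0)"
      by (auto simp: F_def G_def nn_integral_0_iff_AE)
    then have "AE x in M. epowr (f x) a * epowr (g x) b = 0" by auto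
    then have "(\<integral>\<^sup>+x. epowr (f x) a * epowr (g x) b \<partial>M) = 0"
      by (simp add: nn_integral_0_iff_AE)
    then show ?thesis by simp
  next
    case 2
    then have "epowr F a * epowr G b = top"
      by (auto simp: ennreal_mult_eq_top_iff)
    then show ?thesis by (simp add: F_def G_def)
  next
    case 3
    have FF: "x = F * (x / F)" for x
      using 3 by (simp add: ennreal_times_divide ennreal_mult_divide_cancel_left)
    have GG: "x = G * (x / G)" for x
      using 3 by (simp add: ennreal_times_divide ennreal_mult_divide_cancel_left)
    \<comment> \<open>after normalising both integrals to 1, Young's inequality yields the constant \<open>a + b = 1\<close>\<close>
    have "(\<integral>\<^sup>+x. epowr (f x) a * epowr (g x) b \<partial>M)
       = (\<integral>\<^sup>+x. (epowr F a * epowr G b) * (epowr (f x / F) a * epowr (g x / G) b) \<partial>M)"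
    proof (intro nn_integral_cong)
      fix x
      have "epowr (f x) a = epowr F a * epowr (f x / F) a" "epowr (g x) b = epowr G b * epowr (g x / G) b"
        using epowr_mult[OF ab(1), of F "f x / F"] epowr_mult[OF ab(2), of G "g x / G"]
          FF[of "f x"] GG[of "g x"] by metis+
      then show "epowr (f x) a * epowr (g x) b
          = (epowr F a * epowr G b) * (epowr (f x / F) a * epowr (g x / G) b)"
        by (simp only: mult_ac)
    qed
    also have "\<dots> \<le> (\<integral>\<^sup>+x. (epowr F a * epowr G b) * (ennreal a * (f x / F) + ennreal b * (g x / G)) \<partial>M)"
      using ab by (intro nn_integral_mono mult_left_mono ennreal_Youngs) auto
    also have "\<dots> = (epowr F a * epowr G b) * (ennreal a * (F / F) + ennreal b * (G / G))"
      by (simp add: nn_integral_cmult nn_integral_add nn_integral_divide F_def G_def)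
    also have "\<dots> = epowr F a * epowr G b"
      using 3 ab by (simp add: top.not_eq_extremum flip: ennreal_plus)
    finally show ?thesis by (simp add: F_def G_def)
  qed
qed

definition Lp_norm :: "real \<Rightarrow> 'a measure \<Rightarrow> ('a \<Rightarrow> ennreal) \<Rightarrow> ennreal" where
  "Lp_norm q N u = epowr (\<integral>\<^sup>+x. epowr (u x) q \<partial>N) (1 / q)"

definition square_fun :: "(nat \<Rightarrow> 'a \<Rightarrow> ennreal) \<Rightarrow> 'a \<Rightarrow> ennreal" where
  "square_fun u x = epowr (\<Sum>k. (u k x)\<^sup>2) (1 / 2)"

lemma measurable_square_fun [measurable (raw)]:
  "(\<And>k. u k \<in> borel_measurable M) \<Longrightarrow> square_fun u \<in> borel_measurable M"
  unfolding square_fun_def[abs_def] by measurable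

lemma conj_exponent_facts:
  assumes "1 < q"
  shows "1 < conj_exponent q" "1 / q + 1 / conj_exponent q = 1"
    "conj_exponent (conj_exponent q) = q" "(q - 1) * conj_exponent q = q"
    "q / conj_exponent q = q - 1" "conj_exponent q - 1 = 1 / (q - 1)"
  using assms by (auto simp: conj_exponent_def field_simps)

lemma Lp_norm_Hoelder:
  assumes [measurable]: "f \<in> borel_measurable M" "g \<in> borel_measurable M" and q: "1 < q"
  shows "(\<integral>\<^sup>+x. f x * g x \<partial>M) \<le> Lp_norm q M f * Lp_norm (conj_exponent q) M g"
  using nn_integral_Hoelder[of "\<lambda>x. epowr (f x) q" M "\<lambda>x. epowr (g x) (conj_exponent q)"
      "1 / q" "1 / conj_exponent q"] conj_exponent_facts[OF q] q
  by (simp add: Lp_norm_def epowr_epowr)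

lemma suminf_Cauchy_Schwarz:
  fixes f g :: "nat \<Rightarrow> ennreal"
  shows "(\<Sum>k. f k * g k) \<le> epowr (\<Sum>k. (f k)\<^sup>2) (1/2) * epowr (\<Sum>k. (g k)\<^sup>2) (1/2)"
  using nn_integral_Hoelder[of "\<lambda>k. (f k)\<^sup>2" "count_space UNIV" "\<lambda>k. (g k)\<^sup>2" "1/2" "1/2"]
  by (simp add: nn_integral_count_space_nat epowr_epowr flip: epowr_2)

lemma nn_integral_Cauchy_Schwarz:
  assumes [measurable]: "f \<in> borel_measurable M" "g \<in> borel_measurable M"
  shows "(\<integral>\<^sup>+x. f x * g x \<partial>M)\<^sup>2 \<le> (\<integral>\<^sup>+x. (f x)\<^sup>2 \<partial>M) * (\<integral>\<^sup>+x. (g x)\<^sup>2 \<partial>M)"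
proof -
  have "(\<integral>\<^sup>+x. f x * g x \<partial>M) \<le> epowr ((\<integral>\<^sup>+x. (f x)\<^sup>2 \<partial>M) * (\<integral>\<^sup>+x. (g x)\<^sup>2 \<partial>M)) (1/2)"
    using nn_integral_Hoelder[of "\<lambda>k. (f k)\<^sup>2" M "\<lambda>k. (g k)\<^sup>2" "1/2" "1/2"]
    by (simp add: epowr_epowr epowr_mult flip: epowr_2)
  then show ?thesis by (simp add: epowr_le_iff flip: epowr_2)
qed

lemma Lp_norm_mono: "(\<And>x. x \<in> space N \<Longrightarrow> f x \<le> g x) \<Longrightarrow> 0 < q \<Longrightarrow> Lp_norm q N f \<le> Lp_norm q N g"
  unfolding Lp_norm_def by (intro epowr_mono nn_integral_mono) auto

lemma Lp_norm_cong_AE: "(AE x in N. f x = g x) \<Longrightarrow> Lp_norm q N f = Lp_norm q N g"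
  unfolding Lp_norm_def by (intro arg_cong2[where f=epowr] nn_integral_cong_AE) (auto elim: AE_mp)

lemma Lp_norm_cmult:
  assumes [measurable]: "f \<in> borel_measurable M" and q: "0 < q"
  shows "Lp_norm q M (\<lambda>x. c * f x) = c * Lp_norm q M f"
  using q by (simp add: Lp_norm_def epowr_mult nn_integral_cmult epowr_epowr)

text \<open>Absorption: this is how a bound for a norm is extracted once the extremal function has been
  inserted into the dual pairing. Finiteness of \<open>I\<close> is what permits the division.\<close>
lemma epowr_le_self_cancel:
  fixes I C :: ennreal
  assumes "I \<le> C * epowr I b" "I < top" "0 < a" "a + b = 1"
  shows "epowr I a \<le> C"
proof (cases "I = 0")
  case False
  have "I = epowr I a * epowr I b" using epowr_add[of I a b] assms by simp
  then have "epowr I a * epowr I b \<le> C * epowr I b" using assms by simp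
  then have "epowr I a * epowr I b / epowr I b \<le> C * epowr I b / epowr I b"
    by (rule divide_right_mono_ennreal)
  then show ?thesis using False assms(2)
    by (simp add: mult_divide_eq_ennreal ennreal_mult_divide_eq)
qed simp

lemma nn_integral_epowr_SUP:
  assumes [measurable]: "\<And>m::nat. u m \<in> borel_measurable N" and inc: "\<And>x. incseq (\<lambda>m. u m x)"
    and q: "0 < q"
  shows "(\<integral>\<^sup>+x. epowr (SUP m. u m x) q \<partial>N) = (SUP m. \<integral>\<^sup>+x. epowr (u m x) q \<partial>N)"
proof -
  have "(\<integral>\<^sup>+x. epowr (SUP m. u m x) q \<partial>N) = (\<integral>\<^sup>+x. (SUP m. epowr (u m x) q) \<partial>N)"
    by (simp add: epowr_SUP[OF q])
  also have "\<dots> = (SUP m. \<integral>\<^sup>+x. epowr (u m x) q \<partial>N)"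
    using inc q by (intro nn_integral_monotone_convergence_SUP)
      (auto simp: incseq_def le_fun_def intro!: epowr_mono)
  finally show ?thesis .
qed

lemma Lp_norm_SUP_le:
  assumes [measurable]: "\<And>m::nat. u m \<in> borel_measurable N" and inc: "\<And>x. incseq (\<lambda>m. u m x)"
    and q: "0 < q" and le: "\<And>m. Lp_norm q N (u m) \<le> C"
  shows "Lp_norm q N (\<lambda>x. SUP m. u m x) \<le> C"
  unfolding Lp_norm_def nn_integral_epowr_SUP[OF assms(1) inc q]
  using le q by (auto simp: epowr_SUP Lp_norm_def intro!: SUP_least)

lemma SUP_min_of_nat: "(SUP m. min (x::ennreal) (of_nat m)) = x"
proof (rule antisym)
  show "x \<le> (SUP m. min x (of_nat m))"
  proof (cases "x = top")
    case True
    then show ?thesis by (simp add: ennreal_SUP_of_nat_eq_top)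
  next
    case False
    then obtain m where "x < of_nat m"
      using ennreal_Ex_less_of_nat top.not_eq_extremum by blast
    then have "x = min x (of_nat m)" by simp
    then show ?thesis by (metis SUP_upper UNIV_I)
  qed
qed (auto intro: SUP_least)

text \<open>The extremal test function is \<open>g = u\<^sup>q\<^sup>-\<^sup>1\<close>; it yields \<open>I \<le> C I\<^sup>1\<^sup>/\<^sup>q'\<close> for \<open>I = \<integral> u\<^sup>q\<close>. To
  cancel, \<open>I\<close> must be finite, which is arranged by truncating \<open>u\<close> at height \<open>m\<close> (the measure is
  finite) and letting \<open>m\<close> increase.\<close>
lemma Lp_norm_le_by_duality:
  assumes N: "finite_measure N" and [measurable]: "u \<in> borel_measurable N" and q: "1 < q"
    and le: "\<And>g. g \<in> borel_measurable N \<Longrightarrow> (\<integral>\<^sup>+x. u x * g x \<partial>N) \<le> C * Lp_norm (conj_exponent q) N g"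
  shows "Lp_norm q N u \<le> C"
proof -
  interpret finite_measure N by fact
  note cf = conj_exponent_facts[OF q]
  define v where "v m x = min (u x) (of_nat m)" for m :: nat and x
  have [measurable]: "v m \<in> borel_measurable N" for m unfolding v_def[abs_def] by measurable
  have inc: "incseq (\<lambda>m. v m x)" for x
    by (auto simp: incseq_def v_def intro: min.coboundedI2)
  have "Lp_norm q N (v m) \<le> C" for m
  proof -
    define I where "I = (\<integral>\<^sup>+x. epowr (v m x) q \<partial>N)"
    have "I \<le> (\<integral>\<^sup>+x. epowr (of_nat m) q \<partial>N)"
      unfolding I_def v_def using q by (intro nn_integral_mono epowr_mono) auto
    also have "\<dots> < top"
      by (simp add: ennreal_mult_less_top of_nat_less_top emeasure_eq_measure)
    finally have fin: "I < top" .
    have "I = (\<integral>\<^sup>+x. v m x * epowr (v m x) (q - 1) \<partial>N)"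
      using epowr_add[of _ 1 "q - 1"] by (simp add: I_def)
    also have "\<dots> \<le> (\<integral>\<^sup>+x. u x * epowr (v m x) (q - 1) \<partial>N)"
      by (intro nn_integral_mono mult_right_mono) (auto simp: v_def)
    also have "\<dots> \<le> C * Lp_norm (conj_exponent q) N (\<lambda>x. epowr (v m x) (q - 1))"
      by (rule le) measurable
    also have "\<dots> = C * epowr I (1 / conj_exponent q)"
      by (simp add: Lp_norm_def epowr_epowr cf I_def)
    finally have "epowr I (1 / q) \<le> C"
      using fin q cf by (intro epowr_le_self_cancel[of _ _ "1 / conj_exponent q"]) auto
    then show ?thesis by (simp add: Lp_norm_def I_def)
  qed
  then have "Lp_norm q N (\<lambda>x. SUP m. v m x) \<le> C"
    using q inc by (intro Lp_norm_SUP_le) auto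
  then show ?thesis by (simp add: v_def SUP_min_of_nat)
qed

text \<open>Reduction to scalar duality: a test function \<open>g\<close> for the square function \<open>U\<close> is distributed
  over the components as \<open>g\<^sub>k = u\<^sub>k g / U\<close>, which has square function at most \<open>g\<close> and satisfies
  \<open>\<Sum>\<^sub>k u\<^sub>k g\<^sub>k = U g\<close>. The division requires \<open>U < \<infinity>\<close>, hence the truncation in both height and
  number of components.\<close>
lemma square_fun_le_by_duality:
  fixes u :: "nat \<Rightarrow> 'a \<Rightarrow> ennreal"
  assumes N: "finite_measure N" and [measurable]: "\<And>k. u k \<in> borel_measurable N" and q: "1 < q"
    and le: "\<And>g. (\<And>k. g k \<in> borel_measurable N) \<Longrightarrow>
      (\<Sum>k. \<integral>\<^sup>+x. u k x * g k x \<partial>N) \<le> C * Lp_norm (conj_exponent q) N (square_fun g)"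
  shows "Lp_norm q N (square_fun u) \<le> C"
proof -
  note cf = conj_exponent_facts[OF q]
  define v where "v m k x = (if k < m then min (u k x) (of_nat m) else 0)" for m k :: nat and x
  have [measurable]: "v m k \<in> borel_measurable N" for m k unfolding v_def[abs_def] by measurable
  have vinc: "v m k x \<le> v m' k x" if "m \<le> m'" for m m' k x
    using that by (auto simp: v_def intro: min.coboundedI2)
  have inc: "incseq (\<lambda>m. square_fun (v m) x)" for x
    by (auto simp: incseq_def square_fun_def intro!: epowr_mono suminf_le power_mono vinc)
  have SUPv: "(SUP m. v m k x) = u k x" for k x
  proof (rule antisym)
    show "(SUP m. v m k x) \<le> u k x" by (rule SUP_least) (auto simp: v_def)
    have "min (u k x) (of_nat m) \<le> v (max m (Suc k)) k x" for m
      by (auto simp: v_def intro: min.coboundedI2)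
    then have "(SUP m. min (u k x) (of_nat m)) \<le> (SUP m. v m k x)"
      by (intro SUP_mono) auto
    then show "u k x \<le> (SUP m. v m k x)" by (simp add: SUP_min_of_nat)
  qed
  have SUPs: "(SUP m. square_fun (v m) x) = square_fun u x" for x
  proof -
    have "(SUP m. (v m k x)\<^sup>2) = (u k x)\<^sup>2" for k
      using epowr_SUP[of 2 "\<lambda>m. v m k x" UNIV] by (simp add: SUPv epowr_2)
    moreover have "(\<Sum>k. SUP m. (v m k x)\<^sup>2) = (SUP m. \<Sum>k. (v m k x)\<^sup>2)"
      by (intro ennreal_suminf_SUP_eq) (auto simp: incseq_def intro!: power_mono vinc)
    ultimately show ?thesis
      by (simp add: square_fun_def epowr_SUP[symmetric])
  qed
  have "Lp_norm q N (square_fun (v m)) \<le> C" for m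
  proof (rule Lp_norm_le_by_duality[OF N _ q])
    fix g :: "'a \<Rightarrow> ennreal" assume [measurable]: "g \<in> borel_measurable N"
    define U where "U = square_fun (v m)"
    have [measurable]: "U \<in> borel_measurable N" unfolding U_def by measurable
    have U2: "(U x)\<^sup>2 = (\<Sum>k. (v m k x)\<^sup>2)" for x
      by (simp add: U_def square_fun_def epowr_epowr flip: epowr_2)
    have "(\<Sum>k. (v m k x)\<^sup>2) = (\<Sum>k<m. (v m k x)\<^sup>2)" for x
      by (rule suminf_finite) (auto simp: v_def)
    moreover have "(v m k x)\<^sup>2 < top" for k x
    proof -
      have "v m k x \<le> of_nat m" by (simp add: v_def)
      then have "v m k x < top" using of_nat_less_top order_le_less_trans by blast
      then show ?thesis by (simp add: power_less_top_ennreal)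
    qed
    ultimately have "(U x)\<^sup>2 < top" for x
      by (simp add: U2 ennreal_sum_less_top)
    then have Ufin: "U x < top" for x
      by (simp add: power_less_top_ennreal)
    define b where "b k x = v m k x * (g x / U x)" for k x
    have [measurable]: "b k \<in> borel_measurable N" for k unfolding b_def[abs_def] by measurable
    have Ug: "(\<Sum>k. v m k x * b k x) = U x * g x" for x
    proof (cases "U x = 0")
      case True
      then have "v m k x = 0" for k using U2[of x] by (simp add: suminf_eq_zero_iff)
      then show ?thesis using True by (simp add: b_def)
    next
      case False
      have "(\<Sum>k. v m k x * b k x) = (\<Sum>k. (v m k x)\<^sup>2 * (g x / U x))"
        by (simp add: b_def power2_eq_square mult_ac)
      also have "\<dots> = (U x)\<^sup>2 * (g x / U x)" by (simp add: U2)
      also have "\<dots> = U x * (U x * g x / U x)"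
        by (simp add: power2_eq_square ennreal_times_divide mult_ac)
      also have "U x * g x / U x = g x" using False Ufin[of x]
        by (intro ennreal_mult_divide_cancel_left) auto
      finally show ?thesis .
    qed
    have bg: "square_fun b x \<le> g x" for x
    proof (cases "U x = 0")
      case True
      then have "v m k x = 0" for k using U2[of x] by (simp add: suminf_eq_zero_iff)
      then show ?thesis by (simp add: b_def square_fun_def)
    next
      case False
      have "square_fun b x = epowr ((U x)\<^sup>2 * (g x / U x)\<^sup>2) (1 / 2)"
        by (simp add: square_fun_def b_def power_mult_distrib U2)
      also have "\<dots> = epowr ((U x * g x / U x)\<^sup>2) (1 / 2)"
        by (simp add: power_mult_distrib[symmetric] ennreal_times_divide)
      also have "U x * g x / U x = g x" using False Ufin[of x]
        by (intro ennreal_mult_divide_cancel_left) auto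
      finally show ?thesis by (simp add: epowr_epowr flip: epowr_2)
    qed
    have "(\<integral>\<^sup>+x. square_fun (v m) x * g x \<partial>N) = (\<integral>\<^sup>+x. (\<Sum>k. v m k x * b k x) \<partial>N)"
      by (simp add: Ug flip: U_def)
    also have "\<dots> = (\<Sum>k. \<integral>\<^sup>+x. v m k x * b k x \<partial>N)"
      by (rule nn_integral_suminf) measurable
    also have "\<dots> \<le> (\<Sum>k. \<integral>\<^sup>+x. u k x * b k x \<partial>N)"
      by (intro suminf_le nn_integral_mono mult_right_mono) (auto simp: v_def)
    also have "\<dots> \<le> C * Lp_norm (conj_exponent q) N (square_fun b)"
      by (rule le) measurable
    also have "\<dots> \<le> C * Lp_norm (conj_exponent q) N g"
      using bg cf by (intro mult_left_mono Lp_norm_mono) auto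
    finally show "(\<integral>\<^sup>+x. square_fun (v m) x * g x \<partial>N) \<le> C * Lp_norm (conj_exponent q) N g" .
  qed measurable
  then have "Lp_norm q N (\<lambda>x. SUP m. square_fun (v m) x) \<le> C"
    using q inc by (intro Lp_norm_SUP_le) auto
  then show ?thesis by (simp add: SUPs)
qed

lemma square_fun_pairing:
  assumes [measurable]: "\<And>k. u k \<in> borel_measurable N" "\<And>k. g k \<in> borel_measurable N" and q: "1 < q"
  shows "(\<Sum>k. \<integral>\<^sup>+x. u k x * g k x \<partial>N) \<le> Lp_norm q N (square_fun u) * Lp_norm (conj_exponent q) N (square_fun g)"
proof -
  have "(\<Sum>k. \<integral>\<^sup>+x. u k x * g k x \<partial>N) = (\<integral>\<^sup>+x. (\<Sum>k. u k x * g k x) \<partial>N)"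
    by (rule nn_integral_suminf[symmetric]) measurable
  also have "\<dots> \<le> (\<integral>\<^sup>+x. square_fun u x * square_fun g x \<partial>N)"
    unfolding square_fun_def by (intro nn_integral_mono suminf_Cauchy_Schwarz)
  also have "\<dots> \<le> Lp_norm q N (square_fun u) * Lp_norm (conj_exponent q) N (square_fun g)"
    using q by (intro Lp_norm_Hoelder) auto
  finally show ?thesis .
qed

section \<open>Maximal averages over quasi-metric balls\<close>

lemma nn_integral_powr_Ioo:
  assumes "0 \<le> (m::real)" "0 < s"
  shows "(\<integral>\<^sup>+\<tau>. ennreal (s * \<tau> powr (s - 1)) * indicator {0<..<m} \<tau> \<partial>lborel) = ennreal (m powr s)"
proof -
  have "((\<lambda>\<tau>. \<tau> powr (s - 1)) has_integral (m powr (s - 1 + 1) / (s - 1 + 1))) {0..m}"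
    using assms by (intro has_integral_powr_from_0) auto
  then have "((\<lambda>\<tau>. s * \<tau> powr (s - 1)) has_integral (s * (m powr s / s))) {0..m}"
    by (intro has_integral_mult_right) simp
  then have "((\<lambda>\<tau>. s * \<tau> powr (s - 1)) has_integral (m powr s)) {0..m}"
    using assms by simp
  then have "(\<integral>\<^sup>+\<tau>. ennreal (s * \<tau> powr (s - 1)) * indicator {0..m} \<tau> \<partial>lborel) = ennreal (m powr s)"
    using assms by (intro nn_integral_has_integral_lborel nn_integral_has_integral_lebesgue' ) auto
  moreover have "AE \<tau> in lborel. indicator {0..m} \<tau> = (indicator {0<..<m} \<tau> :: ennreal)"
    using AE_lborel_singleton[of 0] AE_lborel_singleton[of m]
    by eventually_elim (auto simp: indicator_def)
  then have "(\<integral>\<^sup>+\<tau>. ennreal (s * \<tau> powr (s - 1)) * indicator {0<..<m} \<tau> \<partial>lborel)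
      = (\<integral>\<^sup>+\<tau>. ennreal (s * \<tau> powr (s - 1)) * indicator {0..m} \<tau> \<partial>lborel)"
    by (intro nn_integral_cong_AE) auto
  ultimately show ?thesis by simp
qed

text \<open>Layer cake representation \<open>a\<^sup>s = \<integral>\<^sub>0\<^sup>a s \<tau>\<^sup>s\<^sup>-\<^sup>1 d\<tau>\<close>, valid also for \<open>a = \<infinity>\<close>.\<close>
lemma epowr_layer_cake:
  assumes "0 < s"
  shows "epowr a s = (\<integral>\<^sup>+\<tau>. ennreal (s * \<tau> powr (s - 1)) * (if 0 < \<tau> \<and> ennreal \<tau> < a then 1 else 0) \<partial>lborel)"
proof (cases a)
  case (real m)
  have "(if 0 < \<tau> \<and> ennreal \<tau> < a then 1 else 0) = (indicator {0<..<m} \<tau> :: ennreal)" for \<tau>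
    using real by (auto simp: indicator_def ennreal_less_iff)
  then show ?thesis using nn_integral_powr_Ioo[of m s] real assms by (simp add: epowr_ennreal)
next
  case top
  let ?I = "\<integral>\<^sup>+\<tau>. ennreal (s * \<tau> powr (s - 1)) * (if 0 < \<tau> \<and> ennreal \<tau> < a then 1 else 0) \<partial>lborel"
  have le: "of_nat m \<le> ?I" for m :: nat
  proof -
    have "of_nat m = ennreal ((real m powr (1/s)) powr s)"
      using assms by (cases "m = 0") (auto simp: powr_powr ennreal_of_nat_eq_real_of_nat)
    also have "\<dots> = (\<integral>\<^sup>+\<tau>. ennreal (s * \<tau> powr (s - 1)) * indicator {0<..<real m powr (1/s)} \<tau> \<partial>lborel)"
      using assms by (subst nn_integral_powr_Ioo) auto
    also have "\<dots> \<le> ?I"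
      using top by (intro nn_integral_mono mult_left_mono) (auto simp: indicator_def)
    finally show ?thesis .
  qed
  have "?I = top"
  proof (rule ccontr)
    assume "?I \<noteq> top"
    then obtain m where "?I < of_nat m"
      using ennreal_Ex_less_of_nat[of ?I] by (auto simp: less_top)
    then show False using le[of m] by simp
  qed
  then show ?thesis using top by simp
qed

text \<open>A quasi-metric space of homogeneous dimension \<open>n\<close>, abstracted from the sphere with \<open>d \<zeta> \<eta> =
  \<bar>1 - \<zeta>\<cdot>\<eta>\<bar>\<close>. The lower bound on the measure of balls is only available up to radius 1, since the
  space has finite measure.\<close>
locale homogeneous_space = finite_measure M for M :: "'a measure" +
  fixes d :: "'a \<Rightarrow> 'a \<Rightarrow> real" and n :: nat and c C :: real
  assumes measurable_d: "(\<lambda>(x, y). d x y) \<in> borel_measurable (M \<Otimes>\<^sub>M M)"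
    and d_sym: "x \<in> space M \<Longrightarrow> y \<in> space M \<Longrightarrow> d x y = d y x"
    and d_self: "x \<in> space M \<Longrightarrow> d x x = 0"
    and d_tri: "x \<in> space M \<Longrightarrow> y \<in> space M \<Longrightarrow> z \<in> space M \<Longrightarrow> d x z \<le> 2 * (d x y + d y z)"
    and cC: "0 < c" "0 < C"
    and ball_lower: "x \<in> space M \<Longrightarrow> 0 < r \<Longrightarrow> r \<le> 1 \<Longrightarrow> ennreal (c * r ^ n) \<le> emeasure M {y \<in> space M. d x y < r}"
    and ball_upper: "x \<in> space M \<Longrightarrow> 0 < r \<Longrightarrow> emeasure M {y \<in> space M. d x y < r} \<le> ennreal (C * r ^ n)"
begin

text \<open>The indicator of \<open>y \<in> B(x, r)\<close>, written as a symmetric kernel so that Fubini arguments can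
  exchange centre and point.\<close>
definition ball_ind :: "real \<Rightarrow> 'a \<Rightarrow> 'a \<Rightarrow> ennreal" where
  "ball_ind r x y = (if d x y < r then 1 else 0)"

lemma measurable_d' [measurable (raw)]:
  assumes [measurable]: "f \<in> measurable K M" "g \<in> measurable K M"
  shows "(\<lambda>k. d (f k) (g k)) \<in> borel_measurable K"
  using measurable_compose[OF measurable_Pair[OF assms] measurable_d] by simp

lemma measurable_ball_ind [measurable (raw)]:
  assumes [measurable]: "f \<in> measurable K M" "g \<in> measurable K M"
  shows "(\<lambda>k. ball_ind r (f k) (g k)) \<in> borel_measurable K"
  unfolding ball_ind_def by measurable

lemma nn_integral_ball_ind:
  assumes sN [measurable_cong]: "sets N = sets M" and x [measurable]: "x \<in> space M"
  shows "(\<integral>\<^sup>+y. ball_ind r x y \<partial>N) = emeasure N {y \<in> space M. d x y < r}"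
proof -
  have sp: "space N = space M" using sN sets_eq_imp_space_eq by blast
  have "(\<integral>\<^sup>+y. ball_ind r x y \<partial>N) = (\<integral>\<^sup>+y. indicator {y \<in> space M. d x y < r} y \<partial>N)"
    by (intro nn_integral_cong) (auto simp: ball_ind_def indicator_def sp)
  also have "\<dots> = emeasure N {y \<in> space M. d x y < r}"
    by (rule nn_integral_indicator) measurable
  finally show ?thesis .
qed

lemma nn_integral_ball_ind_less_top:
  assumes "finite_measure N" "sets N = sets M" "x \<in> space M"
  shows "(\<integral>\<^sup>+y. ball_ind t x y \<partial>N) < top"
  using nn_integral_ball_ind[OF assms(2,3), of t] finite_measure.emeasure_finite[OF assms(1)]
  by (simp add: less_top)

lemma ball_ind_mono: "r \<le> s \<Longrightarrow> ball_ind r x y \<le> ball_ind s x y"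
  by (auto simp: ball_ind_def)

lemma ball_ind_le_1: "ball_ind r x y \<le> 1" by (simp add: ball_ind_def)

lemma ball_ind_sym: "x \<in> space M \<Longrightarrow> y \<in> space M \<Longrightarrow> ball_ind r x y = ball_ind r y x"
  by (simp add: ball_ind_def d_sym)

lemma ball_ind_idem: "ball_ind r x y * ball_ind r x y = ball_ind r x y" by (simp add: ball_ind_def)

text \<open>A maximal disjoint family of balls of one fixed radius avoiding \<open>U\<close>. Disjoint balls of
  radius \<open>r\<close> have measure bounded below, so their number is bounded and a family of maximal
  cardinality exists; every ball that could not be added meets \<open>U\<close> or a ball of the family.\<close>
lemma Vitali_step:
  assumes F: "finite (F :: ('a \<times> nat) set)" and E: "E \<subseteq> space M" and r: "0 < r"
  obtains G where "finite G" "G \<subseteq> E"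
    "disjoint_family_on (\<lambda>y. {z \<in> space M. d y z < r}) G"
    "\<And>y. y \<in> G \<Longrightarrow> {z \<in> space M. d y z < r} \<inter> U = {}"
    "\<And>y. y \<in> E \<Longrightarrow> {z \<in> space M. d y z < r} \<inter> U \<noteq> {} \<or> (\<exists>y'\<in>G. {z \<in> space M. d y z < r} \<inter> {z \<in> space M. d y' z < r} \<noteq> {})"
proof -
  define B where "B y = {z \<in> space M. d y z < r}" for y
  define P where "P G \<longleftrightarrow> finite G \<and> G \<subseteq> E \<and> disjoint_family_on B G \<and> (\<forall>y\<in>G. B y \<inter> U = {})" for G
  have [measurable]: "B y \<in> sets M" if "y \<in> space M" for y
    using that unfolding B_def by measurable
  define b where "b = c * (min r 1) ^ n"
  have b: "0 < b" using r cC by (simp add: b_def)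
  have card: "card G \<le> nat \<lceil>measure M (space M) / b\<rceil>" if "P G" for G
  proof -
    have GM: "G \<subseteq> space M" "finite G" using that E by (auto simp: P_def)
    have "real (card G) * b = (\<Sum>y\<in>G. b)" by simp
    also have "\<dots> \<le> (\<Sum>y\<in>G. measure M (B y))"
    proof (rule sum_mono)
      fix y assume "y \<in> G"
      then have y: "y \<in> space M" using GM by auto
      have "ennreal b \<le> emeasure M {z \<in> space M. d y z < min r 1}"
        unfolding b_def using r y by (intro ball_lower) auto
      also have "\<dots> \<le> emeasure M (B y)"
        using y by (intro emeasure_mono) (auto simp: B_def)
      finally show "b \<le> measure M (B y)"
        by (simp add: emeasure_eq_measure)
    qed
    also have "\<dots> = measure M (\<Union>y\<in>G. B y)"
      using that GM by (intro finite_measure_finite_Union[symmetric]) (auto simp: P_def)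
    also have "\<dots> \<le> measure M (space M)"
      by (rule bounded_measure)
    finally have "real (card G) \<le> measure M (space M) / b"
      using b by (simp add: field_simps)
    then show ?thesis by linarith
  qed
  have P0: "P {}" by (simp add: P_def disjoint_family_on_def)
  obtain G where G: "P G" and max: "\<And>H. P H \<Longrightarrow> card H \<le> card G"
    using ex_has_greatest_nat[of P "{}" card "Suc (nat \<lceil>measure M (space M) / b\<rceil>)"] P0 card
    by (metis le_imp_less_Suc)
  have "B y \<inter> U \<noteq> {} \<or> (\<exists>y'\<in>G. B y \<inter> B y' \<noteq> {})" if y: "y \<in> E" for y
  proof (rule ccontr)
    assume neg: "\<not> ?thesis"
    have "y \<in> B y" using y E r d_self by (auto simp: B_def)
    then have "y \<notin> G" using neg by auto
    moreover have "P (insert y G)"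
      using G neg y by (auto simp: P_def disjoint_family_on_def)
    ultimately show False using max[of "insert y G"] G by (auto simp: P_def)
  qed
  then show ?thesis using G by (intro that[of G]) (auto simp: P_def B_def[symmetric])
qed

text \<open>The radii are processed in decreasing order. A ball that is not selected meets a selected
  ball of at least the same radius \<open>r'\<close>, and the quasi-triangle inequality puts its centre within
  \<open>4 r' < 5 r'\<close> of the centre of the latter.\<close>
lemma Vitali_covering:
  fixes r :: "nat \<Rightarrow> real"
  assumes E: "\<And>k. E k \<subseteq> space M" and r: "\<And>k. 0 < r k" "decseq r"
  shows "\<exists>F. finite F \<and> (\<forall>(y, k)\<in>F. k < K \<and> y \<in> E k) \<and>
    disjoint_family_on (\<lambda>(y, k). {z \<in> space M. d y z < r k}) F \<and>
    (\<forall>k<K. \<forall>y\<in>E k. \<exists>(y', k')\<in>F. d y' y < 5 * r k')"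
proof -
  let ?B = "\<lambda>(y, k). {z \<in> space M. d y z < r k}"
  have "\<exists>F. finite F \<and> (\<forall>(y, k)\<in>F. k < K \<and> y \<in> E k) \<and> disjoint_family_on ?B F \<and>
    (\<forall>k<K. \<forall>y\<in>E k. \<exists>(y', k')\<in>F. d y' y < 5 * r k')"
  proof (induction K)
    case 0
    show ?case by (rule exI[of _ "{}"]) (auto simp: disjoint_family_on_def)
  next
    case (Suc K)
    then obtain F where F: "finite F" "\<forall>(y, k)\<in>F. k < K \<and> y \<in> E k" "disjoint_family_on ?B F"
      "\<forall>k<K. \<forall>y\<in>E k. \<exists>(y', k')\<in>F. d y' y < 5 * r k'" by blast
    obtain G where G: "finite G" "G \<subseteq> E K"
      "disjoint_family_on (\<lambda>y. ?B (y, K)) G"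
      "\<And>y. y \<in> G \<Longrightarrow> ?B (y, K) \<inter> (\<Union>i\<in>F. ?B i) = {}"
      "\<And>y. y \<in> E K \<Longrightarrow> ?B (y, K) \<inter> (\<Union>i\<in>F. ?B i) \<noteq> {} \<or> (\<exists>y'\<in>G. ?B (y, K) \<inter> ?B (y', K) \<noteq> {})"
      using Vitali_step[OF F(1) E r(1), of K K "\<Union>i\<in>F. ?B i" thesis] by auto
    define H where "H = F \<union> (\<lambda>y. (y, K)) ` G"
    have near: "d y' y < 5 * r k'" if ne: "?B (y, K) \<inter> ?B (y', k') \<noteq> {}" and "k' \<le> K" "y \<in> E K" "y' \<in> E k'" for y y' k'
    proof -
      obtain u where "u \<in> ?B (y, K) \<inter> ?B (y', k')" using ne by auto
      then have u: "u \<in> space M" "d y u < r K" "d y' u < r k'" by auto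
      have sp: "y \<in> space M" "y' \<in> space M" using that E by auto
      have "r K \<le> r k'" using r(2) that by (auto simp: decseq_def)
      have "d y' y \<le> 2 * (d y' u + d u y)" using sp u by (intro d_tri) auto
      also have "\<dots> \<le> 4 * r k'" using u sp d_sym[of u y] \<open>r K \<le> r k'\<close> by auto
      also have "\<dots> < 5 * r k'" using r(1)[of k'] by auto
      finally show ?thesis .
    qed
    have 1: "finite H" using F G by (simp add: H_def)
    have 2: "\<forall>(y, k)\<in>H. k < Suc K \<and> y \<in> E k" using F(2) G(2) by (auto simp: H_def)
    have 3: "disjoint_family_on ?B H"
      unfolding disjoint_family_on_def
    proof (intro ballI impI)
      fix i j assume ij: "i \<in> H" "j \<in> H" "i \<noteq> j"
      then consider "i \<in> F" "j \<in> F" | y where "i \<in> F" "j = (y, K)" "y \<in> G"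
        | y where "j \<in> F" "i = (y, K)" "y \<in> G"
        | y y' where "i = (y, K)" "y \<in> G" "j = (y', K)" "y' \<in> G" "y \<noteq> y'"
        by (auto simp: H_def)
      then show "?B i \<inter> ?B j = {}"
      proof cases
        case 1
        then show ?thesis using F(3) ij unfolding disjoint_family_on_def by blast
      next
        case 2
        then show ?thesis using G(4)[of y] by blast
      next
        case 3
        then show ?thesis using G(4)[of y] by blast
      next
        case 4
        then show ?thesis using G(3) unfolding disjoint_family_on_def by blast
      qed
    qed
    have 4: "\<exists>(y', k')\<in>H. d y' y < 5 * r k'" if "k < Suc K" "y \<in> E k" for k y
    proof (cases "k < K")
      case True
      then show ?thesis using F(4) that by (fastforce simp: H_def)
    next
      case False
      then have [simp]: "k = K" using that by simp
      from G(5)[of y] that consider i where "i \<in> F" "?B (y, K) \<inter> ?B i \<noteq> {}"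
        | y' where "y' \<in> G" "?B (y, K) \<inter> ?B (y', K) \<noteq> {}" by auto
      then show ?thesis
      proof cases
        case 1
        obtain y' k' where i: "i = (y', k')" by force
        then have "d y' y < 5 * r k'" using 1 that F(2) by (intro near) auto
        then show ?thesis using 1 i by (auto simp: H_def)
      next
        case 2
        then have "d y' y < 5 * r K" using that G(2) by (intro near) auto
        then show ?thesis using 2 by (auto simp: H_def)
      qed
    qed
    show ?case using 1 2 3 4 by (intro exI[of _ H]) auto
  qed
  then show ?thesis .
qed

text \<open>The numerator uses the ball of radius \<open>r\<close>, the denominator that of the larger radius \<open>s\<close>.
  This enlargement is what makes the maximal theorem and the inequality of Stein type below hold
  for every finite measure \<open>N\<close>, doubling or not. For \<open>r \<le> s\<close> the numerator vanishes wherever the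
  denominator does, and the value is then \<open>0\<close>.\<close>
definition avg :: "'a measure \<Rightarrow> real \<Rightarrow> real \<Rightarrow> ('a \<Rightarrow> ennreal) \<Rightarrow> 'a \<Rightarrow> ennreal" where
  "avg N r s f x = (\<integral>\<^sup>+y. ball_ind r x y * f y \<partial>N) / (\<integral>\<^sup>+y. ball_ind s x y \<partial>N)"

lemma measurable_avg [measurable (raw)]:
  assumes "finite_measure N" and sN [measurable_cong]: "sets N = sets M"
    and [measurable]: "f \<in> borel_measurable N" "g \<in> measurable K M"
  shows "(\<lambda>k. avg N r s f (g k)) \<in> borel_measurable K"
proof -
  interpret finite_measure N by fact
  show ?thesis unfolding avg_def by measurable
qed

definition maximal_avg :: "'a measure \<Rightarrow> (nat \<Rightarrow> real) \<Rightarrow> (nat \<Rightarrow> real) \<Rightarrow> ('a \<Rightarrow> ennreal) \<Rightarrow> 'a \<Rightarrow> ennreal" where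
  "maximal_avg N r s h y = (SUP k. avg N (r k) (s k) h y)"

context
  fixes N :: "'a measure" and r s :: "nat \<Rightarrow> real"
  assumes finN: "finite_measure N" and sN [measurable_cong]: "sets N = sets M"
    and r: "\<And>k. 0 < r k" "decseq r"
begin

interpretation N: finite_measure N by (rule finN)

lemma space_N: "space N = space M" using sN sets_eq_imp_space_eq by blast

lemma measurable_maximal_avg [measurable (raw)]:
  assumes [measurable]: "h \<in> borel_measurable N" "g \<in> measurable K M"
  shows "(\<lambda>k. maximal_avg N r s h (g k)) \<in> borel_measurable K"
  unfolding maximal_avg_def using finN sN by measurable

text \<open>A Vitali selection among the balls \<open>B(y, r\<^sub>k)\<close> on which the average exceeds \<open>t\<close>: the balls
  \<open>B(y, s\<^sub>k)\<close>, which contain the five-fold enlargements, cover the level set, and the \<open>N\<close>-measure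
  of each of them is at most \<open>t\<^sup>-\<^sup>1\<close> times the integral of \<open>h\<close> over the selected ball of radius
  \<open>r\<^sub>k\<close>. The latter are disjoint.\<close>
lemma weak_type_finite:
  assumes s: "\<And>k. 5 * r k \<le> s k" and [measurable]: "h \<in> borel_measurable N" 
  shows "t * emeasure N {y \<in> space M. \<exists>k<K. t < avg N (r k) (s k) h y} \<le> (\<integral>\<^sup>+x. h x \<partial>N)"
proof -
  define E where "E k = {y \<in> space M. t < avg N (r k) (s k) h y}" for k
  have EM: "E k \<subseteq> space M" for k by (auto simp: E_def)
  obtain F where F: "finite F" "\<And>y k. (y, k) \<in> F \<Longrightarrow> k < K \<and> y \<in> E k"
    "disjoint_family_on (\<lambda>(y, k). {z \<in> space M. d y z < r k}) F"
    "\<And>k y. k < K \<Longrightarrow> y \<in> E k \<Longrightarrow> \<exists>(y', k')\<in>F. d y' y < 5 * r k'"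
    using Vitali_covering[of E r K, OF EM r] by (smt (verit) case_prodD)
  have FM: "y \<in> space M" if "(y, k) \<in> F" for y k using F(2)[OF that] EM by blast
  let ?B = "\<lambda>(y, k). {z \<in> space M. d y z < s k}"
  have Bm: "?B i \<in> sets N" if "i \<in> F" for i
    using that FM by (cases i) auto
  have "{y \<in> space M. \<exists>k<K. t < avg N (r k) (s k) h y} \<subseteq> (\<Union>i\<in>F. ?B i)"
  proof safe
    fix y k assume "y \<in> space M" "k < K" "t < avg N (r k) (s k) h y"
    then have "\<exists>(y', k')\<in>F. d y' y < 5 * r k'" by (intro F(4)) (auto simp: E_def)
    then show "y \<in> (\<Union>i\<in>F. ?B i)" using s \<open>y \<in> space M\<close> by (fastforce intro: less_le_trans)
  qed
  then have "emeasure N {y \<in> space M. \<exists>k<K. t < avg N (r k) (s k) h y} \<le> emeasure N (\<Union>i\<in>F. ?B i)"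
    using F(1) Bm by (intro emeasure_mono sets.finite_UN)
  also have "\<dots> \<le> (\<Sum>i\<in>F. emeasure N (?B i))"
    using F(1) Bm by (intro emeasure_subadditive_finite image_subsetI)
  finally have "t * emeasure N {y \<in> space M. \<exists>k<K. t < avg N (r k) (s k) h y}
      \<le> t * (\<Sum>i\<in>F. emeasure N (?B i))" by (rule mult_left_mono) simp
  also have "\<dots> = (\<Sum>i\<in>F. t * emeasure N (?B i))" by (rule sum_distrib_left)
  also have "\<dots> \<le> (\<Sum>i\<in>F. \<integral>\<^sup>+x. ball_ind (r (snd i)) (fst i) x * h x \<partial>N)"
  proof (rule sum_mono)
    fix i assume i: "i \<in> F"
    obtain y k where [simp]: "i = (y, k)" by force
    have y [measurable]: "y \<in> space M" using i FM by auto
    have "t < avg N (r k) (s k) h y" using F(2)[of y k] i by (auto simp: E_def)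
    then have "t * (\<integral>\<^sup>+z. ball_ind (s k) y z \<partial>N) \<le> avg N (r k) (s k) h y * (\<integral>\<^sup>+z. ball_ind (s k) y z \<partial>N)"
      by (intro mult_right_mono) auto
    also have "\<dots> \<le> (\<integral>\<^sup>+x. ball_ind (r k) y x * h x \<partial>N)"
      unfolding avg_def using nn_integral_ball_ind_less_top[OF finN sN y, of "s k"]
      by (cases "(\<integral>\<^sup>+z. ball_ind (s k) y z \<partial>N) = 0") (simp_all add: ennreal_divide_times ennreal_times_divide divide_ennreal_def[symmetric] mult_divide_eq_ennreal)
    finally show "t * emeasure N (?B i) \<le> (\<integral>\<^sup>+x. ball_ind (r (snd i)) (fst i) x * h x \<partial>N)"
      using nn_integral_ball_ind[OF sN y, of "s k"] by simp
  qed
  also have "\<dots> = (\<integral>\<^sup>+x. (\<Sum>i\<in>F. ball_ind (r (snd i)) (fst i) x * h x) \<partial>N)"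
  proof (rule nn_integral_sum[symmetric])
    fix i assume "i \<in> F"
    then have [measurable]: "fst i \<in> space M" using FM[of "fst i" "snd i"] by simp
    show "(\<lambda>x. ball_ind (r (snd i)) (fst i) x * h x) \<in> borel_measurable N" by measurable
  qed
  also have "\<dots> \<le> (\<integral>\<^sup>+x. h x \<partial>N)"
  proof (rule nn_integral_mono)
    fix x assume "x \<in> space N"
    then have x: "x \<in> space M" by (simp add: space_N)
    have "(\<Sum>i\<in>F. ball_ind (r (snd i)) (fst i) x) \<le> 1"
    proof (cases "\<exists>i\<in>F. d (fst i) x < r (snd i)")
      case True
      then obtain i where i: "i \<in> F" "d (fst i) x < r (snd i)" by auto
      have "ball_ind (r (snd j)) (fst j) x = 0" if "j \<in> F - {i}" for j
      proof -
        have "\<not> d (fst j) x < r (snd j)"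
          using disjoint_family_onD[OF F(3) i(1), of j] that i x by (auto simp: case_prod_beta)
        then show ?thesis by (simp add: ball_ind_def)
      qed
      then have "(\<Sum>i\<in>F. ball_ind (r (snd i)) (fst i) x) = ball_ind (r (snd i)) (fst i) x"
        using F(1) i by (subst sum.remove[of _ i]) auto
      then show ?thesis by (simp add: ball_ind_le_1)
    qed (simp add: ball_ind_def)
    then have "(\<Sum>i\<in>F. ball_ind (r (snd i)) (fst i) x) * h x \<le> 1 * h x"
      by (rule mult_right_mono) simp
    then show "(\<Sum>i\<in>F. ball_ind (r (snd i)) (fst i) x * h x) \<le> h x"
      by (simp add: sum_distrib_right)
  qed
  finally show ?thesis .
qed

lemma weak_type:
  assumes s: "\<And>k. 5 * r k \<le> s k" and [measurable]: "h \<in> borel_measurable N"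
  shows "t * emeasure N {y \<in> space M. t < maximal_avg N r s h y} \<le> (\<integral>\<^sup>+x. h x \<partial>N)"
proof -
  define A where "A K = {y \<in> space M. \<exists>k<K. t < avg N (r k) (s k) h y}" for K :: nat
  have [measurable]: "(\<lambda>y. avg N (r k) (s k) h y) \<in> borel_measurable N" for k
    using finN sN by measurable
  have A [measurable]: "A K \<in> sets N" for K 
    unfolding A_def space_N[symmetric] by measurable
  have "{y \<in> space M. t < maximal_avg N r s h y} = (\<Union>K. A K)"
    by (auto simp: maximal_avg_def A_def less_SUP_iff)
  then have "t * emeasure N {y \<in> space M. t < maximal_avg N r s h y} = t * (SUP K. emeasure N (A K))"
    by (subst SUP_emeasure_incseq) (auto simp: incseq_def A_def[abs_def] intro: less_le_trans A)
  also have "\<dots> = (SUP K. t * emeasure N (A K))" by (rule SUP_mult_left_ennreal)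
  also have "\<dots> \<le> (\<integral>\<^sup>+x. h x \<partial>N)"
    unfolding A_def using s by (intro SUP_least weak_type_finite) auto
  finally show ?thesis .
qed

text \<open>Marcinkiewicz interpolation between the weak type bound and the trivial bound for bounded
  functions: the part of \<open>h\<close> below \<open>t\<close> contributes at most \<open>t\<close> to the average, so \<open>{M h > 2t}\<close> is
  controlled by the part of \<open>h\<close> above \<open>t\<close>. Integrating over the levels by the layer cake formula
  gives the constant.\<close>
lemma maximal_strong_type:
  assumes s: "\<And>k. 5 * r k \<le> s k" and [measurable]: "h \<in> borel_measurable N" and q: "1 < q"
  shows "Lp_norm q N (maximal_avg N r s h) \<le> ennreal (2 * (q / (q - 1)) powr (1 / q)) * Lp_norm q N h"
proof -
  have [measurable]: "maximal_avg N r s h \<in> borel_measurable N" by measurable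
  interpret pair_sigma_finite lborel N
    by (intro pair_sigma_finite.intro sigma_finite_lborel N.sigma_finite_measure_axioms)
  have trunc: "ennreal t * emeasure N {y \<in> space N. ennreal t < maximal_avg N r s h y / 2}
      \<le> (\<integral>\<^sup>+x. h x * (if ennreal t < h x then 1 else 0) \<partial>N)" if "0 < t" for t
  proof -
    define h' where "h' x = h x * (if ennreal t < h x then 1 else 0)" for x
    have [measurable]: "h' \<in> borel_measurable N" unfolding h'_def[abs_def] by measurable
    have "maximal_avg N r s h y \<le> maximal_avg N r s h' y + ennreal t" if y [measurable]: "y \<in> space M" for y
      unfolding maximal_avg_def
    proof (rule SUP_least)
      fix k
      let ?b = "\<integral>\<^sup>+z. ball_ind (s k) y z \<partial>N"
      have "(\<integral>\<^sup>+x. ball_ind (r k) y x * h x \<partial>N) \<le> (\<integral>\<^sup>+x. ball_ind (r k) y x * h' x + ennreal t * ball_ind (s k) y x \<partial>N)"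
        using ball_ind_mono[of "r k" "s k" y] s[of k] r(1)[of k]
        by (intro nn_integral_mono) (auto simp: h'_def ball_ind_def not_less)
      also have "\<dots> = (\<integral>\<^sup>+x. ball_ind (r k) y x * h' x \<partial>N) + ennreal t * ?b"
        by (simp add: nn_integral_add nn_integral_cmult)
      finally have "avg N (r k) (s k) h y \<le> ((\<integral>\<^sup>+x. ball_ind (r k) y x * h' x \<partial>N) + ennreal t * ?b) / ?b"
        unfolding avg_def by (rule divide_right_mono_ennreal)
      also have "\<dots> = avg N (r k) (s k) h' y + ennreal t * ?b / ?b"
        by (simp add: avg_def add_divide_distrib_ennreal)
      also have "ennreal t * ?b / ?b \<le> ennreal t"
        using nn_integral_ball_ind_less_top[OF finN sN y, of "s k"] by (cases "?b = 0") (auto simp: mult_divide_eq_ennreal)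
      finally show "avg N (r k) (s k) h y \<le> (SUP k. avg N (r k) (s k) h' y) + ennreal t"
        by (meson SUP_upper UNIV_I add_mono order_refl order_trans)
    qed
    then have "{y \<in> space N. ennreal t < maximal_avg N r s h y / 2} \<subseteq> {y \<in> space M. ennreal t < maximal_avg N r s h' y}"
    proof (safe, goal_cases)
      case (2 y)
      then have y: "y \<in> space M" by (simp add: space_N)
      show ?case
      proof (rule ccontr)
        assume "\<not> ennreal t < maximal_avg N r s h' y"
        then have "maximal_avg N r s h y \<le> ennreal t + ennreal t" 
          using 2(1)[OF y] by (meson add_mono not_less order_refl order_trans)
        also have "\<dots> = ennreal t * 2" by (simp add: mult_2_right)
        finally have "maximal_avg N r s h y / 2 \<le> ennreal t * 2 / 2" by (rule divide_right_mono_ennreal)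
        also have "\<dots> = ennreal t" by (simp add: mult_divide_eq_ennreal)
        finally show False using 2 by auto
      qed
    qed (simp add: space_N)
    then have "ennreal t * emeasure N {y \<in> space N. ennreal t < maximal_avg N r s h y / 2}
      \<le> ennreal t * emeasure N {y \<in> space M. ennreal t < maximal_avg N r s h' y}"
      by (intro mult_left_mono emeasure_mono) (auto simp flip: space_N)
    also have "\<dots> \<le> (\<integral>\<^sup>+x. h' x \<partial>N)" by (rule weak_type[OF s]) measurable
    finally show ?thesis by (simp add: h'_def)
  qed
  have "(\<integral>\<^sup>+y. epowr (maximal_avg N r s h y / 2) q \<partial>N) =
    (\<integral>\<^sup>+y. (\<integral>\<^sup>+\<tau>. ennreal (q * \<tau> powr (q - 1)) * (if 0 < \<tau> \<and> ennreal \<tau> < maximal_avg N r s h y / 2 then 1 else 0) \<partial>lborel) \<partial>N)"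
    using q by (subst epowr_layer_cake) auto
  also have "\<dots> = (\<integral>\<^sup>+\<tau>. (\<integral>\<^sup>+y. ennreal (q * \<tau> powr (q - 1)) * (if 0 < \<tau> \<and> ennreal \<tau> < maximal_avg N r s h y / 2 then 1 else 0) \<partial>N) \<partial>lborel)"
    by (rule Fubini') measurable
  also have "\<dots> \<le> (\<integral>\<^sup>+\<tau>. (\<integral>\<^sup>+x. ennreal (q / (q - 1)) * (h x * (ennreal ((q - 1) * \<tau> powr (q - 1 - 1)) * (if 0 < \<tau> \<and> ennreal \<tau> < h x then 1 else 0))) \<partial>N) \<partial>lborel)"
  proof (rule nn_integral_mono)
    fix \<tau> :: real
    show "(\<integral>\<^sup>+y. ennreal (q * \<tau> powr (q - 1)) * (if 0 < \<tau> \<and> ennreal \<tau> < maximal_avg N r s h y / 2 then 1 else 0) \<partial>N)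
      \<le> (\<integral>\<^sup>+x. ennreal (q / (q - 1)) * (h x * (ennreal ((q - 1) * \<tau> powr (q - 1 - 1)) * (if 0 < \<tau> \<and> ennreal \<tau> < h x then 1 else 0))) \<partial>N)"
    proof (cases "0 < \<tau>")
      case True
      have e1: "ennreal (q * \<tau> powr (q - 1)) = ennreal (q * \<tau> powr (q - 2)) * ennreal \<tau>"
        using True q powr_add[of \<tau> "q - 2" 1] by (simp flip: ennreal_mult')
      have e2: "ennreal (q / (q - 1)) * ennreal ((q - 1) * \<tau> powr (q - 2)) = ennreal (q * \<tau> powr (q - 2))"
        using True q by (simp flip: ennreal_mult')
      have "(\<integral>\<^sup>+y. ennreal (q * \<tau> powr (q - 1)) * (if 0 < \<tau> \<and> ennreal \<tau> < maximal_avg N r s h y / 2 then 1 else 0) \<partial>N)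
        = ennreal (q * \<tau> powr (q - 1)) * (\<integral>\<^sup>+y. indicator {y \<in> space N. ennreal \<tau> < maximal_avg N r s h y / 2} y \<partial>N)"
        using True by (subst nn_integral_cmult[symmetric]) (auto intro!: nn_integral_cong simp: indicator_def)
      also have "\<dots> = ennreal (q * \<tau> powr (q - 2)) * (ennreal \<tau> * emeasure N {y \<in> space N. ennreal \<tau> < maximal_avg N r s h y / 2})"
        by (subst nn_integral_indicator) (auto simp: e1 mult.assoc)
      also have "\<dots> \<le> ennreal (q * \<tau> powr (q - 2)) * (\<integral>\<^sup>+x. h x * (if ennreal \<tau> < h x then 1 else 0) \<partial>N)"
        by (intro mult_left_mono trunc True) simp
      also have "\<dots> = (\<integral>\<^sup>+x. ennreal (q * \<tau> powr (q - 2)) * (h x * (if ennreal \<tau> < h x then 1 else 0)) \<partial>N)"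
        by (subst nn_integral_cmult) auto
      also have "\<dots> = (\<integral>\<^sup>+x. ennreal (q / (q - 1)) * (h x * (ennreal ((q - 1) * \<tau> powr (q - 1 - 1)) * (if 0 < \<tau> \<and> ennreal \<tau> < h x then 1 else 0))) \<partial>N)"
        using True by (intro nn_integral_cong) (simp add: e2[symmetric] mult_ac)
      finally show ?thesis .
    qed simp
  qed
  also have "\<dots> = (\<integral>\<^sup>+x. (\<integral>\<^sup>+\<tau>. ennreal (q / (q - 1)) * (h x * (ennreal ((q - 1) * \<tau> powr (q - 1 - 1)) * (if 0 < \<tau> \<and> ennreal \<tau> < h x then 1 else 0))) \<partial>lborel) \<partial>N)"
    by (rule Fubini'[symmetric]) measurable
  also have "\<dots> = (\<integral>\<^sup>+x. ennreal (q / (q - 1)) * (h x * epowr (h x) (q - 1)) \<partial>N)"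
    using q by (subst epowr_layer_cake) (auto simp: nn_integral_cmult)
  also have "\<dots> = ennreal (q / (q - 1)) * (\<integral>\<^sup>+x. epowr (h x) q \<partial>N)"
    using epowr_add[of _ 1 "q - 1"] by (simp add: nn_integral_cmult)
  finally have *: "(\<integral>\<^sup>+y. epowr (maximal_avg N r s h y / 2) q \<partial>N) \<le> ennreal (q / (q - 1)) * (\<integral>\<^sup>+x. epowr (h x) q \<partial>N)" .
  have "Lp_norm q N (maximal_avg N r s h) = Lp_norm q N (\<lambda>y. 2 * (maximal_avg N r s h y / 2))"
    by (simp add: ennreal_times_divide ennreal_mult_divide_cancel_left)
  also have "\<dots> = 2 * Lp_norm q N (\<lambda>y. maximal_avg N r s h y / 2)"
    using q by (intro Lp_norm_cmult) auto
  also have "Lp_norm q N (\<lambda>y. maximal_avg N r s h y / 2) \<le> epowr (ennreal (q / (q - 1)) * (\<integral>\<^sup>+x. epowr (h x) q \<partial>N)) (1 / q)"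
    unfolding Lp_norm_def using * q by (intro epowr_mono) auto
  also have "\<dots> = ennreal ((q / (q - 1)) powr (1/q)) * Lp_norm q N h"
    using q by (simp add: epowr_mult Lp_norm_def epowr_ennreal)
  finally show ?thesis 
    by (simp add: ennreal_mult' mult.assoc mult_left_mono)
qed

end

end

section \<open>A vector-valued inequality of Stein type\<close>

lemma inverse_ennreal_antimono:
  assumes "(x::ennreal) \<le> y" shows "inverse y \<le> inverse x"
proof (cases "x = 0 \<or> y = top")
  case False
  then obtain a b where "x = ennreal a" "y = ennreal b" "0 < a" "0 \<le> b"
    using assms by (cases x; cases y) (auto simp: top_unique)
  then show ?thesis using assms by (simp add: inverse_ennreal le_imp_inverse_le)
qed auto

definition maximal_const :: "real \<Rightarrow> real" where
  "maximal_const q = 2 * (q / (q - 1)) powr (1 / q)"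

text \<open>By duality the constant for \<open>q < 2\<close> is that of the conjugate exponent; for \<open>q > 2\<close> it is the
  square root of the maximal constant for the exponent conjugate to \<open>q / 2\<close>.\<close>
definition Stein_const :: "real \<Rightarrow> real" where
  "Stein_const q = (if q = 2 then 1 else
     let t = (if 2 < q then q else conj_exponent q) in sqrt (maximal_const (t / (t - 2))))"

lemma Lp_norm_square_fun_half: "0 < q \<Longrightarrow> Lp_norm q N (square_fun f) = epowr (Lp_norm (q / 2) N (\<lambda>x. \<Sum>k. (f k x)\<^sup>2)) (1 / 2)"
  by (simp add: Lp_norm_def square_fun_def epowr_epowr)

context homogeneous_space
begin

context
  fixes N :: "'a measure"
  assumes finN: "finite_measure N" and sN [measurable_cong]: "sets N = sets M"
begin

interpretation N: finite_measure N by (rule finN)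

lemma avg_square_le:
  assumes "r \<le> s" and x [measurable]: "x \<in> space M" and [measurable]: "f \<in> borel_measurable N"
  shows "(avg N r s f x)\<^sup>2 \<le> avg N r s (\<lambda>y. (f y)\<^sup>2) x"
proof -
  define b where "b = (\<integral>\<^sup>+y. ball_ind s x y \<partial>N)"
  define X where "X = (\<integral>\<^sup>+y. ball_ind r x y * (f y)\<^sup>2 \<partial>N)"
  have b: "b < top" unfolding b_def by (rule nn_integral_ball_ind_less_top[OF finN sN x])
  have "(\<integral>\<^sup>+y. ball_ind r x y * f y \<partial>N)\<^sup>2 = (\<integral>\<^sup>+y. ball_ind r x y * (ball_ind r x y * f y) \<partial>N)\<^sup>2"
    by (simp add: mult.assoc[symmetric] ball_ind_idem)
  also have "\<dots> \<le> (\<integral>\<^sup>+y. (ball_ind r x y)\<^sup>2 \<partial>N) * (\<integral>\<^sup>+y. (ball_ind r x y * f y)\<^sup>2 \<partial>N)"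
    by (rule nn_integral_Cauchy_Schwarz) measurable
  also have "\<dots> = (\<integral>\<^sup>+y. ball_ind r x y \<partial>N) * X"
    by (simp add: power2_eq_square X_def mult_ac ball_ind_idem)
  also have "\<dots> \<le> b * X"
    unfolding b_def using assms(1) by (intro mult_right_mono nn_integral_mono ball_ind_mono) auto
  finally have le: "(\<integral>\<^sup>+y. ball_ind r x y * f y \<partial>N)\<^sup>2 \<le> b * X" .
  show ?thesis
  proof (cases "b = 0")
    case True
    then show ?thesis using le by (simp add: avg_def)
  next
    case False
    have "(avg N r s f x)\<^sup>2 = (\<integral>\<^sup>+y. ball_ind r x y * f y \<partial>N)\<^sup>2 / b\<^sup>2"
      by (simp add: avg_def b_def power_divide_distrib_ennreal)
    also have "\<dots> \<le> (X * b) / (b * b)"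
      using le by (simp add: power2_eq_square divide_right_mono_ennreal mult.commute)
    also have "\<dots> = X / b" using False b by (intro divide_mult_eq) auto
    finally show ?thesis by (simp add: avg_def b_def X_def)
  qed
qed

text \<open>Averaging is almost self-adjoint: if \<open>d x y < r\<close> then \<open>B(y, s') \<subseteq> B(x, s)\<close>, so replacing the
  normalisation at \<open>x\<close> by the one at \<open>y\<close> only increases the kernel. The price is the decrease of
  the enlargement from \<open>s\<close> to \<open>s'\<close>.\<close>
lemma avg_adjoint:
  assumes rs: "2 * (r + s') \<le> s" and [measurable]: "f \<in> borel_measurable N" "g \<in> borel_measurable N"
  shows "(\<integral>\<^sup>+x. avg N r s f x * g x \<partial>N) \<le> (\<integral>\<^sup>+x. f x * avg N r s' g x \<partial>N)"
proof -
  interpret pair_sigma_finite N N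
    by (intro pair_sigma_finite.intro N.sigma_finite_measure_axioms)
  have sp: "space N = space M" using sN sets_eq_imp_space_eq by blast
  have [measurable]: "(\<lambda>x. \<integral>\<^sup>+z. ball_ind s x z \<partial>N) \<in> borel_measurable N" for s by measurable
  have swap: "ball_ind r x y / (\<integral>\<^sup>+z. ball_ind s x z \<partial>N) \<le> ball_ind r y x / (\<integral>\<^sup>+z. ball_ind s' y z \<partial>N)"
    if "x \<in> space M" "y \<in> space M" for x y
  proof (cases "d x y < r")
    case True
    have "ball_ind s' y z \<le> ball_ind s x z" if z: "z \<in> space M" for z
      using d_tri[of x y z] z \<open>x \<in> space M\<close> \<open>y \<in> space M\<close> True rs by (auto simp: ball_ind_def)
    then have "(\<integral>\<^sup>+z. ball_ind s' y z \<partial>N) \<le> (\<integral>\<^sup>+z. ball_ind s x z \<partial>N)"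
      by (intro nn_integral_mono) (auto simp: sp)
    then show ?thesis using ball_ind_sym[OF that, of r]
      by (simp add: divide_ennreal_def mult_left_mono inverse_ennreal_antimono)
  qed (simp add: ball_ind_def)
  have "(\<integral>\<^sup>+x. avg N r s f x * g x \<partial>N)
      = (\<integral>\<^sup>+x. (\<integral>\<^sup>+y. ball_ind r x y / (\<integral>\<^sup>+z. ball_ind s x z \<partial>N) * (f y * g x) \<partial>N) \<partial>N)"
  proof (rule nn_integral_cong)
    fix x assume "x \<in> space N"
    then have [measurable]: "x \<in> space M" by (simp add: sp)
    have "(\<integral>\<^sup>+y. ball_ind r x y / (\<integral>\<^sup>+z. ball_ind s x z \<partial>N) * (f y * g x) \<partial>N)
       = (\<integral>\<^sup>+y. (ball_ind r x y * f y) * (inverse (\<integral>\<^sup>+z. ball_ind s x z \<partial>N) * g x) \<partial>N)"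
      by (simp add: divide_ennreal_def mult_ac)
    also have "\<dots> = (\<integral>\<^sup>+y. ball_ind r x y * f y \<partial>N) * (inverse (\<integral>\<^sup>+z. ball_ind s x z \<partial>N) * g x)"
      by (rule nn_integral_multc) measurable
    finally show "avg N r s f x * g x = (\<integral>\<^sup>+y. ball_ind r x y / (\<integral>\<^sup>+z. ball_ind s x z \<partial>N) * (f y * g x) \<partial>N)"
      by (simp add: avg_def divide_ennreal_def mult_ac)
  qed
  also have "\<dots> \<le> (\<integral>\<^sup>+x. (\<integral>\<^sup>+y. ball_ind r y x / (\<integral>\<^sup>+z. ball_ind s' y z \<partial>N) * (f y * g x) \<partial>N) \<partial>N)"
    by (intro nn_integral_mono mult_right_mono swap) (auto simp: sp)
  also have "\<dots> = (\<integral>\<^sup>+y. (\<integral>\<^sup>+x. ball_ind r y x / (\<integral>\<^sup>+z. ball_ind s' y z \<partial>N) * (f y * g x) \<partial>N) \<partial>N)"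
    by (rule Fubini') measurable
  also have "\<dots> = (\<integral>\<^sup>+y. f y * avg N r s' g y \<partial>N)"
  proof (rule nn_integral_cong)
    fix y assume "y \<in> space N"
    then have [measurable]: "y \<in> space M" by (simp add: sp)
    have "(\<integral>\<^sup>+x. ball_ind r y x / (\<integral>\<^sup>+z. ball_ind s' y z \<partial>N) * (f y * g x) \<partial>N)
       = (\<integral>\<^sup>+x. (ball_ind r y x * g x) * (inverse (\<integral>\<^sup>+z. ball_ind s' y z \<partial>N) * f y) \<partial>N)"
      by (simp add: divide_ennreal_def mult_ac)
    also have "\<dots> = (\<integral>\<^sup>+x. ball_ind r y x * g x \<partial>N) * (inverse (\<integral>\<^sup>+z. ball_ind s' y z \<partial>N) * f y)"
      by (rule nn_integral_multc) measurable
    finally show "(\<integral>\<^sup>+x. ball_ind r y x / (\<integral>\<^sup>+z. ball_ind s' y z \<partial>N) * (f y * g x) \<partial>N) = f y * avg N r s' g y"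
      by (simp add: avg_def divide_ennreal_def mult_ac)
  qed
  finally show ?thesis .
qed

context
  fixes r :: "nat \<Rightarrow> real"
  assumes r: "\<And>k. 0 < r k" "decseq r"
begin

text \<open>For \<open>q > 2\<close> the square of the left-hand side is an \<open>L\<^sup>q\<^sup>/\<^sup>2\<close> norm and is tested against \<open>h\<close>;
  the averages are moved from the squares to \<open>h\<close> by \<open>avg_adjoint\<close> and dominated by the maximal
  function of \<open>h\<close>. The factor 12 is \<open>2 (1 + 5)\<close>, leaving the enlargement 5 required by the maximal
  theorem. For \<open>q = 2\<close> the choice \<open>h = 1\<close> suffices.\<close>
lemma Stein_inequality_ge_2:
  fixes s :: "nat \<Rightarrow> real"
  assumes s: "\<And>k. 12 * r k \<le> s k" and f [measurable]: "\<And>k. f k \<in> borel_measurable N" and q: "2 \<le> q"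
  shows "Lp_norm q N (square_fun (\<lambda>k. avg N (r k) (s k) (f k))) \<le> ennreal (Stein_const q) * Lp_norm q N (square_fun f)"
proof -
  have [measurable]: "(\<lambda>x. avg N r' s' g x) \<in> borel_measurable N" if "g \<in> borel_measurable N" for r' s' g
    using finN sN that by measurable
  have sp: "space N = space M" using sN sets_eq_imp_space_eq by blast
  define s' where "s' k = 5 * r k" for k
  define P where "P x = (\<Sum>k. (avg N (r k) (s k) (f k) x)\<^sup>2)" for x
  define Q where "Q x = (\<Sum>k. (f k x)\<^sup>2)" for x
  have [measurable]: "P \<in> borel_measurable N" "Q \<in> borel_measurable N"
    unfolding P_def[abs_def] Q_def[abs_def] by measurable
  have main: "(\<integral>\<^sup>+x. P x * h x \<partial>N) \<le> (\<Sum>k. \<integral>\<^sup>+x. (f k x)\<^sup>2 * avg N (r k) (s' k) h x \<partial>N)"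
    if [measurable]: "h \<in> borel_measurable N" for h
  proof -
    have "(\<integral>\<^sup>+x. P x * h x \<partial>N) = (\<Sum>k. \<integral>\<^sup>+x. (avg N (r k) (s k) (f k) x)\<^sup>2 * h x \<partial>N)"
      by (simp add: P_def nn_integral_suminf ennreal_suminf_multc[symmetric] del: ennreal_suminf_multc)
    also have "\<dots> \<le> (\<Sum>k. \<integral>\<^sup>+x. avg N (r k) (s k) (\<lambda>y. (f k y)\<^sup>2) x * h x \<partial>N)"
    proof (intro suminf_le nn_integral_mono mult_right_mono avg_square_le)
      fix k show "r k \<le> s k" using s[of k] r(1)[of k] by linarith
    qed (auto simp: sp)
    also have "\<dots> \<le> (\<Sum>k. \<integral>\<^sup>+x. (f k x)\<^sup>2 * avg N (r k) (s' k) h x \<partial>N)"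
      using s by (intro suminf_le avg_adjoint) (auto simp: s'_def)
    finally show ?thesis .
  qed
  show ?thesis
  proof (cases "q = 2")
    case True
    have "(\<integral>\<^sup>+x. P x \<partial>N) \<le> (\<Sum>k. \<integral>\<^sup>+x. (f k x)\<^sup>2 * avg N (r k) (s' k) (\<lambda>_. 1) x \<partial>N)"
      using main[of "\<lambda>_. 1"] by simp
    also have "\<dots> \<le> (\<Sum>k. \<integral>\<^sup>+x. (f k x)\<^sup>2 * 1 \<partial>N)"
    proof (intro suminf_le nn_integral_mono mult_left_mono)
      fix k x assume "x \<in> space N"
      have "(\<integral>\<^sup>+y. ball_ind (r k) x y * 1 \<partial>N) \<le> (\<integral>\<^sup>+y. ball_ind (s' k) x y \<partial>N)"
        using r(1)[of k] by (auto simp: s'_def intro!: nn_integral_mono ball_ind_mono)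
      then show "avg N (r k) (s' k) (\<lambda>_. 1) x \<le> 1"
        unfolding avg_def using nn_integral_ball_ind_less_top[OF finN sN, of x "s' k"] \<open>x \<in> space N\<close>
        by (cases "(\<integral>\<^sup>+y. ball_ind (s' k) x y \<partial>N) = 0") (auto simp: sp divide_le_posI_ennreal zero_less_iff_neq_zero)
    qed auto
    also have "\<dots> = (\<integral>\<^sup>+x. Q x \<partial>N)"
      by (simp add: Q_def nn_integral_suminf)
    finally have "(\<integral>\<^sup>+x. P x \<partial>N) \<le> (\<integral>\<^sup>+x. Q x \<partial>N)" .
    moreover have "Lp_norm 2 N (square_fun f) = epowr (\<integral>\<^sup>+x. Q x \<partial>N) (1/2)"
      "Lp_norm 2 N (square_fun (\<lambda>k. avg N (r k) (s k) (f k))) = epowr (\<integral>\<^sup>+x. P x \<partial>N) (1/2)"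
      by (simp_all add: Lp_norm_def square_fun_def epowr_epowr P_def Q_def)
    ultimately show ?thesis using True
      by (simp add: Stein_const_def epowr_mono)
  next
    case False
    with q have q2: "1 < q / 2" by simp
    have cq: "conj_exponent (q / 2) = q / (q - 2)"
      using False q by (simp add: conj_exponent_def field_simps)
    have c1: "1 < q / (q - 2)" using False q by simp
    have "Lp_norm (q / 2) N P \<le> ennreal (maximal_const (q / (q - 2))) * Lp_norm (q / 2) N Q"
    proof (rule Lp_norm_le_by_duality[OF finN _ q2])
      fix h :: "'a \<Rightarrow> ennreal" assume h [measurable]: "h \<in> borel_measurable N"
      have [measurable]: "maximal_avg N r s' h \<in> borel_measurable N"
        using measurable_maximal_avg[OF finN sN r h measurable_ident_sets[OF sN]] by simp
      have "(\<integral>\<^sup>+x. P x * h x \<partial>N) \<le> (\<Sum>k. \<integral>\<^sup>+x. (f k x)\<^sup>2 * avg N (r k) (s' k) h x \<partial>N)"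
        by (rule main) measurable
      also have "\<dots> \<le> (\<Sum>k. \<integral>\<^sup>+x. (f k x)\<^sup>2 * maximal_avg N r s' h x \<partial>N)"
        by (intro suminf_le nn_integral_mono mult_left_mono) (auto simp: maximal_avg_def intro: SUP_upper)
      also have "\<dots> = (\<integral>\<^sup>+x. Q x * maximal_avg N r s' h x \<partial>N)"
        by (simp add: Q_def nn_integral_suminf ennreal_suminf_multc[symmetric] del: ennreal_suminf_multc)
      also have "\<dots> \<le> Lp_norm (q / 2) N Q * Lp_norm (conj_exponent (q / 2)) N (maximal_avg N r s' h)"
        by (rule Lp_norm_Hoelder[OF _ _ q2]) measurable
      also have "\<dots> \<le> Lp_norm (q / 2) N Q * (ennreal (maximal_const (q / (q - 2))) * Lp_norm (q / (q - 2)) N h)"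
        unfolding cq maximal_const_def
        using c1 by (intro mult_left_mono maximal_strong_type[OF finN sN r]) (auto simp: s'_def)
      finally show "(\<integral>\<^sup>+x. P x * h x \<partial>N)
          \<le> ennreal (maximal_const (q / (q - 2))) * Lp_norm (q / 2) N Q * Lp_norm (conj_exponent (q / 2)) N h"
        by (simp add: cq mult_ac)
    qed measurable
    then have "epowr (Lp_norm (q / 2) N P) (1/2) \<le> epowr (ennreal (maximal_const (q / (q - 2))) * Lp_norm (q / 2) N Q) (1/2)"
      by (intro epowr_mono) auto
    also have "\<dots> = ennreal (sqrt (maximal_const (q / (q - 2)))) * epowr (Lp_norm (q / 2) N Q) (1/2)"
      by (simp add: epowr_mult epowr_ennreal maximal_const_def powr_half_sqrt)
    finally show ?thesis using False q
      by (simp add: Lp_norm_square_fun_half Stein_const_def flip: P_def Q_def)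
  qed
qed

text \<open>For \<open>q < 2\<close> the averages are moved to the dual functions; the factor 26 is \<open>2 (1 + 12)\<close>.\<close>
lemma Stein_inequality:
  fixes s :: "nat \<Rightarrow> real"
  assumes s: "\<And>k. 26 * r k \<le> s k" and f [measurable]: "\<And>k. f k \<in> borel_measurable N" and q: "1 < q"
  shows "Lp_norm q N (square_fun (\<lambda>k. avg N (r k) (s k) (f k))) \<le> ennreal (Stein_const q) * Lp_norm q N (square_fun f)"
proof (cases "2 \<le> q")
  case True
  have "12 * r k \<le> s k" for k using s[of k] r(1)[of k] by linarith
  then show ?thesis using f True by (intro Stein_inequality_ge_2) auto
next
  case False
  have [measurable]: "(\<lambda>x. avg N r' s' g x) \<in> borel_measurable N" if "g \<in> borel_measurable N" for r' s' g
    using finN sN that by measurable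
  define s' where "s' k = 12 * r k" for k
  have cq: "2 < conj_exponent q" "Stein_const (conj_exponent q) = Stein_const q"
    using False q conj_exponent_facts[OF q] by (auto simp: Stein_const_def conj_exponent_def field_simps)
  show ?thesis
  proof (rule square_fun_le_by_duality[OF finN _ q])
    fix g :: "nat \<Rightarrow> 'a \<Rightarrow> ennreal" assume [measurable]: "\<And>k. g k \<in> borel_measurable N"
    have "(\<Sum>k. \<integral>\<^sup>+x. avg N (r k) (s k) (f k) x * g k x \<partial>N)
        \<le> (\<Sum>k. \<integral>\<^sup>+x. f k x * avg N (r k) (s' k) (g k) x \<partial>N)"
      using s by (intro suminf_le avg_adjoint) (auto simp: s'_def)
    also have "\<dots> \<le> Lp_norm q N (square_fun f) * Lp_norm (conj_exponent q) N (square_fun (\<lambda>k. avg N (r k) (s' k) (g k)))"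
      by (rule square_fun_pairing[OF _ _ q]) measurable
    also have "\<dots> \<le> Lp_norm q N (square_fun f) * (ennreal (Stein_const q) * Lp_norm (conj_exponent q) N (square_fun g))"
      unfolding cq(2)[symmetric]
      using cq(1) by (intro mult_left_mono Stein_inequality_ge_2) (auto simp: s'_def)
    finally show "(\<Sum>k. \<integral>\<^sup>+x. avg N (r k) (s k) (f k) x * g k x \<partial>N)
        \<le> ennreal (Stein_const q) * Lp_norm q N (square_fun f) * Lp_norm (conj_exponent q) N (square_fun g)"
      by (simp add: mult_ac)
  qed measurable
qed

end

end

end

section \<open>Weighted square function estimate for dyadic averages\<close>

text \<open>A relation \<open>b a\<^sup>p\<^sup>-\<^sup>1 = 1\<close> in \<open>[0, \<infinity>]\<close> forces both numbers to be positive and real. It is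
  the form in which the duality between \<open>\<omega>\<close> and \<open>\<omega>'\<close> is used.\<close>
lemma inverse_power_pair:
  fixes a b :: ennreal
  assumes ab: "b * epowr a (p - 1) = 1" and p: "1 < p"
  obtains r where "0 < r" "a = ennreal r" "b = ennreal (r powr (1 - p))"
proof -
  have b0: "b \<noteq> 0" using ab by auto
  have a0: "a \<noteq> 0" using ab by auto
  have at: "a \<noteq> top" using ab b0 by (auto simp: ennreal_mult_top)
  have bt: "b \<noteq> top" using ab a0 by (auto simp: ennreal_top_mult)
  obtain r where r: "a = ennreal r" "0 < r" using a0 at by (cases a) auto
  obtain s where s: "b = ennreal s" "0 < s" using b0 bt by (cases b) auto
  have "s * r powr (p - 1) = 1"
    using ab r s by (simp add: epowr_ennreal flip: ennreal_mult)
  then have "s = r powr (1 - p)"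
    using r by (simp add: powr_diff field_simps)
  then show ?thesis using r s that by auto
qed

definition \<delta> :: "nat \<Rightarrow> real" where "\<delta> k = (1/2) ^ k"

lemma \<delta>_pos [simp]: "0 < \<delta> k" and \<delta>_le: "\<delta> k \<le> 1"
  by (auto simp: \<delta>_def intro: power_le_one)

lemma decseq_\<delta>: "decseq \<delta>"
  by (auto simp: decseq_def \<delta>_def intro: power_decreasing)

context homogeneous_space
begin

definition mass :: "('a \<Rightarrow> ennreal) \<Rightarrow> real \<Rightarrow> 'a \<Rightarrow> ennreal" where
  "mass w r x = (\<integral>\<^sup>+y. ball_ind r x y * w y \<partial>M)"

text \<open>Normalised by \<open>\<delta>\<^sub>k\<^sup>n\<close>, which is comparable to the measure of the ball of radius \<open>4 \<delta>\<^sub>k\<close> and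
  does not depend on its centre; this makes the operator symmetric.\<close>
definition dyadic_avg :: "nat \<Rightarrow> ('a \<Rightarrow> ennreal) \<Rightarrow> 'a \<Rightarrow> ennreal" where
  "dyadic_avg k f x = ennreal (1 / \<delta> k ^ n) * (\<integral>\<^sup>+y. ball_ind (4 * \<delta> k) x y * f y \<partial>M)"

lemma measurable_mass [measurable (raw)]:
  assumes [measurable]: "f \<in> borel_measurable M" "g \<in> measurable K M"
  shows "(\<lambda>k. mass f r (g k)) \<in> borel_measurable K"
  unfolding mass_def by measurable

lemma measurable_dyadic_avg [measurable (raw)]:
  assumes [measurable]: "f \<in> borel_measurable M" "g \<in> measurable K M"
  shows "(\<lambda>k. dyadic_avg j f (g k)) \<in> borel_measurable K"
  unfolding dyadic_avg_def by measurable

lemma mass_eq: "w \<in> borel_measurable M \<Longrightarrow> x \<in> space M \<Longrightarrow> mass w r x = (\<integral>\<^sup>+y. ball_ind r x y \<partial>density M w)"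
  unfolding mass_def by (subst nn_integral_density) (auto simp: mult.commute)

lemma sigma_finite_M: "pair_sigma_finite M M"
  by (intro pair_sigma_finite.intro sigma_finite_measure_axioms)

lemma dyadic_avg_symmetric:
  assumes [measurable]: "f \<in> borel_measurable M" "g \<in> borel_measurable M"
  shows "(\<integral>\<^sup>+x. dyadic_avg k f x * g x \<partial>M) = (\<integral>\<^sup>+x. f x * dyadic_avg k g x \<partial>M)"
proof -
  interpret pair_sigma_finite M M by (rule sigma_finite_M)
  let ?D = "ennreal (1 / \<delta> k ^ n)"
  have "(\<integral>\<^sup>+x. dyadic_avg k f x * g x \<partial>M) = (\<integral>\<^sup>+x. (\<integral>\<^sup>+y. ?D * (ball_ind (4 * \<delta> k) x y * f y * g x) \<partial>M) \<partial>M)"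
  proof (rule nn_integral_cong)
    fix x assume [measurable]: "x \<in> space M"
    have "(\<integral>\<^sup>+y. ?D * (ball_ind (4 * \<delta> k) x y * f y * g x) \<partial>M) = ?D * ((\<integral>\<^sup>+y. ball_ind (4 * \<delta> k) x y * f y \<partial>M) * g x)"
      by (subst nn_integral_cmult, measurable, subst nn_integral_multc, auto)
    then show "dyadic_avg k f x * g x = (\<integral>\<^sup>+y. ?D * (ball_ind (4 * \<delta> k) x y * f y * g x) \<partial>M)"
      by (simp add: dyadic_avg_def mult.assoc)
  qed
  also have "\<dots> = (\<integral>\<^sup>+y. (\<integral>\<^sup>+x. ?D * (ball_ind (4 * \<delta> k) x y * f y * g x) \<partial>M) \<partial>M)"
    by (rule Fubini') measurable
  also have "\<dots> = (\<integral>\<^sup>+y. (\<integral>\<^sup>+x. f y * (?D * (ball_ind (4 * \<delta> k) y x * g x)) \<partial>M) \<partial>M)"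
    by (intro nn_integral_cong) (simp add: ball_ind_sym mult_ac)
  also have "\<dots> = (\<integral>\<^sup>+y. f y * dyadic_avg k g y \<partial>M)"
    by (intro nn_integral_cong) (simp add: dyadic_avg_def nn_integral_cmult)
  finally show ?thesis .
qed

text \<open>If \<open>d x y < 4 \<delta>\<^sub>k\<close>, every point \<open>z\<close> with \<open>d x z < \<delta>\<^sub>k\<close> has both \<open>x\<close> and \<open>y\<close> within \<open>10 \<delta>\<^sub>k =
  2 (1 + 4) \<delta>\<^sub>k\<close>. Averaging over such \<open>z\<close> decouples the two functions into masses of balls with a
  common centre, to which the \<open>A\<^sub>p\<close> condition can be applied.\<close>
lemma dyadic_pairing_le_third_point:
  assumes [measurable]: "f \<in> borel_measurable M" "g \<in> borel_measurable M"
  shows "(\<integral>\<^sup>+x. dyadic_avg k f x * g x \<partial>M)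
    \<le> ennreal (1 / c) * (ennreal (1 / \<delta> k ^ n))\<^sup>2 * (\<integral>\<^sup>+z. mass f (10 * \<delta> k) z * mass g (10 * \<delta> k) z \<partial>M)"
proof -
  interpret pair_sigma_finite M M by (rule sigma_finite_M)
  let ?D = "ennreal (1 / \<delta> k ^ n)"
  let ?K = "ennreal (1 / c) * ?D"
  let ?J = "ball_ind (10 * \<delta> k)"
  have key: "ball_ind (4 * \<delta> k) x y \<le> ?K * (\<integral>\<^sup>+z. ?J z x * ?J z y \<partial>M)"
    if x [measurable]: "x \<in> space M" and y [measurable]: "y \<in> space M" for x y
  proof (cases "d x y < 4 * \<delta> k")
    case True
    have "ennreal (c * \<delta> k ^ n) \<le> emeasure M {z \<in> space M. d x z < \<delta> k}"
      using x \<delta>_le by (intro ball_lower) auto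
    also have "\<dots> = (\<integral>\<^sup>+z. ball_ind (\<delta> k) x z \<partial>M)" using x by (simp add: nn_integral_ball_ind)
    also have "\<dots> \<le> (\<integral>\<^sup>+z. ?J z x * ?J z y \<partial>M)"
    proof (rule nn_integral_mono)
      fix z assume z: "z \<in> space M"
      show "ball_ind (\<delta> k) x z \<le> ?J z x * ?J z y"
      proof (cases "d x z < \<delta> k")
        case d: True
        have "d z y \<le> 2 * (d z x + d x y)" using x y z by (rule_tac d_tri)
        then have "d z y < 10 * \<delta> k" using True d d_sym[of x z] x z by auto
        moreover have "d z x < 10 * \<delta> k" using d d_sym[OF x z] \<delta>_pos[of k] by linarith
        ultimately show ?thesis by (simp add: ball_ind_def)
      qed (simp add: ball_ind_def)
    qed
    finally have "?K * ennreal (c * \<delta> k ^ n) \<le> ?K * (\<integral>\<^sup>+z. ?J z x * ?J z y \<partial>M)"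
      by (rule mult_left_mono) simp
    moreover have "?K * ennreal (c * \<delta> k ^ n) = ennreal (1 / c * (1 / \<delta> k ^ n) * (c * \<delta> k ^ n))"
      using cC by (simp only: ennreal_mult'[symmetric] divide_nonneg_pos zero_less_one less_imp_le zero_less_power \<delta>_pos mult_nonneg_nonneg)
    then have "?K * ennreal (c * \<delta> k ^ n) = 1"
      using cC \<delta>_pos[of k] by simp
    ultimately show ?thesis using True by (simp add: ball_ind_def)
  qed (simp add: ball_ind_def)
  have "(\<integral>\<^sup>+x. dyadic_avg k f x * g x \<partial>M) = (\<integral>\<^sup>+x. (\<integral>\<^sup>+y. ball_ind (4 * \<delta> k) x y * (?D * (f y * g x)) \<partial>M) \<partial>M)"
  proof (rule nn_integral_cong)
    fix x assume [measurable]: "x \<in> space M"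
    have "(\<integral>\<^sup>+y. ball_ind (4 * \<delta> k) x y * (?D * (f y * g x)) \<partial>M) = (\<integral>\<^sup>+y. (?D * (ball_ind (4 * \<delta> k) x y * f y)) * g x \<partial>M)"
      by (simp add: mult_ac)
    also have "\<dots> = dyadic_avg k f x * g x"
      unfolding dyadic_avg_def by (simp add: nn_integral_cmult nn_integral_multc)
    finally show "dyadic_avg k f x * g x = (\<integral>\<^sup>+y. ball_ind (4 * \<delta> k) x y * (?D * (f y * g x)) \<partial>M)" by simp
  qed
  also have "\<dots> \<le> (\<integral>\<^sup>+x. (\<integral>\<^sup>+y. (?K * (\<integral>\<^sup>+z. ?J z x * ?J z y \<partial>M)) * (?D * (f y * g x)) \<partial>M) \<partial>M)"
    by (intro nn_integral_mono mult_right_mono key) auto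
  also have "\<dots> = (\<integral>\<^sup>+x. (\<integral>\<^sup>+y. (\<integral>\<^sup>+z. (?K * ?D) * ((?J z y * f y) * (?J z x * g x)) \<partial>M) \<partial>M) \<partial>M)"
  proof (intro nn_integral_cong)
    fix x y assume [measurable]: "x \<in> space M" "y \<in> space M"
    have "(\<integral>\<^sup>+z. (?K * ?D) * ((?J z y * f y) * (?J z x * g x)) \<partial>M)
      = (\<integral>\<^sup>+z. (?J z x * ?J z y) * ((?K * ?D) * (f y * g x)) \<partial>M)" by (simp add: mult_ac)
    also have "\<dots> = (\<integral>\<^sup>+z. ?J z x * ?J z y \<partial>M) * ((?K * ?D) * (f y * g x))"
      by (rule nn_integral_multc) measurable
    finally show "(?K * (\<integral>\<^sup>+z. ?J z x * ?J z y \<partial>M)) * (?D * (f y * g x))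
      = (\<integral>\<^sup>+z. (?K * ?D) * ((?J z y * f y) * (?J z x * g x)) \<partial>M)" by (simp add: mult_ac)
  qed
  also have "\<dots> = (\<integral>\<^sup>+x. (\<integral>\<^sup>+z. (\<integral>\<^sup>+y. (?K * ?D) * ((?J z y * f y) * (?J z x * g x)) \<partial>M) \<partial>M) \<partial>M)"
    by (intro nn_integral_cong Fubini') measurable
  also have "\<dots> = (\<integral>\<^sup>+z. (\<integral>\<^sup>+x. (\<integral>\<^sup>+y. (?K * ?D) * ((?J z y * f y) * (?J z x * g x)) \<partial>M) \<partial>M) \<partial>M)"
    by (rule Fubini') measurable
  also have "\<dots> = (\<integral>\<^sup>+z. (?K * ?D) * (mass f (10 * \<delta> k) z * mass g (10 * \<delta> k) z) \<partial>M)"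
  proof (rule nn_integral_cong)
    fix z assume [measurable]: "z \<in> space M"
    show "(\<integral>\<^sup>+x. (\<integral>\<^sup>+y. (?K * ?D) * ((?J z y * f y) * (?J z x * g x)) \<partial>M) \<partial>M)
      = (?K * ?D) * (mass f (10 * \<delta> k) z * mass g (10 * \<delta> k) z)"
      unfolding mass_def by (simp add: nn_integral_cmult nn_integral_multc)
  qed
  also have "\<dots> = (?K * ?D) * (\<integral>\<^sup>+z. mass f (10 * \<delta> k) z * mass g (10 * \<delta> k) z \<partial>M)"
    by (rule nn_integral_cmult) measurable
  finally show ?thesis by (simp add: power2_eq_square mult_ac)
qed

text \<open>Jensen's inequality for the convex function \<open>t \<mapsto> t\<^sup>2\<^sup>-\<^sup>p\<close>, in the form of Hoelder's
  inequality for \<open>1 = v\<^sup>a v\<^sup>-\<^sup>a\<close>, \<open>a = (p - 2) / (p - 1)\<close>. It turns a negative power of the mass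
  of a ball into an average of the same power of \<open>v\<close>, i.e. into something that can be integrated.\<close>
lemma inverse_power_mass_le_mass:
  assumes [measurable]: "v \<in> borel_measurable M" and v: "AE x in M. v x \<noteq> 0 \<and> v x \<noteq> top"
    and p: "2 \<le> p" and z [measurable]: "z \<in> space M" and R: "\<delta> k \<le> R" and fin: "mass v R z < top"
  shows "inverse (epowr (mass v R z) (p - 2))
    \<le> ennreal (inverse ((c * \<delta> k ^ n) powr (p - 1))) * mass (\<lambda>x. inverse (epowr (v x) (p - 2))) (\<delta> k) z"
proof -
  define u where "u x = inverse (epowr (v x) (p - 2))" for x
  have [measurable]: "u \<in> borel_measurable M" unfolding u_def[abs_def] by measurable
  define m where "m = ennreal (c * \<delta> k ^ n)"
  have pos: "0 < c * \<delta> k ^ n" using cC by simp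
  then have m0: "m \<noteq> 0" "m < top" unfolding m_def by (simp_all only: ennreal_eq_0_iff not_le ennreal_less_top)
  have m_le: "m \<le> (\<integral>\<^sup>+x. ball_ind (\<delta> k) z x \<partial>M)"
    unfolding m_def using ball_lower[OF z, of "\<delta> k"] \<delta>_le[of k] nn_integral_ball_ind[OF refl z, of "\<delta> k"] by simp
  have jensen: "epowr m (p - 1) \<le> epowr (mass v R z) (p - 2) * mass u (\<delta> k) z"
  proof (cases "p = 2")
    case True
    have "(\<integral>\<^sup>+x. ball_ind (\<delta> k) z x \<partial>M) = mass u (\<delta> k) z"
      unfolding mass_def
    proof (intro nn_integral_cong_AE, use v in eventually_elim)
      case (elim x)
      then have "u x = 1" using True by (cases "v x") (auto simp: u_def epowr_ennreal)
      then show ?case by simp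
    qed
    moreover have "mass v R z \<noteq> 0"
    proof
      assume "mass v R z = 0"
      then have "AE x in M. ball_ind R z x * v x = 0"
        by (simp add: mass_def nn_integral_0_iff_AE)
      then have "AE x in M. ball_ind (\<delta> k) z x = 0"
        using v by eventually_elim (use R in \<open>auto simp: ball_ind_def split: if_splits\<close>)
      then have "(\<integral>\<^sup>+x. ball_ind (\<delta> k) z x \<partial>M) = 0" by (simp add: nn_integral_0_iff_AE)
      then show False using m_le m0 by simp
    qed
    then have "epowr (mass v R z) (p - 2) = 1"
      using True fin by (cases "mass v R z") (auto simp: epowr_ennreal)
    ultimately show ?thesis using True m_le by simp
  next
    case False
    define a where "a = (p - 2) / (p - 1)"
    define b where "b = 1 / (p - 1)"
    have ab: "0 < a" "0 < b" "a + b = 1" using p False by (auto simp: a_def b_def field_simps)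
    have ap: "a * (p - 1) = p - 2" "b * (p - 1) = 1" using p by (auto simp: a_def b_def)
    have pb: "(p - 2) * b = a" by (simp add: a_def b_def)
    have "(\<integral>\<^sup>+x. ball_ind (\<delta> k) z x \<partial>M) = (\<integral>\<^sup>+x. epowr (ball_ind (\<delta> k) z x * v x) a * epowr (ball_ind (\<delta> k) z x * u x) b \<partial>M)"
    proof (intro nn_integral_cong_AE, use v in eventually_elim)
      case (elim x)
      have "epowr (v x) a * epowr (u x) b = epowr (v x) a / epowr (v x) a"
        using ab by (simp add: u_def epowr_inverse epowr_epowr pb divide_ennreal_def)
      also have "\<dots> = 1" using elim by (simp add: less_top)
      finally show ?case using ab by (simp add: ball_ind_def)
    qed
    also have "\<dots> \<le> epowr (\<integral>\<^sup>+x. ball_ind (\<delta> k) z x * v x \<partial>M) a * epowr (\<integral>\<^sup>+x. ball_ind (\<delta> k) z x * u x \<partial>M) b"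
      by (rule nn_integral_Hoelder[OF _ _ ab]) measurable
    also have "\<dots> \<le> epowr (mass v R z) a * epowr (mass u (\<delta> k) z) b"
      unfolding mass_def using ab R
      by (intro mult_right_mono epowr_mono nn_integral_mono mult_right_mono ball_ind_mono) auto
    finally have "m \<le> epowr (mass v R z) a * epowr (mass u (\<delta> k) z) b" using m_le by simp
    then have "epowr m (p - 1) \<le> epowr (epowr (mass v R z) a * epowr (mass u (\<delta> k) z) b) (p - 1)"
      using p by (intro epowr_mono) auto
    then show ?thesis using p ap by (simp add: epowr_mult epowr_epowr)
  qed
  let ?X = "epowr (mass v R z) (p - 2)" 
  have X0: "?X \<noteq> 0" using jensen m0 by auto
  have Xt: "?X \<noteq> top" using fin by auto
  have e: "epowr m (p - 1) \<noteq> 0" "epowr m (p - 1) \<noteq> top" using m0 by auto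
  have "inverse ?X = inverse (epowr m (p - 1)) * (epowr m (p - 1) * inverse ?X)"
    using e by (metis divide_ennreal_def ennreal_divide_self less_top mult.assoc mult.commute mult_1)
  also have "\<dots> \<le> inverse (epowr m (p - 1)) * (?X * mass u (\<delta> k) z * inverse ?X)"
    by (intro mult_left_mono mult_right_mono jensen) auto
  also have "?X * mass u (\<delta> k) z * inverse ?X = mass u (\<delta> k) z"
    using X0 Xt ennreal_mult_divide_cancel_left[of ?X] by (simp add: divide_ennreal_def)
  also have "inverse (epowr m (p - 1)) = ennreal (inverse ((c * \<delta> k ^ n) powr (p - 1)))"
  proof -
    have "epowr m (p - 1) = ennreal ((c * \<delta> k ^ n) powr (p - 1))"
      unfolding m_def by (rule epowr_ennreal) (use pos in linarith)
    moreover have "0 < (c * \<delta> k ^ n) powr (p - 1)" using pos by (metis powr_gt_zero less_irrefl)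
    ultimately show ?thesis by (simp add: inverse_ennreal)
  qed
  finally show ?thesis by (simp add: u_def[abs_def])
qed

text \<open>The identity also holds where \<open>v\<close> has no mass in the large ball, since both sides are then
  0.\<close>
lemma mass_avg:
  assumes [measurable]: "v \<in> borel_measurable M" "f \<in> borel_measurable M" and z [measurable]: "z \<in> space M"
    and rR: "r \<le> R" and fin: "finite_measure (density M v)"
  shows "mass (\<lambda>y. f y * v y) r z = mass v R z * avg (density M v) r R f z"
proof -
  let ?N = "density M v"
  have b: "mass v R z = (\<integral>\<^sup>+y. ball_ind R z y \<partial>?N)" by (rule mass_eq) measurable
  have bt: "(\<integral>\<^sup>+y. ball_ind R z y \<partial>?N) < top" by (rule nn_integral_ball_ind_less_top[OF fin _ z]) simp
  have "mass (\<lambda>y. f y * v y) r z = (\<integral>\<^sup>+y. ball_ind r z y * f y \<partial>?N)"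
    unfolding mass_def by (subst nn_integral_density) (auto simp: mult_ac)
  moreover have "(\<integral>\<^sup>+y. ball_ind r z y * f y \<partial>?N) = 0" if "(\<integral>\<^sup>+y. ball_ind R z y \<partial>?N) = 0"
  proof -
    have "AE y in ?N. ball_ind R z y = 0" using that by (subst (asm) nn_integral_0_iff_AE) measurable
    then have "AE y in ?N. ball_ind r z y * f y = 0"
      by eventually_elim (use rR in \<open>auto simp: ball_ind_def split: if_splits\<close>)
    then show ?thesis by (subst nn_integral_0_iff_AE) measurable
  qed
  ultimately show ?thesis
    unfolding avg_def b using bt
    by (cases "(\<integral>\<^sup>+y. ball_ind R z y \<partial>?N) = 0")
      (auto simp: ennreal_times_divide ennreal_mult_divide_cancel_left)
qed

lemma avg_shift:
  assumes N: "finite_measure N" "sets N = sets M" and xz: "x \<in> space M" "z \<in> space M" "d z x < t"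
    and r: "2 * (t + r) \<le> r'" "2 * (t + s') \<le> s"
  shows "avg N r s f z \<le> avg N r' s' f x"
proof -
  have sp: "space N = space M" using N(2) sets_eq_imp_space_eq by blast
  have dxz: "d x z < t" using xz d_sym by simp
  have 1: "ball_ind r z y \<le> ball_ind r' x y" if "y \<in> space M" for y
    using d_tri[of x z y] that xz dxz r by (auto simp: ball_ind_def)
  have 2: "ball_ind s' x y \<le> ball_ind s z y" if "y \<in> space M" for y
    using d_tri[of z x y] that xz r by (auto simp: ball_ind_def)
  show ?thesis
    unfolding avg_def divide_ennreal_def
    by (intro mult_mono inverse_ennreal_antimono nn_integral_mono mult_right_mono) (auto simp: sp 1 2)
qed

text \<open>The central estimate at a single scale. After inserting the third point \<open>z\<close>, the pairing is
  the integral over \<open>z\<close> of \<open>v(B) w(B)\<close> times a \<open>v\<close>-average of \<open>f\<close> and a \<open>w\<close>-average of \<open>g\<close>, where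
  \<open>B = B(z, 1146 \<delta>\<^sub>k)\<close>. The \<open>A\<^sub>p\<close> condition gives \<open>v(B) w(B) \<le> A \<delta>\<^sub>k\<^sup>n\<^sup>p v(B)\<^sup>2\<^sup>-\<^sup>p\<close>, linear in
  \<open>A\<close>, and Jensen's inequality replaces \<open>v(B)\<^sup>2\<^sup>-\<^sup>p\<close> by an average of \<open>v\<^sup>2\<^sup>-\<^sup>p\<close> over points \<open>x\<close>
  with \<open>d z x < \<delta>\<^sub>k\<close>. Finally the two averages are moved from \<open>z\<close> to \<open>x\<close>: the numerator radius
  becomes \<open>22 = 2 (1 + 10)\<close>, the denominator radius \<open>572 = 26 \<cdot> 22\<close> is what the inequality of
  Stein type asks for, and \<open>1146 = 2 (1 + 572)\<close> is the enlargement needed before the move.\<close>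
lemma scale_bilinear_bound:
  fixes w v :: "'a \<Rightarrow> ennreal" and p :: real
  assumes [measurable]: "w \<in> borel_measurable M" "v \<in> borel_measurable M"
    and finw: "finite_measure (density M w)" and finv: "finite_measure (density M v)"
    and wv: "AE x in M. w x * epowr (v x) (p - 1) = 1"
    and A: "\<And>x. x \<in> space M \<Longrightarrow>
      mass w (1146 * \<delta> k) x * epowr (mass v (1146 * \<delta> k) x) (p - 1) \<le> A * ennreal (\<delta> k powr (n * p))"
    and p: "2 \<le> p"
    and [measurable]: "f \<in> borel_measurable M" "g \<in> borel_measurable M"
  shows "(\<integral>\<^sup>+x. dyadic_avg k (\<lambda>y. f y * v y) x * (g x * w x) \<partial>M)
    \<le> ennreal (c powr - p * C) * A * (\<integral>\<^sup>+x. inverse (epowr (v x) (p - 2)) *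
        (avg (density M v) (22 * \<delta> k) (572 * \<delta> k) f x * avg (density M w) (22 * \<delta> k) (572 * \<delta> k) g x) \<partial>M)"
proof -
  interpret pair_sigma_finite M M by (rule sigma_finite_M)
  let ?D = "ennreal (1 / \<delta> k ^ n)"
  let ?V = "density M v" let ?W = "density M w"
  let ?R = "1146 * \<delta> k"
  let ?F = "avg ?V (10 * \<delta> k) ?R f" let ?G = "avg ?W (10 * \<delta> k) ?R g"
  let ?F' = "avg ?V (22 * \<delta> k) (572 * \<delta> k) f" let ?G' = "avg ?W (22 * \<delta> k) (572 * \<delta> k) g"
  let ?K = "ennreal (inverse ((c * \<delta> k ^ n) powr (p - 1)))"
  let ?P = "ennreal (\<delta> k powr (n * p))"
  define u where "u x = inverse (epowr (v x) (p - 2))" for x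
  have [measurable]: "u \<in> borel_measurable M" unfolding u_def[abs_def] by measurable
  have [measurable]: "(\<lambda>x. avg ?V r s f x) \<in> borel_measurable M" "(\<lambda>x. avg ?W r s g x) \<in> borel_measurable M" for r s
    by (rule measurable_avg[OF finv], simp, simp, simp, rule measurable_avg[OF finw], simp_all)
  have v: "AE x in M. v x \<noteq> 0 \<and> v x \<noteq> top"
    using wv
  proof eventually_elim
    case (elim x)
    then show ?case using inverse_power_pair[of "w x" "v x" p] p by force
  qed
  have dR: "\<delta> k \<le> ?R" "10 * \<delta> k \<le> ?R" using \<delta>_pos[of k] by linarith+
  \<comment> \<open>the \<open>A\<^sub>p\<close> condition followed by Jensen's inequality\<close>
  have pt: "mass v ?R z * mass w ?R z \<le> A * ?P * (?K * mass u (\<delta> k) z)" if z: "z \<in> space M" for z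
  proof (cases "mass v ?R z = 0")
    case False
    have fin: "mass v ?R z < top" using mass_eq[of v z ?R] z nn_integral_ball_ind_less_top[OF finv _ z] by simp
    let ?X = "epowr (mass v ?R z) (p - 2)"
    have X: "?X \<noteq> 0" "?X \<noteq> top" using False fin by auto
    have "mass v ?R z * ?X = epowr (mass v ?R z) (p - 1)"
      using epowr_add[of "mass v ?R z" 1 "p - 2"] by simp
    moreover have "?X * (mass v ?R z * mass w ?R z) = mass w ?R z * (mass v ?R z * ?X)"
      by (simp only: mult_ac)
    ultimately have "?X * (mass v ?R z * mass w ?R z) = mass w ?R z * epowr (mass v ?R z) (p - 1)"
      by simp
    also have "\<dots> \<le> A * ?P" by (rule A[OF z])
    finally have "?X * (mass v ?R z * mass w ?R z) / ?X \<le> A * ?P / ?X"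
      by (rule divide_right_mono_ennreal)
    then have "mass v ?R z * mass w ?R z \<le> A * ?P * inverse ?X"
      using X ennreal_mult_divide_cancel_left[of ?X] by (simp add: divide_ennreal_def)
    also have "\<dots> \<le> A * ?P * (?K * mass u (\<delta> k) z)"
      unfolding u_def using v p z dR fin by (intro mult_left_mono inverse_power_mass_le_mass) auto
    finally show ?thesis .
  qed simp
  \<comment> \<open>all powers of \<open>\<delta>\<^sub>k\<close> cancel, except for one \<open>\<delta>\<^sub>k\<^sup>-\<^sup>n\<close> that normalises the average over \<open>x\<close>\<close>
  have coeff: "ennreal (1 / c) * ?D\<^sup>2 * (?P * ?K) = ennreal (c powr - p) * ?D"
  proof -
    have "0 < c" using cC by simp
    have "1 / c * (1 / \<delta> k ^ n)\<^sup>2 * (\<delta> k powr (n * p) * inverse ((c * \<delta> k ^ n) powr (p - 1))) = c powr - p * (1 / \<delta> k ^ n)"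
    proof -
      have "1 / c = c powr -1" using \<open>0 < c\<close> by (simp only: powr_minus_divide powr_one)
      moreover have "(1 / \<delta> k ^ n) = \<delta> k powr (- n)" by (simp add: powr_minus_divide powr_realpow)
      moreover have "(\<delta> k powr (- n))\<^sup>2 = \<delta> k powr (- 2 * n)"
        by (simp add: power2_eq_square flip: powr_add)
      moreover have "inverse ((c * \<delta> k ^ n) powr (p - 1)) = c powr (1 - p) * \<delta> k powr (n * (1 - p))"
        by (simp add: powr_mult powr_powr powr_realpow[symmetric] powr_minus[symmetric] algebra_simps)
      ultimately have "1 / c * (1 / \<delta> k ^ n)\<^sup>2 * (\<delta> k powr (n * p) * inverse ((c * \<delta> k ^ n) powr (p - 1)))
        = (c powr -1 * c powr (1 - p)) * (\<delta> k powr (- 2 * n) * (\<delta> k powr (n * p) * \<delta> k powr (n * (1 - p))))"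
        by (simp only: mult_ac)
      also have "\<dots> = c powr (-1 + (1 - p)) * \<delta> k powr (- 2 * n + (n * p + n * (1 - p)))"
        by (simp only: powr_add)
      also have "\<dots> = c powr - p * \<delta> k powr (- n)"
        by (intro arg_cong2[where f="(*)"] arg_cong2[where f="(powr)"]) (auto simp: algebra_simps)
      finally show ?thesis by (simp add: powr_minus_divide powr_realpow)
    qed
    moreover have "ennreal (1 / c) * ?D\<^sup>2 * (?P * ?K)
      = ennreal (1 / c * (1 / \<delta> k ^ n)\<^sup>2 * (\<delta> k powr (n * p) * inverse ((c * \<delta> k ^ n) powr (p - 1))))"
    proof -
      have "ennreal a * (ennreal b)\<^sup>2 * (ennreal x * ennreal y) = ennreal (a * b\<^sup>2 * (x * y))"
        if "0 \<le> a" "0 \<le> b" "0 \<le> x" "0 \<le> y" for a b x y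
        using that by (simp add: ennreal_mult ennreal_power)
      then show ?thesis using cC by (simp add: less_imp_le)
    qed
    moreover have "ennreal (c powr - p) * ?D = ennreal (c powr - p * (1 / \<delta> k ^ n))"
      by (rule ennreal_mult[symmetric]) (simp_all add: less_imp_le)
    ultimately show ?thesis by simp
  qed
  have "(\<integral>\<^sup>+x. dyadic_avg k (\<lambda>y. f y * v y) x * (g x * w x) \<partial>M)
    \<le> ennreal (1 / c) * ?D\<^sup>2 * (\<integral>\<^sup>+z. mass (\<lambda>y. f y * v y) (10 * \<delta> k) z * mass (\<lambda>y. g y * w y) (10 * \<delta> k) z \<partial>M)"
    by (rule dyadic_pairing_le_third_point) measurable
  also have "\<dots> \<le> ennreal (1 / c) * ?D\<^sup>2 * (\<integral>\<^sup>+z. (A * (?P * ?K)) * (mass u (\<delta> k) z * (?F z * ?G z)) \<partial>M)"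
  proof (intro mult_left_mono nn_integral_mono)
    fix z assume z: "z \<in> space M"
    have "mass (\<lambda>y. f y * v y) (10 * \<delta> k) z * mass (\<lambda>y. g y * w y) (10 * \<delta> k) z
      = (mass v ?R z * mass w ?R z) * (?F z * ?G z)"
      using z dR mass_avg[of v f z "10 * \<delta> k" ?R] mass_avg[of w g z "10 * \<delta> k" ?R] finv finw
      by (simp add: mult_ac)
    also have "\<dots> \<le> (A * ?P * (?K * mass u (\<delta> k) z)) * (?F z * ?G z)"
      by (intro mult_right_mono pt z) simp
    finally show "mass (\<lambda>y. f y * v y) (10 * \<delta> k) z * mass (\<lambda>y. g y * w y) (10 * \<delta> k) z
      \<le> (A * (?P * ?K)) * (mass u (\<delta> k) z * (?F z * ?G z))" by (simp add: mult_ac)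
  qed simp
  also have "\<dots> = (ennreal (1 / c) * ?D\<^sup>2 * (?P * ?K)) * A * (\<integral>\<^sup>+z. mass u (\<delta> k) z * (?F z * ?G z) \<partial>M)"
    by (subst nn_integral_cmult) (auto simp: mult_ac)
  also have "\<dots> = ennreal (c powr - p) * A * (?D * (\<integral>\<^sup>+z. mass u (\<delta> k) z * (?F z * ?G z) \<partial>M))"
    unfolding coeff by (simp add: mult_ac)
  finally have outer: "(\<integral>\<^sup>+x. dyadic_avg k (\<lambda>y. f y * v y) x * (g x * w x) \<partial>M)
    \<le> ennreal (c powr - p) * A * (?D * (\<integral>\<^sup>+z. mass u (\<delta> k) z * (?F z * ?G z) \<partial>M))" .
  \<comment> \<open>the average is written out and the two other averages are moved from \<open>z\<close> to \<open>x\<close>\<close>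
  have "?D * (\<integral>\<^sup>+z. mass u (\<delta> k) z * (?F z * ?G z) \<partial>M)
      = ?D * (\<integral>\<^sup>+z. (\<integral>\<^sup>+x. ball_ind (\<delta> k) z x * u x * (?F z * ?G z) \<partial>M) \<partial>M)"
    unfolding mass_def by (intro arg_cong[where f="(*) _"] nn_integral_cong nn_integral_multc[symmetric]) measurable
  also have "\<dots> \<le> ?D * (\<integral>\<^sup>+z. (\<integral>\<^sup>+x. ball_ind (\<delta> k) z x * (u x * (?F' x * ?G' x)) \<partial>M) \<partial>M)"
  proof (intro mult_left_mono nn_integral_mono)
    fix z x assume zx: "z \<in> space M" "x \<in> space M"
    show "ball_ind (\<delta> k) z x * u x * (?F z * ?G z) \<le> ball_ind (\<delta> k) z x * (u x * (?F' x * ?G' x))"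
    proof (cases "d z x < \<delta> k")
      case True
      have "?F z \<le> ?F' x" "?G z \<le> ?G' x"
        using zx True by (auto intro!: avg_shift[OF finv] avg_shift[OF finw])
      then show ?thesis by (simp add: ball_ind_def mult_mono mult_left_mono)
    qed (simp add: ball_ind_def)
  qed simp
  also have "\<dots> = ?D * (\<integral>\<^sup>+x. (\<integral>\<^sup>+z. ball_ind (\<delta> k) z x * (u x * (?F' x * ?G' x)) \<partial>M) \<partial>M)"
    by (intro arg_cong[where f="(*) _"] Fubini') measurable
  also have "\<dots> \<le> ?D * (\<integral>\<^sup>+x. ennreal (C * \<delta> k ^ n) * (u x * (?F' x * ?G' x)) \<partial>M)"
  proof (intro mult_left_mono nn_integral_mono)
    fix x assume x [measurable]: "x \<in> space M"
    have "(\<integral>\<^sup>+z. ball_ind (\<delta> k) z x * (u x * (?F' x * ?G' x)) \<partial>M) = (\<integral>\<^sup>+z. ball_ind (\<delta> k) z x \<partial>M) * (u x * (?F' x * ?G' x))"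
      by (rule nn_integral_multc) measurable
    also have "(\<integral>\<^sup>+z. ball_ind (\<delta> k) z x \<partial>M) = (\<integral>\<^sup>+z. ball_ind (\<delta> k) x z \<partial>M)"
      using x by (intro nn_integral_cong) (simp add: ball_ind_sym)
    also have "\<dots> \<le> ennreal (C * \<delta> k ^ n)"
      using ball_upper[OF x, of "\<delta> k"] nn_integral_ball_ind[OF refl x, of "\<delta> k"] by simp
    finally show "(\<integral>\<^sup>+z. ball_ind (\<delta> k) z x * (u x * (?F' x * ?G' x)) \<partial>M) \<le> ennreal (C * \<delta> k ^ n) * (u x * (?F' x * ?G' x))"
      by (simp add: mult_right_mono)
  qed simp
  also have "\<dots> = (?D * ennreal (C * \<delta> k ^ n)) * (\<integral>\<^sup>+x. u x * (?F' x * ?G' x) \<partial>M)"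
    by (subst nn_integral_cmult) (auto simp: mult_ac)
  also have "?D * ennreal (C * \<delta> k ^ n) = ennreal C"
    using cC \<delta>_pos[of k] by (subst ennreal_mult'[symmetric]) (auto simp: less_imp_le less_imp_neq[symmetric])
  finally have "?D * (\<integral>\<^sup>+z. mass u (\<delta> k) z * (?F z * ?G z) \<partial>M)
      \<le> ennreal C * (\<integral>\<^sup>+x. u x * (?F' x * ?G' x) \<partial>M)" .
  then have "ennreal (c powr - p) * A * (?D * (\<integral>\<^sup>+z. mass u (\<delta> k) z * (?F z * ?G z) \<partial>M))
      \<le> ennreal (c powr - p) * A * (ennreal C * (\<integral>\<^sup>+x. u x * (?F' x * ?G' x) \<partial>M))"
    by (rule mult_left_mono) simp
  also have "\<dots> = ennreal (c powr - p * C) * A * (\<integral>\<^sup>+x. u x * (?F' x * ?G' x) \<partial>M)"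
    using cC by (simp add: ennreal_mult' mult_ac)
  finally show ?thesis using outer unfolding u_def by (rule order_trans[rotated])
qed

lemma Lp_norm_density:
  assumes [measurable]: "w \<in> borel_measurable M" "f \<in> borel_measurable M" and q: "0 < q"
  shows "Lp_norm q (density M w) f = Lp_norm q M (\<lambda>x. epowr (w x) (1 / q) * f x)"
  using q by (simp add: Lp_norm_def nn_integral_density epowr_mult epowr_epowr)

lemma square_fun_cmult: "square_fun (\<lambda>k x. h x * f k x) = (\<lambda>x. h x * square_fun f x)"
  by (rule ext) (simp add: square_fun_def power_mult_distrib epowr_mult epowr_epowr flip: epowr_2)

definition form_const :: "real \<Rightarrow> real" where
  "form_const p = c powr - p * C * Stein_const p * Stein_const (conj_exponent p)"

text \<open>Since \<open>v\<^sup>2\<^sup>-\<^sup>p = v\<^sup>1\<^sup>/\<^sup>p w\<^sup>1\<^sup>/\<^sup>p'\<close>, Hoelder's inequality splits the sum over all scales into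
  an \<open>L\<^sup>p(v)\<close> and an \<open>L\<^sup>p'(w)\<close> norm of square functions of averages, both controlled by the
  inequality of Stein type with constants that do not depend on the weights.\<close>
lemma bilinear_bound:
  fixes w v :: "'a \<Rightarrow> ennreal" and p :: real
  assumes [measurable]: "w \<in> borel_measurable M" "v \<in> borel_measurable M"
    and finw: "finite_measure (density M w)" and finv: "finite_measure (density M v)"
    and wv: "AE x in M. w x * epowr (v x) (p - 1) = 1"
    and A: "\<And>x k. x \<in> space M \<Longrightarrow>
      mass w (1146 * \<delta> k) x * epowr (mass v (1146 * \<delta> k) x) (p - 1) \<le> A * ennreal (\<delta> k powr (n * p))"
    and p: "2 \<le> p"
    and [measurable]: "\<And>k. f k \<in> borel_measurable M" "\<And>k. g k \<in> borel_measurable M"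
  shows "(\<Sum>k. \<integral>\<^sup>+x. dyadic_avg k (\<lambda>y. f k y * v y) x * (g k x * w x) \<partial>M)
    \<le> ennreal (form_const p) * A * (Lp_norm p (density M v) (square_fun f) * Lp_norm (conj_exponent p) (density M w) (square_fun g))"
proof -
  let ?V = "density M v" let ?W = "density M w"
  have p1: "1 < p" using p by simp
  note cf = conj_exponent_facts[OF p1]
  define q where "q = conj_exponent p"
  define F where "F k = avg ?V (22 * \<delta> k) (572 * \<delta> k) (f k)" for k
  define G where "G k = avg ?W (22 * \<delta> k) (572 * \<delta> k) (g k)" for k
  have [measurable]: "F k \<in> borel_measurable M" "G k \<in> borel_measurable M" for k
    unfolding F_def G_def
    by (rule measurable_avg[OF finv], simp, simp, simp, rule measurable_avg[OF finw], simp_all)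
  let ?K = "ennreal (c powr - p * C)"
  have u: "AE x in M. inverse (epowr (v x) (p - 2)) = epowr (v x) (1 / p) * epowr (w x) (1 / q)"
    using wv
  proof eventually_elim
    case (elim x)
    obtain r where r: "0 < r" "v x = ennreal r" "w x = ennreal (r powr (1 - p))"
      by (rule inverse_power_pair[OF elim p1])
    have "1 / p + (1 - p) * (1 / q) = 2 - p"
      using p1 by (simp add: q_def conj_exponent_def field_simps power2_eq_square)
    then have "r powr (1 / p) * (r powr (1 - p)) powr (1 / q) = r powr (2 - p)"
      by (simp add: powr_powr flip: powr_add)
    then show ?case using r
      by (simp add: epowr_ennreal inverse_ennreal powr_minus[symmetric] flip: ennreal_mult)
  qed
  have "(\<Sum>k. \<integral>\<^sup>+x. dyadic_avg k (\<lambda>y. f k y * v y) x * (g k x * w x) \<partial>M)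
    \<le> (\<Sum>k. ?K * A * (\<integral>\<^sup>+x. inverse (epowr (v x) (p - 2)) * (F k x * G k x) \<partial>M))"
    unfolding F_def G_def using finw finv wv A p
    by (intro suminf_le scale_bilinear_bound) auto
  also have "\<dots> = ?K * A * (\<Sum>k. \<integral>\<^sup>+x. inverse (epowr (v x) (p - 2)) * (F k x * G k x) \<partial>M)"
    by simp
  also have "(\<Sum>k. \<integral>\<^sup>+x. inverse (epowr (v x) (p - 2)) * (F k x * G k x) \<partial>M)
     = (\<Sum>k. \<integral>\<^sup>+x. (epowr (v x) (1 / p) * F k x) * (epowr (w x) (1 / q) * G k x) \<partial>M)"
    by (intro suminf_cong nn_integral_cong_AE, use u in eventually_elim) (simp add: mult_ac)
  also have "\<dots> \<le> Lp_norm p M (square_fun (\<lambda>k x. epowr (v x) (1 / p) * F k x)) * Lp_norm q M (square_fun (\<lambda>k x. epowr (w x) (1 / q) * G k x))"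
    unfolding q_def by (rule square_fun_pairing[OF _ _ p1]) measurable
  also have "\<dots> = Lp_norm p ?V (square_fun F) * Lp_norm q ?W (square_fun G)"
    using p1 cf by (simp add: square_fun_cmult Lp_norm_density q_def)
  also have "\<dots> \<le> (ennreal (Stein_const p) * Lp_norm p ?V (square_fun f)) * (ennreal (Stein_const q) * Lp_norm q ?W (square_fun g))"
  proof -
    have dec: "decseq (\<lambda>k. 22 * \<delta> k)" using decseq_\<delta> by (auto simp: decseq_def)
    have pos: "0 < 22 * \<delta> k" "26 * (22 * \<delta> k) \<le> 572 * \<delta> k" for k by simp_all
    have "Lp_norm p ?V (square_fun F) \<le> ennreal (Stein_const p) * Lp_norm p ?V (square_fun f)"
      unfolding F_def by (rule Stein_inequality[OF finv _ pos(1) dec pos(2) _ p1]) auto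
    moreover have "Lp_norm q ?W (square_fun G) \<le> ennreal (Stein_const q) * Lp_norm q ?W (square_fun g)"
      unfolding G_def q_def by (rule Stein_inequality[OF finw _ pos(1) dec pos(2) _ cf(1)]) auto
    ultimately show ?thesis by (intro mult_mono) auto
  qed
  finally have "(\<Sum>k. \<integral>\<^sup>+x. dyadic_avg k (\<lambda>y. f k y * v y) x * (g k x * w x) \<partial>M)
    \<le> ?K * A * ((ennreal (Stein_const p) * Lp_norm p ?V (square_fun f)) * (ennreal (Stein_const q) * Lp_norm q ?W (square_fun g)))"
    by (simp add: mult_left_mono)
  moreover have "0 \<le> Stein_const t" for t
    by (simp add: Stein_const_def Let_def maximal_const_def)
  then have "ennreal (form_const p) = ?K * ennreal (Stein_const p) * ennreal (Stein_const q)"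
    unfolding form_const_def q_def using cC by (simp add: ennreal_mult)
  ultimately show ?thesis by (simp add: mult_ac q_def)
qed

definition square_const :: "real \<Rightarrow> real" where
  "square_const p = form_const (if 2 \<le> p then p else conj_exponent p)"

text \<open>For \<open>p \<ge> 2\<close> this is the dual form of the bilinear bound, with \<open>a = f v\<close>. For \<open>p < 2\<close> the
  bilinear form is symmetric, so the same bound is applied with the exponent \<open>p' > 2\<close> and the
  roles of \<open>w\<close> and \<open>v\<close> exchanged; the constant of the exchanged pair is \<open>A\<^sup>1\<^sup>/\<^sup>(\<^sup>p\<^sup>-\<^sup>1\<^sup>)\<close>. This is
  the origin of the exponent \<open>max {1, 1 / (p - 1)}\<close>.\<close>
theorem weighted_square_function_bound:
  fixes w v :: "'a \<Rightarrow> ennreal" and p :: real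
  assumes [measurable]: "w \<in> borel_measurable M" "v \<in> borel_measurable M"
    and finw: "finite_measure (density M w)" and finv: "finite_measure (density M v)"
    and wv: "AE x in M. w x * epowr (v x) (p - 1) = 1"
    and A: "\<And>x k. x \<in> space M \<Longrightarrow>
      mass w (1146 * \<delta> k) x * epowr (mass v (1146 * \<delta> k) x) (p - 1) \<le> A * ennreal (\<delta> k powr (n * p))"
    and p: "1 < p"
    and [measurable]: "\<And>k. a k \<in> borel_measurable M"
  shows "Lp_norm p (density M w) (square_fun (\<lambda>k. dyadic_avg k (a k)))
    \<le> ennreal (square_const p) * epowr A (max 1 (1 / (p - 1))) * Lp_norm p (density M w) (square_fun a)"
proof -
  let ?V = "density M v" let ?W = "density M w"
  note cf = conj_exponent_facts[OF p]
  define q where "q = conj_exponent p"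
  define f where "f k x = a k x / v x" for k x
  have [measurable]: "f k \<in> borel_measurable M" for k unfolding f_def[abs_def] by measurable
  have vp: "AE x in M. \<exists>r. 0 < r \<and> v x = ennreal r \<and> w x = ennreal (r powr (1 - p))"
    using wv by eventually_elim (use p in \<open>blast elim: inverse_power_pair\<close>)
  have fv: "AE x in M. f k x * v x = a k x" for k
    using vp
  proof eventually_elim
    case (elim x)
    then have "v x \<noteq> 0" "v x \<noteq> top" by auto
    then show ?case by (simp add: f_def ennreal_divide_times ennreal_times_divide mult_divide_eq_ennreal)
  qed
  have da: "dyadic_avg k (a k) x = dyadic_avg k (\<lambda>y. f k y * v y) x" for k x
    unfolding dyadic_avg_def
    by (intro arg_cong[where f="(*) _"] nn_integral_cong_AE, use fv[of k] in eventually_elim) simp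
  have square_fun_f: "Lp_norm p ?V (square_fun f) = Lp_norm p ?W (square_fun a)"
  proof -
    have "f = (\<lambda>k x. inverse (v x) * a k x)"
      by (simp add: f_def[abs_def] divide_ennreal_def mult.commute)
    then have "square_fun f = (\<lambda>x. inverse (v x) * square_fun a x)"
      using square_fun_cmult[of "\<lambda>x. inverse (v x)" a] by simp
    then have "Lp_norm p ?V (square_fun f) = Lp_norm p M (\<lambda>x. epowr (v x) (1 / p) * (inverse (v x) * square_fun a x))"
      using p by (simp add: Lp_norm_density)
    also have "\<dots> = Lp_norm p M (\<lambda>x. epowr (w x) (1 / p) * square_fun a x)"
    proof (rule Lp_norm_cong_AE, use vp in eventually_elim)
      case (elim x)
      then obtain r where r: "0 < r" "v x = ennreal r" "w x = ennreal (r powr (1 - p))" by auto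
      have "r powr (1 / p) * inverse r = r powr (1 / p) * r powr (-1)"
        using r by (simp add: powr_minus)
      also have "\<dots> = r powr ((1 - p) * (1 / p))"
        unfolding powr_add[symmetric] using p by (simp add: field_simps)
      finally have "epowr (v x) (1 / p) * inverse (v x) = epowr (w x) (1 / p)"
        using r by (simp add: epowr_ennreal inverse_ennreal powr_powr flip: ennreal_mult)
      then show ?case by (simp add: mult.assoc[symmetric])
    qed
    also have "\<dots> = Lp_norm p ?W (square_fun a)" using p by (simp add: Lp_norm_density)
    finally show ?thesis .
  qed
  show ?thesis
  proof (rule square_fun_le_by_duality[OF finw _ p])
    fix g :: "nat \<Rightarrow> 'a \<Rightarrow> ennreal" assume "\<And>k. g k \<in> borel_measurable ?W"
    then have [measurable]: "\<And>k. g k \<in> borel_measurable M" by simp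
    have eq: "(\<integral>\<^sup>+x. dyadic_avg k (a k) x * g k x \<partial>?W) = (\<integral>\<^sup>+x. dyadic_avg k (\<lambda>y. f k y * v y) x * (g k x * w x) \<partial>M)" for k
      by (subst nn_integral_density) (auto simp: da mult_ac)
    show "(\<Sum>k. \<integral>\<^sup>+x. dyadic_avg k (a k) x * g k x \<partial>?W)
      \<le> ennreal (square_const p) * epowr A (max 1 (1 / (p - 1))) * Lp_norm p ?W (square_fun a) * Lp_norm (conj_exponent p) ?W (square_fun g)"
    proof (cases "2 \<le> p")
      case True
      have "(\<Sum>k. \<integral>\<^sup>+x. dyadic_avg k (a k) x * g k x \<partial>?W)
        \<le> ennreal (form_const p) * A * (Lp_norm p ?V (square_fun f) * Lp_norm (conj_exponent p) ?W (square_fun g))"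
        unfolding eq using finw finv wv A True by (intro bilinear_bound) auto
      moreover have "max 1 (1 / (p - 1)) = 1" using True by simp
      ultimately show ?thesis using True by (simp add: square_fun_f square_const_def mult.assoc)
    next
      case False
      have q: "1 < q" "2 \<le> q" "q - 1 = 1 / (p - 1)" "conj_exponent q = p"
        using False p cf by (auto simp: q_def conj_exponent_def field_simps)
      have sw: "(\<integral>\<^sup>+x. dyadic_avg k (\<lambda>y. f k y * v y) x * (g k x * w x) \<partial>M)
        = (\<integral>\<^sup>+x. dyadic_avg k (\<lambda>y. g k y * w y) x * (f k x * v x) \<partial>M)" for k
        by (subst dyadic_avg_symmetric) (auto simp: mult.commute)
      have "(\<Sum>k. \<integral>\<^sup>+x. dyadic_avg k (a k) x * g k x \<partial>?W)
        \<le> ennreal (form_const q) * epowr A (q - 1) * (Lp_norm q ?W (square_fun g) * Lp_norm (conj_exponent q) ?V (square_fun f))"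
        unfolding eq sw
      proof (rule bilinear_bound[OF _ _ finv finw _ _ q(2)])
        show "AE x in M. v x * epowr (w x) (q - 1) = 1"
          using vp
        proof eventually_elim
          case (elim x)
          then obtain r where r: "0 < r" "v x = ennreal r" "w x = ennreal (r powr (1 - p))" by auto
          have "(1 - p) * (q - 1) = -1" unfolding q(3) using p by (simp add: field_simps)
          then have "r * (r powr (1 - p)) powr (q - 1) = 1"
            using r by (simp add: powr_powr powr_minus)
          then show ?case using r by (simp add: epowr_ennreal flip: ennreal_mult)
        qed
        fix x k assume x: "x \<in> space M"
        let ?v = "mass v (1146 * \<delta> k) x" and ?w = "mass w (1146 * \<delta> k) x"
        have "?v * epowr ?w (q - 1) = epowr (?w * epowr ?v (p - 1)) (q - 1)"
          using p q(1,3) by (simp add: epowr_mult epowr_epowr mult.commute)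
        also have "\<dots> \<le> epowr (A * ennreal (\<delta> k powr (n * p))) (q - 1)"
          using q(1) by (intro epowr_mono A x) auto
        also have "\<dots> = epowr A (q - 1) * ennreal (\<delta> k powr (n * p * (q - 1)))"
          using q(1) by (simp add: epowr_mult epowr_ennreal powr_powr)
        also have "n * p * (q - 1) = n * q"
          using p by (simp add: q_def conj_exponent_def field_simps)
        finally show "?v * epowr ?w (q - 1) \<le> epowr A (q - 1) * ennreal (\<delta> k powr (n * q))" .
      qed measurable
      moreover have "max 1 (1 / (p - 1)) = q - 1" using False p by (simp add: q(3) max_def field_simps)
      ultimately show ?thesis using False
        by (simp add: square_fun_f square_const_def q mult_ac flip: q_def)
    qed
  qed measurable
qed

end

section \<open>The nonisotropic quasi-metric on the sphere\<close>

lemma cdot_add_left: "cdot (x + y) z = cdot x z + cdot y z"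
  by (simp add: cdot_def algebra_simps sum.distrib)

lemma cdot_diff_left: "cdot (x - y) z = cdot x z - cdot y z"
  by (simp add: cdot_def algebra_simps sum_subtractf)

lemma cdot_diff_right: "cdot z (x - y) = cdot z x - cdot z y"
  by (simp add: cdot_def algebra_simps sum_subtractf)

lemma cdot_smult_left: "cdot (c *s x) z = c * cdot x z"
  by (simp add: cdot_def sum_distrib_left mult.assoc)

lemma cdot_smult_right: "cdot z (c *s x) = cnj c * cdot z x"
  by (simp add: cdot_def sum_distrib_left mult_ac)

lemma cdot_scaleR_left: "cdot (r *\<^sub>R x) z = r * cdot x z"
  by (simp add: cdot_def sum_distrib_left mult.assoc scaleR_conv_of_real[where 'a=complex])

lemma cdot_scaleR_right: "cdot z (r *\<^sub>R x) = r * cdot z x"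
  by (simp add: cdot_def sum_distrib_left mult_ac scaleR_conv_of_real[where 'a=complex])

lemma cdot_cnj: "cdot y x = cnj (cdot x y)"
  by (simp add: cdot_def mult.commute)

lemma cdot_self: "cdot x x = complex_of_real ((norm x)\<^sup>2)"
  by (simp add: cdot_def norm_vec_def L2_set_def complex_mult_cnj cmod_power2 sum_nonneg)

lemma norm_sq_cdot: "(norm x)\<^sup>2 = Re (cdot x x)"
  by (simp add: cdot_self)

lemma norm_cdot_le: "norm (cdot x y) \<le> norm x * norm y"
proof -
  have "norm (cdot x y) \<le> (\<Sum>j\<in>UNIV. \<bar>norm (x $ j)\<bar> * \<bar>norm (y $ j)\<bar>)"
    unfolding cdot_def by (rule order_trans[OF norm_sum]) (simp add: norm_mult)
  also have "\<dots> \<le> norm x * norm y"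
    unfolding norm_vec_def by (rule L2_set_mult_ineq)
  finally show ?thesis .
qed

lemma continuous_cdot: "continuous_on UNIV (\<lambda>(x, y). cdot x y)"
  unfolding cdot_def case_prod_beta by (intro continuous_intros)

lemma measurable_cdot [measurable]: "(\<lambda>(x, y). cdot x y) \<in> borel_measurable (borel \<Otimes>\<^sub>M borel)"
  unfolding borel_prod by (rule borel_measurable_continuous_onI[OF continuous_cdot])

lemma measurable_cdot' [measurable (raw)]:
  assumes [measurable]: "f \<in> borel_measurable M" "g \<in> borel_measurable M"
  shows "(\<lambda>x. cdot (f x) (g x)) \<in> borel_measurable M"
  using measurable_compose[OF measurable_Pair[OF assms] measurable_cdot] by simp

abbreviation sdist :: "complex ^ 'n \<Rightarrow> complex ^ 'n \<Rightarrow> real" where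
  "sdist x y \<equiv> norm (1 - cdot x y)"

lemma sdist_sym: "sdist x y = sdist y x"
  by (metis cdot_cnj complex_cnj_diff complex_cnj_one complex_mod_cnj)

lemma norm_diff_sq_le:
  assumes "norm x = 1" "norm y = 1"
  shows "(norm (x - y))\<^sup>2 \<le> 2 * sdist x y"
proof -
  have "cdot x x = 1" "cdot y y = 1" using assms by (simp_all add: cdot_self)
  then have "Re (cdot (x - y) (x - y)) = 2 - 2 * Re (cdot x y)"
    using cdot_cnj[of y x] by (simp add: cdot_diff_left cdot_diff_right)
  then have "(norm (x - y))\<^sup>2 = 2 - 2 * Re (cdot x y)" by (simp add: norm_sq_cdot)
  also have "\<dots> = 2 * Re (1 - cdot x y)" by simp
  also have "\<dots> \<le> 2 * sdist x y" using complex_Re_le_cmod[of "1 - cdot x y"] by simp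
  finally show ?thesis .
qed

text \<open>From \<open>1 - x\<cdot>z = (1 - x\<cdot>y) + (1 - y\<cdot>z) + (x - y)\<cdot>(y - z)\<close>: the last term is at most \<open>(\<bar>x -
  y\<bar>\<^sup>2 + \<bar>y - z\<bar>\<^sup>2) / 2\<close>, and \<open>\<bar>x - y\<bar>\<^sup>2 \<le> 2 \<bar>1 - x\<cdot>y\<bar>\<close> on the sphere.\<close>
lemma sdist_triangle:
  assumes "norm x = 1" "norm y = 1" "norm z = 1"
  shows "sdist x z \<le> 2 * (sdist x y + sdist y z)"
proof -
  have eq: "1 - cdot x z = (1 - cdot x y) + (1 - cdot y z) + cdot (x - y) (y - z)"
    using assms by (simp add: cdot_diff_left cdot_diff_right cdot_self)
  have "sdist x z \<le> sdist x y + sdist y z + norm (cdot (x - y) (y - z))"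
    unfolding eq using norm_triangle_ineq[of "(1 - cdot x y) + (1 - cdot y z)" "cdot (x - y) (y - z)"]
      norm_triangle_ineq[of "1 - cdot x y" "1 - cdot y z"] by linarith
  also have "norm (cdot (x - y) (y - z)) \<le> norm (x - y) * norm (y - z)" by (rule norm_cdot_le)
  also have "\<dots> \<le> ((norm (x - y))\<^sup>2 + (norm (y - z))\<^sup>2) / 2"
    using sum_squares_bound[of "norm (x - y)" "norm (y - z)"] by simp
  also have "\<dots> \<le> sdist x y + sdist y z"
    using norm_diff_sq_le[of x y] norm_diff_sq_le[of y z] assms by simp
  finally show ?thesis by simp
qed

lemma nn_integral_lborel_translate:
  fixes f :: "'a::euclidean_space \<Rightarrow> ennreal"
  assumes [measurable]: "f \<in> borel_measurable borel"
  shows "(\<integral>\<^sup>+x. f (t + x) \<partial>lborel) = (\<integral>\<^sup>+x. f x \<partial>lborel)"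
proof -
  have "lborel = distr lborel borel (\<lambda>x::'a. t + x)"
    using lborel_affine[of 1 t] by (simp add: density_1)
  then have "(\<integral>\<^sup>+x. f x \<partial>lborel) = (\<integral>\<^sup>+x. f x \<partial>distr lborel borel (\<lambda>x. t + x))" by simp
  also have "\<dots> = (\<integral>\<^sup>+x. f (t + x) \<partial>lborel)" by (rule nn_integral_distr) measurable
  finally show ?thesis by simp
qed

lemma nn_integral_lborel_reflect:
  fixes f :: "'a::euclidean_space \<Rightarrow> ennreal"
  assumes [measurable]: "f \<in> borel_measurable borel"
  shows "(\<integral>\<^sup>+x. f (t - x) \<partial>lborel) = (\<integral>\<^sup>+x. f x \<partial>lborel)"
proof -
  have "lborel = distr lborel borel (\<lambda>x::'a. t - x)"
    using lborel_affine[of "-1" t] by (simp add: density_1)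
  then have "(\<integral>\<^sup>+x. f x \<partial>lborel) = (\<integral>\<^sup>+x. f x \<partial>distr lborel borel (\<lambda>x. t - x))" by simp
  also have "\<dots> = (\<integral>\<^sup>+x. f (t - x) \<partial>lborel)" by (rule nn_integral_distr) measurable
  finally show ?thesis by simp
qed

text \<open>The image of Lebesgue measure under \<open>U\<close> is translation invariant, hence a multiple of
  Lebesgue measure; the unit ball, preserved by \<open>U\<close>, shows that the factor is 1. The proof of
  proportionality is Fubini's theorem for \<open>f(U x) 1\<^sub>B(U x + y)\<close> integrated in both orders.\<close>
lemma nn_integral_lborel_isometry:
  fixes U :: "'a::euclidean_space \<Rightarrow> 'a"
  assumes U: "linear U" "\<And>x. norm (U x) = norm x" and [measurable]: "f \<in> borel_measurable borel"
  shows "(\<integral>\<^sup>+x. f (U x) \<partial>lborel) = (\<integral>\<^sup>+x. f x \<partial>lborel)"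
proof -
  have [measurable]: "U \<in> borel_measurable borel"
    using linear_continuous_on[OF linear_conv_bounded_linear[THEN iffD1, OF U(1)]]
    by (rule borel_measurable_continuous_onI)
  have "inj U" unfolding linear_injective_0[OF U(1)] using U(2) by (metis norm_eq_zero)
  then have "surj U" using U(1) linear_injective_imp_surjective by blast
  let ?B = "indicator (ball 0 1) :: 'a \<Rightarrow> ennreal"
  have B [measurable]: "?B \<in> borel_measurable borel" by (intro borel_measurable_indicator) simp
  let ?I = "\<integral>\<^sup>+x. ?B x \<partial>lborel"
  have UB: "?B (U x) = ?B x" for x using U(2) by (simp add: indicator_def)
  have inv: "(\<integral>\<^sup>+x. g (U x + t) \<partial>lborel) = (\<integral>\<^sup>+x. g (U x) \<partial>lborel)"
    if [measurable]: "g \<in> borel_measurable borel" for g :: "'a \<Rightarrow> ennreal" and t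
  proof -
    obtain s where s: "U s = t" using \<open>surj U\<close> by (metis surjD)
    have "(\<integral>\<^sup>+x. g (U x + t) \<partial>lborel) = (\<integral>\<^sup>+x. g (U (s + x)) \<partial>lborel)"
      by (simp add: linear_add[OF U(1)] s add.commute)
    also have "\<dots> = (\<integral>\<^sup>+x. g (U x) \<partial>lborel)"
      by (rule nn_integral_lborel_translate) measurable
    finally show ?thesis .
  qed
  have "(\<integral>\<^sup>+x. f (U x) \<partial>lborel) * ?I = (\<integral>\<^sup>+x. (\<integral>\<^sup>+y. f (U x) * ?B (U x + y) \<partial>lborel) \<partial>lborel)"
  proof -
    have "(\<integral>\<^sup>+y. f (U x) * ?B (U x + y) \<partial>lborel) = f (U x) * ?I" for x
      using nn_integral_lborel_translate[of ?B "U x", OF B] by (subst nn_integral_cmult) auto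
    then show ?thesis by (subst nn_integral_multc[symmetric]) auto
  qed
  also have "\<dots> = (\<integral>\<^sup>+y. (\<integral>\<^sup>+x. f (U x) * ?B (U x + y) \<partial>lborel) \<partial>lborel)"
    by (rule lborel_pair.Fubini'[symmetric]) measurable
  also have "\<dots> = (\<integral>\<^sup>+y. (\<integral>\<^sup>+x. f (U x - y) * ?B (U x) \<partial>lborel) \<partial>lborel)"
  proof (rule nn_integral_cong)
    fix y
    show "(\<integral>\<^sup>+x. f (U x) * ?B (U x + y) \<partial>lborel) = (\<integral>\<^sup>+x. f (U x - y) * ?B (U x) \<partial>lborel)"
      using inv[of "\<lambda>x. f (x - y) * ?B x" y] by simp
  qed
  also have "\<dots> = (\<integral>\<^sup>+x. (\<integral>\<^sup>+y. f (U x - y) * ?B x \<partial>lborel) \<partial>lborel)"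
    unfolding UB by (rule lborel_pair.Fubini') measurable
  also have "\<dots> = (\<integral>\<^sup>+x. f x \<partial>lborel) * ?I"
  proof -
    have "(\<integral>\<^sup>+y. f (U x - y) * ?B x \<partial>lborel) = (\<integral>\<^sup>+y. f y \<partial>lborel) * ?B x" for x
      using nn_integral_lborel_reflect[of f "U x"] by (simp add: nn_integral_multc)
    then show ?thesis by (subst nn_integral_cmult[symmetric]) auto
  qed
  finally have eq: "(\<integral>\<^sup>+x. f (U x) \<partial>lborel) * ?I = (\<integral>\<^sup>+x. f x \<partial>lborel) * ?I" .
  have "?I = emeasure lborel (ball (0::'a) 1)" by simp
  moreover have "emeasure lborel (ball (0::'a) 1) \<noteq> 0" "emeasure lborel (ball (0::'a) 1) \<noteq> top"
    using content_ball_pos[of 1 "0::'a"] emeasure_lborel_ball_finite[of "0::'a" 1] by (auto simp: measure_def)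
  ultimately show ?thesis using eq mult_divide_eq_ennreal by metis
qed

text \<open>The complex Householder reflection in \<open>a = \<zeta> - \<alpha> e\<^sub>j\<close>, followed by multiplication by the
  conjugate of \<open>\<alpha>\<close>. The phase \<open>\<alpha>\<close> is chosen such that \<open>\<zeta>\<cdot>(\<alpha> e\<^sub>j)\<close> is real, which is what makes the
  reflection exchange \<open>\<zeta>\<close> and \<open>\<alpha> e\<^sub>j\<close>.\<close>
lemma Householder_map:
  fixes \<zeta> :: "complex ^ 'n" and j :: 'n
  assumes "norm \<zeta> = 1"
  obtains U where "linear U" "\<And>x y. cdot (U x) (U y) = cdot x y" "U \<zeta> = axis j 1"
proof -
  define \<alpha> where "\<alpha> = (if \<zeta> $ j = 0 then 1 else sgn (\<zeta> $ j))"
  have \<alpha>: "\<alpha> * cnj \<alpha> = 1"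
    by (auto simp: \<alpha>_def norm_sgn simp flip: complex_norm_square)
  have \<alpha>j: "cnj \<alpha> * \<zeta> $ j = complex_of_real (norm (\<zeta> $ j))"
  proof (cases "\<zeta> $ j = 0")
    case False
    then have "cnj \<alpha> * \<zeta> $ j = (\<zeta> $ j * cnj (\<zeta> $ j)) / complex_of_real (norm (\<zeta> $ j))"
      by (simp add: \<alpha>_def sgn_div_norm scaleR_conv_of_real divide_inverse)
    also have "\<dots> = complex_of_real (norm (\<zeta> $ j))"
      using False by (simp add: complex_norm_square[symmetric] power2_eq_square)
    finally show ?thesis .
  qed simp
  define e :: "complex ^ 'n" where "e = \<alpha> *s axis j 1"
  have cj: "cdot x (axis j 1) = x $ j" for x :: "complex ^ 'n"
  proof -
    have "cdot x (axis j 1) = (\<Sum>i\<in>UNIV. if i = j then x $ i else 0)"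
      unfolding cdot_def by (rule sum.cong) (auto simp: axis_def)
    then show ?thesis by simp
  qed
  have \<alpha>': "cnj \<alpha> * \<alpha> = 1" using \<alpha> by (simp add: mult.commute)
  have ee: "cdot e e = 1" by (simp add: e_def cdot_smult_left cdot_smult_right cj \<alpha> \<alpha>')
  have ze: "cdot \<zeta> e = complex_of_real (norm (\<zeta> $ j))"
    by (simp add: e_def cdot_smult_right cj \<alpha>j)
  have ez: "cdot e \<zeta> = complex_of_real (norm (\<zeta> $ j))" using ze cdot_cnj[of e \<zeta>] by simp
  have zz: "cdot \<zeta> \<zeta> = 1" using assms by (simp add: cdot_self)
  define a where "a = \<zeta> - e"
  define t where "t = norm (\<zeta> $ j)"
  have aa: "cdot a a = complex_of_real (2 * (1 - t))"
    by (simp add: a_def cdot_diff_left cdot_diff_right zz ee ze ez t_def)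
  have za: "cdot \<zeta> a = complex_of_real (1 - t)"
    by (simp add: a_def cdot_diff_right zz ze t_def)
  \<comment> \<open>\<open>k = 2 / \<bar>a\<bar>\<^sup>2\<close>; for \<open>t = 1\<close> one has \<open>a = 0\<close> and the reflection is the identity\<close>
  define k where "k = (if t = 1 then 0 else 1 / (1 - t))"
  define H where "H x = x - (k * cdot x a) *s a" for x
  have H\<zeta>: "H \<zeta> = e"
  proof (cases "t = 1")
    case True
    then have "a = 0" using aa by (simp add: cdot_self)
    then show ?thesis by (simp add: H_def a_def)
  next
    case False
    then have "complex_of_real k * cdot \<zeta> a = 1" unfolding za k_def by (simp flip: of_real_mult)
    then show ?thesis by (simp add: H_def a_def)
  qed
  have k2: "k * k * (2 * (1 - t)) = 2 * k"
  proof -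
    have "k * k * (2 * (1 - t)) = 2 * k * (k * (1 - t))" by (simp only: mult_ac)
    also have "\<dots> = 2 * k" by (simp add: k_def)
    finally show ?thesis .
  qed
  have HH: "cdot (H x) (H y) = cdot x y" for x y
  proof -
    have "cdot (H x) (H y) = cdot x y - 2 * k * (cdot x a * cdot a y) + complex_of_real (k * k * (2 * (1 - t))) * (cdot x a * cdot a y)"
      using cdot_cnj[of a y]
      by (simp add: H_def cdot_diff_left cdot_diff_right cdot_smult_left cdot_smult_right aa) (simp add: algebra_simps)
    then show ?thesis unfolding k2 by simp
  qed
  have linH: "H (x + y) = H x + H y" "H (r *\<^sub>R x) = r *\<^sub>R H x" for x y r
    by (simp_all add: H_def cdot_add_left cdot_scaleR_left vec_eq_iff algebra_simps scaleR_conv_of_real[where 'a=complex])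
  define U where "U x = cnj \<alpha> *s H x" for x
  have "linear U"
    by (rule linearI) (simp_all add: U_def linH vec_eq_iff algebra_simps scaleR_conv_of_real[where 'a=complex])
  moreover have "cdot (U x) (U y) = cdot x y" for x y
    using \<alpha> by (simp add: U_def cdot_smult_left cdot_smult_right HH mult.assoc[symmetric] mult.commute)
  moreover have "U \<zeta> = axis j 1"
    using \<alpha> by (simp add: U_def H\<zeta> e_def vec_eq_iff mult.assoc[symmetric] mult.commute)
  ultimately show ?thesis by (rule that)
qed

text \<open>Unitary invariance, which reduces volumes of nonisotropic balls to balls centred at a basis
  vector.\<close>
lemma cone_volume_unitary:
  fixes \<zeta> :: "complex ^ 'n" and j :: 'n
  assumes \<zeta>: "norm \<zeta> = 1"
  shows "emeasure lborel {w \<in> ball 0 1. sdist \<zeta> (sgn w) < r} = emeasure lborel {w \<in> ball 0 1. sdist (axis j 1 :: complex ^ 'n) (sgn w) < r}"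
proof -
  obtain U :: "complex ^ 'n \<Rightarrow> complex ^ 'n" where U: "linear U" "\<And>x y. cdot (U x) (U y) = cdot x y" "U \<zeta> = axis j 1"
    by (rule Householder_map[OF \<zeta>]) blast
  have nU: "norm (U x) = norm x" for x
  proof -
    have "(norm (U x))\<^sup>2 = (norm x)\<^sup>2" by (simp add: norm_sq_cdot U)
    then show ?thesis by simp
  qed
  have [measurable]: "sgn \<in> borel_measurable (borel :: (complex ^ 'n) measure)"
    unfolding sgn_div_norm[abs_def] by measurable
  define A :: "(complex ^ 'n) set" where "A = {w \<in> ball 0 1. sdist (axis j 1) (sgn w) < r}"
  define A' where "A' = {w \<in> ball 0 1. sdist \<zeta> (sgn w) < r}"
  have [measurable]: "A \<in> sets borel" "A' \<in> sets borel" unfolding A_def A'_def by measurable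
  have "indicator A (U w) = (indicator A' w :: ennreal)" for w
  proof -
    have "sgn (U w) = U (sgn w)" by (simp add: sgn_div_norm nU linear_scale[OF U(1)])
    then have "cdot (axis j 1) (sgn (U w)) = cdot \<zeta> (sgn w)" using U by metis
    then show ?thesis by (simp add: A_def A'_def indicator_def nU)
  qed
  then have "(\<integral>\<^sup>+w. indicator A' w \<partial>lborel) = (\<integral>\<^sup>+w. indicator A w \<partial>lborel)"
    using nn_integral_lborel_isometry[OF U(1) nU, of "indicator A"] by simp
  then show ?thesis by (simp add: A_def A'_def)
qed

section \<open>Volumes of nonisotropic balls\<close>

lemma prod_Basis_complex_vec:
  fixes g :: "complex ^ 'n \<Rightarrow> 'b::comm_monoid_mult"
  shows "(\<Prod>b\<in>Basis. g b) = (\<Prod>i\<in>UNIV. g (axis i 1) * g (axis i \<i>))"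
proof -
  have "(\<Prod>b\<in>Basis. g b) = (\<Prod>i\<in>UNIV. \<Prod>b\<in>(\<Union>u\<in>Basis. {axis i u :: complex ^ 'n}). g b)"
    unfolding Basis_vec_def
    by (rule prod.UNION_disjoint) (auto simp: Basis_complex_def axis_eq_axis)
  also have "(\<Union>u\<in>Basis. {axis i u}) = {axis i 1 :: complex ^ 'n, axis i \<i>}" for i
    by (auto simp: Basis_complex_def)
  then have "(\<Prod>i\<in>UNIV. \<Prod>b\<in>(\<Union>u\<in>Basis. {axis i u :: complex ^ 'n}). g b) = (\<Prod>i\<in>UNIV. g (axis i 1) * g (axis i \<i>))"
    by (intro prod.cong) (auto simp: axis_eq_axis)
  finally show ?thesis .
qed

lemma mem_box_complex_vec:
  "x \<in> box l u \<longleftrightarrow> (\<forall>i. Re (l $ i) < Re (x $ i) \<and> Re (x $ i) < Re (u $ i) \<and> Im (l $ i) < Im (x $ i) \<and> Im (x $ i) < Im (u $ i))"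
  for x l u :: "complex ^ 'n"
  by (auto simp: mem_box Basis_vec_def Basis_complex_def inner_axis)

lemma emeasure_box_complex_vec:
  fixes l u :: "complex ^ 'n"
  assumes "\<And>i. Re (l $ i) \<le> Re (u $ i)" "\<And>i. Im (l $ i) \<le> Im (u $ i)"
  shows "emeasure lborel (box l u) = ennreal (\<Prod>i\<in>UNIV. (Re (u $ i) - Re (l $ i)) * (Im (u $ i) - Im (l $ i)))"
proof -
  have "emeasure lborel (box l u) = ennreal (\<Prod>b\<in>Basis. (u - l) \<bullet> b)"
    using assms by (intro emeasure_lborel_box) (auto simp: Basis_vec_def Basis_complex_def inner_axis)
  also have "(\<Prod>b\<in>Basis. (u - l) \<bullet> b) = (\<Prod>i\<in>UNIV. (Re (u $ i) - Re (l $ i)) * (Im (u $ i) - Im (l $ i)))"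
    by (simp add: prod_Basis_complex_vec inner_axis)
  finally show ?thesis .
qed

lemma prod_distinguished:
  fixes a b :: real
  shows "(\<Prod>i\<in>UNIV. if i = (j::'n::finite) then a else b) = a * b ^ (CARD('n) - 1)"
  by (subst prod.remove[of _ j]) (auto simp: card_Diff_singleton)

lemma norm_vec_sq: "(norm (w :: complex ^ 'n))\<^sup>2 = (\<Sum>i\<in>UNIV. (norm (w $ i))\<^sup>2)"
  by (simp add: norm_vec_def L2_set_def sum_nonneg)

lemma cdot_axis: "cdot (axis j 1) w = cnj (w $ j)"
proof -
  have "cdot (axis j 1) w = (\<Sum>i\<in>UNIV. if i = j then cnj (w $ i) else 0)"
    unfolding cdot_def by (rule sum.cong) (auto simp: axis_def)
  then show ?thesis by simp
qed

lemma sdist_axis: "sdist (axis j 1) w = norm (1 - w $ j)"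
  by (metis cdot_axis complex_cnj_diff complex_cnj_one complex_mod_cnj)

lemma norm_1_minus_sgn:
  assumes "w \<noteq> (0 :: complex ^ 'n)"
  shows "norm (1 - sgn w $ j) = norm (complex_of_real (norm w) - w $ j) / norm w"
proof -
  have "1 - sgn w $ j = (complex_of_real (norm w) - w $ j) / complex_of_real (norm w)"
    using assms by (simp add: sgn_div_norm scaleR_conv_of_real[where 'a=complex] field_simps)
  then show ?thesis by (simp add: norm_divide)
qed

text \<open>For \<open>w\<close> in the cone, \<open>\<bar>\<parallel>w\<parallel> - w\<^sub>j\<bar> < r\<close>. Hence \<open>Im w\<^sub>j\<close> is at most \<open>r\<close>, and the other
  coordinates satisfy \<open>\<bar>w\<^sub>i\<bar>\<^sup>2 \<le> \<parallel>w\<parallel>\<^sup>2 - \<bar>w\<^sub>j\<bar>\<^sup>2 \<le> 2 r\<close>. The cone lies in a box that has one side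
  of unit length, one of length \<open>r\<close> and \<open>2n - 2\<close> sides of length \<open>\<surd>r\<close>, up to constants; the volume
  is of order \<open>r\<^sup>n\<close>.\<close>
lemma cone_volume_le:
  assumes r: "0 < r"
  shows "emeasure lborel {w \<in> ball 0 1. sdist (axis j 1 :: complex ^ 'n) (sgn w) < r} \<le> ennreal (16 ^ CARD('n) * r ^ CARD('n))"
proof -
  define u :: "complex ^ 'n" where "u = (\<chi> i. if i = j then Complex 1 r else Complex (2 * sqrt r) (2 * sqrt r))"
  have "{w \<in> ball 0 1. sdist (axis j 1 :: complex ^ 'n) (sgn w) < r} \<subseteq> box (- u) u"
  proof safe
    fix w :: "complex ^ 'n" assume w: "w \<in> ball 0 1" "sdist (axis j 1 :: complex ^ 'n) (sgn w) < r"
    show "w \<in> box (- u) u"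
    proof (cases "w = 0")
      case True
      then show ?thesis using r by (auto simp: mem_box_complex_vec u_def)
    next
      case False
      define t where "t = norm w"
      have t: "0 < t" "t < 1" using False w by (auto simp: t_def)
      have "norm (complex_of_real t - w $ j) / t < r"
        using w(2) False by (simp add: sdist_axis norm_1_minus_sgn t_def)
      then have near: "norm (complex_of_real t - w $ j) < r * t" using t by (simp add: field_simps)
      have rt: "r * t < r" using r t by simp
      have "\<bar>Im (w $ j)\<bar> \<le> norm (complex_of_real t - w $ j)"
        using abs_Im_le_cmod[of "complex_of_real t - w $ j"] by simp
      then have Im: "\<bar>Im (w $ j)\<bar> < r" using near rt by linarith
      have nj: "norm (w $ j) \<le> t" unfolding t_def by (rule Finite_Cartesian_Product.norm_nth_le)
      have Re: "\<bar>Re (w $ j)\<bar> < 1"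
        using abs_Re_le_cmod[of "w $ j"] nj t by linarith
      have other: "norm (w $ i) < 2 * sqrt r" if i: "i \<noteq> j" for i
      proof -
        have "(norm (w $ i))\<^sup>2 + (norm (w $ j))\<^sup>2 = (\<Sum>k\<in>{i, j}. (norm (w $ k))\<^sup>2)" using i by simp
        also have "\<dots> \<le> t\<^sup>2" unfolding t_def norm_vec_sq by (rule sum_mono2) auto
        finally have le: "(norm (w $ i))\<^sup>2 + (norm (w $ j))\<^sup>2 \<le> t\<^sup>2" .
        have "t - norm (w $ j) \<le> norm (complex_of_real t - w $ j)"
          using norm_triangle_ineq2[of "complex_of_real t" "w $ j"] t by simp
        then have "t - norm (w $ j) \<le> r" using near rt by linarith
        then have "(t - norm (w $ j)) * (t + norm (w $ j)) \<le> r * 2"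
          using nj t r by (intro mult_mono) auto
        then have "(norm (w $ i))\<^sup>2 \<le> 2 * r"
          using le by (simp add: algebra_simps power2_eq_square)
        also have "\<dots> < (2 * sqrt r)\<^sup>2" using r by (simp add: power_mult_distrib)
        finally show ?thesis by (rule power2_less_imp_less) (use r in simp)
      qed
      show ?thesis unfolding mem_box_complex_vec
      proof (intro allI)
        fix i
        show "Re ((- u) $ i) < Re (w $ i) \<and> Re (w $ i) < Re (u $ i) \<and> Im ((- u) $ i) < Im (w $ i) \<and> Im (w $ i) < Im (u $ i)"
        proof (cases "i = j")
          case True
          then show ?thesis using Im Re by (auto simp: u_def abs_less_iff)
        next
          case False
          then show ?thesis using other[OF False] abs_Im_le_cmod[of "w $ i"] abs_Re_le_cmod[of "w $ i"]
            by (auto simp: u_def abs_le_iff)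
        qed
      qed
    qed
  qed
  then have "emeasure lborel {w \<in> ball 0 1. sdist (axis j 1 :: complex ^ 'n) (sgn w) < r} \<le> emeasure lborel (box (- u) u)"
    by (rule emeasure_mono) simp
  also have "\<dots> = ennreal (\<Prod>i\<in>UNIV. if i = j then 4 * r else 16 * r)"
    using r by (subst emeasure_box_complex_vec)
      (auto simp: u_def power2_eq_square[symmetric] power_mult_distrib intro!: arg_cong[where f=ennreal] prod.cong)
  also have "\<dots> \<le> ennreal (\<Prod>i\<in>(UNIV::'n set). 16 * r)"
    using r by (intro ennreal_leI prod_mono) auto
  also have "(\<Prod>i\<in>(UNIV::'n set). 16 * r) = 16 ^ CARD('n) * r ^ CARD('n)"
    by (simp add: power_mult_distrib)
  finally show ?thesis .
qed

text \<open>The cone contains a box of the same shape, whose short sides are multiplied by a small \<open>e\<close>.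
  With \<open>e = 1 / (16 n)\<close> the \<open>n - 1\<close> transversal coordinates and the imaginary part together
  enlarge \<open>\<parallel>w\<parallel>\<^sup>2\<close> by at most \<open>e r / 8\<close> over \<open>(Re w\<^sub>j)\<^sup>2\<close>.\<close>
lemma cone_volume_ge:
  assumes r: "0 < r" "r \<le> 1"
  shows "ennreal ((1 / (32 * CARD('n)) * (4 * (1 / (16 * CARD('n)))\<^sup>2) ^ (CARD('n) - 1)) * r ^ CARD('n))
    \<le> emeasure lborel {w \<in> ball 0 1. sdist (axis j 1 :: complex ^ 'n) (sgn w) < r}"
proof -
  define n where "n = real CARD('n)"
  have n: "1 \<le> n" by (simp add: n_def Suc_leI)
  define e where "e = 1 / (16 * n)"
  have e: "0 < e" "n * e = 1 / 16" "e \<le> 1 / 16" using n by (auto simp: e_def field_simps)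
  define u :: "complex ^ 'n" where "u = (\<chi> i. if i = j then Complex (1/2) (e * r) else Complex (e * sqrt r) (e * sqrt r))"
  define l :: "complex ^ 'n" where "l = (\<chi> i. if i = j then Complex (1/4) (- e * r) else Complex (- e * sqrt r) (- e * sqrt r))"
  have "box l u \<subseteq> {w \<in> ball 0 1. sdist (axis j 1 :: complex ^ 'n) (sgn w) < r}"
  proof
    fix w assume "w \<in> box l u"
    then have b: "Re (l $ i) < Re (w $ i)" "Re (w $ i) < Re (u $ i)" "Im (l $ i) < Im (w $ i)" "Im (w $ i) < Im (u $ i)" for i
      by (auto simp: mem_box_complex_vec)
    define x where "x = Re (w $ j)"
    define t where "t = norm w"
    have x: "1 / 4 < x" "x < 1 / 2" and Im: "\<bar>Im (w $ j)\<bar> < e * r"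
      using b[of j] by (auto simp: u_def l_def x_def)
    have "(norm (w $ i))\<^sup>2 \<le> (if i = j then x\<^sup>2 else 0) + 2 * e\<^sup>2 * r" for i
    proof (cases "i = j")
      case True
      have "(Im (w $ j))\<^sup>2 \<le> (e * r)\<^sup>2" using Im by (metis abs_le_square_iff abs_of_pos e(1) less_imp_le mult_pos_pos r(1))
      also have "\<dots> = e\<^sup>2 * r * r" by (simp add: power2_eq_square)
      also have "\<dots> \<le> e\<^sup>2 * r * 2" using r by (intro mult_left_mono) auto
      finally show ?thesis using True by (simp add: cmod_power2 x_def mult_ac)
    next
      case False
      have sq: "y\<^sup>2 \<le> e\<^sup>2 * r" if "\<bar>y\<bar> < e * sqrt r" for y
      proof -
        have "y\<^sup>2 \<le> (e * sqrt r)\<^sup>2" using that by (metis abs_ge_zero less_imp_le power2_abs power_mono)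
        then show ?thesis using r by (simp add: power_mult_distrib)
      qed
      have "\<bar>Re (w $ i)\<bar> < e * sqrt r" "\<bar>Im (w $ i)\<bar> < e * sqrt r"
        using b[of i] False by (auto simp: u_def l_def)
      from this[THEN sq] False show ?thesis by (simp add: cmod_power2)
    qed
    then have "t\<^sup>2 \<le> (\<Sum>i\<in>UNIV. (if i = j then x\<^sup>2 else 0) + 2 * e\<^sup>2 * r)"
      unfolding t_def norm_vec_sq by (rule sum_mono)
    also have "\<dots> = x\<^sup>2 + 2 * (n * e) * e * r"
      by (simp add: sum.distrib n_def power2_eq_square)
    finally have t2: "t\<^sup>2 \<le> x\<^sup>2 + e * r / 8" by (simp add: e(2))
    have xt: "x \<le> t" unfolding x_def t_def
      using complex_Re_le_cmod[of "w $ j"] Finite_Cartesian_Product.norm_nth_le[of w j] by linarith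
    have er: "e * r \<le> 1 / 16" using e r mult_mono[of e "1/16" r 1] by simp
    have "x\<^sup>2 \<le> (1/2)\<^sup>2" using x by (intro power_mono) auto
    then have "t\<^sup>2 < 1\<^sup>2" using t2 er by (simp add: power2_eq_square)
    then have t1: "t < 1" by (rule power2_less_imp_less) simp
    have "(t - x) * (1 / 2) \<le> (t - x) * (t + x)" using x xt by (intro mult_left_mono) auto
    also have "\<dots> = t\<^sup>2 - x\<^sup>2" by (simp add: algebra_simps power2_eq_square)
    finally have tx: "t - x \<le> e * r / 4" using t2 by simp
    have "norm (complex_of_real t - w $ j) \<le> \<bar>Re (complex_of_real t - w $ j)\<bar> + \<bar>Im (complex_of_real t - w $ j)\<bar>"
      by (rule cmod_le)
    also have "\<dots> < e * r / 4 + e * r" using tx xt Im by (simp add: x_def)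
    also have "\<dots> \<le> r * (1 / 4)" using e r mult_right_mono[of e "1/16" r] by simp
    also have "\<dots> \<le> r * t" using r x xt by (intro mult_left_mono) auto
    finally have near: "norm (complex_of_real t - w $ j) < r * t" .
    have "w \<noteq> 0" using x by (auto simp: x_def)
    then have "sdist (axis j 1 :: complex ^ 'n) (sgn w) < r"
      using near xt x by (simp add: sdist_axis norm_1_minus_sgn t_def divide_less_eq)
    then show "w \<in> {w \<in> ball 0 1. sdist (axis j 1 :: complex ^ 'n) (sgn w) < r}"
      using t1 by (simp add: t_def)
  qed
  then have le: "emeasure lborel (box l u) \<le> emeasure lborel {w \<in> ball 0 1. sdist (axis j 1 :: complex ^ 'n) (sgn w) < r}"
    by (rule emeasure_mono) measurable
  have "emeasure lborel (box l u) = ennreal (\<Prod>i\<in>UNIV. if i = j then 1 / 4 * (2 * e * r) else 4 * e\<^sup>2 * r)"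
    using r e by (subst emeasure_box_complex_vec)
      (auto simp: u_def l_def power2_eq_square intro!: arg_cong[where f=ennreal] prod.cong)
  also have "(\<Prod>i\<in>(UNIV::'n set). if i = j then 1 / 4 * (2 * e * r) else 4 * e\<^sup>2 * r) = 1 / 4 * (2 * e * r) * (4 * e\<^sup>2 * r) ^ (CARD('n) - 1)"
    by (rule prod_distinguished)
  also have "\<dots> = (e / 2 * (4 * e\<^sup>2) ^ (CARD('n) - 1)) * (r * r ^ (CARD('n) - 1))"
    by (simp add: power_mult_distrib)
  also have "r * r ^ (CARD('n) - 1) = r ^ CARD('n)"
    by (simp add: power_eq_if[of r "CARD('n)"])
  also have "e / 2 = 1 / (32 * CARD('n))" by (simp add: e_def n_def)
  finally show ?thesis using le by (simp add: e_def n_def)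
qed

section \<open>Surface measure and polar coordinates\<close>

text \<open>The Borel version of \<open>ball_meas\<close>. Completed measures do not behave well under products, so
  Fubini arguments are carried out for Borel functions.\<close>
definition nu :: "(complex ^ 'n) measure" where
  "nu = uniform_measure lborel (ball 0 1)"

text \<open>The law of \<open>\<bar>w\<bar>\<close> for \<open>w\<close> uniformly distributed in the unit ball of \<open>\<complex>\<^sup>n\<close>.\<close>
definition radial_meas :: "nat \<Rightarrow> real measure" where
  "radial_meas n = density lborel (\<lambda>r. ennreal (indicator {0<..<1} r * (2 * real n * r ^ (2 * n - 1))))"

lemma measurable_sgn_vec [measurable]: "sgn \<in> borel_measurable (borel :: (complex ^ 'n) measure)"
  unfolding sgn_div_norm[abs_def] by measurable

lemma unit_ball_volume: "emeasure lborel (ball (0 :: complex ^ 'n) 1) \<noteq> 0" "emeasure lborel (ball (0 :: complex ^ 'n) 1) \<noteq> top"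
  using content_ball_pos[of 1 "0 :: complex ^ 'n"] emeasure_lborel_ball_finite[of "0 :: complex ^ 'n" 1]
  by (auto simp: measure_def)

lemma sets_nu [simp, measurable_cong]: "sets nu = sets borel"
  by (simp add: nu_def)

lemma space_nu [simp]: "space nu = UNIV"
  by (simp add: nu_def)

lemma AE_nu: "AE w in nu. w \<in> ball 0 1 \<and> w \<noteq> (0 :: complex ^ 'n)"
proof -
  have "AE w in lborel. w \<noteq> (0 :: complex ^ 'n)" by (rule AE_lborel_singleton)
  then show ?thesis
    unfolding nu_def using unit_ball_volume[where 'n='n]
    by (subst AE_uniform_measure) (auto simp: less_top)
qed

lemma emeasure_nu: "A \<in> sets borel \<Longrightarrow> emeasure nu A = emeasure lborel (ball (0::complex^'n) 1 \<inter> A) / emeasure lborel (ball (0::complex^'n) 1)"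
  unfolding nu_def by (rule emeasure_uniform_measure) auto

lemma emeasure_nu_UNIV: "emeasure nu (UNIV :: (complex ^ 'n) set) = 1"
  using unit_ball_volume[where 'n='n] by (simp add: emeasure_nu less_top)

lemma finite_measure_nu: "finite_measure (nu :: (complex ^ 'n) measure)"
  by (rule finite_measureI) (simp add: emeasure_nu_UNIV)

lemma nn_integral_nu:
  fixes f :: "complex ^ 'n \<Rightarrow> ennreal"
  shows "f \<in> borel_measurable borel \<Longrightarrow>
  (\<integral>\<^sup>+w. f w \<partial>nu) = (\<integral>\<^sup>+w. f w * indicator (ball 0 1) w \<partial>lborel) / emeasure lborel (ball (0::complex^'n) 1)"
  unfolding nu_def by (subst nn_integral_uniform_measure) auto

definition sphere_borel :: "(complex ^ 'n) measure" where
  "sphere_borel = restrict_space (distr nu borel sgn) (sphere 0 1)"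

lemma sphere_meas_eq: "sphere_meas = completion sphere_borel"
  by (simp add: sphere_meas_def sphere_borel_def nu_def)

lemma space_sphere_meas [simp]: "space sphere_meas = sphere 0 1"
  by (simp add: sphere_meas_eq sphere_borel_def space_restrict_space)

lemma nn_integral_sphere_borel:
  fixes f :: "complex ^ 'n \<Rightarrow> ennreal"
  assumes [measurable]: "f \<in> borel_measurable borel"
  shows "(\<integral>\<^sup>+\<zeta>. f \<zeta> \<partial>sphere_borel) = (\<integral>\<^sup>+w. f (sgn w) \<partial>nu)"
proof -
  have [measurable]: "sphere (0 :: complex ^ 'n) 1 \<in> sets borel" by (intro borel_closed closed_sphere)
  have "(\<integral>\<^sup>+\<zeta>. f \<zeta> \<partial>sphere_borel) = (\<integral>\<^sup>+\<zeta>. f \<zeta> * indicator (sphere 0 1) \<zeta> \<partial>distr nu borel sgn)"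
    unfolding sphere_borel_def by (rule nn_integral_restrict_space) auto
  also have "\<dots> = (\<integral>\<^sup>+w. f (sgn w) * indicator (sphere 0 1) (sgn w :: complex ^ 'n) \<partial>nu)"
    by (rule nn_integral_distr) measurable
  also have "\<dots> = (\<integral>\<^sup>+w. f (sgn w) \<partial>nu)"
    by (intro nn_integral_cong_AE, use AE_nu in eventually_elim) (auto simp: indicator_def norm_sgn)
  finally show ?thesis .
qed

lemma nn_integral_sphere_meas:
  fixes f :: "complex ^ 'n \<Rightarrow> ennreal"
  assumes "f \<in> borel_measurable borel"
  shows "(\<integral>\<^sup>+\<zeta>. f \<zeta> \<partial>sphere_meas) = (\<integral>\<^sup>+w. f (sgn w) \<partial>nu)"
  using nn_integral_sphere_borel[OF assms] by (simp add: sphere_meas_eq nn_integral_completion)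

lemma measurable_sphere_meas:
  "f \<in> measurable borel K \<Longrightarrow> f \<in> measurable sphere_meas K"
  unfolding sphere_meas_eq sphere_borel_def
  by (intro measurable_completion measurable_restrict_space1) auto

lemma measurable_id_sphere: "(\<lambda>x. x) \<in> borel_measurable sphere_meas"
  by (rule measurable_sphere_meas) simp

lemma emeasure_sphere_meas:
  assumes [measurable]: "Measurable.pred borel P"
  shows "emeasure sphere_meas {\<zeta> \<in> sphere 0 1. P (\<zeta> :: complex ^ 'n)} = emeasure nu {w. P (sgn w)}"
proof -
  have s: "{\<zeta> \<in> sphere 0 1. P \<zeta>} \<in> sets sphere_meas"
  proof -
    have [measurable]: "Measurable.pred sphere_meas P" by (rule measurable_sphere_meas) measurable
    have "{\<zeta> \<in> space sphere_meas. P \<zeta>} \<in> sets sphere_meas" by measurable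
    then show ?thesis by simp
  qed
  have "emeasure sphere_meas {\<zeta> \<in> sphere 0 1. P \<zeta>} = (\<integral>\<^sup>+\<zeta>. indicator {\<zeta> \<in> sphere 0 1. P \<zeta>} \<zeta> \<partial>sphere_meas)"
    using s by simp
  also have "\<dots> = (\<integral>\<^sup>+\<zeta>. indicator {\<zeta>. P \<zeta>} \<zeta> \<partial>sphere_meas)"
    by (intro nn_integral_cong) (auto simp: indicator_def)
  also have "\<dots> = (\<integral>\<^sup>+w. indicator {\<zeta>. P \<zeta>} (sgn w) \<partial>nu)"
    by (rule nn_integral_sphere_meas) measurable
  also have "\<dots> = (\<integral>\<^sup>+w. indicator {w. P (sgn w)} w \<partial>nu)"
    by (intro nn_integral_cong) (simp add: indicator_def)
  also have "\<dots> = emeasure nu {w. P (sgn w)}" by (rule nn_integral_indicator) measurable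
  finally show ?thesis .
qed

lemma emeasure_sphere_UNIV: "emeasure sphere_meas (sphere (0 :: complex ^ 'n) 1) = 1"
proof -
  have "emeasure sphere_meas {\<zeta> \<in> sphere (0 :: complex ^ 'n) 1. True} = emeasure nu {w :: complex ^ 'n. True}"
    by (rule emeasure_sphere_meas) simp
  moreover have "{\<zeta> \<in> sphere (0 :: complex ^ 'n) 1. True} = sphere 0 1" by auto
  ultimately show ?thesis using emeasure_nu_UNIV[where 'n='n] by simp
qed

lemma finite_measure_sphere_meas: "finite_measure (sphere_meas :: (complex ^ 'n) measure)"
  by (rule finite_measureI) (simp add: emeasure_sphere_UNIV)

lemma emeasure_noniso_ball:
  fixes \<zeta> :: "complex ^ 'n"
  shows "emeasure sphere_meas {\<eta> \<in> sphere 0 1. sdist \<zeta> \<eta> < r}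
    = emeasure lborel {w \<in> ball 0 1. sdist \<zeta> (sgn w) < r} / emeasure lborel (ball (0::complex^'n) 1)"
proof -
  have "emeasure sphere_meas {\<eta> \<in> sphere 0 1. sdist \<zeta> \<eta> < r} = emeasure nu {w. sdist \<zeta> (sgn w) < r}"
    by (rule emeasure_sphere_meas) measurable
  also have "\<dots> = emeasure lborel (ball 0 1 \<inter> {w. sdist \<zeta> (sgn w) < r}) / emeasure lborel (ball (0::complex^'n) 1)"
    by (rule emeasure_nu) measurable
  also have "ball 0 1 \<inter> {w. sdist \<zeta> (sgn w) < r} = {w \<in> ball 0 1. sdist \<zeta> (sgn w) < r}" by auto
  finally show ?thesis .
qed

theorem sphere_homogeneous:
  "\<exists>c C. homogeneous_space (sphere_meas :: (complex ^ 'n) measure) sdist CARD('n) c C"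
proof -
  define \<beta> where "\<beta> = measure lborel (ball (0::complex^'n) 1)"
  have \<beta>: "0 < \<beta>" "emeasure lborel (ball (0::complex^'n) 1) = ennreal \<beta>"
    unfolding \<beta>_def by (rule content_ball_pos, simp, rule emeasure_eq_ennreal_measure, rule unit_ball_volume)
  define k where "k = 1 / (32 * CARD('n)) * (4 * (1 / (16 * CARD('n)))\<^sup>2) ^ (CARD('n) - 1)"
  have k: "0 < k" by (simp add: k_def)
  obtain j :: 'n where True by simp
  interpret finite_measure "sphere_meas :: (complex ^ 'n) measure" by (rule finite_measure_sphere_meas)
  have "homogeneous_space (sphere_meas :: (complex ^ 'n) measure) sdist CARD('n) (k / \<beta>) (16 ^ CARD('n) / \<beta>)"
  proof
    have "(\<lambda>x. sdist (fst x) (snd x)) \<in> borel_measurable (sphere_meas \<Otimes>\<^sub>M (sphere_meas :: (complex ^ 'n) measure))"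
    proof -
      have [measurable]: "fst \<in> borel_measurable (sphere_meas \<Otimes>\<^sub>M (sphere_meas :: (complex ^ 'n) measure))"
        "snd \<in> borel_measurable (sphere_meas \<Otimes>\<^sub>M (sphere_meas :: (complex ^ 'n) measure))"
        using measurable_compose[OF measurable_fst measurable_id_sphere] measurable_compose[OF measurable_snd measurable_id_sphere] by auto
      show ?thesis by measurable
    qed
    then show "(\<lambda>(x, y). sdist x y) \<in> borel_measurable (sphere_meas \<Otimes>\<^sub>M (sphere_meas :: (complex ^ 'n) measure))"
      by (simp add: case_prod_beta)
    fix x y z :: "complex ^ 'n"
    show "sdist x y = sdist y x" by (rule sdist_sym)
    show "0 < k / \<beta>" "0 < 16 ^ CARD('n) / \<beta>" using k \<beta> by simp_all
    assume x: "x \<in> space sphere_meas"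
    then have nx: "norm x = 1" by simp
    show "sdist x x = 0" using nx by (simp add: cdot_self)
    show "y \<in> space sphere_meas \<Longrightarrow> z \<in> space sphere_meas \<Longrightarrow> sdist x z \<le> 2 * (sdist x y + sdist y z)"
      using nx by (intro sdist_triangle) auto
    fix r :: real assume r: "0 < r"
    have eq: "emeasure sphere_meas {y \<in> space sphere_meas. sdist x y < r}
      = emeasure lborel {w \<in> ball 0 1. sdist (axis j 1 :: complex ^ 'n) (sgn w) < r} / ennreal \<beta>"
      using cone_volume_unitary[OF nx, of r j] emeasure_noniso_ball[of x r] by (simp add: \<beta>(2))
    have "ennreal (16 ^ CARD('n) / \<beta> * r ^ CARD('n)) = ennreal (16 ^ CARD('n) * r ^ CARD('n)) / ennreal \<beta>"
      using \<beta> r by (simp add: divide_ennreal)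
    then show "emeasure sphere_meas {y \<in> space sphere_meas. sdist x y < r} \<le> ennreal (16 ^ CARD('n) / \<beta> * r ^ CARD('n))"
      unfolding eq using cone_volume_le[OF r, of j] by (simp add: divide_right_mono_ennreal)
    assume r1: "r \<le> 1"
    have "ennreal (k / \<beta> * r ^ CARD('n)) = ennreal (k * r ^ CARD('n)) / ennreal \<beta>"
      using \<beta> r k by (simp add: divide_ennreal)
    then show "ennreal (k / \<beta> * r ^ CARD('n)) \<le> emeasure sphere_meas {y \<in> space sphere_meas. sdist x y < r}"
      unfolding eq k_def using cone_volume_ge[OF r r1, of j] by (simp only: divide_right_mono_ennreal)
  qed
  then show ?thesis by blast
qed

lemma radial_tail:
  assumes n: "0 < n"
  shows "emeasure (radial_meas n) {x<..} = ennreal (1 - (min 1 (max 0 x)) ^ (2 * n))"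
proof -
  define a where "a = min 1 (max 0 x)"
  have a: "0 \<le> a" "a \<le> 1" by (auto simp: a_def)
  have "emeasure (radial_meas n) {x<..} = (\<integral>\<^sup>+r. ennreal (indicator {0<..<1} r * (2 * real n * r ^ (2 * n - 1))) * indicator {x<..} r \<partial>lborel)"
    unfolding radial_meas_def by (rule emeasure_density) auto
  also have "\<dots> = (\<integral>\<^sup>+r. ennreal (2 * real n * r ^ (2 * n - 1)) * indicator {a..1} r \<partial>lborel)"
    using AE_lborel_singleton[of a] AE_lborel_singleton[of 1] 
    by (intro nn_integral_cong_AE, eventually_elim) (auto simp: a_def indicator_def)
  also have "\<dots> = ennreal (1 ^ (2 * n) - a ^ (2 * n))"
  proof (rule nn_integral_FTC_Icc)
    fix x :: real
    show "((\<lambda>r. r ^ (2 * n)) has_real_derivative 2 * real n * x ^ (2 * n - 1)) (at x)"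
      by (auto intro!: derivative_eq_intros)
  qed (use a in auto)
  finally show ?thesis by (simp add: a_def)
qed

lemma emeasure_radial_UNIV: assumes n: "0 < n" shows "emeasure (radial_meas n) UNIV = 1"
proof -
  have "emeasure (radial_meas n) UNIV = (\<integral>\<^sup>+r. ennreal (indicator {0<..<1} r * (2 * real n * r ^ (2 * n - 1))) * indicator UNIV r \<partial>lborel)"
    unfolding radial_meas_def by (subst emeasure_density) auto
  also have "\<dots> = (\<integral>\<^sup>+r. ennreal (indicator {0<..<1} r * (2 * real n * r ^ (2 * n - 1))) * indicator {0<..} r \<partial>lborel)"
    by (intro nn_integral_cong) (auto simp: indicator_def)
  also have "\<dots> = emeasure (radial_meas n) {0<..}"
    unfolding radial_meas_def by (subst emeasure_density) auto
  finally show ?thesis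
    using radial_tail[OF n, of 0] n by simp
qed

lemma finite_radial: "0 < n \<Longrightarrow> finite_measure (radial_meas n)"
  using emeasure_radial_UNIV[of n] by (intro finite_measureI) (simp add: radial_meas_def)

text \<open>Homogeneity of Lebesgue measure in real dimension \<open>2n\<close>.\<close>
lemma cone_scaling:
  assumes [measurable]: "B \<in> sets borel" and x: "0 < x"
  shows "emeasure lborel {w :: complex ^ 'n. norm w < x \<and> sgn w \<in> B} = ennreal (x ^ (2 * CARD('n))) * emeasure lborel {w :: complex ^ 'n. norm w < 1 \<and> sgn w \<in> B}"
proof -
  have DIM: "DIM(complex ^ 'n) = 2 * CARD('n)" by simp
  define A where "A t = {w :: complex ^ 'n. norm w < t \<and> sgn w \<in> B}" for t
  have [measurable]: "A t \<in> sets borel" for t unfolding A_def by measurable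
  have "emeasure lborel (A x) = emeasure (density (distr lborel borel (\<lambda>w :: complex ^ 'n. 0 + x *\<^sub>R w)) (\<lambda>_. \<bar>x\<bar>^DIM(complex ^ 'n))) (A x)"
    using x by (subst lborel_affine[of x "0 :: complex ^ 'n"]) auto
  also have "\<dots> = ennreal (x ^ (2 * CARD('n))) * emeasure (distr lborel borel (\<lambda>w :: complex ^ 'n. 0 + x *\<^sub>R w)) (A x)"
    using x by (subst emeasure_density_const) (auto simp: mult.commute[of "CARD('n)"])
  also have "emeasure (distr lborel borel (\<lambda>w :: complex ^ 'n. 0 + x *\<^sub>R w)) (A x) = emeasure lborel ((\<lambda>w. x *\<^sub>R w) -` A x)"
    by (subst emeasure_distr) auto
  also have "(\<lambda>w. x *\<^sub>R w) -` A x = A 1"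
    using x by (auto simp: A_def sgn_scaleR)
  finally show ?thesis by (simp add: A_def)
qed

lemma nu_cone_tail:
  assumes [measurable]: "B \<in> sets borel"
  shows "emeasure nu {w :: complex ^ 'n. x < norm w \<and> sgn w \<in> B} = ennreal (1 - (min 1 (max 0 x)) ^ (2 * CARD('n))) * emeasure nu {w :: complex ^ 'n. sgn w \<in> B}"
proof -
  interpret finite_measure "nu :: (complex ^ 'n) measure" by (rule finite_measure_nu)
  define a where "a = min 1 (max 0 x)"
  have a: "0 \<le> a" "a \<le> 1" by (auto simp: a_def)
  define D where "D = {w :: complex ^ 'n. sgn w \<in> B}"
  define E where "E = {w :: complex ^ 'n. norm w < a \<and> sgn w \<in> B}"
  have [measurable]: "D \<in> sets borel" "E \<in> sets borel" unfolding D_def E_def by measurable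
  have mE: "measure nu E = a ^ (2 * CARD('n)) * measure nu D"
  proof (cases "a = 0")
    case True
    then show ?thesis by (simp add: E_def)
  next
    case False
    then have a0: "0 < a" using a by simp
    have "emeasure nu E = emeasure lborel (ball 0 1 \<inter> E) / emeasure lborel (ball (0::complex^'n) 1)"
      by (rule emeasure_nu) measurable
    also have "ball 0 1 \<inter> E = {w. norm w < a \<and> sgn w \<in> B}" using a by (auto simp: E_def)
    also have "emeasure lborel {w :: complex ^ 'n. norm w < a \<and> sgn w \<in> B} = ennreal (a ^ (2 * CARD('n))) * emeasure lborel {w :: complex ^ 'n. norm w < 1 \<and> sgn w \<in> B}"
      by (rule cone_scaling[OF assms a0])
    also have "{w :: complex ^ 'n. norm w < 1 \<and> sgn w \<in> B} = ball 0 1 \<inter> D" by (auto simp: D_def)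
    also have "ennreal (a ^ (2 * CARD('n))) * emeasure lborel (ball 0 1 \<inter> D) / emeasure lborel (ball (0::complex^'n) 1) = ennreal (a ^ (2 * CARD('n))) * emeasure nu D"
      by (simp add: emeasure_nu ennreal_times_divide)
    finally show ?thesis using a by (simp add: emeasure_eq_measure flip: ennreal_mult)
  qed
  have nul: "AE w in nu. norm (w :: complex ^ 'n) \<noteq> a" if "0 < a"
  proof -
    have "sphere (0 :: complex ^ 'n) a \<in> null_sets lborel"
      using negligible_sphere[of "0 :: complex ^ 'n" a]
      by (simp add: negligible_iff_null_sets null_sets_completion_iff)
    then have "AE w in lborel. w \<notin> sphere (0 :: complex ^ 'n) a" by (rule AE_not_in)
    then show ?thesis unfolding nu_def using unit_ball_volume[where 'n='n]
      by (subst AE_uniform_measure) (auto simp: less_top)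
  qed
  have "emeasure nu {w :: complex ^ 'n. x < norm w \<and> sgn w \<in> B} = emeasure nu (D - E)"
  proof (rule emeasure_eq_AE)
    show "AE w in nu. (w \<in> {w :: complex ^ 'n. x < norm w \<and> sgn w \<in> B}) = (w \<in> D - E)"
    proof (cases "0 < a")
      case True
      show ?thesis using nul[OF True] AE_nu
        by eventually_elim (use True in \<open>auto simp: D_def E_def a_def min_def max_def split: if_splits\<close>)
    next
      case False
      then have "x \<le> 0" "a = 0" using a by (auto simp: a_def min_def max_def split: if_splits)
      then have pos: "x < norm w" if "w \<noteq> 0" for w :: "complex ^ 'n"
        using that zero_less_norm_iff[of w] by linarith
      show ?thesis using AE_nu
      proof eventually_elim
        case (elim w)
        then show ?case using pos[of w] \<open>a = 0\<close> by (simp add: D_def E_def)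
      qed
    qed
  qed measurable
  also have "\<dots> = ennreal (measure nu D - measure nu E)"
    by (subst emeasure_eq_measure, subst finite_measure_Diff) (auto simp: D_def E_def)
  also have "\<dots> = ennreal ((1 - a ^ (2 * CARD('n))) * measure nu D)"
    by (simp add: mE algebra_simps)
  also have "\<dots> = ennreal (1 - a ^ (2 * CARD('n))) * emeasure nu D"
    using a by (simp add: ennreal_mult emeasure_eq_measure power_le_one)
  finally show ?thesis by (simp add: a_def D_def)
qed

text \<open>For a uniformly distributed point of the ball, modulus and direction are independent: by
  \<open>nu_cone_tail\<close> the joint law agrees with the product law on sets \<open>{x<..} \<times> B\<close>. Since the surface
  measure is defined as the law of the direction, this is the formula of integration in polar
  coordinates.\<close>
theorem polar_coordinates:
  fixes f :: "complex ^ 'n \<Rightarrow> ennreal"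
  assumes [measurable]: "f \<in> borel_measurable borel"
  shows "(\<integral>\<^sup>+w. f w \<partial>nu) = (\<integral>\<^sup>+\<zeta>. (\<integral>\<^sup>+r. f (r *\<^sub>R \<zeta>) \<partial>radial_meas CARD('n)) \<partial>sphere_meas)"
proof -
  let ?R = "radial_meas CARD('n)"
  let ?S = "distr nu borel sgn :: (complex ^ 'n) measure"
  interpret R: finite_measure ?R by (rule finite_radial) simp
  interpret N: finite_measure "nu :: (complex ^ 'n) measure" by (rule finite_measure_nu)
  interpret S: finite_measure ?S by (rule N.finite_measure_distr) measurable
  interpret RS: pair_sigma_finite ?R ?S ..
  have sR [measurable_cong]: "sets ?R = sets borel" by (simp add: radial_meas_def)
  have prod: "?R \<Otimes>\<^sub>M ?S = distr nu (borel \<Otimes>\<^sub>M borel) (\<lambda>w. (norm w, sgn w))"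
  proof (rule pair_measure_eqI)
    show "sigma_finite_measure ?R" "sigma_finite_measure ?S" by unfold_locales
    show "sets (?R \<Otimes>\<^sub>M ?S) = sets (distr nu (borel \<Otimes>\<^sub>M borel) (\<lambda>w. (norm w, sgn w)))"
      unfolding sets_distr by (rule sets_pair_measure_cong) (simp_all add: sR)
    fix A :: "real set" and B :: "(complex ^ 'n) set" assume "A \<in> sets ?R" "B \<in> sets ?S"
    then have [measurable]: "A \<in> sets borel" "B \<in> sets borel" by (simp_all add: sR)
    define NB where "NB = distr (density nu (indicator {w. sgn w \<in> B})) borel (norm :: complex ^ 'n \<Rightarrow> real)"
    have NB: "emeasure NB X = emeasure nu {w. norm w \<in> X \<and> sgn w \<in> B}" if [measurable]: "X \<in> sets borel" for X
    proof -
      have [measurable]: "(norm -` X :: (complex ^ 'n) set) \<in> sets borel"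
        using measurable_sets[of norm "borel :: (complex ^ 'n) measure" borel X] by simp
      have "emeasure NB X = emeasure (density nu (indicator {w. sgn w \<in> B})) (norm -` X)"
        unfolding NB_def by (subst emeasure_distr) auto
      also have "\<dots> = emeasure nu ({w. sgn w \<in> B} \<inter> norm -` X)"
      proof (subst emeasure_density)
        show "(\<integral>\<^sup>+x. indicator {w. sgn w \<in> B} x * indicator (norm -` X) x \<partial>nu) = emeasure nu ({w. sgn w \<in> B} \<inter> norm -` X)"
        proof -
          have "(\<integral>\<^sup>+x. indicator {w. sgn w \<in> B} x * indicator (norm -` X) x \<partial>nu)
            = (\<integral>\<^sup>+x. indicator ({w. sgn w \<in> B} \<inter> norm -` X) x \<partial>nu)"
            by (intro nn_integral_cong) (auto simp: indicator_def)
          also have "\<dots> = emeasure nu ({w. sgn w \<in> B} \<inter> norm -` X)"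
            by (rule nn_integral_indicator) (simp add: vimage_def)
          finally show ?thesis .
        qed
      qed auto
      also have "{w. sgn w \<in> B} \<inter> norm -` X = {w. norm w \<in> X \<and> sgn w \<in> B}" by auto
      finally show ?thesis .
    qed
    have "density ?R (\<lambda>_. emeasure ?S B) = NB"
    proof (rule measure_eqI_lessThan)
      show "sets (density ?R (\<lambda>_. emeasure ?S B)) = sets borel" "sets NB = sets borel" by (simp_all add: NB_def sR)
      fix x :: real
      have e: "emeasure (density ?R (\<lambda>_. emeasure ?S B)) {x<..} = emeasure ?S B * emeasure ?R {x<..}"
        by (rule emeasure_density_const) (simp add: sR)
      then show "emeasure (density ?R (\<lambda>_. emeasure ?S B)) {x<..} < \<infinity>"
        by (simp add: S.emeasure_eq_measure R.emeasure_eq_measure ennreal_mult_less_top)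
      show "emeasure (density ?R (\<lambda>_. emeasure ?S B)) {x<..} = emeasure NB {x<..}"
        unfolding e using nu_cone_tail[of B x]
        by (simp add: NB radial_tail emeasure_distr vimage_def mult.commute)
    qed
    then have "emeasure NB A = emeasure ?S B * emeasure ?R A"
      by (metis \<open>A \<in> sets ?R\<close> emeasure_density_const)
    moreover have "emeasure (distr nu (borel \<Otimes>\<^sub>M borel) (\<lambda>w. (norm w, sgn w))) (A \<times> B) = emeasure NB A"
      by (subst emeasure_distr) (auto simp: NB intro!: arg_cong2[where f=emeasure])
    ultimately show "emeasure ?R A * emeasure ?S B = emeasure (distr nu (borel \<Otimes>\<^sub>M borel) (\<lambda>w. (norm w, sgn w))) (A \<times> B)"
      by (simp add: mult.commute)
  qed
  have "(\<integral>\<^sup>+w. f w \<partial>nu) = (\<integral>\<^sup>+w. (\<lambda>(r, \<zeta>). f (r *\<^sub>R \<zeta>)) (norm w, sgn w) \<partial>nu)"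
  proof (rule nn_integral_cong)
    fix w :: "complex ^ 'n"
    have "norm w *\<^sub>R sgn w = w" by (cases "w = 0") (simp_all add: sgn_div_norm)
    then show "f w = (\<lambda>(r, \<zeta>). f (r *\<^sub>R \<zeta>)) (norm w, sgn w)" by simp
  qed
  also have "\<dots> = (\<integral>\<^sup>+(r, \<zeta>). f (r *\<^sub>R \<zeta>) \<partial>distr nu (borel \<Otimes>\<^sub>M borel) (\<lambda>w. (norm w, sgn w)))"
    by (subst nn_integral_distr) auto
  also have "\<dots> = (\<integral>\<^sup>+\<zeta>. (\<integral>\<^sup>+r. f (r *\<^sub>R \<zeta>) \<partial>?R) \<partial>?S)"
    unfolding prod[symmetric] by (subst RS.nn_integral_snd[symmetric]) auto
  also have "\<dots> = (\<integral>\<^sup>+w. (\<integral>\<^sup>+r. f (r *\<^sub>R sgn w) \<partial>?R) \<partial>nu)"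
    by (subst nn_integral_distr) auto
  also have "\<dots> = (\<integral>\<^sup>+\<zeta>. (\<integral>\<^sup>+r. f (r *\<^sub>R \<zeta>) \<partial>?R) \<partial>sphere_meas)"
    by (subst nn_integral_sphere_meas) auto
  finally show ?thesis .
qed

section \<open>From the Bergman kernel to dyadic averages\<close>

lemma ennreal_term_le_suminf: "f k \<le> (\<Sum>k. f k :: ennreal)"
  using sum_le_suminf[of f "{k}"] by simp

text \<open>\<open>\<bar>1 - z\<cdot>w\<bar>\<close> dominates each of the distances of \<open>z\<close> and \<open>w\<close> to the sphere and, up to the
  factor 2, the nonisotropic distance of their directions.\<close>
lemma bergman_denominator:
  fixes \<zeta> \<eta> :: "complex ^ 'n"
  assumes u: "norm \<zeta> = 1" "norm \<eta> = 1" and rs: "0 < r" "r < 1" "0 < s" "s < 1"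
  defines "D \<equiv> norm (1 - cdot (r *\<^sub>R \<zeta>) (s *\<^sub>R \<eta>))"
  shows "0 < D" "D < 2" "1 - r \<le> D" "1 - s \<le> D" "sdist \<zeta> \<eta> \<le> 2 * D"
proof -
  define q where "q = cdot \<zeta> \<eta>"
  have q: "norm q \<le> 1" using norm_cdot_le[of \<zeta> \<eta>] u by (simp add: q_def)
  have D: "D = norm (1 - complex_of_real (r * s) * q)"
    by (simp add: D_def cdot_scaleR_left cdot_scaleR_right q_def mult_ac)
  have rs1: "r * s < r" "r * s < s" "0 < r * s" using rs by simp_all
  have nq: "norm (complex_of_real (r * s) * q) = r * s * norm q" using rs1 by (simp add: norm_mult)
  have nq1: "r * s * norm q \<le> r * s" using q rs1 by (simp add: mult_left_le)
  have ge: "1 - r * s \<le> D"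
    using norm_triangle_ineq2[of 1 "complex_of_real (r * s) * q"] nq nq1 unfolding D by simp
  show "1 - r \<le> D" "1 - s \<le> D" "0 < D" using ge rs1 rs by linarith+
  have "D \<le> 1 + r * s" using norm_triangle_ineq4[of 1 "complex_of_real (r * s) * q"] nq nq1 unfolding D by simp
  then show "D < 2" using rs1 rs by linarith
  have "1 - q = (1 - complex_of_real (r * s) * q) - complex_of_real (1 - r * s) * q" by (simp add: algebra_simps)
  then have "norm (1 - q) \<le> D + norm (complex_of_real (1 - r * s) * q)"
    unfolding D by (metis norm_triangle_ineq4)
  also have "norm (complex_of_real (1 - r * s) * q) \<le> 1 - r * s"
  proof -
    have "0 \<le> 1 - r * s" using rs1 rs by linarith
    then show ?thesis using mult_left_le[OF q, of "1 - r * s"] by (simp add: norm_mult del: of_real_diff)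
  qed
  also have "\<dots> \<le> D" by (rule ge)
  finally show "sdist \<zeta> \<eta> \<le> 2 * D" by (simp add: q_def)
qed

lemma dyadic_scale_exists:
  assumes "0 < D" "D < 2"
  obtains k where "\<delta> k \<le> D" "D < 2 * \<delta> k"
proof -
  obtain m where "(1/2::real) ^ m < D" using real_arch_pow_inv[of D "1/2"] assms by auto
  then have ex: "\<delta> m \<le> D" by (simp add: \<delta>_def)
  define k where "k = (LEAST k. \<delta> k \<le> D)"
  have k: "\<delta> k \<le> D" unfolding k_def by (rule LeastI[of _ m]) (rule ex)
  moreover have "D < 2 * \<delta> k"
  proof (cases k)
    case 0
    then show ?thesis using assms by (simp add: \<delta>_def)
  next
    case (Suc j)
    then have "\<not> \<delta> j \<le> D" using not_less_Least[of j "\<lambda>k. \<delta> k \<le> D"] by (simp add: k_def)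
    then show ?thesis using Suc by (simp add: \<delta>_def)
  qed
  ultimately show ?thesis by (rule that)
qed

text \<open>Only the term with \<open>\<delta>\<^sub>k \<le> \<bar>1 - z\<cdot>w\<bar> < 2 \<delta>\<^sub>k\<close> enters the proof; the sum over all scales is
  taken because each of its terms has the three conditions on radii and directions decoupled. The
  factor 4 combines the 2 from the dyadic scale with the one from \<open>bergman_denominator\<close> or \<open>1 -
  r\<^sup>2 \<le> 2 (1 - r)\<close>.\<close>
lemma dyadic_kernel_bound:
  fixes \<zeta> \<eta> :: "complex ^ 'n"
  assumes u: "norm \<zeta> = 1" "norm \<eta> = 1" and rs: "0 < r" "r < 1" "0 < s" "s < 1"
  shows "ennreal (1 / norm (1 - cdot (r *\<^sub>R \<zeta>) (s *\<^sub>R \<eta>)) ^ m)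
    \<le> (\<Sum>k. if 1 - r\<^sup>2 < 4 * \<delta> k \<and> 1 - s\<^sup>2 < 4 * \<delta> k \<and> sdist \<zeta> \<eta> < 4 * \<delta> k then ennreal (1 / \<delta> k ^ m) else 0)"
proof -
  define D where "D = norm (1 - cdot (r *\<^sub>R \<zeta>) (s *\<^sub>R \<eta>))"
  note D = bergman_denominator[OF assms, folded D_def]
  obtain k where k: "\<delta> k \<le> D" "D < 2 * \<delta> k" by (rule dyadic_scale_exists[OF D(1,2)])
  have "1 - r\<^sup>2 = (1 - r) * (1 + r)" by (simp add: power2_eq_square algebra_simps)
  also have "\<dots> \<le> D * 2" using D rs by (intro mult_mono) auto
  finally have 1: "1 - r\<^sup>2 < 4 * \<delta> k" using k by simp
  have "1 - s\<^sup>2 = (1 - s) * (1 + s)" by (simp add: power2_eq_square algebra_simps)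
  also have "\<dots> \<le> D * 2" using D rs by (intro mult_mono) auto
  finally have 2: "1 - s\<^sup>2 < 4 * \<delta> k" using k by simp
  have 3: "sdist \<zeta> \<eta> < 4 * \<delta> k" using D(5) k by simp
  have "1 / D ^ m \<le> 1 / \<delta> k ^ m"
    using k(1) by (intro divide_left_mono power_mono mult_pos_pos zero_less_power) (auto intro: less_imp_le D(1))
  then have "ennreal (1 / D ^ m) \<le> (if 1 - r\<^sup>2 < 4 * \<delta> k \<and> 1 - s\<^sup>2 < 4 * \<delta> k \<and> sdist \<zeta> \<eta> < 4 * \<delta> k then ennreal (1 / \<delta> k ^ m) else 0)"
    using 1 2 3 by (simp add: ennreal_leI)
  also have "\<dots> \<le> (\<Sum>k. if 1 - r\<^sup>2 < 4 * \<delta> k \<and> 1 - s\<^sup>2 < 4 * \<delta> k \<and> sdist \<zeta> \<eta> < 4 * \<delta> k then ennreal (1 / \<delta> k ^ m) else 0)"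
    by (rule ennreal_term_le_suminf)
  finally show ?thesis by (simp add: D_def)
qed

text \<open>A geometric sum of powers \<open>2\<^sup>k\<close>, all smaller than \<open>4 / X\<close>, hence dominated by twice its
  largest term.\<close>
lemma dyadic_geometric_sum:
  assumes X: "0 < X"
  shows "(\<Sum>k. if X < 4 * \<delta> k then ennreal (1 / \<delta> k) else 0) \<le> ennreal (8 / X)"
proof (rule suminf_le_const)
  fix N
  have inv: "1 / \<delta> k = 2 ^ k" for k by (simp add: \<delta>_def power_one_over)
  have "(\<Sum>k<N. if X < 4 * \<delta> k then 1 / \<delta> k else 0) \<le> 8 / X"
  proof (induction N)
    case 0
    show ?case using X by simp
  next
    case (Suc N)
    show ?case
    proof (cases "X < 4 * \<delta> N")
      case True
      have "(\<Sum>k<Suc N. if X < 4 * \<delta> k then 1 / \<delta> k else 0) \<le> (\<Sum>k<Suc N. 2 ^ k)"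
        by (intro sum_mono) (simp add: inv)
      also have "\<dots> = 2 ^ Suc N - 1" by (subst power_diff_1_eq) auto
      also have "\<dots> \<le> 2 * (1 / \<delta> N)" by (simp add: inv)
      also have "\<dots> \<le> 8 / X" using True X \<delta>_pos[of N] by (simp add: field_simps)
      finally show ?thesis .
    qed (use Suc in simp)
  qed
  then have "ennreal (\<Sum>k<N. if X < 4 * \<delta> k then 1 / \<delta> k else 0) \<le> ennreal (8 / X)" by (rule ennreal_leI)
  also have "ennreal (\<Sum>k<N. if X < 4 * \<delta> k then 1 / \<delta> k else 0) = (\<Sum>k<N. if X < 4 * \<delta> k then ennreal (1 / \<delta> k) else 0)"
  proof -
    have "(\<Sum>k<N. if X < 4 * \<delta> k then ennreal (1 / \<delta> k) else 0) = (\<Sum>k<N. ennreal (if X < 4 * \<delta> k then 1 / \<delta> k else 0))"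
      by (intro sum.cong) auto
    also have "\<dots> = ennreal (\<Sum>k<N. if X < 4 * \<delta> k then 1 / \<delta> k else 0)"
      by (rule sum_ennreal) (simp add: less_imp_le)
    finally show ?thesis by simp
  qed
  finally show "(\<Sum>k<N. if X < 4 * \<delta> k then ennreal (1 / \<delta> k) else 0) \<le> ennreal (8 / X)" .
qed simp

lemma sets_radial [simp, measurable_cong]: "sets (radial_meas n) = sets borel"
  by (simp add: radial_meas_def)

lemma AE_radial: "AE r in radial_meas n. 0 < r \<and> r < 1"
  unfolding radial_meas_def by (subst AE_density) (auto simp: indicator_def)

lemma radial_shell:
  assumes c: "0 < c"
  shows "(\<integral>\<^sup>+r. (if 1 - r\<^sup>2 < c then 1 else 0) \<partial>radial_meas n) \<le> ennreal (2 * real n * c)"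
proof -
  have "(\<integral>\<^sup>+r. (if 1 - r\<^sup>2 < c then 1 else 0) \<partial>radial_meas n)
    = (\<integral>\<^sup>+r. ennreal (indicator {0<..<1} r * (2 * real n * r ^ (2 * n - 1))) * (if 1 - r\<^sup>2 < c then 1 else 0) \<partial>lborel)"
    unfolding radial_meas_def by (rule nn_integral_density) auto
  also have "\<dots> \<le> (\<integral>\<^sup>+r. ennreal (2 * real n) * indicator {1 - c..1} r \<partial>lborel)"
  proof (rule nn_integral_mono)
    fix r :: real
    show "ennreal (indicator {0<..<1} r * (2 * real n * r ^ (2 * n - 1))) * (if 1 - r\<^sup>2 < c then 1 else 0) \<le> ennreal (2 * real n) * indicator {1 - c..1} r"
    proof (cases "0 < r \<and> r < 1 \<and> 1 - r\<^sup>2 < c")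
      case True
      then have "r\<^sup>2 \<le> r" by (simp add: power2_eq_square mult_left_le)
      moreover have "r ^ (2 * n - 1) \<le> 1" using True by (intro power_le_one) auto
      ultimately show ?thesis using True by (auto simp: indicator_def intro!: ennreal_leI mult_left_le)
    qed (auto simp: indicator_def)
  qed
  also have "\<dots> = ennreal (2 * real n) * ennreal c"
    using c by (subst nn_integral_cmult) auto
  finally show ?thesis using c by (simp add: ennreal_mult)
qed

text \<open>The inner radial integral in the norm of \<open>L\<^sup>p\<^sup>,\<^sup>2(\<omega>)\<close>.\<close>
definition area :: "(complex ^ 'n \<Rightarrow> complex) \<Rightarrow> complex ^ 'n \<Rightarrow> ennreal" where
  "area \<phi> \<zeta> = (\<integral>\<^sup>+r. (ennreal (norm (\<phi> (r *\<^sub>R \<zeta>))))\<^sup>2 * ennreal (1 / (1 - r\<^sup>2)) \<partial>radial_meas CARD('n))"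

text \<open>The positive majorant of \<open>(I + R/n)\<close> applied to the Bergman integral, up to a factor 2.\<close>
definition potential :: "(complex ^ 'n \<Rightarrow> complex) \<Rightarrow> complex ^ 'n \<Rightarrow> ennreal" where
  "potential \<phi> z = (\<integral>\<^sup>+w. ennreal (norm (\<phi> w)) * ennreal (1 / norm (1 - cdot z w) ^ (CARD('n) + 2)) \<partial>nu)"

text \<open>Up to a factor that depends on the dimension only, the radial average of \<open>\<bar>\<phi>\<bar>\<close> over the
  shell of thickness \<open>\<delta>\<^sub>k\<close> adjacent to the sphere.\<close>
definition shell_avg :: "(complex ^ 'n \<Rightarrow> complex) \<Rightarrow> nat \<Rightarrow> complex ^ 'n \<Rightarrow> ennreal" where
  "shell_avg \<phi> k \<eta> = ennreal (1 / \<delta> k) *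
     (\<integral>\<^sup>+s. (if 1 - s\<^sup>2 < 4 * \<delta> k then 1 else 0) * ennreal (norm (\<phi> (s *\<^sub>R \<eta>))) \<partial>radial_meas CARD('n))"

text \<open>The operator \<open>dyadic_avg\<close> of the sphere, regarded as a homogeneous space.\<close>
definition sph_avg :: "nat \<Rightarrow> (complex ^ 'n \<Rightarrow> ennreal) \<Rightarrow> complex ^ 'n \<Rightarrow> ennreal" where
  "sph_avg k f \<zeta> = ennreal (1 / \<delta> k ^ CARD('n)) *
     (\<integral>\<^sup>+\<eta>. (if sdist \<zeta> \<eta> < 4 * \<delta> k then 1 else 0) * f \<eta> \<partial>sphere_meas)"

lemma measurable_radial_integral:
  assumes [measurable]: "(\<lambda>(r, \<zeta>). f r \<zeta>) \<in> borel_measurable (borel \<Otimes>\<^sub>M (borel :: (complex ^ 'n) measure))" and n: "0 < n"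
  shows "(\<lambda>\<zeta>. \<integral>\<^sup>+r. f r \<zeta> \<partial>radial_meas n) \<in> borel_measurable borel"
proof -
  interpret finite_measure "radial_meas n" by (rule finite_radial[OF n])
  show ?thesis by measurable
qed

lemma measurable_area [measurable]:
  assumes [measurable]: "\<phi> \<in> borel_measurable borel"
  shows "area \<phi> \<in> borel_measurable borel"
  unfolding area_def[abs_def] by (rule measurable_radial_integral) auto

lemma measurable_shell_avg [measurable]:
  fixes \<phi> :: "complex ^ 'n \<Rightarrow> complex"
  assumes [measurable]: "\<phi> \<in> borel_measurable borel"
  shows "shell_avg \<phi> k \<in> borel_measurable borel"
proof -
  have [measurable]: "(\<lambda>\<eta>. \<integral>\<^sup>+s. (if 1 - s\<^sup>2 < 4 * \<delta> k then 1 else 0) * ennreal (norm (\<phi> (s *\<^sub>R \<eta>))) \<partial>radial_meas CARD('n)) \<in> borel_measurable borel"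
    by (rule measurable_radial_integral) auto
  show ?thesis unfolding shell_avg_def[abs_def] by measurable
qed

text \<open>The exponent \<open>n + 2\<close> of the kernel is distributed as follows: \<open>\<delta>\<^sub>k\<^sup>-\<^sup>n\<close> normalises the
  average over the sphere, one factor \<open>\<delta>\<^sub>k\<^sup>-\<^sup>1\<close> the average over the shell, and the last one is
  compensated by the weight \<open>1 - r\<^sup>2\<close> of the norm.\<close>
lemma potential_le:
  fixes \<zeta> :: "complex ^ 'n"
  assumes [measurable]: "\<phi> \<in> borel_measurable borel" and \<zeta>: "norm \<zeta> = 1" and r: "0 < r" "r < 1"
  shows "potential \<phi> (r *\<^sub>R \<zeta>) \<le> (\<Sum>k. (if 1 - r\<^sup>2 < 4 * \<delta> k then ennreal (1 / \<delta> k) else 0) * sph_avg k (shell_avg \<phi> k) \<zeta>)"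
proof -
  let ?n = "CARD('n)"
  let ?R = "radial_meas ?n"
  interpret R: finite_measure ?R by (rule finite_radial) simp
  let ?X = "\<lambda>r k. 1 - r\<^sup>2 < 4 * \<delta> k"
  let ?m = "?n + 2"
  define T where "T k s \<eta> = (if ?X r k then ennreal (1 / \<delta> k ^ ?m) else 0) * (if sdist \<zeta> \<eta> < 4 * \<delta> k then 1 else 0) * ((if ?X s k then 1 else 0) * ennreal (norm (\<phi> (s *\<^sub>R \<eta>))))"
    for k :: nat and s and \<eta> :: "complex ^ 'n"
  have [measurable]: "(\<lambda>s. T k s \<eta>) \<in> borel_measurable borel" for k \<eta>
    unfolding T_def by measurable
  have inner: "(\<integral>\<^sup>+s. T k s \<eta> \<partial>?R) = (if ?X r k then ennreal (1 / \<delta> k ^ ?m) else 0) * ((if sdist \<zeta> \<eta> < 4 * \<delta> k then 1 else 0) * (ennreal (\<delta> k) * shell_avg \<phi> k \<eta>))" for k \<eta>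
  proof -
    have "ennreal (\<delta> k) * ennreal (1 / \<delta> k) = 1" by (subst ennreal_mult'[symmetric]) (auto simp: less_imp_le less_imp_neq[symmetric])
    then have "ennreal (\<delta> k) * shell_avg \<phi> k \<eta> = (\<integral>\<^sup>+s. (if ?X s k then 1 else 0) * ennreal (norm (\<phi> (s *\<^sub>R \<eta>))) \<partial>?R)"
      by (simp add: shell_avg_def mult.assoc[symmetric])
    then show ?thesis unfolding T_def by (subst nn_integral_cmult) (auto simp: mult.assoc)
  qed
  have [measurable]: "(\<lambda>\<eta>. \<integral>\<^sup>+s. T k s \<eta> \<partial>?R) \<in> borel_measurable borel" for k
    unfolding inner by measurable
  have "potential \<phi> (r *\<^sub>R \<zeta>) = (\<integral>\<^sup>+\<eta>. (\<integral>\<^sup>+s. ennreal (norm (\<phi> (s *\<^sub>R \<eta>))) * ennreal (1 / norm (1 - cdot (r *\<^sub>R \<zeta>) (s *\<^sub>R \<eta>)) ^ ?m) \<partial>?R) \<partial>sphere_meas)"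
    unfolding potential_def by (rule polar_coordinates) measurable
  also have "\<dots> \<le> (\<integral>\<^sup>+\<eta>. (\<integral>\<^sup>+s. (\<Sum>k. T k s \<eta>) \<partial>?R) \<partial>sphere_meas)"
  proof (rule nn_integral_mono, rule nn_integral_mono_AE)
    fix \<eta> :: "complex ^ 'n" assume "\<eta> \<in> space sphere_meas"
    then have \<eta>: "norm \<eta> = 1" by simp
    show "AE s in ?R. ennreal (norm (\<phi> (s *\<^sub>R \<eta>))) * ennreal (1 / norm (1 - cdot (r *\<^sub>R \<zeta>) (s *\<^sub>R \<eta>)) ^ ?m) \<le> (\<Sum>k. T k s \<eta>)"
      using AE_radial
    proof eventually_elim
      case (elim s)
      have "ennreal (norm (\<phi> (s *\<^sub>R \<eta>))) * ennreal (1 / norm (1 - cdot (r *\<^sub>R \<zeta>) (s *\<^sub>R \<eta>)) ^ ?m)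
        \<le> ennreal (norm (\<phi> (s *\<^sub>R \<eta>))) * (\<Sum>k. if ?X r k \<and> ?X s k \<and> sdist \<zeta> \<eta> < 4 * \<delta> k then ennreal (1 / \<delta> k ^ ?m) else 0)"
        using \<zeta> \<eta> r elim by (intro mult_left_mono dyadic_kernel_bound) auto
      also have "\<dots> = (\<Sum>k. ennreal (norm (\<phi> (s *\<^sub>R \<eta>))) * (if ?X r k \<and> ?X s k \<and> sdist \<zeta> \<eta> < 4 * \<delta> k then ennreal (1 / \<delta> k ^ ?m) else 0))"
        by (rule ennreal_suminf_cmult[symmetric])
      also have "\<dots> = (\<Sum>k. T k s \<eta>)"
        by (intro suminf_cong) (auto simp: T_def mult_ac)
      finally show ?case .
    qed
  qed
  also have "\<dots> = (\<integral>\<^sup>+\<eta>. (\<Sum>k. \<integral>\<^sup>+s. T k s \<eta> \<partial>?R) \<partial>sphere_meas)"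
    by (intro nn_integral_cong nn_integral_suminf) auto
  also have "\<dots> = (\<Sum>k. \<integral>\<^sup>+\<eta>. (\<integral>\<^sup>+s. T k s \<eta> \<partial>?R) \<partial>sphere_meas)"
    by (intro nn_integral_suminf measurable_sphere_meas) measurable
  also have "\<dots> = (\<Sum>k. (if ?X r k then ennreal (1 / \<delta> k) else 0) * sph_avg k (shell_avg \<phi> k) \<zeta>)"
  proof (intro suminf_cong)
    fix k
    let ?c = "(if ?X r k then ennreal (1 / \<delta> k ^ ?m) else 0) * ennreal (\<delta> k)"
    have [measurable]: "shell_avg \<phi> k \<in> borel_measurable sphere_meas"
      "(\<lambda>\<eta>. if sdist \<zeta> \<eta> < 4 * \<delta> k then 1 else 0 :: ennreal) \<in> borel_measurable sphere_meas"
      by (rule measurable_sphere_meas, measurable)+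
    have "1 / \<delta> k ^ ?m * \<delta> k = 1 / \<delta> k * (1 / \<delta> k ^ ?n)"
      by (simp add: power_add power2_eq_square)
    then have c: "?c = (if ?X r k then ennreal (1 / \<delta> k) else 0) * ennreal (1 / \<delta> k ^ ?n)"
      using \<delta>_pos[of k] by (simp add: less_imp_le flip: ennreal_mult')
    have "(\<integral>\<^sup>+\<eta>. (\<integral>\<^sup>+s. T k s \<eta> \<partial>?R) \<partial>sphere_meas) = (\<integral>\<^sup>+\<eta>. ?c * ((if sdist \<zeta> \<eta> < 4 * \<delta> k then 1 else 0) * shell_avg \<phi> k \<eta>) \<partial>sphere_meas)"
      unfolding inner by (simp only: mult_ac)
    also have "\<dots> = ?c * (\<integral>\<^sup>+\<eta>. (if sdist \<zeta> \<eta> < 4 * \<delta> k then 1 else 0) * shell_avg \<phi> k \<eta> \<partial>sphere_meas)"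
      by (rule nn_integral_cmult) measurable
    finally show "(\<integral>\<^sup>+\<eta>. (\<integral>\<^sup>+s. T k s \<eta> \<partial>?R) \<partial>sphere_meas) = (if ?X r k then ennreal (1 / \<delta> k) else 0) * sph_avg k (shell_avg \<phi> k) \<zeta>"
      unfolding c sph_avg_def by (simp only: mult.assoc)
  qed
  finally show ?thesis .
qed

text \<open>The Cauchy-Schwarz inequality on each shell, whose radial measure is at most \<open>8 n \<delta>\<^sub>k\<close>.
  Summing over the shells that contain a given radius \<open>s\<close> produces \<open>\<Sum> \<delta>\<^sub>k\<^sup>-\<^sup>1 \<le> 8 / (1 - s\<^sup>2)\<close>,
  the weight in the norm.\<close>
lemma square_fun_shell_avg_le:
  fixes \<eta> :: "complex ^ 'n"
  assumes [measurable]: "\<phi> \<in> borel_measurable borel"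
  shows "square_fun (shell_avg \<phi>) \<eta> \<le> ennreal (sqrt (64 * CARD('n))) * epowr (area \<phi> \<eta>) (1 / 2)"
proof -
  let ?n = "CARD('n)"
  let ?R = "radial_meas ?n"
  interpret R: finite_measure ?R by (rule finite_radial) simp
  define g where "g s = ennreal (norm (\<phi> (s *\<^sub>R \<eta>)))" for s
  define I where "I k s = (if 1 - s\<^sup>2 < 4 * \<delta> k then 1 else 0 :: ennreal)" for k and s :: real
  have [measurable]: "g \<in> borel_measurable borel" "I k \<in> borel_measurable borel" for k
    unfolding g_def[abs_def] I_def[abs_def] by measurable
  have II: "(I k s)\<^sup>2 = I k s" "I k s * (I k s * y) = I k s * y" for k s y by (simp_all add: I_def)
  have one: "(shell_avg \<phi> k \<eta>)\<^sup>2 \<le> ennreal (8 * ?n) * (\<integral>\<^sup>+s. ennreal (1 / \<delta> k) * (I k s * (g s)\<^sup>2) \<partial>?R)" for k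
  proof -
    let ?d = "ennreal (1 / \<delta> k)"
    have "(\<integral>\<^sup>+s. I k s * (I k s * g s) \<partial>?R)\<^sup>2 \<le> (\<integral>\<^sup>+s. (I k s)\<^sup>2 \<partial>?R) * (\<integral>\<^sup>+s. (I k s * g s)\<^sup>2 \<partial>?R)"
      by (rule nn_integral_Cauchy_Schwarz) measurable
    also have "(\<integral>\<^sup>+s. (I k s)\<^sup>2 \<partial>?R) \<le> ennreal (2 * real ?n * (4 * \<delta> k))"
      unfolding II(1) unfolding I_def by (rule radial_shell) simp
    finally have "(\<integral>\<^sup>+s. I k s * g s \<partial>?R)\<^sup>2 \<le> ennreal (2 * real ?n * (4 * \<delta> k)) * (\<integral>\<^sup>+s. I k s * (g s)\<^sup>2 \<partial>?R)"
      by (simp add: II power_mult_distrib mult_right_mono)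
    then have "?d\<^sup>2 * (\<integral>\<^sup>+s. I k s * g s \<partial>?R)\<^sup>2 \<le> ?d\<^sup>2 * (ennreal (2 * real ?n * (4 * \<delta> k)) * (\<integral>\<^sup>+s. I k s * (g s)\<^sup>2 \<partial>?R))"
      by (rule mult_left_mono) simp
    also have "\<dots> = (?d * ennreal (2 * real ?n * (4 * \<delta> k))) * (?d * (\<integral>\<^sup>+s. I k s * (g s)\<^sup>2 \<partial>?R))"
      by (simp add: power2_eq_square mult_ac)
    also have "?d * ennreal (2 * real ?n * (4 * \<delta> k)) = ennreal (8 * ?n)"
      using \<delta>_pos[of k] by (subst ennreal_mult'[symmetric]) (auto simp: less_imp_le less_imp_neq[symmetric])
    also have "?d * (\<integral>\<^sup>+s. I k s * (g s)\<^sup>2 \<partial>?R) = (\<integral>\<^sup>+s. ?d * (I k s * (g s)\<^sup>2) \<partial>?R)"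
      by (rule nn_integral_cmult[symmetric]) measurable
    finally show ?thesis by (simp add: shell_avg_def power_mult_distrib I_def g_def)
  qed
  have "(\<Sum>k. (shell_avg \<phi> k \<eta>)\<^sup>2) \<le> (\<Sum>k. ennreal (8 * ?n) * (\<integral>\<^sup>+s. ennreal (1 / \<delta> k) * (I k s * (g s)\<^sup>2) \<partial>?R))"
    by (intro suminf_le one) auto
  also have "\<dots> = ennreal (8 * ?n) * (\<integral>\<^sup>+s. (\<Sum>k. ennreal (1 / \<delta> k) * (I k s * (g s)\<^sup>2)) \<partial>?R)"
    by (subst nn_integral_suminf) auto
  also have "(\<integral>\<^sup>+s. (\<Sum>k. ennreal (1 / \<delta> k) * (I k s * (g s)\<^sup>2)) \<partial>?R) \<le> (\<integral>\<^sup>+s. ennreal 8 * ((g s)\<^sup>2 * ennreal (1 / (1 - s\<^sup>2))) \<partial>?R)"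
  proof (rule nn_integral_mono_AE, use AE_radial in eventually_elim)
    case (elim s)
    then have X: "0 < 1 - s\<^sup>2" by (simp add: power_less_one_iff abs_square_less_1)
    have "(\<Sum>k. ennreal (1 / \<delta> k) * (I k s * (g s)\<^sup>2)) = (\<Sum>k. (if 1 - s\<^sup>2 < 4 * \<delta> k then ennreal (1 / \<delta> k) else 0) * (g s)\<^sup>2)"
      by (intro suminf_cong) (simp add: I_def)
    also have "\<dots> = (\<Sum>k. (if 1 - s\<^sup>2 < 4 * \<delta> k then ennreal (1 / \<delta> k) else 0)) * (g s)\<^sup>2"
      by (rule ennreal_suminf_multc)
    also have "\<dots> \<le> ennreal (8 / (1 - s\<^sup>2)) * (g s)\<^sup>2"
      by (intro mult_right_mono dyadic_geometric_sum X) simp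
    also have "ennreal (8 / (1 - s\<^sup>2)) = ennreal 8 * ennreal (1 / (1 - s\<^sup>2))"
      using X by (subst ennreal_mult[symmetric]) auto
    finally show ?case by (simp add: mult_ac)
  qed
  also have "\<dots> = ennreal 8 * area \<phi> \<eta>"
    unfolding area_def g_def by (rule nn_integral_cmult) measurable
  finally have "(\<Sum>k. (shell_avg \<phi> k \<eta>)\<^sup>2) \<le> ennreal (8 * ?n) * (ennreal 8 * area \<phi> \<eta>)"
    by (simp add: mult_left_mono)
  also have "ennreal (8 * ?n) * (ennreal 8 * area \<phi> \<eta>) = ennreal (64 * ?n) * area \<phi> \<eta>"
  proof -
    have "ennreal (8 * ?n) * ennreal 8 = ennreal (64 * ?n)" by (subst ennreal_mult'[symmetric]) auto
    then show ?thesis by (simp only: mult.assoc[symmetric])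
  qed
  finally have "square_fun (shell_avg \<phi>) \<eta> \<le> epowr (ennreal (64 * ?n) * area \<phi> \<eta>) (1 / 2)"
    unfolding square_fun_def by (rule epowr_mono) simp
  then show ?thesis by (simp add: epowr_mult epowr_ennreal powr_half_sqrt)
qed

text \<open>The Cauchy-Schwarz inequality for the sum over \<open>k\<close> with weights \<open>\<delta>\<^sub>k\<^sup>-\<^sup>1\<close>, whose total is at
  most \<open>8 / (1 - r\<^sup>2)\<close>; the factor \<open>1 - r\<^sup>2\<close> squared against the weight \<open>1 / (1 - r\<^sup>2)\<close> of the
  norm absorbs it, and integration over the radius turns \<open>\<delta>\<^sub>k\<^sup>-\<^sup>1\<close> into a constant.\<close>
lemma area_le_square_fun:
  fixes \<zeta> :: "complex ^ 'n"
  assumes [measurable]: "\<psi> \<in> borel_measurable borel"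
    and le: "\<And>r. 0 < r \<Longrightarrow> r < 1 \<Longrightarrow> ennreal (norm (\<psi> (r *\<^sub>R \<zeta>)))
      \<le> ennreal (2 * (1 - r\<^sup>2)) * (\<Sum>k. (if 1 - r\<^sup>2 < 4 * \<delta> k then ennreal (1 / \<delta> k) else 0) * b k)"
  shows "epowr (area \<psi> \<zeta>) (1 / 2) \<le> ennreal (sqrt (256 * CARD('n))) * epowr (\<Sum>k. (b k)\<^sup>2) (1 / 2)"
proof -
  let ?n = "CARD('n)"
  let ?R = "radial_meas ?n"
  define I where "I k s = (if 1 - s\<^sup>2 < 4 * \<delta> k then 1 else 0 :: ennreal)" for k and s :: real
  have [measurable]: "I k \<in> borel_measurable borel" for k
    unfolding I_def[abs_def] by measurable
  have pt: "(ennreal (norm (\<psi> (r *\<^sub>R \<zeta>))))\<^sup>2 * ennreal (1 / (1 - r\<^sup>2)) \<le> (\<Sum>k. ennreal 32 * (I k r * (ennreal (1 / \<delta> k) * (b k)\<^sup>2)))"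
    if r: "0 < r" "r < 1" for r
  proof -
    define X where "X = 1 - r\<^sup>2"
    have X: "0 < X" using r by (simp add: X_def power_less_one_iff abs_square_less_1)
    define c where "c k = (if X < 4 * \<delta> k then ennreal (1 / \<delta> k) else 0)" for k
    \<comment> \<open>the square root of the weight, to be split between the two factors\<close>
    define e where "e k = epowr (c k) (1/2)" for k
    have ee: "e k * e k = c k" for k by (simp add: e_def flip: epowr_add)
    have "(\<Sum>k. c k * b k)\<^sup>2 = (\<Sum>k. e k * (e k * b k))\<^sup>2" by (simp add: mult.assoc[symmetric] ee)
    also have "\<dots> \<le> (epowr (\<Sum>k. (e k)\<^sup>2) (1/2) * epowr (\<Sum>k. (e k * b k)\<^sup>2) (1/2))\<^sup>2"
      by (intro power_mono suminf_Cauchy_Schwarz) simp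
    also have "\<dots> = (\<Sum>k. c k) * (\<Sum>k. c k * (b k)\<^sup>2)"
      by (simp add: power_mult_distrib epowr_epowr ee power2_eq_square[of "e _"] flip: epowr_2[of "epowr _ _"])
    also have "\<dots> \<le> ennreal (8 / X) * (\<Sum>k. c k * (b k)\<^sup>2)"
      unfolding c_def by (intro mult_right_mono dyadic_geometric_sum X) simp
    finally have cs: "(\<Sum>k. c k * b k)\<^sup>2 \<le> ennreal (8 / X) * (\<Sum>k. c k * (b k)\<^sup>2)" .
    have "(ennreal (norm (\<psi> (r *\<^sub>R \<zeta>))))\<^sup>2 \<le> (ennreal (2 * X) * (\<Sum>k. c k * b k))\<^sup>2"
      using le[OF r] by (intro power_mono) (simp_all add: X_def c_def)
    also have "\<dots> \<le> (ennreal (2 * X))\<^sup>2 * (ennreal (8 / X) * (\<Sum>k. c k * (b k)\<^sup>2))"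
      unfolding power_mult_distrib by (intro mult_left_mono cs) simp
    finally have "(ennreal (norm (\<psi> (r *\<^sub>R \<zeta>))))\<^sup>2 * ennreal (1 / X) \<le> (ennreal (2 * X))\<^sup>2 * (ennreal (8 / X) * (\<Sum>k. c k * (b k)\<^sup>2)) * ennreal (1 / X)"
      by (rule mult_right_mono) simp
    also have "\<dots> = ((ennreal (2 * X))\<^sup>2 * ennreal (8 / X) * ennreal (1 / X)) * (\<Sum>k. c k * (b k)\<^sup>2)"
      by (simp add: mult_ac)
    also have "(ennreal (2 * X))\<^sup>2 * ennreal (8 / X) * ennreal (1 / X) = ennreal ((2 * X)\<^sup>2 * (8 / X) * (1 / X))"
    proof -
      have "(ennreal x)\<^sup>2 * ennreal y * ennreal z = ennreal (x\<^sup>2 * y * z)" if "0 \<le> x" "0 \<le> y" "0 \<le> z" for x y z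
        using that by (simp add: ennreal_mult ennreal_power)
      then show ?thesis using X by (simp add: less_imp_le)
    qed
    also have "(2 * X)\<^sup>2 * (8 / X) * (1 / X) = 32" using X by (simp add: power2_eq_square)
    also have "ennreal 32 * (\<Sum>k. c k * (b k)\<^sup>2) = (\<Sum>k. ennreal 32 * (c k * (b k)\<^sup>2))" by simp
    also have "\<dots> = (\<Sum>k. ennreal 32 * (I k r * (ennreal (1 / \<delta> k) * (b k)\<^sup>2)))"
      by (intro suminf_cong) (simp add: c_def I_def X_def)
    finally show ?thesis by (simp add: X_def)
  qed
  have "area \<psi> \<zeta> \<le> (\<integral>\<^sup>+r. (\<Sum>k. ennreal 32 * (I k r * (ennreal (1 / \<delta> k) * (b k)\<^sup>2))) \<partial>?R)"
    unfolding area_def by (rule nn_integral_mono_AE, use AE_radial in eventually_elim) (blast intro: pt)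
  also have "\<dots> = (\<Sum>k. ennreal 32 * ((\<integral>\<^sup>+r. I k r \<partial>?R) * (ennreal (1 / \<delta> k) * (b k)\<^sup>2)))"
    by (subst nn_integral_suminf) (auto simp: nn_integral_cmult nn_integral_multc)
  also have "\<dots> \<le> (\<Sum>k. ennreal (256 * ?n) * (b k)\<^sup>2)"
  proof (intro suminf_le)
    fix k
    have "ennreal 32 * ((\<integral>\<^sup>+r. I k r \<partial>?R) * (ennreal (1 / \<delta> k) * (b k)\<^sup>2)) \<le> ennreal 32 * (ennreal (2 * real ?n * (4 * \<delta> k)) * (ennreal (1 / \<delta> k) * (b k)\<^sup>2))"
      unfolding I_def by (intro mult_left_mono mult_right_mono radial_shell) auto
    also have "\<dots> = (ennreal 32 * ennreal (2 * real ?n * (4 * \<delta> k)) * ennreal (1 / \<delta> k)) * (b k)\<^sup>2" by (simp add: mult_ac)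
    also have "ennreal 32 * ennreal (2 * real ?n * (4 * \<delta> k)) * ennreal (1 / \<delta> k) = ennreal (32 * (2 * real ?n * (4 * \<delta> k)) * (1 / \<delta> k))"
    proof -
      have "ennreal x * ennreal y * ennreal z = ennreal (x * y * z)" if "0 \<le> x" "0 \<le> y" "0 \<le> z" for x y z
        using that by (simp add: ennreal_mult)
      then show ?thesis by (simp only: less_imp_le[OF \<delta>_pos] mult_nonneg_nonneg zero_le_numeral of_nat_0_le_iff divide_nonneg_nonneg zero_le_one)
    qed
    also have "32 * (2 * real ?n * (4 * \<delta> k)) * (1 / \<delta> k) = 256 * ?n" using \<delta>_pos[of k] by (simp add: less_imp_neq[symmetric])
    finally show "ennreal 32 * ((\<integral>\<^sup>+r. I k r \<partial>?R) * (ennreal (1 / \<delta> k) * (b k)\<^sup>2)) \<le> ennreal (256 * ?n) * (b k)\<^sup>2" .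
  qed auto
  also have "\<dots> = ennreal (256 * ?n) * (\<Sum>k. (b k)\<^sup>2)" by simp
  finally have "epowr (area \<psi> \<zeta>) (1 / 2) \<le> epowr (ennreal (256 * ?n) * (\<Sum>k. (b k)\<^sup>2)) (1 / 2)"
    by (rule epowr_mono) simp
  then show ?thesis by (simp add: epowr_mult epowr_ennreal powr_half_sqrt)
qed

section \<open>The Bergman integral as a holomorphic function\<close>

text \<open>Second-order remainder of \<open>t \<mapsto> (1 - t)\<^sup>-\<^sup>m\<close>, uniform on a disc of radius less than 1; with
  \<open>t = z\<cdot>w\<close> it allows differentiation of the Bergman integral with an error bound that is uniform
  in \<open>w\<close>.\<close>
lemma power_kernel_Taylor:
  fixes t t0 :: complex
  assumes R: "R < 1" and t: "norm t \<le> R" "norm t0 \<le> R"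
  shows "norm (1 / (1 - t) ^ m - 1 / (1 - t0) ^ m - of_nat m / (1 - t0) ^ (m + 1) * (t - t0))
    \<le> real m * (real m + 1) / (1 - R) ^ (m + 2) * (norm (t - t0))\<^sup>2"
proof -
  define f :: "nat \<Rightarrow> complex \<Rightarrow> complex" where
    "f i x = (if i = 0 then 1 / (1 - x) ^ m else if i = 1 then of_nat m / (1 - x) ^ (m + 1)
       else of_nat m * (of_nat m + 1) / (1 - x) ^ (m + 2))" for i x
  have far: "1 - R \<le> norm (1 - x)" if "norm x \<le> R" for x :: complex
    using norm_triangle_ineq2[of 1 x] that by simp
  have ne: "1 - x \<noteq> 0" if "norm x \<le> R" for x :: complex
    using far[OF that] R by auto
  have "norm (f 0 t - (\<Sum>i\<le>1. f i t0 * (t - t0) ^ i / fact i)) \<le> real m * (real m + 1) / (1 - R) ^ (m + 2) * norm (t - t0) ^ Suc 1 / fact 1"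
  proof (rule complex_Taylor[where S = "cball 0 R"])
    fix i :: nat and x :: complex assume x: "x \<in> cball 0 R" and i: "i \<le> 1"
    then have n1: "1 - x \<noteq> 0" using ne by simp
    have D: "((\<lambda>x. a / (1 - x) ^ k) has_field_derivative a * of_nat k / (1 - x) ^ (k + 1)) (at x within cball 0 R)" for a k
    proof -
      have "((\<lambda>x. a * inverse (1 - x) ^ k) has_field_derivative a * of_nat k * inverse (1 - x) ^ (k + 1)) (at x within cball 0 R)"
      proof -
        have "((\<lambda>x. inverse (1 - x)) has_field_derivative (inverse (1 - x))\<^sup>2) (at x within cball 0 R)"
          using n1 by (auto intro!: derivative_eq_intros simp: power2_eq_square)
        from DERIV_cmult[OF DERIV_power[OF this, of k], of a] show ?thesis
          by (rule DERIV_cong) (cases k; simp add: power2_eq_square)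
      qed
      then show ?thesis by (simp add: divide_inverse power_inverse)
    qed
    show "(f i has_field_derivative f (Suc i) x) (at x within cball 0 R)"
    proof (cases "i = 0")
      case True
      then show ?thesis using D[of 1 m] by (simp add: f_def[abs_def])
    next
      case False
      then have "i = 1" using i by simp
      then show ?thesis using D[of "of_nat m" "m + 1"] by (simp add: f_def[abs_def] add.commute)
    qed
  next
    fix x :: complex assume "x \<in> cball 0 R"
    then have x: "1 - R \<le> norm (1 - x)" using far by simp
    have "norm (f (Suc 1) x) = real m * (real m + 1) / norm (1 - x) ^ (m + 2)"
    proof -
      have "norm (of_nat m * (of_nat m + 1) :: complex) = real m * (real m + 1)"
        by (metis norm_of_nat of_nat_1 of_nat_add of_nat_mult)
      moreover have "f (Suc 1) x = of_nat m * (of_nat m + 1) / (1 - x) ^ (m + 2)" by (simp add: f_def)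
      ultimately show ?thesis by (simp only: norm_divide norm_power)
    qed
    also have "\<dots> \<le> real m * (real m + 1) / (1 - R) ^ (m + 2)"
      using x R by (intro divide_left_mono power_mono mult_pos_pos zero_less_power) auto
    finally show "norm (f (Suc 1) x) \<le> real m * (real m + 1) / (1 - R) ^ (m + 2)" .
  qed (use t in auto)
  then show ?thesis by (simp add: f_def power2_eq_square diff_diff_eq)
qed

lemma space_ball_meas [simp]: "space (ball_meas :: (complex ^ 'n) measure) = ball 0 1"
  by (simp add: ball_meas_def space_restrict_space)

lemma measurable_ball_meas:
  assumes "f \<in> measurable borel K"
  shows "f \<in> measurable ball_meas K"
proof -
  have "f \<in> measurable lebesgue K" using assms by (intro measurable_completion) simp
  then have "f \<in> measurable (lebesgue_on (ball 0 1)) K" by (rule measurable_restrict_space1)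
  then show ?thesis unfolding ball_meas_def by simp
qed

lemma emeasure_lebesgue_on_ball:
  "emeasure (lebesgue_on (ball 0 1)) (ball (0 :: complex ^ 'n) 1) = emeasure lborel (ball (0 :: complex ^ 'n) 1)"
  by (subst emeasure_restrict_space) auto

lemma nn_integral_ball_meas:
  fixes f :: "complex ^ 'n \<Rightarrow> ennreal"
  assumes [measurable]: "f \<in> borel_measurable borel"
  shows "(\<integral>\<^sup>+w. f w \<partial>ball_meas) = (\<integral>\<^sup>+w. f w \<partial>nu)"
proof -
  have [measurable]: "f \<in> borel_measurable (lebesgue_on (ball 0 1))"
    by (intro measurable_restrict_space1 measurable_completion) simp
  have "(\<integral>\<^sup>+w. f w \<partial>ball_meas) = (\<integral>\<^sup>+w. f w * indicator (ball 0 1) w \<partial>lebesgue_on (ball 0 1)) / emeasure lborel (ball (0 :: complex ^ 'n) 1)"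
    unfolding ball_meas_def by (subst nn_integral_uniform_measure) (auto simp: emeasure_lebesgue_on_ball sets_restrict_space)
  also have "(\<integral>\<^sup>+w. f w * indicator (ball 0 1) w \<partial>lebesgue_on (ball 0 1)) = (\<integral>\<^sup>+w. f w \<partial>lebesgue_on (ball 0 1))"
    by (intro nn_integral_cong) (auto simp: space_restrict_space)
  also have "\<dots> = (\<integral>\<^sup>+w. f w * indicator (ball 0 1) w \<partial>lebesgue)"
    by (rule nn_integral_restrict_space) auto
  also have "\<dots> = (\<integral>\<^sup>+w. f w * indicator (ball 0 1) w \<partial>lborel)" by (rule nn_integral_completion)
  finally show ?thesis by (simp only: nn_integral_nu[OF assms])
qed

context
  fixes \<phi> :: "complex ^ 'n \<Rightarrow> complex"
  assumes int: "integrable ball_meas \<phi>"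
begin

lemma kernel_integrable:
  assumes z: "norm z < 1" and [measurable]: "g \<in> borel_measurable borel" and g: "\<And>w. norm w < 1 \<Longrightarrow> norm (g w) \<le> B"
  shows "integrable ball_meas (\<lambda>w. \<phi> w * (g w / (1 - cdot z w) ^ m))"
proof -
  have gm: "(\<lambda>w. g w / (1 - cdot z w) ^ m) \<in> borel_measurable ball_meas"
    by (rule measurable_ball_meas) measurable
  have "integrable ball_meas (\<lambda>w. (B / (1 - norm z) ^ m) *\<^sub>R \<phi> w)" using int by (rule integrable_scaleR_right)
  then show ?thesis
  proof (rule Bochner_Integration.integrable_bound)
    show "(\<lambda>w. \<phi> w * (g w / (1 - cdot z w) ^ m)) \<in> borel_measurable ball_meas"
      using gm int by (intro borel_measurable_times) auto
    show "AE w in ball_meas. norm (\<phi> w * (g w / (1 - cdot z w) ^ m)) \<le> norm ((B / (1 - norm z) ^ m) *\<^sub>R \<phi> w)"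
    proof (rule AE_I2)
      fix w :: "complex ^ 'n" assume "w \<in> space ball_meas"
      then have w: "norm w < 1" by simp
      have "norm (cdot z w) \<le> norm z * norm w" by (rule norm_cdot_le)
      also have "\<dots> \<le> norm z" using w by (simp add: mult_left_le)
      finally have "1 - norm z \<le> norm (1 - cdot z w)"
        using norm_triangle_ineq2[of 1 "cdot z w"] by simp
      then have "(1 - norm z) ^ m \<le> norm (1 - cdot z w) ^ m" using z by (intro power_mono) auto
      moreover have "0 \<le> B" using g[of 0] by (rule order_trans[OF norm_ge_zero]) simp
      ultimately have "norm (g w) / norm (1 - cdot z w) ^ m \<le> B / (1 - norm z) ^ m"
        using g[OF w] z by (intro frac_le) auto
      then have "norm (\<phi> w) * (norm (g w) / norm (1 - cdot z w) ^ m) \<le> norm (\<phi> w) * (B / (1 - norm z) ^ m)"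
        by (rule mult_left_mono) simp
      moreover have "0 \<le> B / (1 - norm z) ^ m" using \<open>0 \<le> B\<close> z by simp
      then have "norm ((B / (1 - norm z) ^ m) *\<^sub>R \<phi> w) = norm (\<phi> w) * (B / (1 - norm z) ^ m)"
        by (simp only: norm_scaleR abs_of_nonneg mult.commute)
      ultimately show "norm (\<phi> w * (g w / (1 - cdot z w) ^ m)) \<le> norm ((B / (1 - norm z) ^ m) *\<^sub>R \<phi> w)"
        by (simp only: norm_mult norm_divide norm_power)
    qed
  qed
qed

definition bergman_deriv :: "complex ^ 'n \<Rightarrow> complex ^ 'n \<Rightarrow> complex" where
  "bergman_deriv z h = (\<integral>w. \<phi> w * (of_nat (CARD('n) + 1) * cdot h w / (1 - cdot z w) ^ (CARD('n) + 2)) \<partial>ball_meas)"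

lemma bergman_deriv_integrable:
  assumes z: "norm z < 1"
  shows "integrable ball_meas (\<lambda>w. \<phi> w * (of_nat (CARD('n) + 1) * cdot h w / (1 - cdot z w) ^ (CARD('n) + 2)))"
proof (rule kernel_integrable[OF z])
  fix w :: "complex ^ 'n" assume "norm w < 1"
  have "norm (cdot h w) \<le> norm h * norm w" by (rule norm_cdot_le)
  also have "\<dots> \<le> norm h" using \<open>norm w < 1\<close> by (simp add: mult_left_le)
  finally show "norm (of_nat (CARD('n) + 1) * cdot h w) \<le> real (CARD('n) + 1) * norm h"
    unfolding norm_mult norm_of_nat by (rule mult_left_mono) simp
qed measurable

lemma bergman_kernel_integrable:
  assumes z: "norm z < 1"
  shows "integrable ball_meas (\<lambda>w. \<phi> w / (1 - cdot z w) ^ m)"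
  using kernel_integrable[OF z, of "\<lambda>_. 1" 1 m] by simp

lemma bergman_has_derivative:
  assumes z: "norm z < 1"
  shows "(bergman \<phi> has_derivative bergman_deriv z) (at z)"
proof -
  let ?m = "CARD('n) + 1"
  define R where "R = (1 + norm z) / 2"
  have R: "norm z < R" "R < 1" using z by (auto simp: R_def)
  define L where "L = (\<integral>w. norm (\<phi> w) \<partial>ball_meas)"
  have intn: "integrable ball_meas (\<lambda>w. norm (\<phi> w))" using int by (rule integrable_norm)
  define K where "K = real ?m * (real ?m + 1) / (1 - R) ^ (?m + 2)"
  have K: "0 \<le> K" using R by (simp add: K_def)
  have cw: "norm (cdot h w) \<le> norm h" if "norm w < 1" for h w :: "complex ^ 'n"
  proof -
    have "norm (cdot h w) \<le> norm h * norm w" by (rule norm_cdot_le)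
    also have "\<dots> \<le> norm h" using that by (simp add: mult_left_le)
    finally show ?thesis .
  qed
  show ?thesis
  proof (rule has_derivativeI_sandwich[where e = "R - norm z" and H = "\<lambda>y. K * L * norm (y - z)"])
    show "0 < R - norm z" using R by simp
    show "bounded_linear (bergman_deriv z)"
    proof (rule bounded_linear_intro[where K = "real ?m / (1 - norm z) ^ (?m + 1) * L"])
      fix x y :: "complex ^ 'n" and r :: real
      show "bergman_deriv z (x + y) = bergman_deriv z x + bergman_deriv z y"
        unfolding bergman_deriv_def
        by (subst Bochner_Integration.integral_add[OF bergman_deriv_integrable[OF z] bergman_deriv_integrable[OF z], symmetric])
          (auto simp: cdot_add_left algebra_simps add_divide_distrib intro!: Bochner_Integration.integral_cong)
      have "bergman_deriv z (r *\<^sub>R x) = (\<integral>w. complex_of_real r * (\<phi> w * (of_nat (CARD('n) + 1) * cdot x w / (1 - cdot z w) ^ (CARD('n) + 2))) \<partial>ball_meas)"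
        unfolding bergman_deriv_def by (intro Bochner_Integration.integral_cong) (simp_all add: cdot_scaleR_left)
      also have "\<dots> = complex_of_real r * bergman_deriv z x"
        unfolding bergman_deriv_def by (rule integral_mult_right_zero)
      finally show "bergman_deriv z (r *\<^sub>R x) = r *\<^sub>R bergman_deriv z x"
        by (simp add: scaleR_conv_of_real[where 'a=complex])
      have "norm (bergman_deriv z x) \<le> (\<integral>w. (real ?m / (1 - norm z) ^ (?m + 1) * norm x) * norm (\<phi> w) \<partial>ball_meas)"
        unfolding bergman_deriv_def
      proof (rule Bochner_Integration.integral_norm_bound_integral[OF bergman_deriv_integrable[OF z]])
        show "integrable ball_meas (\<lambda>w. (real ?m / (1 - norm z) ^ (?m + 1) * norm x) * norm (\<phi> w))" using intn by simp
        fix w :: "complex ^ 'n" assume "w \<in> space ball_meas"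
        then have w: "norm w < 1" by simp
        have "1 - norm z \<le> norm (1 - cdot z w)"
          using norm_triangle_ineq2[of 1 "cdot z w"] cw[OF w, of z] by simp
        then have "(1 - norm z) ^ (?m + 1) \<le> norm (1 - cdot z w) ^ (?m + 1)" using z by (intro power_mono) auto
        then have "(real ?m * norm (cdot x w)) / norm (1 - cdot z w) ^ (?m + 1) \<le> (real ?m * norm x) / (1 - norm z) ^ (?m + 1)"
          using z by (intro frac_le mult_left_mono cw w) auto
        then have "norm (\<phi> w) * ((real ?m * norm (cdot x w)) / norm (1 - cdot z w) ^ (?m + 1)) \<le> norm (\<phi> w) * ((real ?m * norm x) / (1 - norm z) ^ (?m + 1))"
          by (rule mult_left_mono) simp
        moreover have "norm (complex_of_nat ?m) = real ?m" by (rule norm_of_nat)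
        ultimately show "norm (\<phi> w * (of_nat (CARD('n) + 1) * cdot x w / (1 - cdot z w) ^ (CARD('n) + 2))) \<le> (real ?m / (1 - norm z) ^ (?m + 1) * norm x) * norm (\<phi> w)"
          by (simp add: norm_mult norm_divide norm_power mult_ac del: of_nat_add of_nat_Suc)
      qed
      then show "norm (bergman_deriv z x) \<le> norm x * (real ?m / (1 - norm z) ^ (?m + 1) * L)"
        by (simp add: L_def mult_ac)
    qed
    show "((\<lambda>y. K * L * norm (y - z)) \<longlongrightarrow> 0) (at z)"
      by (rule tendsto_eq_intros refl | simp)+
    fix y :: "complex ^ 'n" assume y: "y \<noteq> z" "dist y z < R - norm z"
    have yR: "norm y < R" using y(2) norm_triangle_sub[of y z] by (simp add: dist_norm)
    then have y1: "norm y < 1" using R by simp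
    let ?E = "\<lambda>w. \<phi> w / (1 - cdot y w) ^ ?m - \<phi> w / (1 - cdot z w) ^ ?m - \<phi> w * (of_nat (CARD('n) + 1) * cdot (y - z) w / (1 - cdot z w) ^ (CARD('n) + 2))"
    have ig: "integrable ball_meas ?E"
      by (intro Bochner_Integration.integrable_diff bergman_kernel_integrable bergman_deriv_integrable y1 z)
    have "(bergman \<phi> y - bergman \<phi> z) - bergman_deriv z (y - z) = (\<integral>w. ?E w \<partial>ball_meas)"
      unfolding bergman_def bergman_deriv_def
      by (simp only: Bochner_Integration.integral_diff bergman_kernel_integrable bergman_deriv_integrable y1 z Bochner_Integration.integrable_diff)
    also have "norm \<dots> \<le> (\<integral>w. (K * (norm (y - z))\<^sup>2) * norm (\<phi> w) \<partial>ball_meas)"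
    proof (rule Bochner_Integration.integral_norm_bound_integral[OF ig])
      show "integrable ball_meas (\<lambda>w. (K * (norm (y - z))\<^sup>2) * norm (\<phi> w))" using intn by simp
      fix w :: "complex ^ 'n" assume "w \<in> space ball_meas"
      then have w: "norm w < 1" by simp
      have "?E w = \<phi> w * (1 / (1 - cdot y w) ^ ?m - 1 / (1 - cdot z w) ^ ?m - of_nat ?m / (1 - cdot z w) ^ (?m + 1) * (cdot y w - cdot z w))"
        by (simp add: cdot_diff_left algebra_simps)
      then have "norm (?E w) = norm (\<phi> w) * norm (1 / (1 - cdot y w) ^ ?m - 1 / (1 - cdot z w) ^ ?m - of_nat ?m / (1 - cdot z w) ^ (?m + 1) * (cdot y w - cdot z w))"
        by (simp only: norm_mult)
      also have "\<dots> \<le> norm (\<phi> w) * (K * (norm (cdot y w - cdot z w))\<^sup>2)"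
        unfolding K_def using R yR cw[OF w, of y] cw[OF w, of z]
        by (intro mult_left_mono power_kernel_Taylor) auto
      also have "\<dots> \<le> norm (\<phi> w) * (K * (norm (y - z))\<^sup>2)"
        unfolding cdot_diff_left[symmetric] using K by (intro mult_left_mono power_mono cw w) auto
      finally show "norm (?E w) \<le> (K * (norm (y - z))\<^sup>2) * norm (\<phi> w)" by (simp add: mult.commute)
    qed
    also have "\<dots> = K * L * (norm (y - z))\<^sup>2" by (simp add: L_def)
    finally show "norm ((bergman \<phi> y - bergman \<phi> z) - bergman_deriv z (y - z)) / norm (y - z) \<le> K * L * norm (y - z)"
      using y(1) by (simp add: divide_le_eq power2_eq_square mult.assoc)
  qed
qed

lemma bergman_deriv_smult: "bergman_deriv z (c *s h) = c * bergman_deriv z h"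
proof -
  have "bergman_deriv z (c *s h) = (\<integral>w. c * (\<phi> w * (of_nat (CARD('n) + 1) * cdot h w / (1 - cdot z w) ^ (CARD('n) + 2))) \<partial>ball_meas)"
    unfolding bergman_deriv_def by (intro Bochner_Integration.integral_cong) (simp_all add: cdot_smult_left)
  also have "\<dots> = c * bergman_deriv z h"
    unfolding bergman_deriv_def by (rule integral_mult_right_zero)
  finally show ?thesis .
qed

lemma bergman_holo: "holo_on (bergman \<phi>) (ball 0 1)"
  unfolding holo_on_def using bergman_has_derivative bergman_deriv_smult by fastforce

lemma radial_deriv_bergman:
  assumes z: "norm z < 1"
  shows "radial_deriv (bergman \<phi>) z = bergman_deriv z z"
proof -
  have lin: "linear (bergman_deriv z)"
    using bergman_has_derivative[OF z] has_derivative_bounded_linear bounded_linear.linear by blast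
  have "partial_z j (bergman \<phi>) z = bergman_deriv z (axis j 1)" for j
  proof -
    have "((\<lambda>t. z + t *s axis j (1::complex)) has_derivative (\<lambda>t. t *s axis j 1)) (at 0)"
    proof -
      have "bounded_linear (\<lambda>t. t *s axis j (1::complex))"
        by (intro bounded_linearI' ) (simp_all add: vec_eq_iff axis_def scaleR_conv_of_real[where 'a=complex] algebra_simps)
      then have "((\<lambda>t. t *s axis j (1::complex)) has_derivative (\<lambda>t. t *s axis j 1)) (at 0)"
        by (rule bounded_linear.has_derivative) (rule has_derivative_ident)
      then show ?thesis by (auto intro: has_derivative_eq_rhs[OF has_derivative_add[OF has_derivative_const]])
    qed
    moreover have "(bergman \<phi> has_derivative bergman_deriv z) (at (z + 0 *s axis j 1))"
      using bergman_has_derivative[OF z] by simp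
    ultimately have "((\<lambda>t. bergman \<phi> (z + t *s axis j 1)) has_derivative (\<lambda>t. bergman_deriv z (t *s axis j 1))) (at 0)"
      using diff_chain_at[of "\<lambda>t. z + t *s axis j (1::complex)" _ 0 "bergman \<phi>"] by (simp add: o_def)
    then have "((\<lambda>t. bergman \<phi> (z + t *s axis j 1)) has_field_derivative bergman_deriv z (axis j 1)) (at 0)"
      by (simp add: has_field_derivative_def bergman_deriv_smult mult.commute[of _ "bergman_deriv z (axis j 1)"])
    then show ?thesis unfolding partial_z_def by (rule DERIV_imp_deriv)
  qed
  then have "radial_deriv (bergman \<phi>) z = (\<Sum>j\<in>UNIV. bergman_deriv z (z $ j *s axis j 1))"
    by (simp add: radial_deriv_def bergman_deriv_smult)
  also have "\<dots> = bergman_deriv z (\<Sum>j\<in>UNIV. z $ j *s axis j 1)"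
    by (rule linear_sum[OF lin, symmetric])
  also have "\<dots> = bergman_deriv z z" by (simp add: basis_expansion)
  finally show ?thesis .
qed

text \<open>For \<open>q = z\<cdot>w\<close> the radial derivative acts as \<open>q d/dq\<close>, and \<open>(1 - q)\<^sup>-\<^sup>n\<^sup>-\<^sup>1 + (n + 1) q (1 -
  q)\<^sup>-\<^sup>n\<^sup>-\<^sup>2 / n = (1 + q / n) (1 - q)\<^sup>-\<^sup>n\<^sup>-\<^sup>2\<close>.\<close>
lemma bergman_radial_formula:
  assumes z: "norm z < 1"
  shows "bergman \<phi> z + radial_deriv (bergman \<phi>) z / of_nat CARD('n)
    = (\<integral>w. \<phi> w * ((1 + cdot z w / of_nat CARD('n)) / (1 - cdot z w) ^ (CARD('n) + 2)) \<partial>ball_meas)"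
proof -
  let ?n = "CARD('n)"
  let ?K = "\<lambda>w. \<phi> w * (of_nat (CARD('n) + 1) * cdot z w / (1 - cdot z w) ^ (CARD('n) + 2))"
  have "bergman \<phi> z + radial_deriv (bergman \<phi>) z / of_nat ?n
     = (\<integral>w. \<phi> w / (1 - cdot z w) ^ (?n + 1) \<partial>ball_meas) + (\<integral>w. ?K w / of_nat ?n \<partial>ball_meas)"
    unfolding radial_deriv_bergman[OF z] bergman_def bergman_deriv_def
    by (intro arg_cong2[where f="(+)"] refl integral_divide_zero[symmetric])
  also have "\<dots> = (\<integral>w. \<phi> w / (1 - cdot z w) ^ (?n + 1) + ?K w / of_nat ?n \<partial>ball_meas)"
    by (rule Bochner_Integration.integral_add[symmetric, OF bergman_kernel_integrable[OF z]])
      (intro integrable_divide bergman_deriv_integrable[OF z])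
  also have "\<dots> = (\<integral>w. \<phi> w * ((1 + cdot z w / of_nat ?n) / (1 - cdot z w) ^ (?n + 2)) \<partial>ball_meas)"
  proof (rule Bochner_Integration.integral_cong[OF refl])
    fix w :: "complex ^ 'n" assume "w \<in> space ball_meas"
    then have w: "norm w < 1" by simp
    have "norm (cdot z w) \<le> norm z * norm w" by (rule norm_cdot_le)
    also have "\<dots> < 1 * 1" using z w by (intro mult_strict_mono') auto
    finally have "cdot z w \<noteq> 1" by auto
    then have ne: "1 - cdot z w \<noteq> 0" by simp
    define q where "q = cdot z w"
    have "1 / (1 - q) ^ (?n + 1) + of_nat (?n + 1) * q / (1 - q) ^ (?n + 2) / of_nat ?n = (1 + q / of_nat ?n) / (1 - q) ^ (?n + 2)"
    proof -
      have "1 / (1 - q) ^ (?n + 1) = (1 - q) / (1 - q) ^ (?n + 2)"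
        using ne by (simp add: q_def)
      moreover have "(1 - q) + of_nat (?n + 1) * q / of_nat ?n = 1 + q / of_nat ?n"
        by (simp add: field_simps)
      ultimately show ?thesis
        by (metis (no_types, opaque_lifting) add_divide_distrib divide_divide_eq_left mult.commute)
    qed
    then show "\<phi> w / (1 - cdot z w) ^ (?n + 1) + ?K w / of_nat ?n = \<phi> w * ((1 + cdot z w / of_nat ?n) / (1 - cdot z w) ^ (?n + 2))"
      unfolding q_def[symmetric] by (simp only: times_divide_eq_right[symmetric] distrib_left[symmetric] times_divide_eq_left mult_1_right divide_inverse mult.assoc) (metis distrib_left divide_inverse mult_1)
  qed
  finally show ?thesis .
qed

lemma bergman_radial_bound:
  assumes z: "norm z < 1" and [measurable]: "\<phi> \<in> borel_measurable borel"
  shows "ennreal (norm (bergman \<phi> z + radial_deriv (bergman \<phi>) z / of_nat CARD('n))) \<le> ennreal 2 * potential \<phi> z"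
proof -
  let ?n = "CARD('n)"
  let ?K = "\<lambda>w. \<phi> w * ((1 + cdot z w / of_nat ?n) / (1 - cdot z w) ^ (?n + 2))"
  have cw: "norm (cdot z w) \<le> 1" if "norm w < 1" for w :: "complex ^ 'n"
  proof -
    have "norm (cdot z w) \<le> norm z * norm w" by (rule norm_cdot_le)
    also have "\<dots> \<le> 1" using z that by (intro mult_le_one) auto
    finally show ?thesis .
  qed
  have two: "norm (1 + cdot z w / of_nat ?n) \<le> 2" if "norm w < 1" for w :: "complex ^ 'n"
  proof -
    have "norm (cdot z w) / real ?n \<le> norm (cdot z w) / 1"
      by (intro divide_left_mono) (simp_all add: Suc_leI)
    then have "norm (cdot z w / of_nat ?n) \<le> 1"
      using cw[OF that] by (simp only: norm_divide norm_of_nat div_by_1)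
    then show ?thesis using norm_triangle_ineq[of 1 "cdot z w / of_nat ?n"] by simp
  qed
  have ig: "integrable ball_meas ?K"
    by (rule kernel_integrable[OF z _ two]) measurable
  have "ennreal (norm (bergman \<phi> z + radial_deriv (bergman \<phi>) z / of_nat ?n)) \<le> (\<integral>\<^sup>+w. norm (?K w) \<partial>ball_meas)"
    unfolding bergman_radial_formula[OF z] by (rule integral_norm_bound_ennreal[OF ig])
  also have "\<dots> \<le> (\<integral>\<^sup>+w. ennreal 2 * (ennreal (norm (\<phi> w)) * ennreal (1 / norm (1 - cdot z w) ^ (?n + 2))) \<partial>ball_meas)"
  proof (rule nn_integral_mono)
    fix w :: "complex ^ 'n" assume "w \<in> space ball_meas"
    then have w: "norm w < 1" by simp
    have "norm (?K w) = norm (1 + cdot z w / of_nat ?n) * (norm (\<phi> w) * (1 / norm (1 - cdot z w) ^ (?n + 2)))"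
      by (simp add: norm_mult norm_divide norm_power)
    also have "\<dots> \<le> 2 * (norm (\<phi> w) * (1 / norm (1 - cdot z w) ^ (?n + 2)))"
      by (intro mult_right_mono two w) simp
    finally have "ennreal (norm (?K w)) \<le> ennreal (2 * (norm (\<phi> w) * (1 / norm (1 - cdot z w) ^ (?n + 2))))"
      by (rule ennreal_leI)
    then show "ennreal (norm (?K w)) \<le> ennreal 2 * (ennreal (norm (\<phi> w)) * ennreal (1 / norm (1 - cdot z w) ^ (?n + 2)))"
      by (subst (asm) ennreal_mult', simp, subst (asm) ennreal_mult', simp, simp)
  qed
  also have "\<dots> = (\<integral>\<^sup>+w. ennreal 2 * (ennreal (norm (\<phi> w)) * ennreal (1 / norm (1 - cdot z w) ^ (?n + 2))) \<partial>nu)"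
    by (rule nn_integral_ball_meas) measurable
  also have "\<dots> = ennreal 2 * potential \<phi> z"
    unfolding potential_def by (rule nn_integral_cmult) measurable
  finally show ?thesis .
qed

end

section \<open>Boundedness for Muckenhoupt weights\<close>

lemma emeasure_ball_meas_ball: "emeasure (ball_meas :: (complex ^ 'n) measure) (ball 0 1) = 1"
proof -
  have "emeasure (ball_meas :: (complex ^ 'n) measure) (ball 0 1) = (\<integral>\<^sup>+w. 1 \<partial>(ball_meas :: (complex ^ 'n) measure))"
    by simp
  also have "\<dots> = (\<integral>\<^sup>+w. 1 \<partial>(nu :: (complex ^ 'n) measure))" by (rule nn_integral_ball_meas) simp
  finally show ?thesis by (simp add: emeasure_nu_UNIV)
qed

lemma finite_measure_ball_meas: "finite_measure (ball_meas :: (complex ^ 'n) measure)"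
  by (rule finite_measureI) (simp add: emeasure_ball_meas_ball)

lemma AE_ball_meas:
  assumes N: "N \<in> null_sets lborel"
  shows "AE w in ball_meas. w \<notin> (N :: (complex ^ 'n) set)"
proof -
  have "AE w in lebesgue. w \<notin> N" using N by (intro AE_not_in null_sets_completionI)
  then have "AE w in lebesgue_on (ball 0 1). w \<notin> N"
    by (subst AE_restrict_space_iff) auto
  then show ?thesis
    unfolding ball_meas_def using unit_ball_volume[where 'n='n]
    by (subst AE_uniform_measure) (auto simp: emeasure_lebesgue_on_ball less_top)
qed

text \<open>Functions in the norms are Lebesgue measurable; polar coordinates and Fubini's theorem are
  applied to this Borel representative.\<close>
lemma Borel_representative:
  fixes \<phi> :: "complex ^ 'n \<Rightarrow> complex"
  assumes "\<phi> \<in> borel_measurable ball_meas"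
  obtains \<psi> N where "\<psi> \<in> borel_measurable borel" "N \<in> null_sets lborel" "\<And>w. w \<in> ball 0 1 - N \<Longrightarrow> \<phi> w = \<psi> w"
proof -
  define f where "f w = (if w \<in> ball 0 1 then \<phi> w else 0)" for w
  have "\<phi> \<in> borel_measurable (lebesgue_on (ball 0 1))"
    using assms by (simp add: ball_meas_def)
  then have f [measurable]: "f \<in> borel_measurable lebesgue"
    unfolding f_def[abs_def] by (subst measurable_restrict_space_iff[symmetric]) auto
  have "(\<lambda>w. Re (f w)) \<in> borel_measurable lebesgue" "(\<lambda>w. Im (f w)) \<in> borel_measurable lebesgue" by measurable
  then obtain g h where g: "g \<in> borel_measurable lborel" "AE w in lborel. Re (f w) = g w"
    and h: "h \<in> borel_measurable lborel" "AE w in lborel. Im (f w) = h w"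
    using completion_ex_borel_measurable_real by blast
  have [measurable]: "g \<in> borel_measurable borel" "h \<in> borel_measurable borel" using g h by simp_all
  have "AE w in lborel. f w = complex_of_real (g w) + \<i> * complex_of_real (h w)"
    using g(2) h(2) by eventually_elim (simp add: complex_eq_iff)
  then obtain N where N: "{w \<in> space lborel. f w \<noteq> complex_of_real (g w) + \<i> * complex_of_real (h w)} \<subseteq> N" "emeasure lborel N = 0" "N \<in> sets lborel"
    by (rule AE_E)
  show ?thesis
  proof (rule that[of "\<lambda>w. complex_of_real (g w) + \<i> * complex_of_real (h w)" N])
    show "N \<in> null_sets lborel" using N by auto
    fix w assume "w \<in> ball 0 1 - N"
    then have "w \<notin> {w \<in> space lborel. f w \<noteq> complex_of_real (g w) + \<i> * complex_of_real (h w)}" "f w = \<phi> w"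
      using N(1) by (blast, simp add: f_def)
    then show "\<phi> w = complex_of_real (g w) + \<i> * complex_of_real (h w)" by simp
  qed measurable
qed

text \<open>A null set of the ball meets almost every radius in a null set, so that modification on a
  null set does not affect the iterated integral in the norm.\<close>
lemma null_set_radial:
  assumes N: "N \<in> null_sets lborel"
  shows "AE \<zeta> in sphere_meas. AE r in lborel. 0 < r \<and> r < 1 \<longrightarrow> r *\<^sub>R \<zeta> \<notin> (N :: (complex ^ 'n) set)"
proof -
  have [measurable]: "N \<in> sets borel" using N by auto
  let ?R = "radial_meas CARD('n)"
  interpret finite_measure ?R by (rule finite_radial) simp
  have m: "(\<lambda>\<zeta>. \<integral>\<^sup>+r. indicator N (r *\<^sub>R \<zeta>) \<partial>?R) \<in> borel_measurable sphere_meas"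
    by (intro measurable_sphere_meas measurable_radial_integral) auto
  have "(\<integral>\<^sup>+w. indicator N w * indicator (ball 0 1) w \<partial>lborel) = 0"
  proof (subst nn_integral_0_iff_AE)
    show "(\<lambda>w. indicator N w * indicator (ball 0 1) w :: ennreal) \<in> borel_measurable lborel"
      by (intro borel_measurable_times_ennreal borel_measurable_indicator) auto
    show "AE w in lborel. indicator N w * indicator (ball 0 1) w = (0 :: ennreal)"
      using AE_not_in[OF N] by eventually_elim simp
  qed
  then have "(\<integral>\<^sup>+w. indicator N w \<partial>nu) = 0" by (subst nn_integral_nu) auto
  then have "(\<integral>\<^sup>+\<zeta>. (\<integral>\<^sup>+r. indicator N (r *\<^sub>R \<zeta>) \<partial>?R) \<partial>sphere_meas) = 0"
    by (subst polar_coordinates[symmetric]) auto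
  then have "AE \<zeta> in sphere_meas. (\<integral>\<^sup>+r. indicator N (r *\<^sub>R \<zeta>) \<partial>?R) = 0"
    by (simp add: nn_integral_0_iff_AE[OF m])
  then show ?thesis
  proof eventually_elim
    case (elim \<zeta>)
    have "AE r in ?R. indicator N (r *\<^sub>R \<zeta>) = (0 :: ennreal)"
      using elim by (subst (asm) nn_integral_0_iff_AE) auto
    then have "AE r in lborel. 0 < ennreal (indicator {0<..<1} r * (2 * real CARD('n) * r ^ (2 * CARD('n) - 1))) \<longrightarrow> indicator N (r *\<^sub>R \<zeta>) = (0 :: ennreal)"
      unfolding radial_meas_def by (subst (asm) AE_density) auto
    then show ?case by eventually_elim (auto simp: indicator_def split: if_splits)
  qed
qed

lemma L_norm_cong:
  fixes \<phi> \<psi> :: "complex ^ 'n \<Rightarrow> complex"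
  assumes N: "N \<in> null_sets lborel" and eq: "\<And>w. w \<in> ball 0 1 - N \<Longrightarrow> \<phi> w = \<psi> w"
  shows "L_norm p \<omega> \<phi> = L_norm p \<omega> \<psi>"
proof -
  have "AE \<zeta> in sphere_meas. (\<integral>\<^sup>+r\<in>{0<..<1}. ennreal ((norm (\<phi> (r *\<^sub>R \<zeta>)))\<^sup>2 * (2 * real CARD('n) * r ^ (2 * CARD('n) - 1) / (1 - r\<^sup>2))) \<partial>lebesgue)
    = (\<integral>\<^sup>+r\<in>{0<..<1}. ennreal ((norm (\<psi> (r *\<^sub>R \<zeta>)))\<^sup>2 * (2 * real CARD('n) * r ^ (2 * CARD('n) - 1) / (1 - r\<^sup>2))) \<partial>lebesgue)"
    using null_set_radial[OF N] AE_space
  proof eventually_elim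
    case (elim \<zeta>)
    then have \<zeta>: "norm \<zeta> = 1" by simp
    have "AE r in lebesgue. 0 < r \<and> r < 1 \<longrightarrow> r *\<^sub>R \<zeta> \<notin> N" using elim(1) by (rule AE_completion)
    then show ?case
      by (intro nn_integral_cong_AE, eventually_elim) (use \<zeta> eq in \<open>auto simp: indicator_def\<close>)
  qed
  then show ?thesis unfolding L_norm_def
    by (intro arg_cong2[where f=epowr] nn_integral_cong_AE refl, eventually_elim) (simp only:)
qed

lemma L_norm_cong_ball:
  "(\<And>w. norm w < 1 \<Longrightarrow> \<phi> w = \<psi> w) \<Longrightarrow> L_norm p \<omega> \<phi> = L_norm p \<omega> \<psi>"
  by (rule L_norm_cong[of "{}"]) auto

lemma L_norm_area:
  fixes \<phi> :: "complex ^ 'n \<Rightarrow> complex"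
  assumes [measurable]: "\<phi> \<in> borel_measurable borel" "\<omega> \<in> borel_measurable sphere_meas" and p: "0 < p"
  shows "L_norm p \<omega> \<phi> = Lp_norm p (density sphere_meas (\<lambda>\<zeta>. ennreal (\<omega> \<zeta>))) (\<lambda>\<zeta>. epowr (area \<phi> \<zeta>) (1 / 2))"
proof -
  have inner: "(\<integral>\<^sup>+r\<in>{0<..<1}. ennreal ((norm (\<phi> (r *\<^sub>R \<zeta>)))\<^sup>2 * (2 * real CARD('n) * r ^ (2 * CARD('n) - 1) / (1 - r\<^sup>2))) \<partial>lebesgue) = area \<phi> \<zeta>" for \<zeta>
  proof -
    have "area \<phi> \<zeta> = (\<integral>\<^sup>+r. ennreal (indicator {0<..<1} r * (2 * real CARD('n) * r ^ (2 * CARD('n) - 1))) * ((ennreal (norm (\<phi> (r *\<^sub>R \<zeta>))))\<^sup>2 * ennreal (1 / (1 - r\<^sup>2))) \<partial>lborel)"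
      unfolding area_def radial_meas_def by (rule nn_integral_density) auto
    also have "\<dots> = (\<integral>\<^sup>+r\<in>{0<..<1}. ennreal ((norm (\<phi> (r *\<^sub>R \<zeta>)))\<^sup>2 * (2 * real CARD('n) * r ^ (2 * CARD('n) - 1) / (1 - r\<^sup>2))) \<partial>lborel)"
    proof (rule nn_integral_cong)
      fix r :: real
      show "ennreal (indicator {0<..<1} r * (2 * real CARD('n) * r ^ (2 * CARD('n) - 1))) * ((ennreal (norm (\<phi> (r *\<^sub>R \<zeta>))))\<^sup>2 * ennreal (1 / (1 - r\<^sup>2)))
        = ennreal ((norm (\<phi> (r *\<^sub>R \<zeta>)))\<^sup>2 * (2 * real CARD('n) * r ^ (2 * CARD('n) - 1) / (1 - r\<^sup>2))) * indicator {0<..<1} r"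
      proof (cases "0 < r \<and> r < 1")
        case True
        then have X: "0 < 1 - r\<^sup>2" by (simp add: power_less_one_iff abs_square_less_1)
        have "ennreal a * ((ennreal b)\<^sup>2 * ennreal c) = ennreal (b\<^sup>2 * (a * c))" if "0 \<le> a" "0 \<le> b" "0 \<le> c" for a b c
          using that by (simp add: ennreal_mult ennreal_power mult_ac)
        from this[of "2 * real CARD('n) * r ^ (2 * CARD('n) - 1)" "norm (\<phi> (r *\<^sub>R \<zeta>))" "1 / (1 - r\<^sup>2)"]
        show ?thesis using True X by (simp add: indicator_def)
      qed (auto simp: indicator_def)
    qed
    finally show ?thesis by (simp add: nn_integral_completion)
  qed
  have [measurable]: "area \<phi> \<in> borel_measurable sphere_meas"
    by (rule measurable_sphere_meas) measurable
  show ?thesis unfolding L_norm_def inner Lp_norm_def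
    by (subst nn_integral_density) (auto simp: epowr_epowr mult.commute)
qed

lemma weight_facts:
  fixes \<omega> :: "complex ^ 'n \<Rightarrow> real"
  assumes p: "1 < p" and w: "weight \<omega>"
  shows "\<omega> \<in> borel_measurable sphere_meas" "dual_weight p \<omega> \<in> borel_measurable sphere_meas"
    "finite_measure (density sphere_meas (\<lambda>\<zeta>. ennreal (\<omega> \<zeta>)))"
    "AE \<zeta> in sphere_meas. ennreal (\<omega> \<zeta>) * epowr (ennreal (dual_weight p \<omega> \<zeta>)) (p - 1) = 1"
proof -
  show m [measurable]: "\<omega> \<in> borel_measurable sphere_meas" using w by (auto simp: weight_def)
  show "dual_weight p \<omega> \<in> borel_measurable sphere_meas" unfolding dual_weight_def[abs_def] by measurable
  have "(\<integral>\<^sup>+\<zeta>. ennreal (\<omega> \<zeta>) \<partial>sphere_meas) < \<infinity>"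
  proof -
    have "(\<integral>\<^sup>+\<zeta>. ennreal (\<omega> \<zeta>) \<partial>sphere_meas) \<le> (\<integral>\<^sup>+\<zeta>. ennreal (norm (\<omega> \<zeta>)) \<partial>sphere_meas)"
      by (intro nn_integral_mono ennreal_leI) simp
    then show ?thesis using w by (auto simp: weight_def integrable_iff_bounded)
  qed
  moreover have "emeasure (density sphere_meas (\<lambda>\<zeta>. ennreal (\<omega> \<zeta>))) (space sphere_meas) = (\<integral>\<^sup>+\<zeta>. ennreal (\<omega> \<zeta>) \<partial>sphere_meas)"
    by (subst emeasure_density) (auto intro!: nn_integral_cong simp del: space_sphere_meas)
  ultimately show "finite_measure (density sphere_meas (\<lambda>\<zeta>. ennreal (\<omega> \<zeta>)))"
    by (intro finite_measureI) simp
  have "AE \<zeta> in sphere_meas. 0 < \<omega> \<zeta>" using w by (auto simp: weight_def)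
  then show "AE \<zeta> in sphere_meas. ennreal (\<omega> \<zeta>) * epowr (ennreal (dual_weight p \<omega> \<zeta>)) (p - 1) = 1"
  proof eventually_elim
    case (elim \<zeta>)
    have "- (conj_exponent p - 1) * (p - 1) = - 1" using p by (simp add: conj_exponent_facts)
    then have "\<omega> \<zeta> * dual_weight p \<omega> \<zeta> powr (p - 1) = \<omega> \<zeta> * \<omega> \<zeta> powr (- 1)"
      by (simp add: dual_weight_def powr_powr)
    also have "\<dots> = 1" using elim by (simp add: powr_minus)
    finally show ?case using elim
      by (simp add: epowr_ennreal dual_weight_def flip: ennreal_mult)
  qed
qed

lemma Ap_const_bound:
  fixes \<omega> :: "complex ^ 'n \<Rightarrow> real"
  assumes "norm \<zeta> = 1" "0 < r" and pos: "emeasure sphere_meas (noniso_ball \<zeta> r) \<noteq> 0" and p: "1 < p"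
  shows "weight_mass \<omega> (noniso_ball \<zeta> r) * epowr (weight_mass (dual_weight p \<omega>) (noniso_ball \<zeta> r)) (p - 1)
    \<le> Ap_const p \<omega> * epowr (emeasure sphere_meas (noniso_ball \<zeta> r)) p"
proof -
  let ?B = "noniso_ball \<zeta> r"
  let ?L = "weight_mass \<omega> ?B * epowr (weight_mass (dual_weight p \<omega>) ?B) (p - 1)"
  have "?L / epowr (emeasure sphere_meas ?B) p \<le> Ap_const p \<omega>"
    unfolding Ap_const_def conj_exponent_facts(5)[OF p] using assms by (intro SUP_upper) auto
  then have "?L / epowr (emeasure sphere_meas ?B) p * epowr (emeasure sphere_meas ?B) p \<le> Ap_const p \<omega> * epowr (emeasure sphere_meas ?B) p"
    by (rule mult_right_mono) simp
  moreover have "emeasure sphere_meas ?B \<noteq> top"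
    by (rule finite_measure.emeasure_finite[OF finite_measure_sphere_meas])
  ultimately show ?thesis using pos
    by (simp add: ennreal_divide_times ennreal_times_divide mult_divide_eq_ennreal)
qed

lemma noniso_ball_eq: "noniso_ball \<zeta> r = {\<eta> \<in> space sphere_meas. sdist \<zeta> \<eta> < r}"
  by (simp add: noniso_ball_def)

lemma noniso_ball_whole:
  assumes "norm \<zeta> = 1" shows "noniso_ball \<zeta> 3 = sphere 0 1"
proof -
  have "sdist \<zeta> \<eta> < 3" if "norm \<eta> = 1" for \<eta>
    using norm_triangle_ineq4[of 1 "cdot \<zeta> \<eta>"] norm_cdot_le[of \<zeta> \<eta>] assms that by simp
  then show ?thesis by (auto simp: noniso_ball_def)
qed

text \<open>The \<open>A\<^sub>p\<close> condition for the ball of radius 3, which is the whole sphere, together with \<open>\<omega> >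
  0\<close>.\<close>
lemma dual_mass_finite:
  fixes \<omega> :: "complex ^ 'n \<Rightarrow> real"
  assumes p: "1 < p" and w: "weight \<omega>" and A: "Ap_const p \<omega> < \<infinity>"
  shows "(\<integral>\<^sup>+\<zeta>. ennreal (dual_weight p \<omega> \<zeta>) \<partial>sphere_meas) < \<infinity>"
proof -
  obtain j :: 'n where True by simp
  define \<zeta> :: "complex ^ 'n" where "\<zeta> = axis j 1"
  have "(norm \<zeta>)\<^sup>2 = 1" by (simp add: \<zeta>_def norm_sq_cdot cdot_axis)
  then have \<zeta>: "norm \<zeta> = 1" using norm_ge_zero[of \<zeta>] by (auto simp: power2_eq_1_iff simp del: norm_ge_zero)
  note [measurable] = weight_facts(1,2)[OF p w]
  have mass: "weight_mass f (sphere 0 1) = (\<integral>\<^sup>+\<zeta>. ennreal (f \<zeta>) \<partial>sphere_meas)" for f :: "complex ^ 'n \<Rightarrow> real"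
    unfolding weight_mass_def by (intro nn_integral_cong) (auto simp: indicator_def)
  have "(\<integral>\<^sup>+\<zeta>. ennreal (\<omega> \<zeta>) \<partial>sphere_meas) * epowr (\<integral>\<^sup>+\<zeta>. ennreal (dual_weight p \<omega> \<zeta>) \<partial>sphere_meas) (p - 1)
    \<le> Ap_const p \<omega> * epowr 1 p"
    using Ap_const_bound[OF \<zeta>, of 3 p \<omega>] p by (simp add: noniso_ball_whole[OF \<zeta>] emeasure_sphere_UNIV mass)
  then have fin: "(\<integral>\<^sup>+\<zeta>. ennreal (\<omega> \<zeta>) \<partial>sphere_meas) * epowr (\<integral>\<^sup>+\<zeta>. ennreal (dual_weight p \<omega> \<zeta>) \<partial>sphere_meas) (p - 1) < top"
    using A by (auto simp: less_top top_unique)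
  moreover have "(\<integral>\<^sup>+\<zeta>. ennreal (\<omega> \<zeta>) \<partial>sphere_meas) \<noteq> 0"
  proof
    assume "(\<integral>\<^sup>+\<zeta>. ennreal (\<omega> \<zeta>) \<partial>sphere_meas) = 0"
    then have "AE \<zeta> in sphere_meas. ennreal (\<omega> \<zeta>) = 0" by (subst (asm) nn_integral_0_iff_AE) auto
    moreover have "AE \<zeta> in sphere_meas. 0 < \<omega> \<zeta>" using w by (simp add: weight_def)
    ultimately have "AE \<zeta> in (sphere_meas :: (complex ^ 'n) measure). (1::ennreal) = 0" by eventually_elim auto
    then have "(\<integral>\<^sup>+\<zeta>. 1 \<partial>(sphere_meas :: (complex ^ 'n) measure)) = 0"
      by (subst nn_integral_0_iff_AE) auto
    then show False by (simp add: emeasure_sphere_UNIV)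
  qed
  ultimately show ?thesis by (auto simp: ennreal_mult_less_top less_top top_unique ennreal_mult_top)
qed

text \<open>This is \<open>(1 - \<bar>z\<bar>\<^sup>2) (I + R/n)\<close> applied to the Bergman integral, with the derivative carried
  out under the integral.\<close>
definition transformed :: "(complex ^ 'n \<Rightarrow> complex) \<Rightarrow> complex ^ 'n \<Rightarrow> complex" where
  "transformed \<phi> z = complex_of_real (1 - (norm z)\<^sup>2) *
     (\<integral>w. \<phi> w * ((1 + cdot z w / of_nat CARD('n)) / (1 - cdot z w) ^ (CARD('n) + 2)) \<partial>ball_meas)"

lemma measurable_transformed:
  fixes \<phi> :: "complex ^ 'n \<Rightarrow> complex"
  assumes [measurable]: "\<phi> \<in> borel_measurable borel"
  shows "transformed \<phi> \<in> borel_measurable borel"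
proof -
  interpret finite_measure "ball_meas :: (complex ^ 'n) measure" by (rule finite_measure_ball_meas)
  have [measurable]: "snd \<in> borel_measurable ((borel :: (complex ^ 'n) measure) \<Otimes>\<^sub>M (ball_meas :: (complex ^ 'n) measure))"
  proof -
    have "(\<lambda>x. x) \<in> borel_measurable (ball_meas :: (complex ^ 'n) measure)" by (rule measurable_ball_meas) simp
    then show ?thesis by (rule measurable_compose[OF measurable_snd])
  qed
  have [measurable]: "fst \<in> borel_measurable ((borel :: (complex ^ 'n) measure) \<Otimes>\<^sub>M (ball_meas :: (complex ^ 'n) measure))"
    by (rule measurable_fst)
  have "(\<lambda>x. \<phi> (snd x) * ((1 + cdot (fst x) (snd x) / of_nat CARD('n)) / (1 - cdot (fst x) (snd x)) ^ (CARD('n) + 2))) \<in> borel_measurable (borel \<Otimes>\<^sub>M ball_meas)"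
    by measurable
  then have [measurable]: "(\<lambda>z. \<integral>w. \<phi> w * ((1 + cdot z w / of_nat CARD('n)) / (1 - cdot z w) ^ (CARD('n) + 2)) \<partial>ball_meas) \<in> borel_measurable borel"
    by (intro borel_measurable_lebesgue_integral) (simp add: case_prod_beta)
  show ?thesis unfolding transformed_def[abs_def] by measurable
qed

lemma F_norm_bergman:
  fixes \<phi> :: "complex ^ 'n \<Rightarrow> complex"
  assumes "integrable ball_meas \<phi>"
  shows "F_norm p \<omega> (bergman \<phi>) = L_norm p \<omega> (transformed \<phi>)"
  unfolding F_norm_def
  by (rule L_norm_cong_ball) (simp add: bergman_radial_formula[OF assms] transformed_def)

lemma bergman_cong:
  fixes \<phi> \<psi> :: "complex ^ 'n \<Rightarrow> complex"
  assumes \<phi>: "\<phi> \<in> borel_measurable ball_meas" and \<psi>: "\<psi> \<in> borel_measurable borel"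
    and N: "N \<in> null_sets lborel" "\<And>w. w \<in> ball 0 1 - N \<Longrightarrow> \<phi> w = \<psi> w"
  shows "bergman \<phi> = bergman \<psi>" "integrable ball_meas \<phi> \<longleftrightarrow> integrable ball_meas \<psi>"
proof -
  have \<psi>': "\<psi> \<in> borel_measurable ball_meas" using \<psi> by (rule measurable_ball_meas)
  have ae: "AE w in ball_meas. \<phi> w = \<psi> w"
    using AE_ball_meas[OF N(1)] AE_space by eventually_elim (use N(2) in auto)
  show "integrable ball_meas \<phi> \<longleftrightarrow> integrable ball_meas \<psi>"
    by (rule integrable_cong_AE[OF \<phi> \<psi>' ae])
  show "bergman \<phi> = bergman \<psi>"
  proof
    fix z :: "complex ^ 'n"
    have "(\<lambda>w. 1 / (1 - cdot z w) ^ (CARD('n) + 1)) \<in> borel_measurable ball_meas"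
      by (rule measurable_ball_meas) measurable
    then have k: "(\<lambda>w. f w * (1 / (1 - cdot z w) ^ (CARD('n) + 1))) \<in> borel_measurable ball_meas"
      if "f \<in> borel_measurable ball_meas" for f
      using that by (rule borel_measurable_times[rotated])
    show "bergman \<phi> z = bergman \<psi> z"
      unfolding bergman_def using k[OF \<phi>] k[OF \<psi>'] ae
      by (intro integral_cong_AE) (auto elim!: eventually_mono)
  qed
qed

lemma transformed_bound:
  fixes \<phi> :: "complex ^ 'n \<Rightarrow> complex"
  assumes int: "integrable ball_meas \<phi>" and \<phi>: "\<phi> \<in> borel_measurable borel"
    and \<zeta>: "norm \<zeta> = 1" and r: "0 < r" "r < 1"
  shows "ennreal (norm (transformed \<phi> (r *\<^sub>R \<zeta>)))
    \<le> ennreal (2 * (1 - r\<^sup>2)) * (\<Sum>k. (if 1 - r\<^sup>2 < 4 * \<delta> k then ennreal (1 / \<delta> k) else 0) * sph_avg k (shell_avg \<phi> k) \<zeta>)"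
proof -
  have z: "norm (r *\<^sub>R \<zeta>) = r" using \<zeta> r by simp
  then have z1: "norm (r *\<^sub>R \<zeta>) < 1" using r by simp
  have X: "0 \<le> 1 - r\<^sup>2" using r by (simp add: power_le_one)
  have "norm (transformed \<phi> (r *\<^sub>R \<zeta>)) = (1 - r\<^sup>2) * norm (bergman \<phi> (r *\<^sub>R \<zeta>) + radial_deriv (bergman \<phi>) (r *\<^sub>R \<zeta>) / of_nat CARD('n))"
    unfolding transformed_def bergman_radial_formula[OF int z1] z using X
    by (simp only: norm_mult norm_of_real abs_of_nonneg)
  then have "ennreal (norm (transformed \<phi> (r *\<^sub>R \<zeta>))) = ennreal (1 - r\<^sup>2) * ennreal (norm (bergman \<phi> (r *\<^sub>R \<zeta>) + radial_deriv (bergman \<phi>) (r *\<^sub>R \<zeta>) / of_nat CARD('n)))"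
    using X by (simp only: ennreal_mult'[OF X])
  also have "\<dots> \<le> ennreal (1 - r\<^sup>2) * (ennreal 2 * potential \<phi> (r *\<^sub>R \<zeta>))"
    by (intro mult_left_mono bergman_radial_bound[OF int z1 \<phi>]) simp
  also have "\<dots> = ennreal (2 * (1 - r\<^sup>2)) * potential \<phi> (r *\<^sub>R \<zeta>)"
    using X by (subst ennreal_mult) (auto simp: mult_ac)
  also have "\<dots> \<le> ennreal (2 * (1 - r\<^sup>2)) * (\<Sum>k. (if 1 - r\<^sup>2 < 4 * \<delta> k then ennreal (1 / \<delta> k) else 0) * sph_avg k (shell_avg \<phi> k) \<zeta>)"
    by (intro mult_left_mono potential_le[OF \<phi> \<zeta> r]) simp
  finally show ?thesis .
qed

text \<open>The radial measure is a probability measure and \<open>1 / (1 - r\<^sup>2) \<ge> 1\<close>, so the mean of \<open>\<bar>\<phi>\<bar>\<close> on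
  a radius is at most the square root of \<open>area\<close>. Over the sphere, Hoelder's inequality with \<open>1 =
  \<omega>\<^sup>1\<^sup>/\<^sup>p \<omega>'\<^sup>1\<^sup>/\<^sup>p'\<close> applies, since \<open>\<omega>'\<close> has finite mass.\<close>
lemma L_space_integrable:
  fixes \<phi> :: "complex ^ 'n \<Rightarrow> complex" and \<omega> :: "complex ^ 'n \<Rightarrow> real"
  assumes p: "1 < p" and w: "weight \<omega>" and A: "Ap_const p \<omega> < \<infinity>"
    and [measurable]: "\<phi> \<in> borel_measurable borel" and L: "L_norm p \<omega> \<phi> < \<infinity>"
  shows "integrable ball_meas \<phi>"
proof -
  let ?R = "radial_meas CARD('n)"
  interpret R: finite_measure ?R by (rule finite_radial) simp
  note [measurable] = weight_facts(1,2)[OF p w]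
  have [measurable]: "area \<phi> \<in> borel_measurable sphere_meas"
    by (rule measurable_sphere_meas) measurable
  let ?w = "\<lambda>\<zeta>. ennreal (\<omega> \<zeta>)" and ?v = "\<lambda>\<zeta>. ennreal (dual_weight p \<omega> \<zeta>)"
  let ?q = "conj_exponent p"
  let ?g = "\<lambda>\<zeta>. epowr (area \<phi> \<zeta>) (1 / 2)"
  have q: "1 < ?q" using conj_exponent_facts[OF p] by simp
  have inner: "(\<integral>\<^sup>+r. ennreal (norm (\<phi> (r *\<^sub>R \<zeta>))) \<partial>?R) \<le> ?g \<zeta>" for \<zeta>
  proof -
    have "(\<integral>\<^sup>+r. ennreal (norm (\<phi> (r *\<^sub>R \<zeta>))) \<partial>?R)\<^sup>2
      = (\<integral>\<^sup>+r. ennreal (norm (\<phi> (r *\<^sub>R \<zeta>))) * 1 \<partial>?R)\<^sup>2" by simp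
    also have "\<dots> \<le> (\<integral>\<^sup>+r. (ennreal (norm (\<phi> (r *\<^sub>R \<zeta>))))\<^sup>2 \<partial>?R) * (\<integral>\<^sup>+r. 1\<^sup>2 \<partial>?R)"
      by (rule nn_integral_Cauchy_Schwarz) measurable
    also have "(\<integral>\<^sup>+r. 1\<^sup>2 \<partial>?R) = 1"
      using emeasure_radial_UNIV[of "CARD('n)"] by (simp add: radial_meas_def)
    also have "(\<integral>\<^sup>+r. (ennreal (norm (\<phi> (r *\<^sub>R \<zeta>))))\<^sup>2 \<partial>?R) * 1 \<le> area \<phi> \<zeta>"
      unfolding area_def mult_1_right
    proof (rule nn_integral_mono_AE, use AE_radial in eventually_elim)
      case (elim r)
      then have "0 < 1 - r\<^sup>2" "1 - r\<^sup>2 \<le> 1" by (auto simp: power_less_one_iff abs_square_less_1)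
      then have "ennreal 1 \<le> ennreal (1 / (1 - r\<^sup>2))" by (intro ennreal_leI) (simp add: field_simps)
      then show ?case using mult_left_mono[of 1 "ennreal (1 / (1 - r\<^sup>2))" "(ennreal (norm (\<phi> (r *\<^sub>R \<zeta>))))\<^sup>2"] by simp
    qed
    finally have "epowr ((\<integral>\<^sup>+r. ennreal (norm (\<phi> (r *\<^sub>R \<zeta>))) \<partial>?R)\<^sup>2) (1/2) \<le> ?g \<zeta>"
      by (rule epowr_mono) simp
    then show ?thesis by (simp add: epowr_epowr flip: epowr_2)
  qed
  have "(\<integral>\<^sup>+w. ennreal (norm (\<phi> w)) \<partial>ball_meas) = (\<integral>\<^sup>+w. ennreal (norm (\<phi> w)) \<partial>nu)"
    by (rule nn_integral_ball_meas) measurable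
  also have "\<dots> = (\<integral>\<^sup>+\<zeta>. (\<integral>\<^sup>+r. ennreal (norm (\<phi> (r *\<^sub>R \<zeta>))) \<partial>?R) \<partial>sphere_meas)"
    by (rule polar_coordinates) measurable
  also have "\<dots> \<le> (\<integral>\<^sup>+\<zeta>. ?g \<zeta> \<partial>sphere_meas)"
    by (intro nn_integral_mono inner)
  also have "\<dots> = (\<integral>\<^sup>+\<zeta>. (epowr (?w \<zeta>) (1 / p) * ?g \<zeta>) * epowr (?v \<zeta>) (1 / ?q) \<partial>sphere_meas)"
  proof (rule nn_integral_cong_AE, use weight_facts(4)[OF p w] in eventually_elim)
    case (elim \<zeta>)
    have "epowr (?w \<zeta>) (1 / p) * epowr (?v \<zeta>) ((p - 1) * (1 / p)) = epowr (?w \<zeta> * epowr (?v \<zeta>) (p - 1)) (1 / p)"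
      using p by (simp only: epowr_mult[of "1/p"] epowr_epowr zero_less_divide_1_iff)
    moreover have "(p - 1) * (1 / p) = 1 / ?q" using p by (simp add: conj_exponent_def field_simps)
    ultimately have "epowr (?w \<zeta>) (1 / p) * epowr (?v \<zeta>) (1 / ?q) = 1" using elim by simp
    then show ?case by (metis mult.assoc mult.commute mult_1_right)
  qed
  also have "\<dots> \<le> Lp_norm p sphere_meas (\<lambda>\<zeta>. epowr (?w \<zeta>) (1 / p) * ?g \<zeta>) * Lp_norm ?q sphere_meas (\<lambda>\<zeta>. epowr (?v \<zeta>) (1 / ?q))"
    by (rule Lp_norm_Hoelder[OF _ _ p]) measurable
  also have "Lp_norm p sphere_meas (\<lambda>\<zeta>. epowr (?w \<zeta>) (1 / p) * ?g \<zeta>) = L_norm p \<omega> \<phi>"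
    using p by (subst L_norm_area) (auto simp: Lp_norm_def nn_integral_density epowr_mult epowr_epowr)
  also have "Lp_norm ?q sphere_meas (\<lambda>\<zeta>. epowr (?v \<zeta>) (1 / ?q)) = epowr (\<integral>\<^sup>+\<zeta>. ?v \<zeta> \<partial>sphere_meas) (1 / ?q)"
    using q by (simp add: Lp_norm_def epowr_epowr)
  also have "L_norm p \<omega> \<phi> * epowr (\<integral>\<^sup>+\<zeta>. ?v \<zeta> \<partial>sphere_meas) (1 / ?q) < top"
    using L dual_mass_finite[OF p w A] by (simp add: ennreal_mult_less_top)
  finally have "(\<integral>\<^sup>+w. ennreal (norm (\<phi> w)) \<partial>ball_meas) < \<infinity>" by simp
  moreover have "\<phi> \<in> borel_measurable ball_meas" by (rule measurable_ball_meas) measurable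
  ultimately show ?thesis by (simp add: integrable_iff_bounded)
qed

text \<open>The chain of estimates is: the norm of the image is at most that of the square function of
  the spherical averages of shell averages, the weighted square function bound removes the
  spherical averages, and the square function of the shell averages is controlled by the norm of
  \<open>\<phi>\<close>.\<close>
theorem bergman_bound_Ap:
  assumes p: "1 < p"
  shows "\<exists>K. 0 < K \<and> (\<forall>\<omega> :: complex ^ 'n \<Rightarrow> real. weight \<omega> \<longrightarrow> Ap_const p \<omega> < \<infinity> \<longrightarrow> (\<forall>\<phi>\<in>L_space p \<omega>.
    integrable ball_meas \<phi> \<and> F_norm p \<omega> (bergman \<phi>) \<le> ennreal K * epowr (Ap_const p \<omega>) (max 1 (1 / (p - 1))) * L_norm p \<omega> \<phi>))"
proof -
  obtain c C where H: "homogeneous_space (sphere_meas :: (complex ^ 'n) measure) sdist CARD('n) c C"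
    using sphere_homogeneous by blast
  interpret H: homogeneous_space "sphere_meas :: (complex ^ 'n) measure" sdist "CARD('n)" c C by (rule H)
  let ?n = "CARD('n)"
  let ?m = "max 1 (1 / (p - 1))"
  have m: "0 < ?m" by simp
  \<comment> \<open>the passage from \<open>\<bar>B\<bar>\<^sup>p\<close> to \<open>\<delta>\<^sub>k\<^sup>n\<^sup>p\<close> for balls \<open>B\<close> of radius \<open>1146 \<delta>\<^sub>k\<close> costs the factor
    \<open>b\<close>\<close>
  define b where "b = (C * 1146 ^ ?n) powr p"
  have b: "0 \<le> b" by (simp add: b_def)
  \<comment> \<open>the absolute value and the summand 1 make \<open>K\<close> visibly positive\<close>
  define K where "K = sqrt (256 * ?n) * \<bar>H.square_const p\<bar> * b powr ?m * sqrt (64 * ?n) + 1"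
  have K: "0 < K" unfolding K_def by (intro add_nonneg_pos mult_nonneg_nonneg) auto
  have "integrable ball_meas \<phi> \<and> F_norm p \<omega> (bergman \<phi>) \<le> ennreal K * epowr (Ap_const p \<omega>) ?m * L_norm p \<omega> \<phi>"
    if w: "weight \<omega>" and Afin: "Ap_const p \<omega> < \<infinity>" and \<phi>: "\<phi> \<in> L_space p \<omega>" for \<omega> :: "complex ^ 'n \<Rightarrow> real" and \<phi>
  proof -
    have \<phi>m: "\<phi> \<in> borel_measurable ball_meas" and \<phi>L: "L_norm p \<omega> \<phi> < \<infinity>" using \<phi> by (auto simp: L_space_def)
    obtain \<psi> N where \<psi> [measurable]: "\<psi> \<in> borel_measurable borel" and N: "N \<in> null_sets lborel" "\<And>w. w \<in> ball 0 1 - N \<Longrightarrow> \<phi> w = \<psi> w"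
      using Borel_representative[OF \<phi>m] by blast
    have L: "L_norm p \<omega> \<phi> = L_norm p \<omega> \<psi>" by (rule L_norm_cong[OF N])
    have int: "integrable ball_meas \<psi>"
      using \<phi>L unfolding L by (rule L_space_integrable[OF p w Afin \<psi>])
    note [measurable] = weight_facts(1,2)[OF p w]
    let ?w = "\<lambda>\<zeta>. ennreal (\<omega> \<zeta>)" and ?v = "\<lambda>\<zeta>. ennreal (dual_weight p \<omega> \<zeta>)"
    let ?W = "density sphere_meas ?w"
    have finv: "finite_measure (density sphere_meas ?v)"
    proof (rule finite_measureI)
      have "emeasure (density sphere_meas ?v) (space sphere_meas) = (\<integral>\<^sup>+\<zeta>. ?v \<zeta> \<partial>sphere_meas)"
        by (subst emeasure_density) (auto intro!: nn_integral_cong simp del: space_sphere_meas)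
      then show "emeasure (density sphere_meas ?v) (space (density sphere_meas ?v)) \<noteq> \<infinity>"
        using dual_mass_finite[OF p w Afin] by simp
    qed
    define A where "A = Ap_const p \<omega> * ennreal b"
    have mass: "H.mass (\<lambda>\<zeta>. ennreal (f \<zeta>)) r x = weight_mass f (noniso_ball x r)" for f r x
      unfolding H.mass_def weight_mass_def
      by (intro nn_integral_cong) (auto simp: H.ball_ind_def noniso_ball_eq indicator_def)
    have A: "H.mass ?w (1146 * \<delta> k) x * epowr (H.mass ?v (1146 * \<delta> k) x) (p - 1) \<le> A * ennreal (\<delta> k powr (?n * p))"
      if x: "x \<in> space sphere_meas" for x k
    proof -
      have r: "0 < 1146 * \<delta> k" by simp
      have nx: "norm x = 1" using x by simp
      have up: "emeasure sphere_meas (noniso_ball x (1146 * \<delta> k)) \<le> ennreal (C * (1146 * \<delta> k) ^ ?n)"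
        unfolding noniso_ball_eq by (rule H.ball_upper[OF x r])
      have low: "ennreal (c * \<delta> k ^ ?n) \<le> emeasure sphere_meas (noniso_ball x (\<delta> k))"
        unfolding noniso_ball_eq by (rule H.ball_lower[OF x \<delta>_pos \<delta>_le])
      have "noniso_ball x (1146 * \<delta> k) \<in> sets sphere_meas"
      proof -
        have [measurable]: "(\<lambda>\<eta>. sdist x \<eta>) \<in> borel_measurable sphere_meas" by (rule measurable_sphere_meas) measurable
        show ?thesis unfolding noniso_ball_eq by measurable
      qed
      moreover have "noniso_ball x (\<delta> k) \<subseteq> noniso_ball x (1146 * \<delta> k)"
      proof -
        have "\<delta> k \<le> 1146 * \<delta> k" using \<delta>_pos[of k] by linarith
        then show ?thesis by (auto simp: noniso_ball_def intro: less_le_trans)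
      qed
      ultimately have "ennreal (c * \<delta> k ^ ?n) \<le> emeasure sphere_meas (noniso_ball x (1146 * \<delta> k))"
        using low by (meson emeasure_mono order_trans)
      moreover have "0 < c * \<delta> k ^ ?n" using H.cC by simp
      then have "0 < ennreal (c * \<delta> k ^ ?n)" by (simp only: ennreal_less_zero_iff)
      ultimately have pos: "emeasure sphere_meas (noniso_ball x (1146 * \<delta> k)) \<noteq> 0" by (metis leD)
      have "H.mass ?w (1146 * \<delta> k) x * epowr (H.mass ?v (1146 * \<delta> k) x) (p - 1)
        \<le> Ap_const p \<omega> * epowr (emeasure sphere_meas (noniso_ball x (1146 * \<delta> k))) p"
        unfolding mass by (rule Ap_const_bound[OF nx r pos p])
      also have "\<dots> \<le> Ap_const p \<omega> * epowr (ennreal (C * (1146 * \<delta> k) ^ ?n)) p"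
        using p by (intro mult_left_mono epowr_mono up) auto
      also have "epowr (ennreal (C * (1146 * \<delta> k) ^ ?n)) p = ennreal ((C * (1146 * \<delta> k) ^ ?n) powr p)"
        using H.cC by (intro epowr_ennreal) (simp add: less_imp_le)
      also have "(C * (1146 * \<delta> k) ^ ?n) powr p = b * \<delta> k powr (?n * p)"
        using H.cC by (simp add: b_def power_mult_distrib powr_mult powr_powr[symmetric] powr_realpow[symmetric] mult.assoc less_imp_le)
      also have "Ap_const p \<omega> * ennreal (b * \<delta> k powr (?n * p)) = A * ennreal (\<delta> k powr (?n * p))"
        using b by (simp add: A_def ennreal_mult mult.assoc)
      finally show ?thesis .
    qed
    have dy: "H.dyadic_avg k f \<zeta> = sph_avg k f \<zeta>" for k f \<zeta>
      by (simp add: H.dyadic_avg_def sph_avg_def H.ball_ind_def)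
    have [measurable]: "shell_avg \<psi> k \<in> borel_measurable sphere_meas" for k
      by (rule measurable_sphere_meas) measurable
    have [measurable]: "area \<psi> \<in> borel_measurable sphere_meas"
      by (rule measurable_sphere_meas) measurable
    have [measurable]: "sph_avg k (shell_avg \<psi> k) \<in> borel_measurable sphere_meas" for k
      using H.measurable_dyadic_avg[of "shell_avg \<psi> k" "\<lambda>x. x" sphere_meas k] unfolding dy by simp
    have tm: "transformed \<psi> \<in> borel_measurable borel" by (rule measurable_transformed) measurable
    have "F_norm p \<omega> (bergman \<phi>) = L_norm p \<omega> (transformed \<psi>)"
    proof -
      have "bergman \<phi> = bergman \<psi>" by (rule bergman_cong(1)[OF \<phi>m \<psi> N(1)]) (rule N(2))
      then show ?thesis using F_norm_bergman[OF int, of p \<omega>] by simp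
    qed
    also have "\<dots> = Lp_norm p ?W (\<lambda>\<zeta>. epowr (area (transformed \<psi>) \<zeta>) (1 / 2))"
      using p by (intro L_norm_area tm) auto
    also have "\<dots> \<le> Lp_norm p ?W (\<lambda>\<zeta>. ennreal (sqrt (256 * ?n)) * square_fun (\<lambda>k. H.dyadic_avg k (shell_avg \<psi> k)) \<zeta>)"
    proof (rule Lp_norm_mono)
      fix \<zeta> assume "\<zeta> \<in> space ?W"
      then have \<zeta>: "norm \<zeta> = 1" by simp
      show "epowr (area (transformed \<psi>) \<zeta>) (1 / 2) \<le> ennreal (sqrt (256 * ?n)) * square_fun (\<lambda>k. H.dyadic_avg k (shell_avg \<psi> k)) \<zeta>"
        unfolding square_fun_def dy by (rule area_le_square_fun[OF tm]) (rule transformed_bound[OF int \<psi> \<zeta>])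
    qed (use p in simp)
    also have "\<dots> = ennreal (sqrt (256 * ?n)) * Lp_norm p ?W (square_fun (\<lambda>k. H.dyadic_avg k (shell_avg \<psi> k)))"
      using p unfolding dy[abs_def] by (intro Lp_norm_cmult) auto
    also have "Lp_norm p ?W (square_fun (\<lambda>k. H.dyadic_avg k (shell_avg \<psi> k)))
        \<le> ennreal (H.square_const p) * epowr A ?m * Lp_norm p ?W (square_fun (shell_avg \<psi>))"
      using weight_facts(3,4)[OF p w] finv A p
      by (intro H.weighted_square_function_bound) auto
    also have "Lp_norm p ?W (square_fun (shell_avg \<psi>)) \<le> Lp_norm p ?W (\<lambda>\<zeta>. ennreal (sqrt (64 * ?n)) * epowr (area \<psi> \<zeta>) (1 / 2))"
      using p by (intro Lp_norm_mono square_fun_shell_avg_le \<psi>) auto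
    also have "\<dots> = ennreal (sqrt (64 * ?n)) * Lp_norm p ?W (\<lambda>\<zeta>. epowr (area \<psi> \<zeta>) (1 / 2))"
      using p by (intro Lp_norm_cmult) auto
    also have "Lp_norm p ?W (\<lambda>\<zeta>. epowr (area \<psi> \<zeta>) (1 / 2)) = L_norm p \<omega> \<phi>"
      unfolding L using p by (intro L_norm_area[symmetric]) auto
    finally have "F_norm p \<omega> (bergman \<phi>) \<le> ennreal (sqrt (256 * ?n)) * (ennreal (H.square_const p) * epowr A ?m * (ennreal (sqrt (64 * ?n)) * L_norm p \<omega> \<phi>))"
      by (simp add: mult_left_mono)
    also have "epowr A ?m = epowr (Ap_const p \<omega>) ?m * ennreal (b powr ?m)"
      unfolding A_def using m b by (simp only: epowr_mult epowr_ennreal)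
    also have "ennreal (H.square_const p) \<le> ennreal \<bar>H.square_const p\<bar>" by (rule ennreal_leI) simp
    finally have "F_norm p \<omega> (bergman \<phi>) \<le> (ennreal (sqrt (256 * ?n)) * ennreal \<bar>H.square_const p\<bar> * ennreal (b powr ?m) * ennreal (sqrt (64 * ?n))) * epowr (Ap_const p \<omega>) ?m * L_norm p \<omega> \<phi>"
      by (simp add: mult_ac mult_left_mono mult_right_mono)
    also have "ennreal (sqrt (256 * ?n)) * ennreal \<bar>H.square_const p\<bar> * ennreal (b powr ?m) * ennreal (sqrt (64 * ?n)) = ennreal (K - 1)"
      unfolding K_def by (simp add: ennreal_mult)
    also have "ennreal (K - 1) * epowr (Ap_const p \<omega>) ?m * L_norm p \<omega> \<phi> \<le> ennreal K * epowr (Ap_const p \<omega>) ?m * L_norm p \<omega> \<phi>"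
      by (intro mult_right_mono ennreal_leI) auto
    finally have "F_norm p \<omega> (bergman \<phi>) \<le> ennreal K * epowr (Ap_const p \<omega>) ?m * L_norm p \<omega> \<phi>" .
    moreover have "integrable ball_meas \<phi> \<longleftrightarrow> integrable ball_meas \<psi>"
      by (rule bergman_cong(2)[OF \<phi>m \<psi> N(1)]) (rule N(2))
    ultimately show ?thesis using int by simp
  qed
  then show ?thesis using K by blast
qed

section \<open>Necessity of the Muckenhoupt condition\<close>

lemma near_one_power_quotient:
  "\<exists>\<tau>>0. \<forall>e e' :: complex. norm e \<le> \<tau> \<longrightarrow> norm e' \<le> \<tau> \<longrightarrow> 1 / 2 \<le> Re ((1 + e') / (1 + e) ^ m)"
proof -
  have cont: "continuous (at (0, 0)) (\<lambda>x :: complex \<times> complex. Re ((1 + snd x) / (1 + fst x) ^ m))"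
    by (intro continuous_Re isCont_divide isCont_power isCont_add continuous_const isCont_fst isCont_snd continuous_ident) auto
  obtain t where t: "0 < t" "\<And>x. dist x (0, 0) < t \<Longrightarrow> dist (Re ((1 + snd x) / (1 + fst x) ^ m)) 1 < 1 / 2"
  proof -
    have "\<exists>t>0. \<forall>x. dist x (0, 0) < t \<longrightarrow> dist (Re ((1 + snd x) / (1 + fst x) ^ m)) (Re ((1 + snd (0, 0)) / (1 + fst (0, 0)) ^ m)) < 1 / 2"
      using cont unfolding continuous_at_eps_delta by (rule allE[of _ "1 / 2"]) simp
    then show ?thesis using that by auto
  qed
  have "1 / 2 \<le> Re ((1 + e') / (1 + e) ^ m)" if "norm e \<le> t / 3" "norm e' \<le> t / 3" for e e' :: complex
  proof -
    have "dist (e, e') (0, 0) \<le> norm e + norm e'"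
      by (simp add: dist_Pair_Pair sqrt_sum_squares_le_sum)
    also have "\<dots> < t" using that t(1) by simp
    finally have "dist (Re ((1 + e') / (1 + e) ^ m)) 1 < 1 / 2" using t(2)[of "(e, e')"] by simp
    then show ?thesis unfolding dist_real_def by linarith
  qed
  then show ?thesis using t(1) by (intro exI[of _ "t / 3"]) auto
qed

text \<open>On the shell \<open>1 - d < \<bar>z\<bar>, \<bar>w\<bar> < 1 - d/2\<close>, for directions within a small multiple of \<open>d\<close> of
  each other, \<open>1 - z\<cdot>w\<close> is a small complex perturbation of the positive number \<open>t = 1 - r s\<close>,
  which lies between \<open>d/2\<close> and \<open>2d\<close>. There is no cancellation, and the size of the kernel is
  \<open>d\<^sup>-\<^sup>n\<^sup>-\<^sup>2\<close>.\<close>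
lemma kernel_real_part:
  "\<exists>\<epsilon>>0. \<epsilon> \<le> 1 \<and> (\<forall>\<zeta> \<eta> :: complex ^ 'n. \<forall>r s d. norm \<zeta> = 1 \<longrightarrow> norm \<eta> = 1 \<longrightarrow> 0 < d \<longrightarrow> d \<le> 1 / 2 \<longrightarrow>
     1 - d < r \<longrightarrow> r < 1 - d / 2 \<longrightarrow> 1 - d < s \<longrightarrow> s < 1 - d / 2 \<longrightarrow> sdist \<zeta> \<eta> \<le> 4 * \<epsilon> * d \<longrightarrow>
     1 / (2 * (2 * d) ^ (CARD('n) + 2)) \<le> Re ((1 + cdot (r *\<^sub>R \<zeta>) (s *\<^sub>R \<eta>) / of_nat CARD('n)) / (1 - cdot (r *\<^sub>R \<zeta>) (s *\<^sub>R \<eta>)) ^ (CARD('n) + 2)))"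
proof -
  let ?m = "CARD('n) + 2"
  obtain \<tau> where \<tau>: "0 < \<tau>" "\<And>e e' :: complex. norm e \<le> \<tau> \<Longrightarrow> norm e' \<le> \<tau> \<Longrightarrow> 1 / 2 \<le> Re ((1 + e') / (1 + e) ^ ?m)"
    using near_one_power_quotient[of ?m] by blast
  define \<epsilon> where "\<epsilon> = min 1 (\<tau> / 8)"
  have \<epsilon>: "0 < \<epsilon>" "\<epsilon> \<le> 1" "8 * \<epsilon> \<le> \<tau>" using \<tau>(1) by (auto simp: \<epsilon>_def)
  have "1 / (2 * (2 * d) ^ ?m) \<le> Re ((1 + cdot (r *\<^sub>R \<zeta>) (s *\<^sub>R \<eta>) / of_nat CARD('n)) / (1 - cdot (r *\<^sub>R \<zeta>) (s *\<^sub>R \<eta>)) ^ ?m)"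
    if d: "0 < d" "d \<le> 1 / 2" and r: "1 - d < r" "r < 1 - d / 2" and s: "1 - d < s" "s < 1 - d / 2" and near: "sdist \<zeta> \<eta> \<le> 4 * \<epsilon> * d"
    for \<zeta> \<eta> :: "complex ^ 'n" and r s d :: real
  proof -
    define t where "t = 1 - r * s"
    have rs: "0 < r" "r < 1" "0 < s" "s < 1" using d r s by linarith+
    have rs1: "r * s < r" "0 < r * s" using rs by simp_all
    have t1: "d / 2 \<le> t" "t < 1" using rs1 r by (auto simp: t_def)
    have "(1 - r) * (1 - s) \<ge> 0" using rs by simp
    then have "t \<le> (1 - r) + (1 - s)" by (simp add: t_def algebra_simps)
    then have t2: "t \<le> 2 * d" using r s by linarith
    have t0: "0 < t" using t1 d by linarith
    define q where "q = cdot (r *\<^sub>R \<zeta>) (s *\<^sub>R \<eta>)"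
    have q: "q = complex_of_real (r * s) * cdot \<zeta> \<eta>"
      by (simp add: q_def cdot_scaleR_left cdot_scaleR_right mult_ac)
    \<comment> \<open>\<open>1 + e\<close> and, below, \<open>1 + e'\<close> are denominator and numerator relative to their values at \<open>\<zeta> =
      \<eta>\<close>\<close>
    define e where "e = (1 - q) / complex_of_real t - 1"
    have qe: "1 - q = complex_of_real t * (1 + e)" using t0 by (simp add: e_def)
    have "complex_of_real t * e = complex_of_real (r * s) * (1 - cdot \<zeta> \<eta>)"
      using qe by (simp add: q t_def algebra_simps)
    then have "t * norm e = r * s * sdist \<zeta> \<eta>"
      using t0 rs1 by (metis abs_of_pos norm_mult norm_of_real)
    also have "\<dots> \<le> 1 * (4 * \<epsilon> * d)"
    proof (rule mult_mono)
      show "r * s \<le> 1" using rs1 rs by linarith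
    qed (use near in auto)
    finally have "t * norm e \<le> 4 * \<epsilon> * d" by simp
    moreover have "d / 2 * norm e \<le> t * norm e" using t1 by (intro mult_right_mono) auto
    ultimately have "d * norm e \<le> d * (8 * \<epsilon>)" by (simp add: algebra_simps)
    then have ne: "norm e \<le> 8 * \<epsilon>" using d by simp
    define k where "k = 1 + (1 - t) / real CARD('n)"
    have k: "1 \<le> k" using t1 by (simp add: k_def)
    define e' where "e' = - (complex_of_real (t / (real CARD('n) * k)) * e)"
    have "0 \<le> t / (real CARD('n) * k)" using t0 k by simp
    then have "norm e' = t / (real CARD('n) * k) * norm e"
      by (simp only: e'_def norm_minus_cancel norm_mult norm_of_real abs_of_nonneg)
    also have "\<dots> \<le> 1 * norm e"
    proof (intro mult_right_mono)
      have "1 * 1 \<le> real CARD('n) * k" using k by (intro mult_mono) (auto simp: Suc_leI)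
      then show "t / (real CARD('n) * k) \<le> 1" using t1 t0 by (simp add: divide_le_eq)
    qed simp
    finally have ne': "norm e' \<le> 8 * \<epsilon>" using ne by simp
    have "complex_of_real k * (1 + e') = complex_of_real k - complex_of_real (k * (t / (real CARD('n) * k))) * e"
      by (simp add: e'_def algebra_simps)
    also have "k * (t / (real CARD('n) * k)) = t / real CARD('n)" using k by simp
    also have "complex_of_real k - complex_of_real (t / real CARD('n)) * e = 1 + (1 - complex_of_real t * (1 + e)) / of_nat CARD('n)"
      by (simp add: k_def field_simps)
    also have "1 - complex_of_real t * (1 + e) = q" using qe by (simp add: algebra_simps)
    finally have num: "1 + q / of_nat CARD('n) = complex_of_real k * (1 + e')" by simp
    have "(1 + q / of_nat CARD('n)) / (1 - q) ^ ?m = complex_of_real (k / t ^ ?m) * ((1 + e') / (1 + e) ^ ?m)"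
      unfolding num qe power_mult_distrib by simp
    then have "Re ((1 + q / of_nat CARD('n)) / (1 - q) ^ ?m) = k / t ^ ?m * Re ((1 + e') / (1 + e) ^ ?m)"
      by (metis Re_complex_of_real Im_complex_of_real times_complex.sel(1) mult_zero_left diff_zero)
    also have "\<dots> \<ge> 1 / (2 * d) ^ ?m * (1 / 2)"
    proof (rule mult_mono)
      show "1 / (2 * d) ^ ?m \<le> k / t ^ ?m" using k t0 t2 by (intro frac_le power_mono) auto
      show "1 / 2 \<le> Re ((1 + e') / (1 + e) ^ ?m)" using ne ne' \<epsilon>(3) by (intro \<tau>(2)) linarith+
    qed (use k t0 in auto)
    finally show ?thesis by (simp add: q_def mult.commute)
  qed
  then show ?thesis using \<epsilon> by (intro exI[of _ \<epsilon>]) blast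
qed

lemma sphere_Borel_representative:
  fixes f :: "complex ^ 'n \<Rightarrow> real"
  assumes "f \<in> borel_measurable sphere_meas"
  obtains g where "g \<in> borel_measurable borel" "AE \<zeta> in sphere_meas. f \<zeta> = g \<zeta>"
proof -
  obtain g where g: "g \<in> borel_measurable sphere_borel" "AE \<zeta> in sphere_borel. f \<zeta> = g \<zeta>"
    using completion_ex_borel_measurable_real[of f sphere_borel] assms unfolding sphere_meas_eq by blast
  have S: "sphere (0 :: complex ^ 'n) 1 \<in> sets borel" by (intro borel_closed closed_sphere)
  have "(\<lambda>x. indicator (sphere 0 1) x *\<^sub>R g x) \<in> borel_measurable (distr nu borel sgn)"
    using g(1) S unfolding sphere_borel_def by (subst (asm) borel_measurable_restrict_space_iff) auto
  then have m: "(\<lambda>x. indicator (sphere 0 1) x *\<^sub>R g x) \<in> borel_measurable borel" by simp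
  have "AE \<zeta> in sphere_meas. f \<zeta> = g \<zeta>" unfolding sphere_meas_eq using g(2) by (rule AE_completion)
  then have "AE \<zeta> in sphere_meas. f \<zeta> = indicator (sphere 0 1) \<zeta> *\<^sub>R g \<zeta>"
    using AE_space by eventually_elim simp
  with m show ?thesis by (rule that)
qed

lemma shell_mass_ge:
  assumes d: "0 < d" "d \<le> 1 / 2" and n: "0 < n"
  shows "ennreal (d * (n * (1 / 2) ^ (2 * n - 1))) \<le> (\<integral>\<^sup>+r. (if 1 - d < r \<and> r < 1 - d / 2 then 1 else 0) \<partial>radial_meas n)"
proof -
  have "ennreal (d * (n * (1 / 2) ^ (2 * n - 1))) = ennreal (2 * n * (1 / 2) ^ (2 * n - 1)) * ennreal (d / 2)"
    using d by (subst ennreal_mult[symmetric]) auto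
  also have "\<dots> = (\<integral>\<^sup>+r. ennreal (2 * n * (1 / 2) ^ (2 * n - 1)) * indicator {1 - d<..<1 - d / 2} r \<partial>lborel)"
    using d by (subst nn_integral_cmult) auto
  also have "\<dots> \<le> (\<integral>\<^sup>+r. ennreal (indicator {0<..<1} r * (2 * real n * r ^ (2 * n - 1))) * (if 1 - d < r \<and> r < 1 - d / 2 then 1 else 0) \<partial>lborel)"
  proof (rule nn_integral_mono)
    fix r :: real
    show "ennreal (2 * n * (1 / 2) ^ (2 * n - 1)) * indicator {1 - d<..<1 - d / 2} r
      \<le> ennreal (indicator {0<..<1} r * (2 * real n * r ^ (2 * n - 1))) * (if 1 - d < r \<and> r < 1 - d / 2 then 1 else 0)"
    proof (cases "1 - d < r \<and> r < 1 - d / 2")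
      case True
      then have "1 / 2 \<le> r" "0 < r" "r < 1" using d by auto
      then have "(1 / 2) ^ (2 * n - 1) \<le> r ^ (2 * n - 1)" by (intro power_mono) auto
      then have "2 * real n * (1 / 2) ^ (2 * n - 1) \<le> 2 * real n * r ^ (2 * n - 1)" by (rule mult_left_mono) simp
      then show ?thesis using True \<open>0 < r\<close> \<open>r < 1\<close> by (simp add: ennreal_leI)
    qed (auto simp: indicator_def)
  qed
  also have "\<dots> = (\<integral>\<^sup>+r. (if 1 - d < r \<and> r < 1 - d / 2 then 1 else 0) \<partial>radial_meas n)"
    unfolding radial_meas_def by (rule nn_integral_density[symmetric]) auto
  finally show ?thesis .
qed

lemma shell_weighted_mass_le:
  assumes d: "0 < d" "d \<le> 1 / 2"
  shows "(\<integral>\<^sup>+r. (if 1 - d < r \<and> r < 1 - d / 2 then 1 else 0) * ennreal (1 / (1 - r\<^sup>2)) \<partial>radial_meas n) \<le> ennreal (8 * n)"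
proof -
  have "(\<integral>\<^sup>+r. (if 1 - d < r \<and> r < 1 - d / 2 then 1 else 0) * ennreal (1 / (1 - r\<^sup>2)) \<partial>radial_meas n)
    \<le> (\<integral>\<^sup>+r. ennreal (2 / d) * (if 1 - r\<^sup>2 < 2 * d then 1 else 0) \<partial>radial_meas n)"
  proof (rule nn_integral_mono)
    fix r :: real
    show "(if 1 - d < r \<and> r < 1 - d / 2 then 1 else 0) * ennreal (1 / (1 - r\<^sup>2)) \<le> ennreal (2 / d) * (if 1 - r\<^sup>2 < 2 * d then 1 else 0)"
    proof (cases "1 - d < r \<and> r < 1 - d / 2")
      case True
      then have r: "0 < r" "r < 1" using d by auto
      have f: "1 - r\<^sup>2 = (1 - r) * (1 + r)" by (simp add: power2_eq_square algebra_simps)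
      have "d / 2 * 1 \<le> (1 - r) * (1 + r)" using True r d by (intro mult_mono) auto
      then have "1 / (1 - r\<^sup>2) \<le> 1 / (d / 2)" using d unfolding f by (intro divide_left_mono) auto
      moreover have "(1 - r) * (1 + r) < d * 2" using True r d by (intro mult_strict_mono) auto
      ultimately show ?thesis using True d unfolding f by (simp add: ennreal_leI)
    qed auto
  qed
  also have "\<dots> = ennreal (2 / d) * (\<integral>\<^sup>+r. (if 1 - r\<^sup>2 < 2 * d then 1 else 0) \<partial>radial_meas n)"
    by (rule nn_integral_cmult) measurable
  also have "\<dots> \<le> ennreal (2 / d) * ennreal (2 * real n * (2 * d))"
    using d by (intro mult_left_mono radial_shell) auto
  also have "\<dots> = ennreal (8 * n)" using d by (subst ennreal_mult[symmetric]) auto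
  finally show ?thesis .
qed

text \<open>The test function is the dual weight, cut off to the nonisotropic ball \<open>B(\<zeta>\<^sub>0, \<epsilon> d)\<close> and
  extended radially to the shell \<open>1 - d < \<bar>z\<bar> < 1 - d/2\<close>. Its norm is of order \<open>\<omega>'(B)\<^sup>1\<^sup>/\<^sup>p\<close>
  because \<open>\<omega>'\<^sup>p \<omega> = \<omega>'\<close>. By \<open>kernel_real_part\<close> its image is at least a multiple of \<open>d\<^sup>-\<^sup>n \<omega>'(B)\<close>
  on the part of the same shell above \<open>B\<close>, so its norm is at least \<open>d\<^sup>-\<^sup>n \<omega>'(B) \<omega>(B)\<^sup>1\<^sup>/\<^sup>p\<close>.
  Comparing the two and cancelling \<open>\<omega>'(B)\<close> gives the claim. As \<open>\<omega>'(B)\<close> might be infinite, the dual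
  weight is first truncated at height \<open>N\<close>.\<close>
lemma bergman_bounded_imp_small_ball_Ap:
  fixes \<omega> :: "complex ^ 'n \<Rightarrow> real" and p :: real
  assumes p: "1 < p" and w: "weight \<omega>" and bd: "bergman_bounded p \<omega>"
  shows "\<exists>\<epsilon>>0. \<epsilon> \<le> 1 \<and> (\<exists>D. \<forall>\<zeta>0 d. norm \<zeta>0 = 1 \<longrightarrow> 0 < d \<longrightarrow> d \<le> 1 / 2 \<longrightarrow>
    weight_mass \<omega> (noniso_ball \<zeta>0 (\<epsilon> * d)) * epowr (weight_mass (dual_weight p \<omega>) (noniso_ball \<zeta>0 (\<epsilon> * d))) (p - 1)
      \<le> ennreal (D * d powr (CARD('n) * p)))"
proof -
  let ?n = "CARD('n)"
  let ?m = "?n + 2"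
  let ?R = "radial_meas ?n"
  interpret R: finite_measure ?R by (rule finite_radial) simp
  interpret S: finite_measure "sphere_meas :: (complex ^ 'n) measure" by (rule finite_measure_sphere_meas)
  obtain C where C: "\<And>\<phi>. \<phi> \<in> L_space p \<omega> \<Longrightarrow> F_norm p \<omega> (bergman \<phi>) \<le> ennreal C * L_norm p \<omega> \<phi>"
    and int: "\<And>\<phi>. \<phi> \<in> L_space p \<omega> \<Longrightarrow> integrable ball_meas \<phi>"
    using bd unfolding bergman_bounded_def by blast
  obtain \<epsilon> where \<epsilon>: "0 < \<epsilon>" "\<epsilon> \<le> 1" and ker: "\<And>\<zeta> \<eta> :: complex ^ 'n. \<And>r s d. norm \<zeta> = 1 \<Longrightarrow> norm \<eta> = 1 \<Longrightarrow> 0 < d \<Longrightarrow> d \<le> 1 / 2 \<Longrightarrow>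
     1 - d < r \<Longrightarrow> r < 1 - d / 2 \<Longrightarrow> 1 - d < s \<Longrightarrow> s < 1 - d / 2 \<Longrightarrow> sdist \<zeta> \<eta> \<le> 4 * \<epsilon> * d \<Longrightarrow>
     1 / (2 * (2 * d) ^ ?m) \<le> Re ((1 + cdot (r *\<^sub>R \<zeta>) (s *\<^sub>R \<eta>) / of_nat ?n) / (1 - cdot (r *\<^sub>R \<zeta>) (s *\<^sub>R \<eta>)) ^ ?m)"
    using kernel_real_part[where 'n='n] by blast
  note wf = weight_facts[OF p w]
  note [measurable] = wf(1,2)
  obtain g0 where g0: "g0 \<in> borel_measurable borel" "AE \<zeta> in sphere_meas. dual_weight p \<omega> \<zeta> = g0 \<zeta>"
    by (rule sphere_Borel_representative[OF wf(2)])
  define g where "g \<zeta> = \<bar>g0 \<zeta>\<bar>" for \<zeta>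
  have gm [measurable]: "g \<in> borel_measurable borel" unfolding g_def[abs_def] using g0(1) by measurable
  have g_nonneg: "0 \<le> g \<zeta>" for \<zeta> by (simp add: g_def)
  have g: "AE \<zeta> in sphere_meas. dual_weight p \<omega> \<zeta> = g \<zeta>"
    using g0(2)
  proof eventually_elim
    case (elim \<zeta>)
    moreover have "0 \<le> dual_weight p \<omega> \<zeta>" by (simp add: dual_weight_def)
    ultimately show ?case by (simp add: g_def)
  qed
  let ?w = "\<lambda>\<zeta>. ennreal (\<omega> \<zeta>)"
  let ?W = "density sphere_meas ?w"
  define k0 where "k0 = ?n * (1 / 2 :: real) ^ (2 * ?n - 1)"
  have k0: "0 < k0" by (simp add: k0_def)
  define a where "a = k0 / (4 * 2 ^ ?m)"
  have a: "0 < a" using k0 by (simp add: a_def)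
  define D where "D = (\<bar>C\<bar> * sqrt (8 * ?n)) powr p * (a * sqrt (k0 / 2)) powr (- p)"
  have main: "weight_mass \<omega> (noniso_ball \<zeta>0 (\<epsilon> * d)) * epowr (weight_mass (dual_weight p \<omega>) (noniso_ball \<zeta>0 (\<epsilon> * d))) (p - 1)
      \<le> ennreal (D * d powr (?n * p))" if \<zeta>0: "norm \<zeta>0 = 1" and d: "0 < d" "d \<le> 1 / 2" for \<zeta>0 d
  proof -
    let ?B = "noniso_ball \<zeta>0 (\<epsilon> * d)"
    let ?sh = "\<lambda>r. 1 - d < r \<and> r < 1 - d / 2"
    have [measurable]: "(\<lambda>\<eta>. sdist \<zeta>0 \<eta>) \<in> borel_measurable sphere_meas" by (rule measurable_sphere_meas) measurable
    have Bm [measurable]: "?B \<in> sets sphere_meas" unfolding noniso_ball_eq by measurable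
    define q where "q = a * d powr (- ?n)"
    have q: "0 < q" using a d by (simp add: q_def)
    define h where "h N \<zeta> = (if sdist \<zeta>0 \<zeta> < \<epsilon> * d \<and> g \<zeta> \<le> real N then g \<zeta> else 0)" for N \<zeta>
    have hm [measurable]: "h N \<in> borel_measurable borel" for N unfolding h_def[abs_def] by measurable
    have hms [measurable]: "(\<lambda>\<zeta>. ennreal (h N \<zeta>)) \<in> borel_measurable sphere_meas" for N by (rule measurable_sphere_meas) measurable
    have h_nonneg: "0 \<le> h N \<zeta>" "h N \<zeta> \<le> real N" for N \<zeta> by (auto simp: h_def g_nonneg)
    define Hn where "Hn N = (\<integral>\<^sup>+\<zeta>. ennreal (h N \<zeta>) \<partial>sphere_meas)" for N
    have one: "weight_mass \<omega> ?B * epowr (Hn N) (p - 1) \<le> ennreal (D * d powr (?n * p))" for N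
    proof -
      define \<phi> where "\<phi> z = complex_of_real (if ?sh (norm z) then h N (sgn z) else 0)" for z
      have \<phi>m [measurable]: "\<phi> \<in> borel_measurable borel" unfolding \<phi>_def[abs_def] by measurable
      have \<phi>_polar: "\<phi> (r *\<^sub>R \<zeta>) = complex_of_real ((if ?sh r then 1 else 0) * h N \<zeta>)" if "norm \<zeta> = 1" "0 < r" for r \<zeta>
      proof -
        have "sgn \<zeta> = \<zeta>" using that(1) by (simp add: sgn_div_norm)
        then have "sgn (r *\<^sub>R \<zeta>) = \<zeta>" using that by (simp add: sgn_scaleR)
        then show ?thesis using that by (simp add: \<phi>_def)
      qed
      have Hfin: "Hn N < top"
      proof -
        have "Hn N \<le> (\<integral>\<^sup>+\<zeta>. ennreal (real N) \<partial>(sphere_meas :: (complex ^ 'n) measure))"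
          unfolding Hn_def by (intro nn_integral_mono ennreal_leI h_nonneg)
        also have "\<dots> < top" by (simp add: emeasure_sphere_UNIV)
        finally show ?thesis .
      qed
      \<comment> \<open>\<open>h\<^sup>p \<omega> = h\<close>, since \<open>h\<close> coincides with the dual weight where it does not vanish\<close>
      have Lle: "L_norm p \<omega> \<phi> \<le> ennreal (sqrt (8 * ?n)) * epowr (Hn N) (1 / p)"
      proof -
        have ar: "area \<phi> \<zeta> \<le> ennreal (8 * ?n) * (ennreal (h N \<zeta>))\<^sup>2" if \<zeta>: "norm \<zeta> = 1" for \<zeta>
        proof -
          have "area \<phi> \<zeta> = (\<integral>\<^sup>+r. (ennreal (h N \<zeta>))\<^sup>2 * ((if ?sh r then 1 else 0) * ennreal (1 / (1 - r\<^sup>2))) \<partial>?R)"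
            unfolding area_def
          proof (rule nn_integral_cong_AE, use AE_radial in eventually_elim)
            case (elim r)
            then show ?case using h_nonneg[of N \<zeta>] by (simp add: \<phi>_polar[OF \<zeta>])
          qed
          also have "\<dots> = (ennreal (h N \<zeta>))\<^sup>2 * (\<integral>\<^sup>+r. (if ?sh r then 1 else 0) * ennreal (1 / (1 - r\<^sup>2)) \<partial>?R)"
            by (rule nn_integral_cmult) measurable
          also have "\<dots> \<le> (ennreal (h N \<zeta>))\<^sup>2 * ennreal (8 * ?n)"
            by (intro mult_left_mono shell_weighted_mass_le d) simp
          finally show ?thesis by (simp add: mult.commute)
        qed
        have "L_norm p \<omega> \<phi> = Lp_norm p ?W (\<lambda>\<zeta>. epowr (area \<phi> \<zeta>) (1 / 2))"
          using p by (intro L_norm_area) auto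
        also have "\<dots> \<le> Lp_norm p ?W (\<lambda>\<zeta>. ennreal (sqrt (8 * ?n)) * ennreal (h N \<zeta>))"
        proof (rule Lp_norm_mono)
          fix \<zeta> assume "\<zeta> \<in> space ?W"
          then have "epowr (area \<phi> \<zeta>) (1 / 2) \<le> epowr (ennreal (8 * ?n) * (ennreal (h N \<zeta>))\<^sup>2) (1 / 2)"
            by (intro epowr_mono ar) auto
          also have "\<dots> = ennreal (sqrt (8 * ?n)) * ennreal (h N \<zeta>)"
          proof -
            have "epowr ((ennreal (h N \<zeta>))\<^sup>2) (1 / 2) = ennreal (h N \<zeta>)" by (simp add: epowr_epowr flip: epowr_2)
            moreover have "epowr (ennreal (8 * ?n)) (1 / 2) = ennreal (sqrt (8 * ?n))" by (subst epowr_ennreal) (auto simp: powr_half_sqrt)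
            ultimately show ?thesis by (simp add: epowr_mult)
          qed
          finally show "epowr (area \<phi> \<zeta>) (1 / 2) \<le> ennreal (sqrt (8 * ?n)) * ennreal (h N \<zeta>)" .
        qed (use p in simp)
        also have "\<dots> = ennreal (sqrt (8 * ?n)) * Lp_norm p ?W (\<lambda>\<zeta>. ennreal (h N \<zeta>))"
          using p by (intro Lp_norm_cmult) auto
        also have "Lp_norm p ?W (\<lambda>\<zeta>. ennreal (h N \<zeta>)) = epowr (Hn N) (1 / p)"
        proof -
          have "(\<integral>\<^sup>+\<zeta>. epowr (ennreal (h N \<zeta>)) p \<partial>?W) = (\<integral>\<^sup>+\<zeta>. ?w \<zeta> * epowr (ennreal (h N \<zeta>)) p \<partial>sphere_meas)"
            by (rule nn_integral_density) measurable
          also have "\<dots> = Hn N"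
            unfolding Hn_def
          proof (rule nn_integral_cong_AE, use wf(4) g in eventually_elim)
            case (elim \<zeta>)
            show ?case
            proof (cases "h N \<zeta> = 0")
              case False
              then have hg: "h N \<zeta> = dual_weight p \<omega> \<zeta>" using elim(2) by (auto simp: h_def split: if_splits)
              have "epowr (ennreal (h N \<zeta>)) p = ennreal (h N \<zeta>) * epowr (ennreal (h N \<zeta>)) (p - 1)"
                using epowr_add[of "ennreal (h N \<zeta>)" 1 "p - 1"] by simp
              then have "?w \<zeta> * epowr (ennreal (h N \<zeta>)) p = (?w \<zeta> * epowr (ennreal (dual_weight p \<omega> \<zeta>)) (p - 1)) * ennreal (h N \<zeta>)"
                by (simp add: hg mult_ac)
              then show ?thesis using elim(1) by simp
            qed simp
          qed
          finally show ?thesis by (simp add: Lp_norm_def)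
        qed
        finally show ?thesis .
      qed
      have "L_norm p \<omega> \<phi> < top"
        using Lle Hfin by (auto simp: ennreal_mult_less_top intro: le_less_trans)
      then have \<phi>L: "\<phi> \<in> L_space p \<omega>" by (simp add: L_space_def measurable_ball_meas)
      have \<phi>int: "integrable ball_meas \<phi>" by (rule int[OF \<phi>L])
      \<comment> \<open>the image of the test function on the same shell\<close>
      have low: "ennreal (q) * Hn N \<le> ennreal (norm (transformed \<phi> (r *\<^sub>R \<zeta>)))"
        if \<zeta>: "norm \<zeta> = 1" "sdist \<zeta>0 \<zeta> < \<epsilon> * d" and r: "?sh r" for \<zeta> r
      proof -
        have r01: "0 < r" "r < 1" using r d by auto
        let ?z = "r *\<^sub>R \<zeta>"
        have z1: "norm ?z < 1" using \<zeta> r01 by simp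
        define K where "K w = (1 + cdot ?z w / of_nat ?n) / (1 - cdot ?z w) ^ ?m" for w
        define u where "u z = (if ?sh (norm z) then h N (sgn z) else 0)" for z :: "complex ^ 'n"
        have u0: "0 \<le> u z" for z by (simp add: u_def h_nonneg)
        have um [measurable]: "u \<in> borel_measurable borel" unfolding u_def[abs_def] by measurable
        have \<phi>u: "\<phi> w = complex_of_real (u w)" for w by (simp add: \<phi>_def u_def)
        define L where "L = 1 / (2 * (2 * d) ^ ?m)"
        have L0: "0 < L" using d by (simp add: L_def)
        have uint: "integrable ball_meas u"
          using integrable_Re[OF \<phi>int] by (simp add: \<phi>u)
        have Kint: "integrable ball_meas (\<lambda>w. \<phi> w * K w)"
          unfolding K_def
        proof (rule kernel_integrable[OF \<phi>int z1])
          fix w :: "complex ^ 'n" assume nw: "norm w < 1"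
          have "norm (cdot ?z w) \<le> norm ?z * norm w" by (rule norm_cdot_le)
          also have "\<dots> \<le> 1" using z1 nw by (intro mult_le_one) auto
          finally have "norm (cdot ?z w) / real ?n \<le> 1 / 1" by (intro frac_le) (auto simp: Suc_leI)
          then have "norm (cdot ?z w / of_nat ?n) \<le> 1" by (simp only: norm_divide norm_of_nat div_by_1)
          then show "norm (1 + cdot ?z w / of_nat ?n) \<le> 2"
            using norm_triangle_ineq[of 1 "cdot ?z w / of_nat ?n"] by simp
        qed measurable
        have pt: "L * u w \<le> Re (\<phi> w * K w)" if "w \<in> space ball_meas" for w
        proof (cases "u w = 0")
          case True
          then show ?thesis by (simp add: \<phi>u)
        next
          case False
          then have sh: "?sh (norm w)" and hn: "h N (sgn w) \<noteq> 0" by (auto simp: u_def split: if_splits)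
          then have near: "sdist \<zeta>0 (sgn w) < \<epsilon> * d" by (auto simp: h_def split: if_splits)
          have w0: "w \<noteq> 0" using sh d by auto
          then have sw: "norm (sgn w) = 1" by (simp add: norm_sgn)
          have wpol: "norm w *\<^sub>R sgn w = w" using w0 by (simp add: sgn_div_norm)
          have "sdist \<zeta> (sgn w) \<le> 2 * (sdist \<zeta> \<zeta>0 + sdist \<zeta>0 (sgn w))"
            using \<zeta> \<zeta>0 sw by (intro sdist_triangle) auto
          then have "sdist \<zeta> (sgn w) \<le> 4 * \<epsilon> * d" using near \<zeta>(2) sdist_sym[of \<zeta> \<zeta>0] by simp
          then have "L \<le> Re (K (norm w *\<^sub>R sgn w))"
            unfolding L_def K_def using \<zeta> sw d r sh by (intro ker) auto
          then have "L \<le> Re (K w)" by (simp only: wpol)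
          then have "L * u w \<le> Re (K w) * u w" by (rule mult_right_mono) (rule u0)
          then show ?thesis by (simp add: \<phi>u mult.commute)
        qed
        have "L * (\<integral>w. u w \<partial>ball_meas) = (\<integral>w. L * u w \<partial>ball_meas)" by simp
        also have "\<dots> \<le> (\<integral>w. Re (\<phi> w * K w) \<partial>ball_meas)"
          by (intro Bochner_Integration.integral_mono integrable_mult_right uint integrable_Re Kint pt)
        also have "\<dots> = Re (\<integral>w. \<phi> w * K w \<partial>ball_meas)" by (rule integral_Re[OF Kint])
        also have "\<dots> \<le> norm (\<integral>w. \<phi> w * K w \<partial>ball_meas)" by (rule complex_Re_le_cmod)
        finally have Kle: "L * (\<integral>w. u w \<partial>ball_meas) \<le> norm (\<integral>w. \<phi> w * K w \<partial>ball_meas)" .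
        have X: "d / 2 \<le> 1 - r\<^sup>2"
        proof -
          have "d / 2 * 1 \<le> (1 - r) * (1 + r)" using r r01 d by (intro mult_mono) auto
          then show ?thesis by (simp add: power2_eq_square algebra_simps)
        qed
        then have X0: "0 \<le> 1 - r\<^sup>2" using d by linarith
        have I0: "0 \<le> (\<integral>w. u w \<partial>ball_meas)" using u0 by (intro Bochner_Integration.integral_nonneg)
        have "norm (transformed \<phi> ?z) = (1 - r\<^sup>2) * norm (\<integral>w. \<phi> w * K w \<partial>ball_meas)"
        proof -
          have nz: "norm ?z = r" using \<zeta> r01 by simp
          show ?thesis unfolding transformed_def K_def nz using X0
            by (simp only: norm_mult norm_of_real abs_of_nonneg)
        qed
        also have "\<dots> \<ge> d / 2 * (L * (\<integral>w. u w \<partial>ball_meas))"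
          using X X0 Kle L0 I0 d by (intro mult_mono) auto
        finally have ge: "d / 2 * L * (\<integral>w. u w \<partial>ball_meas) \<le> norm (transformed \<phi> ?z)" by (simp add: mult.assoc)
        have "ennreal (\<integral>w. u w \<partial>ball_meas) = (\<integral>\<^sup>+w. ennreal (u w) \<partial>ball_meas)"
          using uint u0 by (intro nn_integral_eq_integral[symmetric]) auto
        also have "\<dots> = (\<integral>\<^sup>+w. ennreal (u w) \<partial>nu)" by (rule nn_integral_ball_meas) measurable
        also have "\<dots> = (\<integral>\<^sup>+\<eta>. (\<integral>\<^sup>+s. ennreal (u (s *\<^sub>R \<eta>)) \<partial>?R) \<partial>sphere_meas)"
          by (rule polar_coordinates) measurable
        also have "\<dots> = (\<integral>\<^sup>+\<eta>. (\<integral>\<^sup>+s. (if ?sh s then 1 else 0) \<partial>?R) * ennreal (h N \<eta>) \<partial>sphere_meas)"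
        proof (rule nn_integral_cong)
          fix \<eta> :: "complex ^ 'n" assume "\<eta> \<in> space sphere_meas"
          then have \<eta>: "norm \<eta> = 1" by simp
          have "(\<integral>\<^sup>+s. ennreal (u (s *\<^sub>R \<eta>)) \<partial>?R) = (\<integral>\<^sup>+s. (if ?sh s then 1 else 0) * ennreal (h N \<eta>) \<partial>?R)"
          proof (rule nn_integral_cong_AE, use AE_radial in eventually_elim)
            case (elim s)
            have "complex_of_real (u (s *\<^sub>R \<eta>)) = complex_of_real ((if ?sh s then 1 else 0) * h N \<eta>)"
              using elim unfolding \<phi>u[symmetric] by (intro \<phi>_polar \<eta>) auto
            then have "u (s *\<^sub>R \<eta>) = (if ?sh s then 1 else 0) * h N \<eta>" by (simp only: of_real_eq_iff)
            then show ?case by simp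
          qed
          also have "\<dots> = (\<integral>\<^sup>+s. (if ?sh s then 1 else 0) \<partial>?R) * ennreal (h N \<eta>)"
            by (rule nn_integral_multc) measurable
          finally show "(\<integral>\<^sup>+s. ennreal (u (s *\<^sub>R \<eta>)) \<partial>?R) = (\<integral>\<^sup>+s. (if ?sh s then 1 else 0) \<partial>?R) * ennreal (h N \<eta>)" .
        qed
        also have "\<dots> = (\<integral>\<^sup>+s. (if ?sh s then 1 else 0) \<partial>?R) * Hn N"
          unfolding Hn_def by (rule nn_integral_cmult) measurable
        also have "\<dots> \<ge> ennreal (d * k0) * Hn N"
          unfolding k0_def using d by (intro mult_right_mono shell_mass_ge) auto
        finally have uge: "ennreal (d * k0) * Hn N \<le> ennreal (\<integral>w. u w \<partial>ball_meas)" .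
        \<comment> \<open>\<open>d / 2\<close> bounds \<open>1 - r\<^sup>2\<close>, \<open>L\<close> the kernel and \<open>d k\<^sub>0\<close> the radial measure of the shell,
          all from below\<close>
        have qe: "q = d / 2 * L * (d * k0)"
        proof -
          have "d powr (- real ?n) = 1 / d ^ ?n" using d by (simp add: powr_minus_divide powr_realpow)
          then show ?thesis using d by (simp add: q_def a_def L_def power_mult_distrib power_add power2_eq_square field_simps)
        qed
        have "ennreal q * Hn N = ennreal (d / 2 * L) * (ennreal (d * k0) * Hn N)"
          unfolding qe using d L0 k0 by (subst ennreal_mult) (auto simp: mult.assoc)
        also have "\<dots> \<le> ennreal (d / 2 * L) * ennreal (\<integral>w. u w \<partial>ball_meas)"
          by (rule mult_left_mono[OF uge]) simp
        also have "\<dots> = ennreal (d / 2 * L * (\<integral>w. u w \<partial>ball_meas))"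
          using d L0 I0 by (intro ennreal_mult[symmetric]) auto
        also have "\<dots> \<le> ennreal (norm (transformed \<phi> ?z))" by (rule ennreal_leI[OF ge])
        finally show ?thesis .
      qed
      have tm: "transformed \<phi> \<in> borel_measurable borel" by (rule measurable_transformed) measurable
      have tms [measurable]: "area (transformed \<phi>) \<in> borel_measurable sphere_meas"
        by (rule measurable_sphere_meas) (rule measurable_area[OF tm])
      let ?Q = "ennreal q * Hn N"
      have Fge: "ennreal (sqrt (k0 / 2)) * ?Q * epowr (weight_mass \<omega> ?B) (1 / p) \<le> F_norm p \<omega> (bergman \<phi>)"
      proof -
        \<comment> \<open>on the shell \<open>1 / (1 - r\<^sup>2) \<ge> 1 / (2 d)\<close>, which is integrated against radial measure at
          least \<open>d k\<^sub>0\<close>\<close>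
        have ar: "ennreal (k0 / 2) * ?Q\<^sup>2 \<le> area (transformed \<phi>) \<zeta>" if \<zeta>: "norm \<zeta> = 1" "sdist \<zeta>0 \<zeta> < \<epsilon> * d" for \<zeta>
        proof -
          have "ennreal (k0 / 2) * ?Q\<^sup>2 = (ennreal (1 / (2 * d)) * ennreal (d * k0)) * ?Q\<^sup>2"
            using d k0 by (subst ennreal_mult[symmetric]) auto
          also have "\<dots> \<le> (ennreal (1 / (2 * d)) * (\<integral>\<^sup>+r. (if ?sh r then 1 else 0) \<partial>?R)) * ?Q\<^sup>2"
            unfolding k0_def using d by (intro mult_right_mono mult_left_mono shell_mass_ge) auto
          also have "\<dots> = (\<integral>\<^sup>+r. ?Q\<^sup>2 * ennreal (1 / (2 * d)) * (if ?sh r then 1 else 0) \<partial>?R)"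
            by (subst nn_integral_cmult) (auto simp: mult_ac)
          also have "\<dots> \<le> area (transformed \<phi>) \<zeta>"
            unfolding area_def
          proof (rule nn_integral_mono)
            fix r
            show "?Q\<^sup>2 * ennreal (1 / (2 * d)) * (if ?sh r then 1 else 0) \<le> (ennreal (norm (transformed \<phi> (r *\<^sub>R \<zeta>))))\<^sup>2 * ennreal (1 / (1 - r\<^sup>2))"
            proof (cases "?sh r")
              case True
              then have r01: "0 < r" "r < 1" using d by auto
              have f: "1 - r\<^sup>2 = (1 - r) * (1 + r)" by (simp add: power2_eq_square algebra_simps)
              have "(1 - r) * (1 + r) \<le> d * 2" using True r01 d by (intro mult_mono) auto
              then have "1 / (2 * d) \<le> 1 / (1 - r\<^sup>2)" unfolding f using r01 d by (intro divide_left_mono) (auto simp: mult.commute)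
              then have "?Q\<^sup>2 * ennreal (1 / (2 * d)) \<le> (ennreal (norm (transformed \<phi> (r *\<^sub>R \<zeta>))))\<^sup>2 * ennreal (1 / (1 - r\<^sup>2))"
                using True by (intro mult_mono power_mono low \<zeta> ennreal_leI) auto
              then show ?thesis using True by simp
            qed auto
          qed
          finally show ?thesis .
        qed
        let ?ind = "indicator ?B :: complex ^ 'n \<Rightarrow> ennreal"
        have "ennreal (sqrt (k0 / 2)) * ?Q * epowr (weight_mass \<omega> ?B) (1 / p) = ennreal (sqrt (k0 / 2)) * ?Q * Lp_norm p ?W ?ind"
        proof -
          have "epowr (?ind \<zeta>) p = ?ind \<zeta>" for \<zeta> by (simp add: indicator_def)
          then have "Lp_norm p ?W ?ind = epowr (weight_mass \<omega> ?B) (1 / p)"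
            by (simp add: Lp_norm_def weight_mass_def emeasure_density)
          then show ?thesis by simp
        qed
        also have "\<dots> = Lp_norm p ?W (\<lambda>\<zeta>. ennreal (sqrt (k0 / 2)) * ?Q * ?ind \<zeta>)"
          using p by (intro Lp_norm_cmult[symmetric]) auto
        also have "\<dots> \<le> Lp_norm p ?W (\<lambda>\<zeta>. epowr (area (transformed \<phi>) \<zeta>) (1 / 2))"
        proof (rule Lp_norm_mono)
          fix \<zeta> assume "\<zeta> \<in> space ?W"
          then have \<zeta>: "norm \<zeta> = 1" by simp
          show "ennreal (sqrt (k0 / 2)) * ?Q * ?ind \<zeta> \<le> epowr (area (transformed \<phi>) \<zeta>) (1 / 2)"
          proof (cases "\<zeta> \<in> ?B")
            case True
            then have "epowr (ennreal (k0 / 2) * ?Q\<^sup>2) (1 / 2) \<le> epowr (area (transformed \<phi>) \<zeta>) (1 / 2)"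
              using \<zeta> by (intro epowr_mono ar) (auto simp: noniso_ball_def)
            moreover have "epowr (ennreal (k0 / 2) * ?Q\<^sup>2) (1 / 2) = ennreal (sqrt (k0 / 2)) * ?Q"
            proof -
              have "epowr (?Q\<^sup>2) (1 / 2) = ?Q" by (simp add: epowr_epowr flip: epowr_2)
              moreover have "epowr (ennreal (k0 / 2)) (1 / 2) = ennreal (sqrt (k0 / 2))" using k0 by (subst epowr_ennreal) (auto simp: powr_half_sqrt)
              ultimately show ?thesis by (simp only: epowr_mult[of "1/2"] half_gt_zero zero_less_one)
            qed
            ultimately show ?thesis using True by simp
          qed simp
        qed (use p in simp)
        also have "\<dots> = L_norm p \<omega> (transformed \<phi>)"
          using p by (intro L_norm_area[symmetric] tm) auto
        also have "\<dots> = F_norm p \<omega> (bergman \<phi>)" by (rule F_norm_bergman[OF \<phi>int, symmetric])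
        finally show ?thesis .
      qed
      have "ennreal (sqrt (k0 / 2)) * ?Q * epowr (weight_mass \<omega> ?B) (1 / p) \<le> ennreal \<bar>C\<bar> * (ennreal (sqrt (8 * ?n)) * epowr (Hn N) (1 / p))"
      proof -
        have "F_norm p \<omega> (bergman \<phi>) \<le> ennreal C * L_norm p \<omega> \<phi>" by (rule C[OF \<phi>L])
        also have "\<dots> \<le> ennreal \<bar>C\<bar> * (ennreal (sqrt (8 * ?n)) * epowr (Hn N) (1 / p))"
          by (intro mult_mono Lle ennreal_leI) auto
        finally show ?thesis using Fge by (rule order_trans[rotated])
      qed
      then have "epowr (ennreal (sqrt (k0 / 2)) * ?Q * epowr (weight_mass \<omega> ?B) (1 / p)) p
        \<le> epowr (ennreal \<bar>C\<bar> * (ennreal (sqrt (8 * ?n)) * epowr (Hn N) (1 / p))) p"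
        using p by (intro epowr_mono) auto
      then have ineq: "ennreal ((sqrt (k0 / 2) * q) powr p) * (weight_mass \<omega> ?B * epowr (Hn N) p) \<le> ennreal ((\<bar>C\<bar> * sqrt (8 * ?n)) powr p) * Hn N"
      proof -
        have "epowr (ennreal (sqrt (k0 / 2)) * ?Q * epowr (weight_mass \<omega> ?B) (1 / p)) p
          = ennreal ((sqrt (k0 / 2) * q) powr p) * (weight_mass \<omega> ?B * epowr (Hn N) p)"
          using p q k0 by (simp add: epowr_mult epowr_epowr epowr_ennreal powr_mult ennreal_mult mult_ac)
        moreover have "epowr (ennreal \<bar>C\<bar> * (ennreal (sqrt (8 * ?n)) * epowr (Hn N) (1 / p))) p = ennreal ((\<bar>C\<bar> * sqrt (8 * ?n)) powr p) * Hn N"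
          using p by (simp add: epowr_mult epowr_epowr epowr_ennreal powr_mult ennreal_mult mult_ac)
        moreover assume "epowr (ennreal (sqrt (k0 / 2)) * ?Q * epowr (weight_mass \<omega> ?B) (1 / p)) p
          \<le> epowr (ennreal \<bar>C\<bar> * (ennreal (sqrt (8 * ?n)) * epowr (Hn N) (1 / p))) p"
        ultimately show ?thesis by simp
      qed
      \<comment> \<open>one factor \<open>Hn N\<close>, finite by truncation, is cancelled\<close>
      show ?thesis
      proof (cases "Hn N = 0")
        case True
        then show ?thesis by simp
      next
        case False
        define Y where "Y = weight_mass \<omega> ?B * epowr (Hn N) (p - 1)"
        define b where "b = (sqrt (k0 / 2) * q) powr p"
        have b: "0 < b" using k0 q by (simp add: b_def)
        have "epowr (Hn N) p = Hn N * epowr (Hn N) (p - 1)" using epowr_add[of "Hn N" 1 "p - 1"] by simp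
        then have "Hn N * (ennreal b * Y) \<le> Hn N * ennreal ((\<bar>C\<bar> * sqrt (8 * ?n)) powr p)"
          using ineq by (simp add: Y_def b_def mult_ac)
        then have "Hn N * (ennreal b * Y) / Hn N \<le> Hn N * ennreal ((\<bar>C\<bar> * sqrt (8 * ?n)) powr p) / Hn N"
          by (rule divide_right_mono_ennreal)
        then have "ennreal b * Y \<le> ennreal ((\<bar>C\<bar> * sqrt (8 * ?n)) powr p)"
          using False Hfin by (simp add: ennreal_mult_divide_cancel_left)
        then have "ennreal b * Y / ennreal b \<le> ennreal ((\<bar>C\<bar> * sqrt (8 * ?n)) powr p) / ennreal b"
          by (rule divide_right_mono_ennreal)
        then have "Y \<le> ennreal ((\<bar>C\<bar> * sqrt (8 * ?n)) powr p / b)"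
          using b by (simp add: ennreal_mult_divide_cancel_left divide_ennreal)
        also have "(\<bar>C\<bar> * sqrt (8 * ?n)) powr p / b = D * d powr (?n * p)"
        proof -
          have "b = (a * sqrt (k0 / 2)) powr p * (d powr (- real ?n)) powr p"
            unfolding b_def q_def using a k0 d by (simp add: powr_mult mult_ac)
          also have "(d powr (- real ?n)) powr p = d powr (- (real ?n * p))" by (simp add: powr_powr)
          finally have "1 / b = inverse ((a * sqrt (k0 / 2)) powr p) * inverse (d powr (- (real ?n * p)))"
            by (simp only: inverse_eq_divide[symmetric] inverse_mult_distrib)
          also have "\<dots> = (a * sqrt (k0 / 2)) powr (- p) * d powr (real ?n * p)"
            by (simp only: powr_minus[symmetric] minus_minus)
          finally have "(\<bar>C\<bar> * sqrt (8 * ?n)) powr p * (1 / b) = D * d powr (?n * p)"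
            by (simp only: D_def mult.assoc)
          then show ?thesis by simp
        qed
        finally show ?thesis by (simp add: Y_def)
      qed
    qed
    \<comment> \<open>removal of the truncation\<close>
    have inc: "incseq (\<lambda>N. Hn N)"
      unfolding incseq_def Hn_def by (auto intro!: nn_integral_mono ennreal_leI simp: h_def g_nonneg)
    have "weight_mass (dual_weight p \<omega>) ?B = (SUP N. Hn N)"
    proof -
      have "weight_mass (dual_weight p \<omega>) ?B = (\<integral>\<^sup>+\<zeta>. (SUP N. ennreal (h N \<zeta>)) \<partial>sphere_meas)"
        unfolding weight_mass_def
      proof (rule nn_integral_cong_AE, use g AE_space in eventually_elim)
        case (elim \<zeta>)
        obtain N where N: "g \<zeta> \<le> real N" using real_arch_simple by blast
        have "(SUP N. ennreal (h N \<zeta>)) = (if sdist \<zeta>0 \<zeta> < \<epsilon> * d then ennreal (g \<zeta>) else 0)"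
        proof (rule antisym)
          show "(SUP N. ennreal (h N \<zeta>)) \<le> (if sdist \<zeta>0 \<zeta> < \<epsilon> * d then ennreal (g \<zeta>) else 0)"
            by (rule SUP_least) (auto simp: h_def)
          have "(if sdist \<zeta>0 \<zeta> < \<epsilon> * d then ennreal (g \<zeta>) else 0) = ennreal (h N \<zeta>)"
            using N by (simp add: h_def)
          also have "\<dots> \<le> (SUP N. ennreal (h N \<zeta>))" by (rule SUP_upper) simp
          finally show "(if sdist \<zeta>0 \<zeta> < \<epsilon> * d then ennreal (g \<zeta>) else 0) \<le> (SUP N. ennreal (h N \<zeta>))" .
        qed
        then show ?case using elim by (simp add: noniso_ball_def indicator_def)
      qed
      also have "\<dots> = (SUP N. Hn N)"
        unfolding Hn_def
      proof (rule nn_integral_monotone_convergence_SUP)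
        show "incseq (\<lambda>N \<zeta>. ennreal (h N \<zeta>))"
          by (auto simp: incseq_def le_fun_def h_def g_nonneg intro!: ennreal_leI)
      qed (rule hms)
      finally show ?thesis .
    qed
    then have "weight_mass \<omega> ?B * epowr (weight_mass (dual_weight p \<omega>) ?B) (p - 1) = (SUP N. weight_mass \<omega> ?B * epowr (Hn N) (p - 1))"
      using p by (simp add: epowr_SUP SUP_mult_left_ennreal)
    also have "\<dots> \<le> ennreal (D * d powr (?n * p))" by (rule SUP_least) (rule one)
    finally show ?thesis .
  qed
  show ?thesis using \<epsilon> main by (intro exI[of _ \<epsilon>] conjI exI[of _ D] allI impI) auto
qed

lemma weight_mass_mono: "A \<subseteq> B \<Longrightarrow> weight_mass f A \<le> weight_mass f B"
  unfolding weight_mass_def by (intro nn_integral_mono) (auto simp: indicator_def)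

lemma noniso_ball_sets: "noniso_ball \<zeta> r \<in> sets sphere_meas"
proof -
  have [measurable]: "(\<lambda>\<eta>. sdist \<zeta> \<eta>) \<in> borel_measurable sphere_meas" by (rule measurable_sphere_meas) measurable
  show ?thesis unfolding noniso_ball_eq by measurable
qed

lemma weight_mass_pos:
  fixes \<omega> :: "complex ^ 'n \<Rightarrow> real"
  assumes w: "weight \<omega>" and B: "B \<in> sets sphere_meas" "emeasure sphere_meas B \<noteq> 0"
  shows "weight_mass \<omega> B \<noteq> 0"
proof
  have [measurable]: "\<omega> \<in> borel_measurable sphere_meas" using w by (auto simp: weight_def)
  note [measurable] = B(1)
  assume "weight_mass \<omega> B = 0"
  then have "AE \<zeta> in sphere_meas. ennreal (\<omega> \<zeta>) * indicator B \<zeta> = 0"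
    unfolding weight_mass_def by (subst (asm) nn_integral_0_iff_AE) auto
  moreover have "AE \<zeta> in sphere_meas. 0 < \<omega> \<zeta>" using w by (simp add: weight_def)
  ultimately have "AE \<zeta> in sphere_meas. \<zeta> \<notin> B"
    by eventually_elim (auto simp: indicator_def split: if_splits)
  then have "B \<in> null_sets sphere_meas" using AE_iff_null_sets[OF B(1)] by simp
  then have "emeasure sphere_meas B = 0" by (rule null_setsD1)
  then show False using B(2) by simp
qed

text \<open>Small balls are covered by testing; the bound \<open>d\<^sup>n\<^sup>p\<close> is comparable to \<open>\<bar>B\<bar>\<^sup>p\<close>. For large
  balls it is enough that \<open>\<omega>'\<close> has finite total mass: each small ball has finite \<open>\<omega>'\<close>-mass because
  its \<open>\<omega>\<close>-mass is positive, and finitely many of them cover the sphere.\<close>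
theorem bergman_bounded_imp_Ap:
  fixes \<omega> :: "complex ^ 'n \<Rightarrow> real"
  assumes p: "1 < p" and w: "weight \<omega>" and bd: "bergman_bounded p \<omega>"
  shows "Ap_const p \<omega> < \<infinity>"
proof -
  let ?n = "CARD('n)"
  obtain c C where H: "homogeneous_space (sphere_meas :: (complex ^ 'n) measure) sdist ?n c C"
    using sphere_homogeneous by blast
  interpret H: homogeneous_space "sphere_meas :: (complex ^ 'n) measure" sdist ?n c C by (rule H)
  note [measurable] = weight_facts(1,2)[OF p w]
  obtain \<epsilon> D where \<epsilon>: "0 < \<epsilon>" "\<epsilon> \<le> 1" and loc: "\<And>\<zeta>0 :: complex ^ 'n. \<And>d. norm \<zeta>0 = 1 \<Longrightarrow> 0 < d \<Longrightarrow> d \<le> 1 / 2 \<Longrightarrow>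
    weight_mass \<omega> (noniso_ball \<zeta>0 (\<epsilon> * d)) * epowr (weight_mass (dual_weight p \<omega>) (noniso_ball \<zeta>0 (\<epsilon> * d))) (p - 1)
      \<le> ennreal (D * d powr (?n * p))"
    using bergman_bounded_imp_small_ball_Ap[OF p w bd] by blast
  define \<rho> where "\<rho> = \<epsilon> / 2"
  have \<rho>: "0 < \<rho>" "\<rho> \<le> 1" using \<epsilon> by (auto simp: \<rho>_def)
  have small: "weight_mass \<omega> (noniso_ball \<zeta> t) * epowr (weight_mass (dual_weight p \<omega>) (noniso_ball \<zeta> t)) (p - 1)
      \<le> ennreal (D * (t / \<epsilon>) powr (?n * p))" if "norm \<zeta> = 1" "0 < t" "t \<le> \<rho>" for \<zeta> t
    using loc[of \<zeta> "t / \<epsilon>"] that \<epsilon> by (simp add: \<rho>_def field_simps)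
  have low: "ennreal (c * t ^ ?n) \<le> emeasure sphere_meas (noniso_ball \<zeta> t)" if "norm \<zeta> = 1" "0 < t" "t \<le> 1" for \<zeta> :: "complex ^ 'n" and t
    unfolding noniso_ball_eq by (rule H.ball_lower) (use that in auto)
  have cpos: "0 < c * t ^ ?n" if "0 < t" for t using H.cC that by simp
  have "weight_mass (dual_weight p \<omega>) (noniso_ball \<zeta> \<rho>) < top" if \<zeta>: "norm \<zeta> = 1" for \<zeta>
  proof -
    have "0 < ennreal (c * \<rho> ^ ?n)" using cpos[OF \<rho>(1)] by simp
    then have "emeasure sphere_meas (noniso_ball \<zeta> \<rho>) \<noteq> 0" using low[OF \<zeta> \<rho>] by (metis leD)
    then have "weight_mass \<omega> (noniso_ball \<zeta> \<rho>) \<noteq> 0"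
      by (intro weight_mass_pos[OF w] noniso_ball_sets)
    moreover have "weight_mass \<omega> (noniso_ball \<zeta> \<rho>) * epowr (weight_mass (dual_weight p \<omega>) (noniso_ball \<zeta> \<rho>)) (p - 1) < top"
      using small[OF \<zeta> \<rho>(1) order_refl] ennreal_less_top le_less_trans by blast
    ultimately show ?thesis by (auto simp: ennreal_mult_less_top)
  qed
  note finball = this
  \<comment> \<open>a Vitali family of balls of radius \<open>\<rho> / 5\<close> provides the finite cover\<close>
  have vfin: "weight_mass (dual_weight p \<omega>) (sphere 0 1) < top"
  proof -
    obtain F where F: "finite F" "\<forall>(y, k)\<in>F. k < Suc 0 \<and> y \<in> space (sphere_meas :: (complex ^ 'n) measure)"
      "\<forall>k<Suc 0. \<forall>y\<in>space sphere_meas. \<exists>(y', k')\<in>F. sdist y' y < 5 * (\<rho> / 5)"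
      using H.Vitali_covering[of "\<lambda>_. space sphere_meas" "\<lambda>_. \<rho> / 5" "Suc 0"] \<rho>(1) by (auto simp: decseq_def)
    have "weight_mass (dual_weight p \<omega>) (sphere 0 1) \<le> (\<Sum>i\<in>F. weight_mass (dual_weight p \<omega>) (noniso_ball (fst i) \<rho>))"
    proof -
      have "weight_mass (dual_weight p \<omega>) (sphere 0 1) \<le> (\<integral>\<^sup>+\<zeta>. (\<Sum>i\<in>F. ennreal (dual_weight p \<omega> \<zeta>) * indicator (noniso_ball (fst i) \<rho>) \<zeta>) \<partial>sphere_meas)"
        unfolding weight_mass_def
      proof (rule nn_integral_mono)
        fix \<zeta> :: "complex ^ 'n" assume \<zeta>: "\<zeta> \<in> space sphere_meas"
        then have "\<exists>(y', k')\<in>F. sdist y' \<zeta> < \<rho>" using F(3) by simp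
        then obtain y' k' where i: "(y', k') \<in> F" "sdist y' \<zeta> < \<rho>" by blast
        then have "ennreal (dual_weight p \<omega> \<zeta>) = ennreal (dual_weight p \<omega> \<zeta>) * indicator (noniso_ball (fst (y', k')) \<rho>) \<zeta>"
          using \<zeta> by (simp add: noniso_ball_def)
        also have "\<dots> \<le> (\<Sum>i\<in>F. ennreal (dual_weight p \<omega> \<zeta>) * indicator (noniso_ball (fst i) \<rho>) \<zeta>)"
          using i(1) F(1) by (intro member_le_sum) auto
        finally show "ennreal (dual_weight p \<omega> \<zeta>) * indicator (sphere 0 1) \<zeta> \<le> (\<Sum>i\<in>F. ennreal (dual_weight p \<omega> \<zeta>) * indicator (noniso_ball (fst i) \<rho>) \<zeta>)"
          using \<zeta> by simp
      qed
      also have "\<dots> = (\<Sum>i\<in>F. weight_mass (dual_weight p \<omega>) (noniso_ball (fst i) \<rho>))"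
        unfolding weight_mass_def
      proof (rule nn_integral_sum)
        fix i assume "i \<in> F"
        note [measurable] = noniso_ball_sets[of "fst i" \<rho>]
        show "(\<lambda>\<zeta>. ennreal (dual_weight p \<omega> \<zeta>) * indicator (noniso_ball (fst i) \<rho>) \<zeta>) \<in> borel_measurable sphere_meas" by measurable
      qed
      finally show ?thesis .
    qed
    also have "\<dots> < top" using F(1,2) finball by (auto simp: ennreal_sum_less_top)
    finally show ?thesis .
  qed
  have wfin: "weight_mass \<omega> (sphere 0 1) < top"
  proof -
    have "weight_mass \<omega> (sphere 0 1) = emeasure (density sphere_meas (\<lambda>\<zeta>. ennreal (\<omega> \<zeta>))) (space sphere_meas)"
      unfolding weight_mass_def by (subst emeasure_density, simp, simp only: sets.top, simp)
    then show ?thesis using finite_measure.emeasure_finite[OF weight_facts(3)[OF p w]] by (simp add: less_top)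
  qed
  \<comment> \<open>\<open>K1\<close> serves the balls of radius at most \<open>\<rho>\<close>, \<open>K2\<close> the others\<close>
  define K1 where "K1 = ennreal (\<bar>D\<bar> * (1 / \<epsilon>) powr (?n * p) / c powr p)"
  define K2 where "K2 = weight_mass \<omega> (sphere 0 1) * epowr (weight_mass (dual_weight p \<omega>) (sphere 0 1)) (p - 1) / ennreal ((c * \<rho> ^ ?n) powr p)"
  have "Ap_const p \<omega> \<le> max K1 K2"
    unfolding Ap_const_def conj_exponent_facts(5)[OF p]
  proof (rule SUP_least, clarify)
    fix \<zeta> :: "complex ^ 'n" and t :: real assume "\<zeta> \<in> sphere 0 1" and t: "0 < t"
    then have \<zeta>: "norm \<zeta> = 1" by simp
    let ?V = "weight_mass \<omega> (noniso_ball \<zeta> t) * epowr (weight_mass (dual_weight p \<omega>) (noniso_ball \<zeta> t)) (p - 1)"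
    have div: "?V / epowr (emeasure sphere_meas (noniso_ball \<zeta> t)) p \<le> X / ennreal ((c * s ^ ?n) powr p)"
      if "?V \<le> X" "0 < s" "s \<le> t" "s \<le> 1" for X s
    proof -
      have "ennreal (c * s ^ ?n) \<le> emeasure sphere_meas (noniso_ball \<zeta> t)"
      proof -
        have "noniso_ball \<zeta> s \<subseteq> noniso_ball \<zeta> t" using that by (auto simp: noniso_ball_def)
        then have "emeasure sphere_meas (noniso_ball \<zeta> s) \<le> emeasure sphere_meas (noniso_ball \<zeta> t)"
          by (intro emeasure_mono noniso_ball_sets)
        with low[OF \<zeta> that(2,4)] show ?thesis by (rule order_trans)
      qed
      then have "epowr (ennreal (c * s ^ ?n)) p \<le> epowr (emeasure sphere_meas (noniso_ball \<zeta> t)) p"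
        using p by (intro epowr_mono) auto
      then have "ennreal ((c * s ^ ?n) powr p) \<le> epowr (emeasure sphere_meas (noniso_ball \<zeta> t)) p"
        using cpos[OF that(2)] by (simp add: epowr_ennreal)
      then show ?thesis unfolding divide_ennreal_def using that(1)
        by (intro mult_mono inverse_ennreal_antimono) auto
    qed
    show "?V / epowr (emeasure sphere_meas (noniso_ball \<zeta> t)) p \<le> max K1 K2"
    proof (cases "t \<le> \<rho>")
      case True
      have "?V \<le> ennreal (\<bar>D\<bar> * (t / \<epsilon>) powr (?n * p))"
        using small[OF \<zeta> t True] by (rule order_trans) (intro ennreal_leI mult_right_mono, auto)
      then have "?V / epowr (emeasure sphere_meas (noniso_ball \<zeta> t)) p \<le> ennreal (\<bar>D\<bar> * (t / \<epsilon>) powr (?n * p)) / ennreal ((c * t ^ ?n) powr p)"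
        using t True \<rho> by (intro div) auto
      also have "\<dots> = ennreal (\<bar>D\<bar> * (t / \<epsilon>) powr (?n * p) / (c * t ^ ?n) powr p)"
      proof (rule divide_ennreal)
        show "0 < (c * t ^ ?n) powr p" using cpos[OF t] by (metis powr_gt_zero less_irrefl)
      qed simp
      also have "\<bar>D\<bar> * (t / \<epsilon>) powr (?n * p) / (c * t ^ ?n) powr p = \<bar>D\<bar> * (1 / \<epsilon>) powr (?n * p) / c powr p"
      proof -
        have "(t / \<epsilon>) powr (?n * p) = (1 / \<epsilon>) powr (?n * p) * t powr (?n * p)"
          using t \<epsilon> by (subst powr_mult[symmetric]) auto
        moreover have "(c * t ^ ?n) powr p = c powr p * t powr (?n * p)"
          using t H.cC by (simp add: powr_mult powr_powr flip: powr_realpow)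
        ultimately show ?thesis using t by simp
      qed
      finally show ?thesis by (simp add: K1_def le_max_iff_disj)
    next
      case False
      have sub: "noniso_ball \<zeta> t \<subseteq> sphere 0 1" by (auto simp: noniso_ball_def)
      have "?V \<le> weight_mass \<omega> (sphere 0 1) * epowr (weight_mass (dual_weight p \<omega>) (sphere 0 1)) (p - 1)"
        using p by (intro mult_mono epowr_mono weight_mass_mono sub) auto
      then have "?V / epowr (emeasure sphere_meas (noniso_ball \<zeta> t)) p \<le> K2"
        unfolding K2_def using False \<rho> by (intro div) auto
      then show ?thesis by (simp add: le_max_iff_disj)
    qed
  qed
  also have "max K1 K2 < \<infinity>"
  proof -
    have "0 < (c * \<rho> ^ ?n) powr p" using cpos[OF \<rho>(1)] by (metis powr_gt_zero less_irrefl)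
    moreover have "weight_mass \<omega> (sphere 0 1) * epowr (weight_mass (dual_weight p \<omega>) (sphere 0 1)) (p - 1) < top"
      using wfin vfin by (simp add: ennreal_mult_less_top)
    ultimately have "K2 \<noteq> top"
      unfolding K2_def by (auto simp: ennreal_divide_eq_top_iff)
    then have "K2 < top" by (simp add: less_top)
    then show ?thesis by (simp add: K1_def)
  qed
  finally show ?thesis .
qed

section \<open>Characterisation of the bounded case\<close>

theorem theorem1p3:
  fixes p :: real
  assumes "1 < p"
  shows "(\<forall>\<omega> :: complex ^ 'n::finite \<Rightarrow> real. weight \<omega> \<longrightarrow>
            (bergman_bounded p \<omega> \<longleftrightarrow> \<omega> \<in> Ap_weights p)) \<and>
         (\<exists>C::real. 0 < C \<and>
            (\<forall>\<omega> :: complex ^ 'n \<Rightarrow> real. weight \<omega> \<and> \<omega> \<in> Ap_weights p \<longrightarrow>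
               bergman_opnorm p \<omega> \<le> ennreal C * epowr (Ap_const p \<omega>) (max 1 (1 / (p - 1)))))"
proof -
  obtain K where K: "0 < K" and bound: "\<And>\<omega> :: complex ^ 'n \<Rightarrow> real. \<And>\<phi>. weight \<omega> \<Longrightarrow> Ap_const p \<omega> < \<infinity> \<Longrightarrow> \<phi> \<in> L_space p \<omega> \<Longrightarrow>
    integrable ball_meas \<phi> \<and> F_norm p \<omega> (bergman \<phi>) \<le> ennreal K * epowr (Ap_const p \<omega>) (max 1 (1 / (p - 1))) * L_norm p \<omega> \<phi>"
    using bergman_bound_Ap[OF assms, where 'n='n] by blast
  have "bergman_bounded p \<omega>" if w: "weight \<omega>" and A: "Ap_const p \<omega> < \<infinity>" for \<omega> :: "complex ^ 'n \<Rightarrow> real"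
  proof -
    let ?C = "ennreal K * epowr (Ap_const p \<omega>) (max 1 (1 / (p - 1)))"
    have fin: "?C < top" using A by (simp add: ennreal_mult_less_top)
    have "integrable ball_meas \<phi> \<and> bergman \<phi> \<in> F_space p \<omega>" if \<phi>: "\<phi> \<in> L_space p \<omega>" for \<phi>
    proof -
      have int: "integrable ball_meas \<phi>" and le: "F_norm p \<omega> (bergman \<phi>) \<le> ?C * L_norm p \<omega> \<phi>"
        using bound[OF w A \<phi>] by auto
      have "?C * L_norm p \<omega> \<phi> < top" using fin \<phi> by (simp add: L_space_def ennreal_mult_less_top)
      then have "F_norm p \<omega> (bergman \<phi>) < \<infinity>" using le by (simp add: le_less_trans)
      then show ?thesis using int bergman_holo[OF int] by (simp add: F_space_def)
    qed
    moreover have "ennreal (enn2real ?C) = ?C" using fin by simp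
    then have "\<exists>C::real. \<forall>\<phi>\<in>L_space p \<omega>. F_norm p \<omega> (bergman \<phi>) \<le> ennreal C * L_norm p \<omega> \<phi>"
      using bound[OF w A] by (intro exI[of _ "enn2real ?C"]) simp
    ultimately show ?thesis by (simp add: bergman_bounded_def)
  qed
  moreover have "bergman_opnorm p \<omega> \<le> ennreal K * epowr (Ap_const p \<omega>) (max 1 (1 / (p - 1)))"
    if "weight \<omega>" "\<omega> \<in> Ap_weights p" for \<omega> :: "complex ^ 'n \<Rightarrow> real"
    unfolding bergman_opnorm_def using that bound by (intro Inf_lower) (auto simp: Ap_weights_def)
  ultimately show ?thesis
    using K bergman_bounded_imp_Ap[OF assms, where 'n='n] by (auto simp: Ap_weights_def)
qed

end
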